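(* Let $m\ge1$, and let $V$ be a finite-dimensional $\mathbb C Mo_m$-module, where $Mo_m$ is the Motzkin monoid, with character $\chi$. For $i,j\geq 0$ put $$S^{-1}_{ij}=\begin{cases}[x^{j-i}](1+x+x^2)^{-(i+1)}=(-1)^{j-i}\sum_{r=0}^{\lfloor (j-i)/2\rfloor}(-1)^r\binom{i+r}{r}\binom{j-r}{j-i-2r}& i\le j,\\0&i>j,\end{cases}$$ where $[x^d]F$ denotes the coefficient of $x^d$ in the power series $F$. Then for $n\ge1$ and $0\le i\le m$, $$[V^{\otimes n}:V_i]=\begin{cases}\sum_{j}(\chi(j))^nS^{-1}_{ji}& i\text{ odd or }i=0,\\[2pt]\sum_j(\chi(j))^nS^{-1}_{ji}+\sum_j(\chi(j))^nS^{-1}_{j,\,i-2}&\text{else,}\end{cases}$$ with sums over $0\le j\le m$. Summing over all $i$ gives a formula for the composition length $l(n)$ of $V^{\otimes n}$.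
   Context: $Mo_m$ is the monoid of crossingless partial matchings of $m$ top and $m$ bottom vertices of a rectangle (each vertex is isolated or joined to exactly one other vertex), with product given by stacking and discarding components not touching the boundary. Its $\mathcal J$-classes are indexed by the number $j\in\{0,\dots,m\}$ of through strands (blocks joining top to bottom); each contains an idempotent $e_j$ and all maximal subgroups are trivial. $\chi(j)$ is the value of $\chi$ on the $j$-th $\mathcal J$-class, i.e. $\chi(j)=\dim e_jV$. $V_i$ is the simple module with apex the $i$-th $\mathcal J$-class: $e_iV_i\ne0$ and all diagrams with fewer than $i$ through strands annihilate $V_i$. $[W:S]$ is the multiplicity of $S$ as a composition factor of $W$. Tensor powers carry the diagonal action. *)

theory Defs
  imports
    "HOL-Algebra.Group"
    "HOL-Computational_Algebra.Formal_Power_Series"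
    "HOL-Library.Function_Algebras"
begin

section \<open>The Motzkin monoid\<close>

text \<open>Vertices are pairs \<open>(l, k)\<close>, with \<open>l = 0\<close> for the top and \<open>l = 1\<close> for the bottom line
  and \<open>k < m\<close> the position from left to right. A diagram is the set of its two-element blocks;
  vertices on no such block are the isolated ones.\<close>

type_synonym vertex = "nat \<times> nat"
type_synonym diagram = "vertex set set"

definition vertices :: "nat \<Rightarrow> vertex set" where
  "vertices m = {0, 1} \<times> {..<m}"

definition partial_matching :: "nat \<Rightarrow> diagram \<Rightarrow> bool" where
  "partial_matching m D \<longleftrightarrow>
     (\<forall>e\<in>D. e \<subseteq> vertices m \<and> card e = 2) \<and> (\<forall>e\<in>D. \<forall>e'\<in>D. e \<noteq> e' \<longrightarrow> e \<inter> e' = {})"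

text \<open>The place of a vertex on a clockwise walk along the boundary of the rectangle, starting at
  the top left corner. Two strands are forced to cross iff their end points interlace on it.\<close>

definition boundary_pos :: "nat \<Rightarrow> vertex \<Rightarrow> nat" where
  "boundary_pos m v = (if fst v = 0 then snd v else 2 * m - 1 - snd v)"

definition crossingless :: "nat \<Rightarrow> diagram \<Rightarrow> bool" where
  "crossingless m D \<longleftrightarrow>
     \<not> (\<exists>a b c d. {a, b} \<in> D \<and> {c, d} \<in> D \<and>
          boundary_pos m a < boundary_pos m c \<and>
          boundary_pos m c < boundary_pos m b \<and>
          boundary_pos m b < boundary_pos m d)"

text \<open>Stacking \<open>D\<close> on top of \<open>E\<close> gives a graph on the three lines 0, 1, 2. Two distinct vertices
  of the outer lines 0 and 2 are joined in the product iff they are connected in it; components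
  that do not touch these lines leave no trace. The map \<open>squash\<close> renames line 2 to line 1.\<close>

definition stack :: "diagram \<Rightarrow> diagram \<Rightarrow> diagram" where
  "stack D E = D \<union> (`) (\<lambda>(l, k). (l + 1, k)) ` E"

definition squash :: "vertex \<Rightarrow> vertex" where
  "squash = (\<lambda>(l, k). (l div 2, k))"

definition diagram_mult :: "diagram \<Rightarrow> diagram \<Rightarrow> diagram" where
  "diagram_mult D E =
     {{squash u, squash v} | u v.
        fst u \<in> {0, 2} \<and> fst v \<in> {0, 2} \<and> u \<noteq> v \<and> (u, v) \<in> {(x, y). {x, y} \<in> stack D E}\<^sup>*}"

definition motzkin :: "nat \<Rightarrow> diagram monoid" where
  "motzkin m =
     \<lparr>carrier = {D. partial_matching m D \<and> crossingless m D},
      monoid.mult = diagram_mult,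
      one = {{(0, k), (1, k)} | k. k < m}\<rparr>"

text \<open>The number of through strands, which indexes the J-classes.\<close>

definition through_strands :: "diagram \<Rightarrow> nat" where
  "through_strands D = card {e \<in> D. \<exists>k l. e = {(0, k), (1, l)}}"

section \<open>Complex modules over a monoid\<close>

text \<open>A module over the monoid algebra is given by a linear action of the monoid. Modules live on
  a subspace \<open>vecs V\<close> of an ambient vector space.\<close>

record ('a, 'v) cmodule =
  vecs :: "'v set"
  smul :: "complex \<Rightarrow> 'v \<Rightarrow> 'v"
  act :: "'a \<Rightarrow> 'v \<Rightarrow> 'v"

locale monoid_module =
  fixes M :: "('a, 'b) monoid_scheme" and V :: "('a, 'v::ab_group_add) cmodule"
  assumes vector_space: "vector_space (smul V)"
    and subspace: "module.subspace (smul V) (vecs V)"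
    and act_closed: "\<lbrakk>a \<in> carrier M; v \<in> vecs V\<rbrakk> \<Longrightarrow> act V a v \<in> vecs V"
    and act_add: "\<lbrakk>a \<in> carrier M; v \<in> vecs V; w \<in> vecs V\<rbrakk> \<Longrightarrow> act V a (v + w) = act V a v + act V a w"
    and act_smul: "\<lbrakk>a \<in> carrier M; v \<in> vecs V\<rbrakk> \<Longrightarrow> act V a (smul V c v) = smul V c (act V a v)"
    and act_one: "v \<in> vecs V \<Longrightarrow> act V \<one>\<^bsub>M\<^esub> v = v"
    and act_mult: "\<lbrakk>a \<in> carrier M; b \<in> carrier M; v \<in> vecs V\<rbrakk>
                    \<Longrightarrow> act V (a \<otimes>\<^bsub>M\<^esub> b) v = act V a (act V b v)"

definition fin_dim :: "('a, 'v::ab_group_add) cmodule \<Rightarrow> bool" where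
  "fin_dim V \<longleftrightarrow> (\<exists>B. finite B \<and> B \<subseteq> vecs V \<and> module.span (smul V) B = vecs V)"

definition submodule ::
    "('a, 'b) monoid_scheme \<Rightarrow> ('a, 'v::ab_group_add) cmodule \<Rightarrow> 'v set \<Rightarrow> bool" where
  "submodule M V U \<longleftrightarrow>
     U \<subseteq> vecs V \<and> module.subspace (smul V) U \<and> (\<forall>a\<in>carrier M. \<forall>u\<in>U. act V a u \<in> U)"

definition simple_module ::
    "('a, 'b) monoid_scheme \<Rightarrow> ('a, 'v::ab_group_add) cmodule \<Rightarrow> bool" where
  "simple_module M V \<longleftrightarrow>
     monoid_module M V \<and> vecs V \<noteq> {0} \<and> (\<forall>U. submodule M V U \<longrightarrow> U = {0} \<or> U = vecs V)"

text \<open>A composition series of length \<open>l\<close> is a list of \<open>l + 1\<close> submodules.\<close>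

definition composition_series ::
    "('a, 'b) monoid_scheme \<Rightarrow> ('a, 'v::ab_group_add) cmodule \<Rightarrow> 'v set list \<Rightarrow> bool" where
  "composition_series M V Us \<longleftrightarrow>
     Us \<noteq> [] \<and> hd Us = {0} \<and> last Us = vecs V \<and> (\<forall>U\<in>set Us. submodule M V U) \<and>
     (\<forall>k. Suc k < length Us \<longrightarrow>
        Us ! k \<subset> Us ! Suc k \<and>
        \<not> (\<exists>U. submodule M V U \<and> Us ! k \<subset> U \<and> U \<subset> Us ! Suc k))"

text \<open>For submodules \<open>U \<subseteq> W\<close> of \<open>V\<close>: the quotient \<open>W / U\<close> is isomorphic to \<open>S\<close>, that is, there is a
  homomorphism from \<open>W\<close> onto \<open>S\<close> with kernel \<open>U\<close>.\<close>

definition factor_iso ::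
    "('a, 'b) monoid_scheme \<Rightarrow> ('a, 'v::ab_group_add) cmodule \<Rightarrow> 'v set \<Rightarrow> 'v set
       \<Rightarrow> ('a, 's::ab_group_add) cmodule \<Rightarrow> bool" where
  "factor_iso M V W U S \<longleftrightarrow>
     (\<exists>f. (\<forall>x\<in>W. \<forall>y\<in>W. f (x + y) = f x + f y) \<and>
          (\<forall>c. \<forall>x\<in>W. f (smul V c x) = smul S c (f x)) \<and>
          (\<forall>a\<in>carrier M. \<forall>x\<in>W. f (act V a x) = act S a (f x)) \<and>
          f ` W = vecs S \<and> {x \<in> W. f x = 0} = U)"

definition comp_mult ::
    "('a, 'b) monoid_scheme \<Rightarrow> ('a, 'v::ab_group_add) cmodule
       \<Rightarrow> ('a, 's::ab_group_add) cmodule \<Rightarrow> nat" where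
  "comp_mult M V S =
     (THE c. \<exists>Us. composition_series M V Us \<and>
        c = card {k. Suc k < length Us \<and> factor_iso M V (Us ! Suc k) (Us ! k) S})"

definition comp_length ::
    "('a, 'b) monoid_scheme \<Rightarrow> ('a, 'v::ab_group_add) cmodule \<Rightarrow> nat" where
  "comp_length M V = (THE l. \<exists>Us. composition_series M V Us \<and> length Us = Suc l)"

section \<open>Tensor powers\<close>

text \<open>Forms are only constrained on lists of length \<open>n\<close> with entries in \<open>vecs V\<close>.\<close>

definition multilinear_form ::
    "nat \<Rightarrow> ('a, 'v::ab_group_add) cmodule \<Rightarrow> ('v list \<Rightarrow> complex) \<Rightarrow> bool" where
  "multilinear_form n V f \<longleftrightarrow>
     (\<forall>vs. length vs = n \<and> set vs \<subseteq> vecs V \<longrightarrow>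
        (\<forall>k<n. \<forall>x\<in>vecs V. \<forall>y\<in>vecs V. f (vs[k := x + y]) = f (vs[k := x]) + f (vs[k := y])) \<and>
        (\<forall>k<n. \<forall>x\<in>vecs V. \<forall>c. f (vs[k := smul V c x]) = c * f (vs[k := x])))"

text \<open>The \<open>n\<close>-th tensor power is realised inside the dual of the space of \<open>n\<close>-linear forms, as the
  span of the pure tensors \<open>v\<^sub>1 \<otimes> \<dots> \<otimes> v\<^sub>n\<close>, which act on forms by evaluation. This is the usual
  tensor power because over a field multilinear forms separate tensors. Functionals get the value
  0 outside the multilinear forms, so that they are determined by their values on these.\<close>

definition pure_tensor ::
    "('a, 'v::ab_group_add) cmodule \<Rightarrow> 'v list \<Rightarrow> ('v list \<Rightarrow> complex) \<Rightarrow> complex" where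
  "pure_tensor V vs = (\<lambda>f. if multilinear_form (length vs) V f then f vs else 0)"

text \<open>The action is the diagonal one: \<open>a\<close> sends \<open>v\<^sub>1 \<otimes> \<dots> \<otimes> v\<^sub>n\<close> to \<open>a v\<^sub>1 \<otimes> \<dots> \<otimes> a v\<^sub>n\<close>.\<close>

definition tensor_power ::
    "nat \<Rightarrow> ('a, 'v::ab_group_add) cmodule \<Rightarrow> ('a, ('v list \<Rightarrow> complex) \<Rightarrow> complex) cmodule" where
  "tensor_power n V =
     \<lparr>vecs = module.span (\<lambda>c t f. c * t f) (pure_tensor V ` {vs. length vs = n \<and> set vs \<subseteq> vecs V}),
      smul = (\<lambda>c t f. c * t f),
      act = (\<lambda>a t f. if multilinear_form n V f then t (\<lambda>vs. f (map (act V a) vs)) else 0)\<rparr>"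

section \<open>Characters and apexes\<close>

definition J_idempotents :: "nat \<Rightarrow> (nat \<Rightarrow> diagram) \<Rightarrow> bool" where
  "J_idempotents m e \<longleftrightarrow>
     (\<forall>j\<le>m. e j \<in> carrier (motzkin m) \<and> e j \<otimes>\<^bsub>motzkin m\<^esub> e j = e j \<and> through_strands (e j) = j)"

definition mo_character ::
    "(nat \<Rightarrow> diagram) \<Rightarrow> (diagram, 'v::ab_group_add) cmodule \<Rightarrow> nat \<Rightarrow> nat" where
  "mo_character e V j = vector_space.dim (smul V) (act V (e j) ` vecs V)"

definition simple_with_apex ::
    "nat \<Rightarrow> (nat \<Rightarrow> diagram) \<Rightarrow> (diagram, 's::ab_group_add) cmodule \<Rightarrow> nat \<Rightarrow> bool" where
  "simple_with_apex m e S i \<longleftrightarrow>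
     simple_module (motzkin m) S \<and>
     act S (e i) ` vecs S \<noteq> {0} \<and>
     (\<forall>D\<in>carrier (motzkin m). through_strands D < i \<longrightarrow> (\<forall>v\<in>vecs S. act S D v = 0))"

section \<open>The matrix of coefficients\<close>

definition S_inv :: "nat \<Rightarrow> nat \<Rightarrow> rat" where
  "S_inv i j =
     (if i \<le> j then fps_nth (inverse ((1 + fps_X + fps_X ^ 2) ^ (i + 1))) (j - i) else 0)"

end

(* The whole proof rests on one concrete model: functions on words over {Emp, Up, Dn}, that is,
   tensor powers of the sum of the trivial and the two-dimensional representation of quantum sl2
   at q = i, on which the generators of the Motzkin monoid act by local operators. Let W / U be a
   section without intermediate submodules of any module, i its apex, and v in W outside U fixed by
   the idempotent with i through strands. Modulo U, applying a word in the generators to v and then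
   that idempotent gives a multiple of v, and the scalar is the matrix coefficient of the same word
   in the model. These scalars determine W / U, so dim e_j W - dim e_j U is a rank r(i, j) of the
   model, and two sections with the same apex are isomorphic.

   The divided powers of the lowering operator commute with the action on the model. They yield
   r(i, j) = M(j, i) for odd i and r(i, j) + r(i + 2, j) = M(j, i) for even i, where M(j, i) counts
   the Motzkin paths of length j from height 0 to height i. The three-term recursions of M and of
   the coefficients of x^j (1 + x + x^2)^(-j-1) show that the two matrices are inverse to each other,
   so the multiplicities are recovered from dim e_j of the module, and for the n-th tensor power
   this is the n-th power of the dimension for V. *)

theory Submission
  imports Defs
begin

subsection \<open>Linear maps on subspaces\<close>

text \<open>The product discards closed loops, so a loop counts 1. The label \<open>Emp\<close>
  alone already gives 1, hence the two-dimensional summand needs quantum dimension q + 1/q = 0,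
  which forces q = \<open>\<i>\<close> up to sign. There the square of the lowering operator
  vanishes and only its divided powers carry information. The pairing that reads coefficients at the
  base word stays nondegenerate for odd i but degenerates for even i, whence the two cases of the
  formula. No space is described by an explicit basis. Cutting off the first letter of a word
  mirrors the recursion of M and bounds dimensions from one side; an independent bound from the
  other side closes the gap, once for the space generated by the base word and once for the pair of
  ranks at i and i + 2. Coefficients are indexed by words in the generators, not by diagrams. So the
  model is never shown to be a representation of the monoid, and the only products worked out are
  those of a diagram with one generator. Planarity enters when such a product is compared with the
  model and when a diagram is reduced to an idempotent.\<close>

context vector_space
begin

text \<open>The ambient space may have infinite dimension, so every dimension count is made relative
  to a finite \<open>T\<close> whose span contains the subspace.\<close>

lemma subspace_basis_extend:
  assumes "subspace W" "W \<subseteq> span T" "finite T" "C \<subseteq> W" "independent C"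
  obtains B where "C \<subseteq> B" "B \<subseteq> W" "independent B" "finite B" "span B = W" "card B = dim W"
proof -
  obtain B where B: "C \<subseteq> B" "B \<subseteq> W" "independent B" "W \<subseteq> span B"
    using maximal_independent_subset_extend[OF assms(4,5)] by blast
  have "finite B" using independent_span_bound[OF assms(3) B(3)] B(2) assms(2) by auto
  moreover have "span B = W" using B assms(1) span_minimal by blast
  moreover have "card B = dim W" using dim_eq_card_independent[OF B(3)] dim_span[of B] calculation(2) by simp
  ultimately show thesis using that B by blast
qed

lemma dim_mono_span:
  assumes "subspace W" "subspace W'" "W \<subseteq> W'" "W' \<subseteq> span T" "finite T"
  shows "dim W \<le> dim W'"
proof -
  obtain C where C: "C \<subseteq> W" "independent C" "finite C" "card C = dim W"
    using subspace_basis_extend[OF assms(1) _ assms(5), of "{}"] assms(3,4)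
    by (metis empty_subsetI independent_empty subset_trans)
  obtain B where B: "C \<subseteq> B" "finite B" "card B = dim W'"
    using subspace_basis_extend[OF assms(2,4,5), of C] C assms(3) by (metis subset_trans)
  show ?thesis using C B card_mono by metis
qed

lemma subspace_dim_equal_span:
  assumes "subspace W" "subspace W'" "W \<subseteq> W'" "W' \<subseteq> span T" "finite T" "dim W' \<le> dim W"
  shows "W = W'"
proof -
  obtain C where C: "C \<subseteq> W" "independent C" "finite C" "span C = W" "card C = dim W"
    using subspace_basis_extend[OF assms(1) _ assms(5), of "{}"] assms(3,4)
    by (metis empty_subsetI independent_empty subset_trans)
  obtain B where B: "C \<subseteq> B" "finite B" "span B = W'" "card B = dim W'"
    using subspace_basis_extend[OF assms(2,4,5), of C] C assms(3) by (metis subset_trans)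
  show ?thesis using C B card_seteq assms(6) by metis
qed

lemma dim_eq_0_iff_subspace:
  assumes "subspace W" "W \<subseteq> span T" "finite T"
  shows "dim W = 0 \<longleftrightarrow> W = {0}"
proof
  obtain B where B: "B \<subseteq> W" "independent B" "finite B" "span B = W" "card B = dim W"
    using subspace_basis_extend[OF assms, of "{}"] independent_empty by auto
  show "W = {0}" if "dim W = 0"
    using that B by auto
  show "dim W = 0" if "W = {0}"
    using that dim_eq_card[of "{}" W] independent_empty by simp
qed

end

text \<open>The action of a module is constrained only on \<open>vecs V\<close>, so linearity is
  demanded on a subspace and not on the whole type.\<close>

definition linear_on :: "('k \<Rightarrow> 'a \<Rightarrow> 'a::ab_group_add) \<Rightarrow> ('k \<Rightarrow> 'b \<Rightarrow> 'b::ab_group_add)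
    \<Rightarrow> 'a set \<Rightarrow> ('a \<Rightarrow> 'b) \<Rightarrow> bool" where
  "linear_on s1 s2 W f \<longleftrightarrow>
     (\<forall>x\<in>W. \<forall>y\<in>W. f (x + y) = f x + f y) \<and> (\<forall>c. \<forall>x\<in>W. f (s1 c x) = s2 c (f x))"

lemma linear_onI:
  assumes "\<And>x y. x \<in> W \<Longrightarrow> y \<in> W \<Longrightarrow> f (x + y) = f x + f y"
    and "\<And>c x. x \<in> W \<Longrightarrow> f (s1 c x) = s2 c (f x)"
  shows "linear_on s1 s2 W f"
  using assms by (auto simp: linear_on_def)

lemma linear_on_subset: "linear_on s1 s2 W f \<Longrightarrow> U \<subseteq> W \<Longrightarrow> linear_on s1 s2 U f"
  unfolding linear_on_def by blast

locale linear_on_subspace =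
  v1: vector_space s1 + v2: vector_space s2
  for s1 :: "'k::field \<Rightarrow> 'a::ab_group_add \<Rightarrow> 'a" and s2 :: "'k \<Rightarrow> 'b::ab_group_add \<Rightarrow> 'b" +
  fixes W :: "'a set" and f :: "'a \<Rightarrow> 'b"
  assumes sub: "v1.subspace W" and lin: "linear_on s1 s2 W f"
begin

lemma map_add: "x \<in> W \<Longrightarrow> y \<in> W \<Longrightarrow> f (x + y) = f x + f y"
  using lin by (auto simp: linear_on_def)

lemma map_scale: "x \<in> W \<Longrightarrow> f (s1 c x) = s2 c (f x)"
  using lin by (auto simp: linear_on_def)

lemma map_zero: "f 0 = 0"
  using map_scale[of 0 0] v1.subspace_0[OF sub] by simp

lemma map_minus: "x \<in> W \<Longrightarrow> f (- x) = - f x"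
  using map_scale[of x "-1"] by simp

lemma map_diff: "x \<in> W \<Longrightarrow> y \<in> W \<Longrightarrow> f (x - y) = f x - f y"
  using map_add[of x "- y"] map_minus v1.subspace_neg[OF sub] by simp

lemma map_sum: "(\<And>i. i \<in> I \<Longrightarrow> g i \<in> W) \<Longrightarrow> f (\<Sum>i\<in>I. g i) = (\<Sum>i\<in>I. f (g i))"
proof (induction I rule: infinite_finite_induct)
  case (insert i I)
  moreover have "(\<Sum>i\<in>I. g i) \<in> W" using insert v1.subspace_sum[OF sub] by blast
  ultimately show ?case by (simp add: map_add)
qed (auto simp: map_zero)

lemma map_span: "B \<subseteq> W \<Longrightarrow> f ` v1.span B = v2.span (f ` B)"
proof
  assume B: "B \<subseteq> W"
  have sW: "v1.span B \<subseteq> W" using B sub v1.span_minimal by blast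
  show "f ` v1.span B \<subseteq> v2.span (f ` B)"
  proof clarify
    fix x assume "x \<in> v1.span B"
    then have "x \<in> W \<and> f x \<in> v2.span (f ` B)"
    proof (induction rule: v1.span_induct_alt)
      case base show ?case by (simp add: map_zero v2.span_zero v1.subspace_0[OF sub])
    next
      case (step c x y)
      have "x \<in> W" "y \<in> W" using step B by auto
      then have "s1 c x + y \<in> W" "f (s1 c x + y) = s2 c (f x) + f y"
        by (simp_all add: map_add map_scale v1.subspace_scale[OF sub] v1.subspace_add[OF sub])
      then show ?case using step by (simp add: v2.span_add v2.span_base v2.span_scale)
    qed
    then show "f x \<in> v2.span (f ` B)" by simp
  qed
  show "v2.span (f ` B) \<subseteq> f ` v1.span B"
  proof (rule v2.span_minimal)
    show "f ` B \<subseteq> f ` v1.span B" using v1.span_superset by blast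
    show "v2.subspace (f ` v1.span B)"
    proof (rule v2.subspaceI)
      show "0 \<in> f ` v1.span B" using map_zero v1.span_zero by (metis image_eqI)
      fix x y assume "x \<in> f ` v1.span B" "y \<in> f ` v1.span B"
      then show "x + y \<in> f ` v1.span B"
        by (smt (verit, best) image_iff map_add sW subsetD v1.span_add)
    next
      fix c x assume "x \<in> f ` v1.span B"
      then show "s2 c x \<in> f ` v1.span B"
        by (smt (verit, best) image_iff map_scale sW subsetD v1.span_scale)
    qed
  qed
qed

lemma subspace_image: "v1.subspace U \<Longrightarrow> U \<subseteq> W \<Longrightarrow> v2.subspace (f ` U)"
  using map_span[of U] v1.span_eq_iff[of U] by (metis v2.subspace_span)

lemma subspace_kernel: "v1.subspace {x \<in> W. f x = 0}"
  by (rule v1.subspaceI)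
    (auto simp: map_zero map_add map_scale v1.subspace_0[OF sub] v1.subspace_add[OF sub]
      v1.subspace_scale[OF sub])

text \<open>A basis \<open>C\<close> of the kernel is extended to a basis \<open>B\<close> of
  \<open>W\<close>; the images of \<open>B - C\<close> form a basis of the image.\<close>

theorem rank_nullity:
  assumes "finite T" "W \<subseteq> v1.span T"
  shows "v1.dim W = v1.dim {x \<in> W. f x = 0} + v2.dim (f ` W)"
proof -
  let ?K = "{x \<in> W. f x = 0}"
  obtain C where C: "C \<subseteq> ?K" "v1.independent C" "finite C" "v1.span C = ?K" "card C = v1.dim ?K"
    using v1.subspace_basis_extend[OF subspace_kernel _ assms(1), of "{}"] assms(2)
      v1.independent_empty by (metis (no_types, lifting) empty_subsetI mem_Collect_eq subset_eq)
  obtain B where B: "C \<subseteq> B" "B \<subseteq> W" "v1.independent B" "finite B" "v1.span B = W"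
      "card B = v1.dim W"
    using v1.subspace_basis_extend[OF sub assms(2,1), of C] C by blast
  let ?E = "B - C"
  \<comment> \<open>A relation among the images puts a combination of \<open>B - C\<close> into the
    kernel, that is, into the span of \<open>C\<close>. Independence of \<open>B\<close> then makes
    all coefficients vanish.\<close>
  have zero: "u b = 0" if eq: "(\<Sum>b\<in>?E. s2 (u b) (f b)) = 0" and b: "b \<in> ?E" for u b
  proof -
    let ?x = "\<Sum>b\<in>?E. s1 (u b) b"
    have xW: "?x \<in> W" using B(2) by (intro v1.subspace_sum[OF sub] v1.subspace_scale[OF sub]) auto
    have "f ?x = (\<Sum>b\<in>?E. s2 (u b) (f b))"
      using B(2) by (subst map_sum) (auto simp: v1.subspace_scale[OF sub] map_scale intro!: sum.cong)
    then have "?x \<in> v1.span C" using xW eq C(4) by simp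
    then obtain w where w: "?x = (\<Sum>c\<in>C. s1 (w c) c)"
      using v1.span_finite[OF C(3)] by auto
    let ?u = "\<lambda>b. if b \<in> C then - w b else u b"
    have "(\<Sum>b\<in>B. s1 (?u b) b) = (\<Sum>b\<in>?E. s1 (?u b) b) + (\<Sum>b\<in>C. s1 (?u b) b)"
      using sum.subset_diff[OF B(1,4)] by blast
    also have "(\<Sum>b\<in>?E. s1 (?u b) b) = ?x" by (rule sum.cong) auto
    also have "(\<Sum>b\<in>C. s1 (?u b) b) = - (\<Sum>c\<in>C. s1 (w c) c)"
      by (simp add: sum_negf)
    finally have "(\<Sum>b\<in>B. s1 (?u b) b) = 0" using w by simp
    then have "?u b = 0" using v1.independentD[OF B(3,4) subset_refl, of ?u b] b by blast
    then show "u b = 0" using b by auto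
  qed
  have inj: "inj_on f ?E"
  proof (rule inj_onI, rule ccontr)
    fix a b assume ab: "a \<in> ?E" "b \<in> ?E" "f a = f b" "a \<noteq> b"
    let ?u = "\<lambda>x. if x = a then 1 else if x = b then - 1 else (0::'k)"
    have "(\<Sum>x\<in>?E. s2 (?u x) (f x)) = (\<Sum>x\<in>{a,b}. s2 (?u x) (f x))"
      using ab B(4) by (intro sum.mono_neutral_right) auto
    also have "\<dots> = 0" using ab by simp
    finally show False using zero[of ?u a] ab by simp
  qed
  have ind: "v2.independent (f ` ?E)"
  proof (rule v2.independent_if_scalars_zero)
    show "finite (f ` ?E)" using B by simp
    fix u y assume s: "(\<Sum>x\<in>f ` ?E. s2 (u x) x) = 0" and y: "y \<in> f ` ?E"
    have "(\<Sum>b\<in>?E. s2 (u (f b)) (f b)) = 0"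
      using s sum.reindex[OF inj, of "\<lambda>x. s2 (u x) x"] by simp
    then show "u y = 0" using zero[of "\<lambda>b. u (f b)"] y by blast
  qed
  have "f ` W = v2.span (f ` B)" using map_span[OF B(2)] B(5) by simp
  also have "\<dots> = v2.span (f ` ?E)"
  proof (rule antisym)
    have "f b \<in> v2.span (f ` ?E)" if "b \<in> B" for b
      using that C(1) by (cases "b \<in> C") (auto simp: v2.span_zero intro: v2.span_base)
    then show "v2.span (f ` B) \<subseteq> v2.span (f ` ?E)" by (intro v2.span_minimal) auto
  qed (rule v2.span_mono, blast)
  finally have "v2.dim (f ` W) = card (f ` ?E)" using v2.dim_span_eq_card_independent[OF ind] by simp
  also have "\<dots> = card B - card C"
    using card_image[OF inj] card_Diff_subset[OF C(3) B(1)] by simp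
  finally show ?thesis using C(5) B(6) card_mono[OF B(4,1)] by simp
qed

end

subsection \<open>Words and local operators\<close>

text \<open>States, families of coefficients indexed by words, and tensors are all complex-valued
  functions, so one interpretation serves the three of them.\<close>

interpretation fn: vector_space "\<lambda>(c::complex) (t::'x \<Rightarrow> complex) x. c * t x"
  by unfold_locales (auto simp: fun_eq_iff algebra_simps)

abbreviation flinear :: "(('x \<Rightarrow> complex) \<Rightarrow> ('y \<Rightarrow> complex)) \<Rightarrow> bool" where
  "flinear \<equiv> linear_on (\<lambda>c t x. c * t x) (\<lambda>c t x. c * t x) UNIV"

lemma flinearI:
  assumes "\<And>y z. L (\<lambda>x. y x + z x) = (\<lambda>x. L y x + L z x)"
    and "\<And>c y. L (\<lambda>x. c * y x) = (\<lambda>x. c * L y x)"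
  shows "flinear L"
  using assms by (auto simp: linear_on_def plus_fun_def)

lemma flinear_onI: "flinear L \<Longrightarrow> fn.subspace W \<Longrightarrow>
    linear_on_subspace (\<lambda>c t x. c * t x) (\<lambda>c t x. c * t x) W L"
  by (intro linear_on_subspace.intro linear_on_subspace_axioms.intro fn.vector_space_axioms)
    (auto intro: linear_on_subset)

lemma flinear_span:
  assumes "flinear L" "L ` B \<subseteq> fn.span S" "y \<in> fn.span B"
  shows "L y \<in> fn.span S"
proof -
  interpret l: linear_on_subspace "\<lambda>c t x. c * t x" "\<lambda>c t x. c * t x" UNIV L
    using flinear_onI[OF assms(1)] by simp
  show ?thesis using l.map_span[of B] fn.span_minimal[OF assms(2)] assms(3) by auto
qed

definition delta :: "'x \<Rightarrow> 'x \<Rightarrow> complex" where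
  "delta v = (\<lambda>w. if w = v then 1 else 0)"

lemma in_span_delta:
  assumes "finite X" "\<And>w. y w \<noteq> 0 \<Longrightarrow> w \<in> X"
  shows "y \<in> fn.span (delta ` X)"
proof -
  have "y = (\<Sum>v\<in>X. (\<lambda>w. y v * delta v w))"
  proof
    fix w
    have "(\<Sum>v\<in>X. (\<lambda>w. y v * delta v w)) w = (\<Sum>v\<in>X. y v * delta v w)"
      using assms(1) by (induction X rule: finite_induct) (auto simp: plus_fun_def zero_fun_def)
    also have "\<dots> = (\<Sum>v\<in>X. if w = v then y v else 0)"
      by (intro sum.cong) (auto simp: delta_def)
    also have "\<dots> = y w" using assms by auto
    finally show "y w = (\<Sum>v\<in>X. (\<lambda>w. y v * delta v w)) w" by simp
  qed
  moreover have "(\<Sum>v\<in>X. (\<lambda>w. y v * delta v w)) \<in> fn.span (delta ` X)"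
    by (intro fn.span_sum fn.span_scale fn.span_base) auto
  ultimately show ?thesis by simp
qed

datatype lab = Emp | Up | Dn

instance lab :: finite
proof
  have "(UNIV :: lab set) = {Emp, Up, Dn}" using lab.exhaust by auto
  then show "finite (UNIV :: lab set)" by (metis finite.emptyI finite_insert)
qed

type_synonym state = "lab list \<Rightarrow> complex"

text \<open>\<open>Dot k\<close> is the identity without its strand \<open>k\<close>, \<open>Hook k\<close> has a cup and a cap at \<open>k, k + 1\<close>,
  \<open>Shr k\<close> joins the top vertex \<open>k\<close> to the bottom vertex \<open>k + 1\<close> and \<open>Shl k\<close> is its mirror image.\<close>

datatype gen = Dot nat | Hook nat | Shr nat | Shl nat

definition gens :: "nat \<Rightarrow> gen set" where
  "gens m = Dot ` {..<m} \<union> (\<Union>k\<in>{k. Suc k < m}. {Hook k, Shr k, Shl k})"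

text \<open>A raised generator acts on the tail of a word and leaves the first letter alone. The
  inductions on word length rest on this.\<close>

primrec raise :: "gen \<Rightarrow> gen" where
  "raise (Dot k) = Dot (Suc k)"
| "raise (Hook k) = Hook (Suc k)"
| "raise (Shr k) = Shr (Suc k)"
| "raise (Shl k) = Shl (Suc k)"

lemma raise_gens: "g \<in> gens m \<Longrightarrow> raise g \<in> gens (Suc m)"
  by (auto simp: gens_def)

lemma gens_cases:
  assumes "g \<in> gens (Suc m)"
  obtains "g = Dot 0" | "m > 0" "g = Hook 0" | "m > 0" "g = Shr 0" | "m > 0" "g = Shl 0"
    | h where "h \<in> gens m" "g = raise h"
proof (cases g)
  case (Dot k) then show thesis using assms that(1) that(5)[of "Dot (k - 1)"] by (cases k) (auto simp: gens_def)
next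
  case (Hook k) then show thesis using assms that(2) that(5)[of "Hook (k - 1)"] by (cases k) (auto simp: gens_def)
next
  case (Shr k) then show thesis using assms that(3) that(5)[of "Shr (k - 1)"] by (cases k) (auto simp: gens_def)
next
  case (Shl k) then show thesis using assms that(4) that(5)[of "Shl (k - 1)"] by (cases k) (auto simp: gens_def)
qed

text \<open>The coefficients \<open>1, - \<i>, 1\<close> of the cap in \<open>op (Hook k)\<close> are forced by the zigzag relations, and
  a closed loop then has the value \<open>1 + 1 \<cdot> (- \<i>) + \<i> \<cdot> 1 = 1\<close>, as it must.\<close>

fun cup :: "lab \<Rightarrow> lab \<Rightarrow> complex" where
  "cup Emp Emp = 1"
| "cup Up Dn = 1"
| "cup Dn Up = \<i>"
| "cup _ _ = 0"

text \<open>\<open>w\<close> labels the top line and \<open>y\<close> is evaluated at labels of the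
  bottom line. This explains why \<open>Shr k\<close>, whose strand ends at the bottom place
  \<open>Suc k\<close>, looks up \<open>y\<close> at the word with the letter moved from
  \<open>k\<close> to \<open>Suc k\<close>.\<close>

primrec op :: "gen \<Rightarrow> state \<Rightarrow> state" where
  "op (Dot k) y = (\<lambda>w. if w ! k = Emp then y w else 0)"
| "op (Hook k) y = (\<lambda>w. cup (w ! k) (w ! Suc k) *
     (y (w[k := Emp, Suc k := Emp]) - \<i> * y (w[k := Up, Suc k := Dn]) + y (w[k := Dn, Suc k := Up])))"
| "op (Shr k) y = (\<lambda>w. if w ! Suc k = Emp then y (w[k := Emp, Suc k := w ! k]) else 0)"
| "op (Shl k) y = (\<lambda>w. if w ! k = Emp then y (w[k := w ! Suc k, Suc k := Emp]) else 0)"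

abbreviation ops :: "gen list \<Rightarrow> state \<Rightarrow> state" where
  "ops ws y \<equiv> foldr op ws y"

lemma op_linear: "flinear (op g)"
  by (rule flinearI; cases g) (auto simp: fun_eq_iff algebra_simps)

lemma ops_linear: "flinear (\<lambda>y. ops ws y)"
proof (induction ws)
  case Nil show ?case by (rule flinearI) auto
next
  case (Cons g ws)
  then show ?case using op_linear[of g] by (auto simp: linear_on_def)
qed

definition ext :: "lab \<Rightarrow> state \<Rightarrow> state" where
  "ext s y = (\<lambda>w. case w of [] \<Rightarrow> 0 | t # u \<Rightarrow> if t = s then y u else 0)"

lemma ext_simps [simp]: "ext s y [] = 0" "ext s y (t # u) = (if t = s then y u else 0)"
  by (auto simp: ext_def)

definition slice :: "lab \<Rightarrow> state \<Rightarrow> state" where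
  "slice s y = (\<lambda>u. y (s # u))"

lemma ext_linear: "flinear (ext s)"
  by (rule flinearI) (auto simp: fun_eq_iff ext_def split: list.splits)

lemma slice_linear: "flinear (slice s)"
  by (rule flinearI) (auto simp: slice_def)

lemma slice_ext [simp]: "slice s (ext t y) = (if s = t then y else 0)"
  by (auto simp: slice_def fun_eq_iff)

lemma ext_delta: "ext s (delta v) = delta (s # v)"
  by (auto simp: delta_def fun_eq_iff ext_def split: list.splits)

lemma op_raise: "op (raise g) y (s # u) = op g (slice s y) u"
  by (cases g) (auto simp: slice_def)

lemma slice_op_raise: "slice s (op (raise g) y) = op g (slice s y)"
  using op_raise by (auto simp: slice_def fun_eq_iff)

lemma slice_ops_raise: "slice s (ops (map raise ws) y) = ops ws (slice s y)"
  by (induction ws) (auto simp: slice_op_raise)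

lemma op_raise_ext: "op (raise g) (ext s y) = ext s (op g y)"
proof
  fix w show "op (raise g) (ext s y) w = ext s (op g y) w"
    by (cases w; cases g) auto
qed

lemma ops_raise_ext: "ops (map raise ws) (ext s y) = ext s (ops ws y)"
  by (induction ws) (auto simp: op_raise_ext)

subsection \<open>Divided powers of the lowering operator\<close>

text \<open>q to the power of minus the weight, at q = \<open>\<i>\<close>: the eigenvalues of the
  group-like factor in the coproduct of the lowering operator.\<close>

fun alpha :: "lab \<Rightarrow> complex" where
  "alpha Emp = 1" | "alpha Up = - \<i>" | "alpha Dn = \<i>"

text \<open>The coproduct of the \<open>r\<close>-th divided power of the lowering operator,
  unfolded along the first letter and evaluated at a word. A letter spans at most half of a
  two-dimensional representation, so at most one of the \<open>r\<close> lowerings falls on it.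
  Divided powers are needed because the quantum factorial of r is 0 at q = \<open>\<i>\<close> for
  every r > 1.\<close>

primrec dpow :: "lab list \<Rightarrow> nat \<Rightarrow> state \<Rightarrow> complex" where
  "dpow [] r y = (if r = 0 then y [] else 0)"
| "dpow (s # u) r y = alpha s ^ r * dpow u r (slice s y)
     + (if s = Dn \<and> r > 0 then dpow u (r - 1) (slice Up y) else 0)"

lemma slice_add: "slice s (\<lambda>x. y x + z x) = (\<lambda>x. slice s y x + slice s z x)"
  and slice_scale: "slice s (\<lambda>x. c * y x) = (\<lambda>x. c * slice s y x)"
  and slice_zero: "slice s (\<lambda>x. 0) = (\<lambda>x. 0)"
  by (auto simp: slice_def)

lemma dpow_add: "dpow w r (\<lambda>x. y x + z x) = dpow w r y + dpow w r z"
  by (induction w arbitrary: r y z) (auto simp: slice_add algebra_simps)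

lemma dpow_scale: "dpow w r (\<lambda>x. c * y x) = c * dpow w r y"
  by (induction w arbitrary: r y) (auto simp: slice_scale algebra_simps)

lemma dpow_zero [simp]: "dpow w r (\<lambda>x. 0) = 0"
  using dpow_scale[of w r 0] by simp

lemma dpow_diff: "dpow w r (\<lambda>x. y x - z x) = dpow w r y - dpow w r z"
  using dpow_add[of w r y "\<lambda>x. (-1) * z x"] dpow_scale[of w r "-1" z] by simp

lemma dpow_linear: "flinear (\<lambda>y w. dpow w r y)"
  by (rule flinearI) (auto simp: dpow_add dpow_scale)

text \<open>Raised generators are covered by induction on the word, so only those that touch the
  first letter are computed. For \<open>Hook 0\<close> the content is that lowering annihilates the
  cup vector and is annihilated by the cap.\<close>

lemma dpow_op:
  assumes "g \<in> gens (length w)"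
  shows "dpow w r (op g y) = op g (\<lambda>w. dpow w r y) w"
  using assms
proof (induction w arbitrary: g r y)
  case Nil then show ?case by (simp add: gens_def)
next
  case (Cons s u)
  from Cons.prems have "g \<in> gens (Suc (length u))" by simp
  then show ?case
  proof (cases rule: gens_cases)
    case 1
    have "slice s (op g y) = (if s = Emp then slice s y else (\<lambda>x. 0))" "slice Up (op g y) = (\<lambda>x. 0)"
      using 1 by (auto simp: slice_def fun_eq_iff)
    then show ?thesis using 1 by auto
  next
    case (5 h)
    have IH: "dpow u r (op h z) = op h (\<lambda>w. dpow w r z) u" for r z using Cons.IH 5 by blast
    have *: "op h (\<lambda>u. a * x u + b * z u) u = a * op h x u + b * op h z u" for a b x z
      by (cases h) (auto simp: algebra_simps)
    have "slice s (\<lambda>w. dpow w r y) = (\<lambda>u. alpha s ^ r * dpow u r (slice s y)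
        + (if s = Dn \<and> r > 0 then 1 else 0) * dpow u (r - 1) (slice Up y))"
      by (rule HOL.ext, simp add: slice_def[of s "\<lambda>w. dpow w r y"])
    then have "op g (\<lambda>w. dpow w r y) (s # u) = op h (\<lambda>u. alpha s ^ r * dpow u r (slice s y)
        + (if s = Dn \<and> r > 0 then 1 else 0) * dpow u (r - 1) (slice Up y)) u"
      using 5 by (simp only: op_raise)
    then show ?thesis using 5 unfolding * by (auto simp: slice_op_raise IH)
  next
    case 2
    then obtain t v where u: "u = t # v" by (cases u) auto
    define z where "z = (\<lambda>x. slice Emp (slice Emp y) x - \<i> * slice Dn (slice Up y) x
        + slice Up (slice Dn y) x)"
    have sl: "slice b (slice a (op g y)) = (\<lambda>x. cup a b * z x)" for a b
      using 2 by (auto simp: slice_def z_def)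
    have z: "dpow v r z = dpow v r (slice Emp (slice Emp y)) - \<i> * dpow v r (slice Dn (slice Up y))
        + dpow v r (slice Up (slice Dn y))" for r
      by (simp add: dpow_add dpow_diff dpow_scale z_def)
    have ii: "\<i> * (\<i> * x) = - x" "(- \<i>) ^ n * (\<i> ^ n * x) = x" "\<i> ^ n * ((- \<i>) ^ n * x) = x" for x n
      by (simp_all flip: mult.assoc power_mult_distrib)
    \<comment> \<open>At \<open>Dn # Dn # v\<close> the cup has no entry, yet lowering the
      \<open>Up\<close> of either summand of the cup leads there. The two contributions cancel
      because \<open>cup Dn Up = \<i>\<close>.\<close>
    have DD: "\<i> ^ r * (\<i> * x) + \<i> ^ (r - Suc 0) * x = 0" if r0: "r > 0" for x
    proof -
      obtain n where n: "r = Suc n" using r0 by (cases r) auto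
      have "\<i> ^ Suc n * (\<i> * x) = (\<i> * \<i>) * (\<i> ^ n * x)" by (simp only: power_Suc mult_ac)
      then show ?thesis using n by simp
    qed
    have L: "dpow (s # u) r (op g y) = cup s t * dpow v r z"
      unfolding u by (cases s; cases t; cases "r = 0"; cases "r = Suc 0") (auto simp: sl dpow_scale ii DD)
    \<comment> \<open>The contribution of the labels \<open>Up\<close>, \<open>Up\<close> with one
      of them lowered. It enters the values at \<open>Up # Dn # v\<close> and
      \<open>Dn # Up # v\<close> with factors that cancel against the coefficients
      \<open>- \<i>\<close> and \<open>1\<close> of the cap.\<close>
    define d where "d = (if r > 0 then dpow v (r - 1) (slice Up (slice Up y)) else 0)"
    have UD: "dpow (Up # Dn # v) r y = dpow v r (slice Dn (slice Up y)) + (- \<i>) ^ r * d"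
      by (simp add: d_def distrib_left ii)
    have DU: "dpow (Dn # Up # v) r y = dpow v r (slice Up (slice Dn y)) + (- \<i>) ^ (r - 1) * d"
      by (simp add: d_def ii)
    have "d = 0 \<or> (- \<i>) ^ (r - 1) = \<i> * (- \<i>) ^ r"
      by (cases r) (auto simp: d_def ii)
    then have R: "op g (\<lambda>w. dpow w r y) (s # u) = cup s t * dpow v r z"
      unfolding u z using 2 by (auto simp: UD DU distrib_left simp del: dpow.simps(2))
         (simp_all add: algebra_simps)
    show ?thesis using L R by simp
  next
    case 3
    then obtain t v where u: "u = t # v" by (cases u) auto
    have sl: "slice b (slice a (op g y)) = (if b = Emp then slice a (slice Emp y) else (\<lambda>x. 0))" for a b
      using 3 by (auto simp: slice_def)
    have "dpow (s # t # v) r (op g y) = (if t = Emp then dpow (Emp # s # v) r y else 0)"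
      by (cases s; cases t; cases "r = 0") (auto simp: sl)
    then show ?thesis unfolding u using 3 by simp
  next
    case 4
    then obtain t v where u: "u = t # v" by (cases u) auto
    have sl: "slice b (slice a (op g y)) = (if a = Emp then slice Emp (slice b y) else (\<lambda>x. 0))" for a b
      using 4 by (auto simp: slice_def)
    have "dpow (s # t # v) r (op g y) = (if s = Emp then dpow (t # Emp # v) r y else 0)"
      by (cases s; cases t; cases "r = 0") (auto simp: sl)
    then show ?thesis unfolding u using 4 by simp
  qed
qed

text \<open>Each lowering uses up one letter \<open>Up\<close>.\<close>

lemma dpow_vanish:
  assumes "\<And>u. y u \<noteq> 0 \<Longrightarrow> count_list u Up < r"
  shows "dpow w r y = 0"
  using assms
proof (induction w arbitrary: r y)
  case Nil then show ?case by auto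
next
  case (Cons s u)
  have "dpow u r (slice s y) = 0"
    by (rule Cons.IH) (use Cons.prems in \<open>fastforce simp: slice_def split: if_splits\<close>)
  moreover have "dpow u (r - 1) (slice Up y) = 0"
    by (rule Cons.IH) (use Cons.prems in \<open>fastforce simp: slice_def split: if_splits\<close>)
  ultimately show ?case by simp
qed

text \<open>Each lowering leaves a letter \<open>Dn\<close> behind.\<close>

lemma dpow_no_Dn: "Dn \<notin> set w \<Longrightarrow> r > 0 \<Longrightarrow> dpow w r y = 0"
  by (induction w arbitrary: y) auto

lemma dpow_length: "(\<And>u. y u \<noteq> 0 \<Longrightarrow> length u = j) \<Longrightarrow> length w \<noteq> j \<Longrightarrow> dpow w r y = 0"
proof (induction w arbitrary: r y j)
  case Nil then show ?case by auto
next
  case (Cons s u)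
  have "dpow u r (slice t y) = 0" for r t
  proof (cases j)
    case 0
    then have "slice t y = (\<lambda>x. 0)" using Cons.prems(1) by (fastforce simp: slice_def)
    then show ?thesis by simp
  next
    case (Suc l)
    show ?thesis
      by (rule Cons.IH[of _ l]) (use Cons.prems Suc in \<open>auto simp: slice_def dest: Cons.prems(1)\<close>)
  qed
  then show ?case by simp
qed

subsection \<open>Motzkin numbers and the cyclic submodules of the model\<close>

primrec weight :: "lab \<Rightarrow> int" where
  "weight Emp = 0"
| "weight Up = 1"
| "weight Dn = - 1"

primrec wt :: "lab list \<Rightarrow> int" where
  "wt [] = 0"
| "wt (s # u) = weight s + wt u"

lemma wt_append [simp]: "wt (u @ v) = wt u + wt v"
  by (induction u) auto

lemma wt_replicate [simp]: "wt (replicate n s) = int n * weight s"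
  by (induction n) (auto simp: algebra_simps)

primrec mot :: "nat \<Rightarrow> nat \<Rightarrow> nat" where
  "mot 0 i = (if i = 0 then 1 else 0)"
| "mot (Suc j) i = (if i = 0 then 0 else mot j (i - 1)) + mot j i + mot j (i + 1)"

lemma mot_zero: "j < i \<Longrightarrow> mot j i = 0"
  by (induction j arbitrary: i) auto

lemma mot_diag [simp]: "mot j j = 1"
  by (induction j) (auto simp: mot_zero)

text \<open>With the empties in front, \<open>base i (Suc j)\<close> is
  \<open>Emp # base i j\<close>, and the idempotent word that keeps the last strands fixes the base
  vector.\<close>

definition base :: "nat \<Rightarrow> nat \<Rightarrow> lab list" where
  "base i j = replicate (j - i) Emp @ replicate i Up"

definition words :: "nat \<Rightarrow> nat \<Rightarrow> lab list set" where
  "words i j = {w. length w = j \<and> wt w = int i}"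

text \<open>A substitute for highest weight vectors of weight \<open>i\<close>: for generic q a
  vector of weight \<open>i\<close> is killed by raising iff all lowering powers beyond the
  \<open>i\<close>-th kill it. Phrased with divided powers, the condition keeps the generic
  dimension at q = \<open>\<i>\<close> and mentions no raising operator.\<close>

definition K :: "nat \<Rightarrow> nat \<Rightarrow> state set" where
  "K i j = {y. (\<forall>w. y w \<noteq> 0 \<longrightarrow> w \<in> words i j) \<and> (\<forall>r>i. \<forall>w. dpow w r y = 0)}"

definition cyc :: "nat \<Rightarrow> nat \<Rightarrow> state set" where
  "cyc i j = fn.span {ops ws (delta (base i j)) | ws. set ws \<subseteq> gens j}"

text \<open>The largest subspace of \<open>K i j\<close> that is stable under the generators and
  whose members vanish at the base word; in other words, the radical of the pairing of
  \<open>K i j\<close> with words of generators.\<close>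

definition rad :: "nat \<Rightarrow> nat \<Rightarrow> state set" where
  "rad i j = {y \<in> K i j. \<forall>ws. set ws \<subseteq> gens j \<longrightarrow> ops ws y (base i j) = 0}"

lemma finite_words: "finite (words i j)"
  by (rule finite_subset[OF _ finite_lists_length_eq[OF finite_UNIV, of j]]) (auto simp: words_def)

lemma K_subset: "K i j \<subseteq> fn.span (delta ` words i j)"
proof
  fix y assume "y \<in> K i j"
  then show "y \<in> fn.span (delta ` words i j)"
    by (intro in_span_delta finite_words) (simp add: K_def)
qed

lemma K_subspace: "fn.subspace (K i j)"
proof (rule fn.subspaceI)
  show "0 \<in> K i j" by (simp add: K_def zero_fun_def)
next
  fix x y assume "x \<in> K i j" "y \<in> K i j"
  then have "w \<in> words i j" if "x w + y w \<noteq> 0" for w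
    using that by (cases "x w = 0") (simp_all add: K_def)
  with \<open>x \<in> K i j\<close> \<open>y \<in> K i j\<close> show "x + y \<in> K i j" by (simp add: K_def plus_fun_def dpow_add)
next
  fix c x assume "x \<in> K i j"
  then show "(\<lambda>w. c * x w) \<in> K i j" by (simp add: K_def dpow_scale)
qed

lemma K_wordsD: "y \<in> K i j \<Longrightarrow> y w \<noteq> 0 \<Longrightarrow> w \<in> words i j"
  and K_dpowD: "y \<in> K i j \<Longrightarrow> r > i \<Longrightarrow> dpow w r y = 0"
  by (auto simp: K_def)

lemma base_words: "i \<le> j \<Longrightarrow> base i j \<in> words i j"
  by (auto simp: base_def words_def)

section \<open>Stability of \<open>K\<close> and \<open>cyc\<close> under the generators\<close>

lemma wt_update2:
  "Suc k < length w \<Longrightarrow> wt (w[k := a, Suc k := b])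
     = wt w - weight (w ! k) - weight (w ! Suc k) + weight a + weight b"
proof (induction w arbitrary: k)
  case (Cons s u)
  then show ?case by (cases k; cases u) auto
qed auto

lemma op_support:
  assumes "op g y w \<noteq> 0"
  obtains "y w \<noteq> 0"
  | k a b where "g \<in> {Hook k, Shr k, Shl k}" "y (w[k := a, Suc k := b]) \<noteq> 0"
      "weight a + weight b = weight (w ! k) + weight (w ! Suc k)"
proof (cases g)
  case (Dot k) then show thesis using assms that(1) by (auto split: if_splits)
next
  case (Hook k)
  have "weight (w ! k) + weight (w ! Suc k) = 0"
    using assms Hook by (cases "w ! k"; cases "w ! Suc k") auto
  moreover have "y (w[k := Emp, Suc k := Emp]) \<noteq> 0 \<or> y (w[k := Up, Suc k := Dn]) \<noteq> 0
      \<or> y (w[k := Dn, Suc k := Up]) \<noteq> 0"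
    using assms Hook by auto
  ultimately show thesis
    using that(2)[of k Emp Emp] that(2)[of k Up Dn] that(2)[of k Dn Up] Hook by auto
next
  case (Shr k)
  then have "y (w[k := Emp, Suc k := w ! k]) \<noteq> 0" "w ! Suc k = Emp"
    using assms by (auto split: if_splits)
  then show thesis using that(2)[of k Emp "w ! k"] Shr by simp
next
  case (Shl k)
  then have "y (w[k := w ! Suc k, Suc k := Emp]) \<noteq> 0" "w ! k = Emp"
    using assms by (auto split: if_splits)
  then show thesis using that(2)[of k "w ! Suc k" Emp] Shl by simp
qed

lemma op_words:
  assumes g: "g \<in> gens j" and y: "\<And>w. y w \<noteq> 0 \<Longrightarrow> w \<in> words i j" and "op g y w \<noteq> 0"
  shows "w \<in> words i j"
  using assms(3)
proof (cases rule: op_support)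
  case 1 then show ?thesis using y by blast
next
  case (2 k a b)
  have l: "length w = j" using y[OF 2(2)] by (simp add: words_def)
  then have "Suc k < length w" using 2(1) g by (auto simp: gens_def)
  from wt_update2[OF this, of a b] show ?thesis using y[OF 2(2)] l 2(3) by (simp add: words_def)
qed

lemma op_K:
  assumes "g \<in> gens j" "y \<in> K i j"
  shows "op g y \<in> K i j"
proof -
  have w: "w \<in> words i j" if "op g y w \<noteq> 0" for w
    using op_words[OF assms(1) K_wordsD[OF assms(2)] that] .
  have "dpow w r (op g y) = 0" if r: "r > i" for w r
  proof (cases "length w = j")
    case True
    have "dpow w r (op g y) = op g (\<lambda>w. dpow w r y) w" using dpow_op True assms(1) by blast
    also have "(\<lambda>w. dpow w r y) = (\<lambda>w. 0)" using K_dpowD[OF assms(2) r] by auto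
    finally show ?thesis by (cases g) auto
  next
    case False
    then show ?thesis using w by (intro dpow_length[of _ j]) (auto simp: words_def)
  qed
  then show ?thesis using w by (auto simp: K_def)
qed

lemma ops_K: "set ws \<subseteq> gens j \<Longrightarrow> y \<in> K i j \<Longrightarrow> ops ws y \<in> K i j"
  by (induction ws) (auto simp: op_K)

lemma count_list_replicate: "count_list (replicate n x) y = (if x = y then n else 0)"
  by (induction n) auto

lemma delta_base_K: "i \<le> j \<Longrightarrow> delta (base i j) \<in> K i j"
  by (auto simp: K_def delta_def base_words split: if_splits)
    (rule dpow_vanish, auto simp: base_def count_list_replicate split: if_splits)

lemma cyc_subset_K: "i \<le> j \<Longrightarrow> cyc i j \<subseteq> K i j"
  unfolding cyc_def by (rule fn.span_minimal) (auto simp: K_subspace ops_K delta_base_K)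

lemma cyc_subspace: "fn.subspace (cyc i j)"
  by (simp add: cyc_def)

lemma cyc_base: "delta (base i j) \<in> cyc i j"
  unfolding cyc_def by (rule fn.span_base) (auto intro!: exI[of _ "[]"])

lemma op_cyc:
  assumes "g \<in> gens j" "y \<in> cyc i j"
  shows "op g y \<in> cyc i j"
proof -
  have "op g (ops ws (delta (base i j))) \<in> {ops ws (delta (base i j)) | ws. set ws \<subseteq> gens j}"
    if "set ws \<subseteq> gens j" for ws
    using that assms(1) by (auto intro!: exI[of _ "g # ws"])
  then show ?thesis
    using assms(2) unfolding cyc_def
    by (intro flinear_span[OF op_linear]) (auto intro!: fn.span_base)
qed

lemma ops_cyc: "set ws \<subseteq> gens j \<Longrightarrow> y \<in> cyc i j \<Longrightarrow> ops ws y \<in> cyc i j"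
  by (induction ws) (auto simp: op_cyc)

lemma linear_into_cyc:
  assumes "flinear L" "y \<in> cyc i j"
    and "\<And>ws. set ws \<subseteq> gens j \<Longrightarrow> L (ops ws (delta (base i j))) \<in> cyc i' j'"
  shows "L y \<in> cyc i' j'"
  using assms unfolding cyc_def
  by (intro flinear_span[of L]) auto

text \<open>Raising a word of generators lets it act behind the new \<open>Emp\<close>, and the base
  vector goes to the base vector.\<close>

lemma ext_Emp_cyc:
  assumes "i \<le> j" "y \<in> cyc i j"
  shows "ext Emp y \<in> cyc i (Suc j)"
proof (rule linear_into_cyc[OF ext_linear assms(2)])
  fix ws assume ws: "set ws \<subseteq> gens j"
  have "ext Emp (ops ws (delta (base i j))) = ops (map raise ws) (delta (base i (Suc j)))"
    using assms(1) by (simp add: ops_raise_ext[symmetric] ext_delta base_def Suc_diff_le)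
  also have "\<dots> \<in> cyc i (Suc j)" by (rule ops_cyc) (use ws raise_gens cyc_base in auto)
  finally show "ext Emp (ops ws (delta (base i j))) \<in> cyc i (Suc j)" .
qed

text \<open>Each new \<open>Emp\<close> is first put in front, where it is harmless by
  \<open>ext_Emp_cyc\<close>; then \<open>Shr 0\<close> makes it change places with the leading
  \<open>Up\<close>.\<close>

lemma Up_first_cyc: "delta (Up # replicate d Emp @ replicate c Up) \<in> cyc (Suc c) (Suc c + d)"
proof (induction d)
  case 0 then show ?case using cyc_base[of "Suc c" "Suc c"] by (simp add: base_def)
next
  case (Suc d)
  let ?v = "replicate d Emp @ replicate c Up"
  have "op (Shr 0) (delta (Emp # Up # ?v)) = delta (Up # Emp # ?v)"
  proof
    fix w show "op (Shr 0) (delta (Emp # Up # ?v)) w = delta (Up # Emp # ?v) w"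
      by (cases w; cases "tl w") (auto simp: delta_def)
  qed
  moreover have "op (Shr 0) (delta (Emp # Up # ?v)) \<in> cyc (Suc c) (Suc (Suc c + d))"
    using ext_Emp_cyc[OF _ Suc] by (intro op_cyc) (auto simp: gens_def ext_delta)
  ultimately show ?case by simp
qed

lemma ext_Up_cyc:
  assumes "i \<le> j" "y \<in> cyc i j"
  shows "ext Up y \<in> cyc (Suc i) (Suc j)"
proof (rule linear_into_cyc[OF ext_linear assms(2)])
  fix ws assume ws: "set ws \<subseteq> gens j"
  have "ext Up (ops ws (delta (base i j))) = ops (map raise ws) (delta (Up # base i j))"
    by (simp add: ops_raise_ext[symmetric] ext_delta)
  also have "\<dots> \<in> cyc (Suc i) (Suc j)"
    using Up_first_cyc[of "j - i" i] assms(1)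
    by (intro ops_cyc) (use ws raise_gens in \<open>auto simp: base_def\<close>)
  finally show "ext Up (ops ws (delta (base i j))) \<in> cyc (Suc i) (Suc j)" .
qed

text \<open>\<open>Hook 0\<close> applied to two leading empties creates a leading
  \<open>Dn\<close>, and \<open>\<i>\<close> is the entry \<open>cup Dn Up\<close>. Further empties
  are moved behind the \<open>Dn\<close> by \<open>Shr 0\<close>. Only the \<open>Dn\<close>-slice
  is recorded, since the cup creates other terms as well.\<close>

lemma Dn_first_cyc:
  "\<exists>y \<in> cyc i (Suc (Suc (i + d))). slice Dn y = (\<lambda>u. \<i> * delta (replicate d Emp @ replicate (Suc i) Up) u)"
proof (induction d)
  case 0
  let ?y = "op (Hook 0) (delta (base i (Suc (Suc i))))"
  have "base i (Suc (Suc i)) = Emp # Emp # replicate i Up"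
    by (simp add: base_def numeral_2_eq_2)
  then have "slice Dn ?y u = \<i> * delta (replicate (Suc i) Up) u" for u
    by (cases u; cases "hd u") (auto simp: slice_def delta_def)
  moreover have "?y \<in> cyc i (Suc (Suc i))" using cyc_base by (intro op_cyc) (auto simp: gens_def)
  ultimately show ?case by auto
next
  case (Suc d)
  then obtain y where y: "y \<in> cyc i (Suc (Suc (i + d)))"
      "slice Dn y = (\<lambda>u. \<i> * delta (replicate d Emp @ replicate (Suc i) Up) u)" by blast
  let ?y = "op (Shr 0) (ext Emp y)"
  have "y [] = 0"
    using cyc_subset_K[of i "Suc (Suc (i + d))"] y(1) K_wordsD[of y i "Suc (Suc (i + d))" "[]"]
    by (auto simp: words_def)
  have "slice Dn ?y u = \<i> * delta (replicate (Suc d) Emp @ replicate (Suc i) Up) u" for u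
    using fun_cong[OF y(2), of "tl u"] \<open>y [] = 0\<close> by (cases u; cases "hd u") (auto simp: slice_def delta_def)
  moreover have "?y \<in> cyc i (Suc (Suc (i + Suc d)))"
    using ext_Emp_cyc[OF _ y(1)] by (intro op_cyc) (auto simp: gens_def)
  ultimately show ?case by auto
qed

lemma slice_Dn_cyc_surj:
  assumes "Suc i \<le> j"
  shows "cyc (Suc i) j \<subseteq> slice Dn ` cyc i (Suc j)"
proof -
  interpret l: linear_on_subspace "\<lambda>c t x. c * t x" "\<lambda>c t x. c * t x" "cyc i (Suc j)" "slice Dn"
    by (rule flinear_onI[OF slice_linear cyc_subspace])
  obtain y where y: "y \<in> cyc i (Suc j)" "slice Dn y = (\<lambda>u. \<i> * delta (base (Suc i) j) u)"
    using Dn_first_cyc[of i "j - Suc i"] assms by (auto simp: base_def)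
  have "ops ws (delta (base (Suc i) j)) \<in> slice Dn ` cyc i (Suc j)" if ws: "set ws \<subseteq> gens j" for ws
  proof -
    \<comment> \<open>The factor \<open>- \<i>\<close> undoes the \<open>\<i>\<close> that the cup
      has left in \<open>slice Dn y\<close>.\<close>
    let ?y = "\<lambda>w. (- \<i>) * ops (map raise ws) y w"
    have "?y \<in> cyc i (Suc j)"
      using y ws raise_gens by (intro fn.subspace_scale[OF cyc_subspace] ops_cyc) auto
    moreover have "ops ws (\<lambda>u. \<i> * delta (base (Suc i) j) u) = (\<lambda>u. \<i> * ops ws (delta (base (Suc i) j)) u)"
      using ops_linear by (auto simp: linear_on_def)
    then have "slice Dn ?y = ops ws (delta (base (Suc i) j))"
      unfolding slice_scale slice_ops_raise y(2) by (simp add: fun_eq_iff algebra_simps flip: mult.assoc)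
    ultimately show ?thesis by (metis image_eqI)
  qed
  moreover have "fn.subspace (slice Dn ` cyc i (Suc j))"
    by (rule l.subspace_image[OF cyc_subspace]) simp
  ultimately show ?thesis unfolding cyc_def[of "Suc i"] by (intro fn.span_minimal) auto
qed

section \<open>Dimension of \<open>K\<close> by cutting off the first letter\<close>

lemma raise_set: "set ws \<subseteq> gens m \<Longrightarrow> set (map raise ws) \<subseteq> gens (Suc m)"
  using raise_gens by auto

lemma slice_0 [simp]: "slice s 0 = 0" and dpow_0 [simp]: "dpow w r 0 = 0"
  by (simp_all add: zero_fun_def slice_zero)

lemma slice_Emp_K: "y \<in> K i (Suc j) \<Longrightarrow> slice Emp y \<in> K i j"
  unfolding K_def
proof (clarify, intro conjI allI impI)
  fix w assume *: "\<forall>w. y w \<noteq> 0 \<longrightarrow> w \<in> words i (Suc j)" "slice Emp y w \<noteq> 0"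
  then have "Emp # w \<in> words i (Suc j)" by (simp add: slice_def)
  then show "w \<in> words i j" by (simp add: words_def)
next
  fix r w assume *: "\<forall>r>i. \<forall>w. dpow w r y = 0" "r > i"
  then have "dpow (Emp # w) r y = 0" by blast
  then show "dpow w r (slice Emp y) = 0" by simp
qed

lemma dpow_slice_Up: "y \<in> K i j \<Longrightarrow> r > i \<Longrightarrow> dpow w r (slice Up y) = 0"
  using K_dpowD[of y i j r "Up # w"] by simp

text \<open>Evaluated at \<open>Dn # w\<close>, the \<open>r\<close>-th lowering of \<open>y\<close>
  involves the \<open>r\<close>-th lowering of \<open>slice Dn y\<close> and the lowering by
  \<open>r - 1\<close> of \<open>slice Up y\<close>. The latter vanishes once
  \<open>r - 1 > i\<close>, so the bound for \<open>slice Dn y\<close> moves up by one.\<close>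

lemma slice_Dn_K:
  assumes "y \<in> K i (Suc j)"
  shows "slice Dn y \<in> K (Suc i) j"
proof -
  have "w \<in> words (Suc i) j" if "slice Dn y w \<noteq> 0" for w
    using K_wordsD[OF assms, of "Dn # w"] that by (simp add: slice_def words_def)
  moreover have "dpow w r (slice Dn y) = 0" if "r > Suc i" for r w
    using K_dpowD[OF assms, of r "Dn # w"] that dpow_slice_Up[OF assms, of "r - 1" w] by simp
  ultimately show ?thesis by (simp add: K_def)
qed

text \<open>Without a \<open>Dn\<close>-slice the same evaluation isolates the lowering of
  \<open>slice Up y\<close> by \<open>r - 1\<close>, so the bound moves down by one. For
  \<open>i = 0\<close> the power 0, the identity, is already among those that vanish.\<close>

lemma slice_Up_K:
  assumes "y \<in> K i (Suc j)" "slice Dn y = 0"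
  shows "if i = 0 then slice Up y = 0 else slice Up y \<in> K (i - 1) j"
proof -
  have *: "dpow w r (slice Up y) = 0" if "Suc r > i" for r w
    using K_dpowD[OF assms(1), of "Suc r" "Dn # w"] that assms(2) by (simp add: zero_fun_def)
  have zero: "slice Up y w = 0" if "i = 0" for w
  proof -
    have "dpow w 0 z = z w" for z w by (induction w arbitrary: z) (auto simp: slice_def)
    then show ?thesis using *[of 0 w] that by simp
  qed
  have "w \<in> words (i - 1) j" if "slice Up y w \<noteq> 0" "i > 0" for w
    using K_wordsD[OF assms(1), of "Up # w"] that by (simp add: slice_def words_def)
  then show ?thesis using * zero by (auto simp: K_def)
qed

lemma state_eq_slices:
  assumes "y [] = 0" "slice Emp y = 0" "slice Up y = 0" "slice Dn y = 0"
  shows "y = 0"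
proof
  fix w show "y w = 0 w"
  proof (cases w)
    case (Cons s u)
    then show ?thesis using assms(2-4)[THEN fun_cong, of u] by (cases s) (auto simp: slice_def)
  qed (use assms in auto)
qed

lemma K_Nil: "y \<in> K i (Suc j) \<Longrightarrow> y [] = 0"
  using K_wordsD[of y i "Suc j" "[]"] by (auto simp: words_def)

lemma fn_dim_zero [simp]: "fn.dim {0} = 0"
  using fn.dim_eq_card[of "{}" "{0}"] fn.independent_empty by simp

lemma fn_dim_mono:
  assumes "fn.subspace W" "fn.subspace W'" "W \<subseteq> W'" "W' \<subseteq> K i j"
  shows "fn.dim W \<le> fn.dim W'"
  using fn.dim_mono_span[OF assms(1-3), of "delta ` words i j"] assms(4) K_subset finite_words by blast

lemma fn_rank_nullity:
  assumes "flinear L" "fn.subspace W" "W \<subseteq> K i j"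
  shows "fn.dim W = fn.dim {y \<in> W. L y = 0} + fn.dim (L ` W)"
proof -
  interpret l: linear_on_subspace "\<lambda>c t x. c * t x" "\<lambda>c t x. c * t x" W L
    by (rule flinear_onI[OF assms(1,2)])
  show ?thesis using l.rank_nullity[of "delta ` words i j"] assms(3) K_subset finite_words by blast
qed

lemma flinear_subspace_image: "flinear L \<Longrightarrow> fn.subspace W \<Longrightarrow> fn.subspace (L ` W)"
  using linear_on_subspace.subspace_image[OF flinear_onI, of L W W] by simp

lemma flinear_subspace_kernel: "flinear L \<Longrightarrow> fn.subspace W \<Longrightarrow> fn.subspace {y \<in> W. L y = 0}"
  using linear_on_subspace.subspace_kernel[OF flinear_onI, of L W] by simp

text \<open>The order of the cuts matters: the \<open>Up\<close>-slice is under control only after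
  the \<open>Dn\<close>-slice has been made zero, by \<open>slice_Up_K\<close>.\<close>

lemma subspace_slices_dim:
  assumes W: "fn.subspace W" "W \<subseteq> K i (Suc j)"
  defines "W1 \<equiv> {y \<in> W. slice Dn y = 0}"
  defines "W2 \<equiv> {y \<in> W1. slice Emp y = 0}"
  shows "fn.dim W = fn.dim (slice Dn ` W) + fn.dim (slice Emp ` W1) + fn.dim (slice Up ` W2)"
    and "fn.subspace W1" "fn.subspace W2"
proof -
  show sub1: "fn.subspace W1" unfolding W1_def by (rule flinear_subspace_kernel[OF slice_linear W(1)])
  show sub2: "fn.subspace W2" unfolding W2_def by (rule flinear_subspace_kernel[OF slice_linear sub1])
  have K: "W1 \<subseteq> K i (Suc j)" "W2 \<subseteq> K i (Suc j)" using W by (auto simp: W1_def W2_def)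
  have "y = 0" if "y \<in> W2" "slice Up y = 0" for y
    by (rule state_eq_slices) (use that W(2) K_Nil[of y i j] in \<open>auto simp: W1_def W2_def\<close>)
  moreover have "slice Up 0 = 0" by (simp add: zero_fun_def slice_zero)
  ultimately have "{y \<in> W2. slice Up y = 0} = {0}"
    using fn.subspace_0[OF sub2] by blast
  then have "fn.dim {y \<in> W2. slice Up y = 0} = 0"
    using fn.dim_eq_card[of "{}" "{0}"] fn.independent_empty by simp
  then show "fn.dim W = fn.dim (slice Dn ` W) + fn.dim (slice Emp ` W1) + fn.dim (slice Up ` W2)"
    using fn_rank_nullity[OF slice_linear W, of Dn] fn_rank_nullity[OF slice_linear sub1 K(1), of Emp]
      fn_rank_nullity[OF slice_linear sub2 K(2), of Up]
    by (simp add: W1_def[symmetric] W2_def[symmetric])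
qed

text \<open>The slices at \<open>Dn\<close>, \<open>Emp\<close>, \<open>Up\<close> lie in
  \<open>K\<close> at heights \<open>i + 1\<close>, \<open>i\<close>, \<open>i - 1\<close>, matching
  the three terms of the recursion of \<open>mot\<close>.\<close>

lemma dim_K_le: "fn.dim (K i j) \<le> mot j i"
proof (induction j arbitrary: i)
  case 0
  have "K i 0 \<subseteq> fn.span (delta ` words i 0)" by (rule K_subset)
  then have "fn.dim (K i 0) \<le> card (delta ` words i 0)"
    by (rule fn.dim_le_card) (simp add: finite_words)
  also have "words i 0 = (if i = 0 then {[]} else {})" by (auto simp: words_def)
  finally show ?case by (auto split: if_splits)
next
  case (Suc j)
  let ?W1 = "{y \<in> K i (Suc j). slice Dn y = 0}"
  let ?W2 = "{y \<in> ?W1. slice Emp y = 0}"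
  note S = subspace_slices_dim[OF K_subspace subset_refl, of i j]
  have 1: "fn.dim (slice Dn ` K i (Suc j)) \<le> mot j (Suc i)"
    by (rule order.trans[OF fn_dim_mono Suc])
      (auto intro: flinear_subspace_image[OF slice_linear] K_subspace slice_Dn_K)
  have 2: "fn.dim (slice Emp ` ?W1) \<le> mot j i"
    by (rule order.trans[OF fn_dim_mono Suc])
      (auto intro!: flinear_subspace_image[OF slice_linear] S(2) K_subspace slice_Emp_K)
  have 3: "fn.dim (slice Up ` ?W2) \<le> (if i = 0 then 0 else mot j (i - 1))"
  proof (cases "i = 0")
    case True
    then have "slice Up ` ?W2 \<subseteq> {0}" using slice_Up_K[of _ i j] by auto
    then have "slice Up ` ?W2 = {0}"
      using fn.subspace_0[OF flinear_subspace_image[OF slice_linear S(3), of Up]] by blast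
    then show ?thesis using True by simp
  next
    case False
    have "slice Up ` ?W2 \<subseteq> K (i - 1) j" using False slice_Up_K[of _ i j] by auto
    then have "fn.dim (slice Up ` ?W2) \<le> mot j (i - 1)"
      by (intro order.trans[OF fn_dim_mono[OF flinear_subspace_image[OF slice_linear S(3)] K_subspace] Suc])
        auto
    then show ?thesis using False by simp
  qed
  show ?case using S(1) 1 2 3 by simp
qed

text \<open>The same three slices, now bounded from below: they contain the spaces
  \<open>cyc\<close> of the shorter length because a letter \<open>Dn\<close>, \<open>Emp\<close> or
  \<open>Up\<close> can be created in front by generators.\<close>

lemma mot_le_dim_cyc: "i \<le> j \<Longrightarrow> mot j i \<le> fn.dim (cyc i j)"
proof (induction j arbitrary: i)
  case 0
  have "delta (base i 0) \<in> cyc i 0" by (rule cyc_base)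
  moreover have "delta (base i 0) \<noteq> 0" by (auto simp: delta_def fun_eq_iff)
  ultimately have "cyc i 0 \<noteq> {0}" by auto
  then have "fn.dim (cyc i 0) \<noteq> 0"
    using fn.dim_eq_0_iff_subspace[OF cyc_subspace, of i 0 "delta ` words i 0"] cyc_subset_K[OF 0]
      K_subset[of i 0] finite_words[of i 0] by blast
  then show ?case by (cases "i = 0") auto
next
  case (Suc j)
  let ?W1 = "{y \<in> cyc i (Suc j). slice Dn y = 0}"
  let ?W2 = "{y \<in> ?W1. slice Emp y = 0}"
  note cK = cyc_subset_K[OF Suc.prems]
  note S = subspace_slices_dim[OF cyc_subspace cK]
  have 1: "mot j (Suc i) \<le> fn.dim (slice Dn ` cyc i (Suc j))"
  proof (cases "Suc i \<le> j")
    case True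
    have "fn.dim (cyc (Suc i) j) \<le> fn.dim (slice Dn ` cyc i (Suc j))"
      by (rule fn_dim_mono[OF cyc_subspace _ slice_Dn_cyc_surj[OF True], of "Suc i" j])
       (use cK slice_Dn_K in \<open>auto intro!: flinear_subspace_image[OF slice_linear] cyc_subspace\<close>)
    then show ?thesis using Suc.IH[OF True] by simp
  qed (simp add: mot_zero)
  have 2: "mot j i \<le> fn.dim (slice Emp ` ?W1)"
  proof (cases "i \<le> j")
    case True
    have "y \<in> slice Emp ` ?W1" if "y \<in> cyc i j" for y
      using ext_Emp_cyc[OF True that] by (intro image_eqI[of _ _ "ext Emp y"]) (auto simp: zero_fun_def)
    then have "fn.dim (cyc i j) \<le> fn.dim (slice Emp ` ?W1)"
      by (intro fn_dim_mono[OF cyc_subspace, of _ _ _ i j])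
       (use cK slice_Emp_K in \<open>auto intro!: flinear_subspace_image[OF slice_linear] S(2)\<close>)
    then show ?thesis using Suc.IH[OF True] by simp
  qed (simp add: mot_zero)
  have 3: "(if i = 0 then 0 else mot j (i - 1)) \<le> fn.dim (slice Up ` ?W2)"
  proof (cases "i = 0")
    case False
    then have le: "i - 1 \<le> j" using Suc.prems by simp
    have 1: "cyc (i - 1) j \<subseteq> slice Up ` ?W2"
    proof
      fix y assume "y \<in> cyc (i - 1) j"
      then show "y \<in> slice Up ` ?W2"
        using ext_Up_cyc[OF le] False
        by (intro image_eqI[of _ _ "ext Up y"]) (auto simp: zero_fun_def)
    qed
    have 2: "slice Up ` ?W2 \<subseteq> K (i - 1) j" using cK slice_Up_K[of _ i j] False by auto
    have "fn.dim (cyc (i - 1) j) \<le> fn.dim (slice Up ` ?W2)"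
      by (rule fn_dim_mono[OF cyc_subspace flinear_subspace_image[OF slice_linear S(3)] 1 2])
    then show ?thesis using Suc.IH[OF le] False by simp
  qed simp
  show ?case using S(1) 1 2 3 by simp
qed

lemma dim_K: "i \<le> j \<Longrightarrow> fn.dim (K i j) = mot j i"
  using dim_K_le[of i j] mot_le_dim_cyc[of i j]
    fn_dim_mono[OF cyc_subspace K_subspace cyc_subset_K subset_refl, of i j] by linarith

text \<open>The base vector generates all of \<open>K i j\<close>. Membership in \<open>cyc\<close>
  can hence be tested by weight and lowering, and the dimension is known.\<close>

lemma cyc_eq_K:
  assumes "i \<le> j"
  shows "cyc i j = K i j"
  by (rule fn.subspace_dim_equal_span[OF cyc_subspace K_subspace cyc_subset_K[OF assms] K_subset])
    (use assms mot_le_dim_cyc dim_K_le[of i j] finite_words in \<open>auto intro: order.trans\<close>)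


section \<open>The radical, and its vanishing at odd heights\<close>

lemma rad_subspace: "fn.subspace (rad i j)"
proof (rule fn.subspaceI)
  have L: "ops ws (\<lambda>w. x w + y w) = (\<lambda>w. ops ws x w + ops ws y w)"
      "ops ws (\<lambda>w. c * x w) = (\<lambda>w. c * ops ws x w)" for ws x y c
    using ops_linear[of ws] by (auto simp: linear_on_def plus_fun_def)
  show "0 \<in> rad i j"
    using fn.subspace_0[OF K_subspace] L(2)[of _ 0 "\<lambda>w. 0"] by (simp add: rad_def zero_fun_def)
  show "x + y \<in> rad i j" if "x \<in> rad i j" "y \<in> rad i j" for x y
    using that fn.subspace_add[OF K_subspace] L(1) by (simp add: rad_def plus_fun_def)
  show "(\<lambda>w. c * x w) \<in> rad i j" if "x \<in> rad i j" for x c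
    using that fn.subspace_scale[OF K_subspace] L(2) by (simp add: rad_def)
qed

lemma rad_K: "y \<in> rad i j \<Longrightarrow> y \<in> K i j"
  by (simp add: rad_def)

lemma op_rad:
  assumes "y \<in> rad i j" "g \<in> gens j"
  shows "op g y \<in> rad i j"
proof -
  have "ops ws (op g y) (base i j) = 0" if "set ws \<subseteq> gens j" for ws
    using assms that by (auto simp: rad_def dest!: spec[of _ "ws @ [g]"])
  then show ?thesis using assms op_K by (simp add: rad_def)
qed

lemma base_Suc: "i \<le> j \<Longrightarrow> base i (Suc j) = Emp # base i j"
  by (simp add: base_def Suc_diff_le)

lemma rad_slice_Emp:
  assumes "i \<le> j" "y \<in> rad i (Suc j)"
  shows "slice Emp y \<in> rad i j"
proof -
  have "ops ws (slice Emp y) (base i j) = 0" if "set ws \<subseteq> gens j" for ws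
  proof -
    have "ops (map raise ws) y (Emp # base i j) = 0"
      using assms raise_set[OF that] unfolding rad_def base_Suc[OF assms(1)] by blast
    then show ?thesis unfolding slice_ops_raise[symmetric] by (simp add: slice_def)
  qed
  then show ?thesis using slice_Emp_K[OF rad_K[OF assms(2)]] by (simp add: rad_def)
qed

text \<open>Read at the base word, a word in the \<open>Shl\<close> returns the coefficient at the
  word whose first \<open>Up\<close> has been pulled in front of the empties.\<close>

lemma move_Up:
  "\<exists>ws. set ws \<subseteq> gens (Suc (d + length v)) \<and>
     (\<forall>y. ops ws y (replicate d Emp @ Up # v) = y (Up # replicate d Emp @ v))"
proof (induction d arbitrary: v)
  case 0 show ?case by (rule exI[of _ "[]"]) auto
next
  case (Suc d)
  obtain ws where ws: "set ws \<subseteq> gens (Suc (d + length (Emp # v)))"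
    "\<And>y. ops ws y (replicate d Emp @ Up # Emp # v) = y (Up # replicate d Emp @ Emp # v)"
    using Suc[of "Emp # v"] by blast
  have "op (Shl d) y (replicate (Suc d) Emp @ Up # v) = y (replicate d Emp @ Up # Emp # v)" for y
  proof -
    have "replicate (Suc d) Emp @ Up # v = replicate d Emp @ Emp # Up # v"
      by (simp add: replicate_app_Cons_same)
    then show ?thesis by (simp add: nth_append list_update_append)
  qed
  then show ?case using ws
    by (intro exI[of _ "Shl d # ws"]) (auto simp: gens_def replicate_app_Cons_same)
qed

lemma rad_ext_Up:
  assumes "i \<le> j" "z \<in> K i j" "ext Up z \<in> rad (Suc i) (Suc j)"
  shows "z \<in> rad i j"
proof -
  obtain ms where ms: "set ms \<subseteq> gens (Suc j)"
    "\<And>y. ops ms y (base (Suc i) (Suc j)) = y (Up # base i j)"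
    using move_Up[of "j - i" "replicate i Up"] assms(1) by (auto simp: base_def)
  have "ops ws z (base i j) = 0" if "set ws \<subseteq> gens j" for ws
  proof -
    have "ops (ms @ map raise ws) (ext Up z) (base (Suc i) (Suc j)) = 0"
      using assms(3) ms(1) raise_set[OF that] by (simp only: rad_def mem_Collect_eq set_append Un_subset_iff)
    then show ?thesis by (simp add: ms(2) ops_raise_ext)
  qed
  then show ?thesis using assms(2) by (simp add: rad_def)
qed

lemma wt_le_length: "wt w \<le> int (length w)"
proof (induction w)
  case (Cons s w) then show ?case by (cases s) auto
qed simp

lemma wt_eq_length: "wt w = int (length w) \<Longrightarrow> w = replicate (length w) Up"
proof (induction w)
  case (Cons s w) then show ?case using wt_le_length[of w] by (cases s) auto
qed simp

lemma words_diag: "words i i = {replicate i Up}"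
  using wt_eq_length by (auto simp: words_def)

lemma rad_diag: "rad i i = {0}"
proof -
  have "y = 0" if "y \<in> rad i i" for y
  proof
    fix w
    have "y (replicate i Up) = 0" using that by (auto simp: rad_def base_def dest!: spec[of _ "[]"])
    then show "y w = 0 w" using K_wordsD[OF rad_K[OF that], of w] words_diag by (cases "y w = 0") auto
  qed
  then show ?thesis using fn.subspace_0[OF rad_subspace] by blast
qed

text \<open>The scalar collected while a word without \<open>Emp\<close> is sorted into
  \<open>Dn\<close>s followed by \<open>Up\<close>s: each \<open>Up\<close> pays
  \<open>- \<i>\<close> for every \<open>Dn\<close> to its right.\<close>

primrec ph :: "lab list \<Rightarrow> complex" where
  "ph [] = 1"
| "ph (s # u) = (if s = Up then (- \<i>) ^ count_list u Dn else 1) * ph u"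

lemma swap_sorted:
  assumes "\<And>u v. y (u @ Up # Dn # v) = - \<i> * y (u @ Dn # Up # v)" "Emp \<notin> set w"
  shows "y w = ph w * y (replicate (count_list w Dn) Dn @ replicate (count_list w Up) Up)"
  using assms
proof (induction w arbitrary: y)
  case (Cons s u)
  have mv: "y (x @ Up # replicate a Dn @ v) = (- \<i>) ^ a * y (x @ replicate a Dn @ Up # v)" for a x v
  proof (induction a arbitrary: x)
    case (Suc a)
    have "y (x @ Up # replicate (Suc a) Dn @ v) = - \<i> * y ((x @ [Dn]) @ Up # replicate a Dn @ v)"
      using Cons.prems(1)[of x "replicate a Dn @ v"] by simp
    also have "\<dots> = - \<i> * ((- \<i>) ^ a * y ((x @ [Dn]) @ replicate a Dn @ Up # v))"
      by (simp only: Suc)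
    finally show ?case by simp
  qed simp
  have "slice s y u = ph u * slice s y (replicate (count_list u Dn) Dn @ replicate (count_list u Up) Up)"
    using Cons.prems Cons.prems(1)[of "s # _"] by (intro Cons.IH) (auto simp: slice_def)
  then show ?case using Cons.prems(2) mv[of "[]" "count_list u Dn" "replicate (count_list u Up) Up"]
    by (cases s) (auto simp: slice_def)
qed auto

text \<open>Up to a scalar the only state on words of length \<open>n\<close> without
  \<open>Emp\<close> and with \<open>r\<close> letters \<open>Up\<close> that satisfies the exchange
  rule of \<open>swap_sorted\<close>.\<close>

definition PH :: "nat \<Rightarrow> nat \<Rightarrow> state" where
  "PH n r w = (if length w = n \<and> count_list w Up = r \<and> Emp \<notin> set w then ph w else 0)"

lemma PH_slices:
  "slice Dn (slice Dn (PH (Suc (Suc n)) r)) = PH n r"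
  "slice Dn (slice Up (PH (Suc (Suc n)) r)) = (\<lambda>w. - \<i> * slice Up (slice Dn (PH (Suc (Suc n)) r)) w)"
  "r \<ge> 2 \<Longrightarrow> slice Up (slice Up (PH (Suc (Suc n)) r)) = (\<lambda>w. (-1) ^ (n + r) * PH n (r - 2) w)"
proof -
  show "slice Up (slice Up (PH (Suc (Suc n)) r)) = (\<lambda>w. (-1) ^ (n + r) * PH n (r - 2) w)" if r: "r \<ge> 2"
  proof
    fix w
    show "slice Up (slice Up (PH (Suc (Suc n)) r)) w = (-1) ^ (n + r) * PH n (r - 2) w"
    proof (cases "length w = n \<and> count_list w Up = r - 2 \<and> Emp \<notin> set w")
      case True
      have "Emp \<notin> set u \<Longrightarrow> length u = count_list u Up + count_list u Dn" for u
      proof (induction u)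
        case (Cons s u) then show ?case by (cases s) auto
      qed simp
      \<comment> \<open>Two letters \<open>Up\<close> pass each of the \<open>Dn\<close>s of
        \<open>w\<close>, which gives \<open>(- \<i>) ^ 2 = - 1\<close> per \<open>Dn\<close>. Their
        number has the parity of \<open>n + r\<close>.\<close>
      then have "n + r = 2 * count_list w Up + count_list w Dn + 2" using True r by auto
      then have e: "(-1::complex) ^ (n + r) = (-1) ^ count_list w Dn" by (simp add: power_add power_mult)
      have "(- \<i>) ^ c * ((- \<i>) ^ c * x) = (-1) ^ c * x" for c x
        by (simp flip: mult.assoc power_mult_distrib)
      then show ?thesis using True r e by (auto simp: slice_def PH_def)
    next
      case False
      then show ?thesis using r by (auto simp: slice_def PH_def)
    qed
  qed
qed (auto simp: slice_def PH_def fun_eq_iff)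

text \<open>Two letters are peeled off at once: the two contributions in which exactly one of them
  is lowered cancel by the exchange rule, so only none or both remain.\<close>

lemma dpow_PH_step:
  "dpow (Dn # Dn # v) r (PH (Suc (Suc n)) r) = (-1) ^ r * dpow v r (PH n r)
      + (if r \<ge> 2 then (-1) ^ (n + r) * dpow v (r - 2) (PH n (r - 2)) else 0)"
proof -
  let ?Y = "PH (Suc (Suc n)) r"
  have ii: "\<i> ^ r * (\<i> ^ r * x) = (-1) ^ r * x" for x
    by (simp flip: mult.assoc power_mult_distrib)
  have e: "dpow v k (slice Dn (slice Up ?Y)) = - \<i> * dpow v k (slice Up (slice Dn ?Y))" for k
    unfolding PH_slices(2) by (rule dpow_scale)
  consider "r = 0" | "r = 1" | "r \<ge> 2" by linarith
  then show ?thesis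
  proof cases
    case 3
    then obtain q where q: "r = Suc (Suc q)" by (metis Suc_le_D numeral_2_eq_2 Suc_le_mono)
    have "dpow v q (slice Up (slice Up ?Y)) = (-1) ^ (n + r) * dpow v q (PH n q)"
      using PH_slices(3)[OF 3, of n] q by (simp add: dpow_scale)
    then show ?thesis using ii[of "dpow v r (PH n r)"] e[of "Suc q"]
      by (simp add: PH_slices(1) q distrib_left algebra_simps)
  next
    case 2
    then show ?thesis using e[of 0] ii by (simp add: PH_slices(1) distrib_left)
  qed (simp add: PH_slices(1))
qed

text \<open>Up to sign the quantum binomial coefficient of \<open>Suc (2 * p)\<close> over
  \<open>r\<close> at q = \<open>\<i>\<close>; the right-hand side is its value by the quantum Lucas
  theorem. That it is nonzero for all \<open>r\<close> in range is special to odd length: for even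
  length it vanishes at odd \<open>r\<close>.\<close>

lemma dpow_PH:
  "dpow (replicate (Suc (2 * p)) Dn) r (PH (Suc (2 * p)) r)
     = (-1) ^ (r * p + r div 2) * of_nat (p choose (r div 2))"
proof (induction p arbitrary: r)
  case 0
  consider "r = 0" | "r = 1" | "r \<ge> 2" by linarith
  then show ?case
  proof cases
    case 3 then have "r div 2 > 0" by simp
    then show ?thesis using 3 by (auto simp: slice_def PH_def)
  qed (auto simp: slice_def PH_def)
next
  case (Suc p)
  let ?n = "Suc (2 * p)" and ?v = "replicate (Suc (2 * p)) Dn"
  have "dpow (Dn # Dn # ?v) r (PH (Suc (Suc ?n)) r) = (-1) ^ r * dpow ?v r (PH ?n r)
      + (if r \<ge> 2 then (-1) ^ (?n + r) * dpow ?v (r - 2) (PH ?n (r - 2)) else 0)"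
    by (rule dpow_PH_step)
  also have "\<dots> = (-1) ^ (r * Suc p + r div 2) * of_nat (Suc p choose (r div 2))"
  proof (cases "r \<ge> 2")
    case True
    then obtain q where q: "r = Suc (Suc q)" by (metis Suc_le_D numeral_2_eq_2 Suc_le_mono)
    have "((-1::complex) ^ p)\<^sup>2 = 1" by (simp add: power2_eq_square flip: power_mult_distrib)
    then show ?thesis unfolding Suc q by (simp add: power_add power_mult algebra_simps)
  next
    case False
    then show ?thesis unfolding Suc by (cases "r = 0") (auto simp: power_add)
  qed
  finally show ?case by simp
qed

text \<open>A radical vector of minimal length has no coefficient at words with an
  \<open>Emp\<close> and is annihilated by every cap. It is therefore a multiple of
  \<open>PH\<close>, and a lowering power that must kill it sends \<open>PH\<close> to a nonzero
  binomial coefficient.\<close>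

lemma rad_odd:
  assumes "odd i" "i \<le> j"
  shows "rad i j = {0}"
  using assms(2)
proof (induction j)
  case 0 then show ?case using assms(1) by simp
next
  case (Suc j)
  show ?case
  proof (cases "i = Suc j")
    case True show ?thesis unfolding True by (rule rad_diag)
  next
    case False
    then have ij: "i \<le> j" and IH: "rad i j = {0}" using Suc by auto
    \<comment> \<open>For \<open>k = 0\<close> the first letter is \<open>Emp\<close> and the
      induction hypothesis for the shorter length applies. Otherwise \<open>Shl\<close> moves the
      empty letter one place to the left without losing information.\<close>
    have dot: "y = 0" if "y \<in> rad i (Suc j)" "k \<le> j" "\<And>w. y w \<noteq> 0 \<Longrightarrow> w ! k = Emp" for y k
      using that
    proof (induction k arbitrary: y)
      case 0
      have "slice Emp y = 0" using rad_slice_Emp[OF ij 0(1)] IH by auto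
      moreover have "slice s y = 0" if "s \<noteq> Emp" for s
        using 0(3)[of "s # _"] that by (fastforce simp: slice_def fun_eq_iff)
      ultimately show ?case using K_Nil[OF rad_K[OF 0(1)]] by - (rule state_eq_slices, simp_all)
    next
      case (Suc k)
      have z: "op (Shl k) y = 0"
      proof (rule Suc.IH)
        show "op (Shl k) y \<in> rad i (Suc j)" by (rule op_rad) (use Suc in \<open>auto simp: gens_def\<close>)
      qed (use Suc in \<open>auto split: if_splits\<close>)
      show ?case
      proof (rule HOL.ext, rule ccontr)
        fix v assume v: "y v \<noteq> 0 v"
        then have e: "v ! Suc k = Emp" and l: "length v = Suc j"
          using Suc.prems(3) K_wordsD[OF rad_K[OF Suc.prems(1)], of v] by (auto simp: words_def)
        let ?w = "v[k := Emp, Suc k := v ! k]"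
        have "?w[k := v ! k, Suc k := Emp] = v"
          using e l Suc.prems(2) by (auto simp: list_eq_iff_nth_eq nth_list_update)
        then show False
          using fun_cong[OF z, of ?w] v l Suc.prems(2) by (simp add: nth_list_update)
      qed
    qed
    have "y = 0" if y: "y \<in> rad i (Suc j)" for y
    proof -
      have Emp0: "y w = 0" if w: "Emp \<in> set w" for w
      proof (rule ccontr)
        assume "y w \<noteq> 0"
        then have l: "length w = Suc j" using K_wordsD[OF rad_K[OF y]] by (auto simp: words_def)
        obtain k where k: "k < Suc j" "w ! k = Emp" using w l by (metis in_set_conv_nth)
        have "op (Dot k) y = 0"
          by (rule dot[of _ k]) (use k y op_rad[OF y, of "Dot k"] in \<open>auto simp: gens_def split: if_splits\<close>)
        then show False using k \<open>y w \<noteq> 0\<close> by (metis op.simps(1) zero_fun_apply)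
      qed
      \<comment> \<open>After \<open>Hook\<close> and \<open>Dot\<close> the letter at
        \<open>length u\<close> is empty, so the result is zero by \<open>dot\<close>. Its value at
        two empties is the cap of \<open>y\<close>, in which \<open>Emp0\<close> removes the first
        term.\<close>
      have swap: "y (u @ Up # Dn # v) = - \<i> * y (u @ Dn # Up # v)" for u v
      proof (cases "Suc (Suc (length u + length v)) = Suc j")
        case True
        let ?k = "length u"
        have H: "op (Hook ?k) y \<in> rad i (Suc j)" by (rule op_rad[OF y]) (use True in \<open>auto simp: gens_def\<close>)
        have "op (Dot ?k) (op (Hook ?k) y) = 0"
          by (rule dot[of _ ?k]) (use True op_rad[OF H, of "Dot ?k"] in \<open>auto simp: gens_def split: if_splits\<close>)
        from fun_cong[OF this, of "u @ Emp # Emp # v"]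
        have "y (u @ Emp # Emp # v) - \<i> * y (u @ Up # Dn # v) + y (u @ Dn # Up # v) = 0"
          by (simp add: nth_append list_update_append)
        then have "y (u @ Dn # Up # v) = \<i> * y (u @ Up # Dn # v)" using Emp0 by (simp add: algebra_simps)
        then show ?thesis by simp
      next
        case False
        then have "y (u @ a # b # v) = 0" for a b
          using K_wordsD[OF rad_K[OF y], of "u @ a # b # v"] by (auto simp: words_def)
        then show ?thesis by simp
      qed
      have cnt: "wt w = int (count_list w Up) - int (count_list w Dn)" for w
      proof (induction w)
        case (Cons s w) then show ?case by (cases s) auto
      qed simp
      have len: "Emp \<notin> set w \<Longrightarrow> length w = count_list w Up + count_list w Dn" for w
      proof (induction w)
        case (Cons s w) then show ?case by (cases s) auto
      qed simp
      show "y = 0"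
      \<comment> \<open>Without empties the weight has the parity of the length, so words of odd
        weight exist only for odd \<open>Suc j\<close>.\<close>
      proof (cases "even j")
        case False
        have "y w = 0" for w
        proof (rule ccontr)
          assume "y w \<noteq> 0"
          then have "w \<in> words i (Suc j)" "Emp \<notin> set w" using K_wordsD[OF rad_K[OF y]] Emp0 by auto
          then have "int (count_list w Up) = int i + int (count_list w Dn)"
             "count_list w Up + count_list w Dn = Suc j"
            using cnt[of w] len[of w] by (auto simp: words_def)
          then have "2 * count_list w Dn + i = Suc j" by linarith
          then show False using False assms(1) by presburger
        qed
        then show ?thesis by auto
      next
        case True
        then obtain p where p: "Suc j = Suc (2 * p)" by auto
        \<comment> \<open>The number of letters \<open>Up\<close> in a word of length
          \<open>Suc j\<close> without \<open>Emp\<close> in which they outnumber the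
          \<open>Dn\<close>s by \<open>i\<close>.\<close>
        define r where "r = (Suc j + i) div 2"
        have r: "2 * r = Suc j + i" using True assms(1) unfolding r_def by presburger
        let ?c = "y (replicate (Suc j - r) Dn @ replicate r Up)"
        have "y = (\<lambda>w. ?c * PH (Suc (2 * p)) r w)"
        proof
          fix w
          show "y w = ?c * PH (Suc (2 * p)) r w"
          proof (cases "length w = Suc j \<and> count_list w Up = r \<and> Emp \<notin> set w")
            case True
            then have "count_list w Dn = Suc j - r" using len[of w] by simp
            then show ?thesis using swap_sorted[OF swap, of w] True p by (simp add: PH_def)
          next
            case False
            have "y w = 0"
            proof (rule ccontr)
              assume "y w \<noteq> 0"
              then have w: "w \<in> words i (Suc j)" "Emp \<notin> set w" using K_wordsD[OF rad_K[OF y]] Emp0 by auto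
              then have "int (count_list w Up) = int i + int (count_list w Dn)"
                 "count_list w Up + count_list w Dn = Suc j"
                using cnt[of w] len[of w] by (auto simp: words_def)
              then have "count_list w Up = r" using r by linarith
              then show False using False w by (simp add: words_def)
            qed
            then show ?thesis using False p by (auto simp: PH_def)
          qed
        qed
        then have "dpow (replicate (Suc (2 * p)) Dn) r y
            = ?c * ((-1) ^ (r * p + r div 2) * of_nat (p choose (r div 2)))"
          using dpow_PH[of p r] dpow_scale by metis
        moreover have "r > i" using r ij by simp
        then have "dpow (replicate (Suc (2 * p)) Dn) r y = 0" by (rule K_dpowD[OF rad_K[OF y]])
        \<comment> \<open>This keeps the binomial coefficient nonzero, so the vanishing of the
          lowering forces the scalar \<open>?c\<close> to be zero.\<close>
        moreover have "r div 2 \<le> p" using r ij p by simp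
        then have "p choose (r div 2) \<noteq> 0" by simp
        ultimately have "?c = 0" by simp
        then show ?thesis using \<open>y = (\<lambda>w. ?c * PH (Suc (2 * p)) r w)\<close> by (simp add: zero_fun_def)
      qed
    qed
    then show ?thesis using fn.subspace_0[OF rad_subspace] by blast
  qed
qed


text \<open>At even \<open>i\<close> this is the alternating sum of \<open>mot j i\<close>,
  \<open>mot j (i + 2)\<close>, \<open>mot j (i + 4)\<close> and so on, as \<open>low_add\<close>
  shows. The recursion avoids subtraction and matches the slices of the radical. It will turn out to
  be the rank.\<close>

primrec low :: "nat \<Rightarrow> nat \<Rightarrow> nat" where
  "low 0 i = (if i = 0 then 1 else 0)"
| "low (Suc j) i = low j i + (if i = 0 then 0 else mot j (i - 1))"

lemma low_zero: "j < i \<Longrightarrow> low j i = 0"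
  by (induction j) (auto simp: mot_zero)

lemma low_add: "even i \<Longrightarrow> low j i + low j (i + 2) = mot j i"
  by (induction j arbitrary: i) auto

lemma low_at_0 [simp]: "low j 0 = 1"
  by (induction j) auto

text \<open>Slices again: the one at \<open>Dn\<close> is bounded by all of \<open>K\<close>, the
  one at \<open>Emp\<close> by the shorter radical, and the one at \<open>Up\<close> vanishes
  because it lies in a radical at the odd height \<open>i - 1\<close>.\<close>

lemma dim_rad:
  assumes "even i" "i \<le> j"
  shows "fn.dim (rad i j) + low j i \<le> mot j i"
  using assms(2)
proof (induction j)
  case 0
  then have "fn.dim (rad i 0) = 0" using rad_diag[of 0] by simp
  then show ?case using 0 by simp
next
  case (Suc j)
  consider "i = 0" | "i = Suc j" | "i > 0" "i \<le> j" using Suc.prems by linarith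
  then show ?case
  proof cases
    case 1
    \<comment> \<open>For \<open>i = 0\<close> the claim only says that the radical is a proper
      subspace, since \<open>low j 0 = 1\<close>.\<close>
    have "delta (base i (Suc j)) \<notin> rad i (Suc j)"
      by (auto simp: rad_def delta_def intro!: exI[of _ "[]"])
    then have "rad i (Suc j) \<noteq> K i (Suc j)"
      using delta_base_K[OF Suc.prems] by blast
    then have "\<not> fn.dim (K i (Suc j)) \<le> fn.dim (rad i (Suc j))"
      using fn.subspace_dim_equal_span[OF rad_subspace K_subspace _ K_subset] finite_words rad_K by blast
    then show ?thesis using dim_K[OF Suc.prems] 1 by simp
  next
    case 2
    then show ?thesis using rad_diag[of i] by (simp add: low_zero)
  next
    case 3
    let ?W = "rad i (Suc j)"
    let ?W1 = "{y \<in> ?W. slice Dn y = 0}"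
    let ?W2 = "{y \<in> ?W1. slice Emp y = 0}"
    have WK: "?W \<subseteq> K i (Suc j)" using rad_K by blast
    note S = subspace_slices_dim[OF rad_subspace WK]
    have d1: "slice Dn ` ?W \<subseteq> K (Suc i) j" using slice_Dn_K WK by blast
    have d2: "slice Emp ` ?W1 \<subseteq> rad i j" using rad_slice_Emp 3 by blast
    have 1: "fn.dim (slice Dn ` ?W) \<le> mot j (Suc i)"
      using fn_dim_mono[OF flinear_subspace_image[OF slice_linear rad_subspace] K_subspace d1 subset_refl]
        dim_K_le[of "Suc i" j] by linarith
    have rK: "rad i j \<subseteq> K i j" using rad_K by blast
    have 2: "fn.dim (slice Emp ` ?W1) \<le> fn.dim (rad i j)"
      by (rule fn_dim_mono[OF flinear_subspace_image[OF slice_linear S(2)] rad_subspace d2 rK])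
    \<comment> \<open>Such a \<open>y\<close> is \<open>ext Up\<close> of its
      \<open>Up\<close>-slice, so \<open>rad_ext_Up\<close> puts that slice into the radical at the
      odd height \<open>i - 1\<close>.\<close>
    have "slice Up y = 0" if y: "y \<in> ?W2" for y
    proof -
      have up: "slice Up y \<in> K (i - 1) j" using slice_Up_K[of y i j] y WK 3 by auto
      have "y = ext Up (slice Up y)"
      proof
        fix w show "y w = ext Up (slice Up y) w"
        proof (cases w)
          case Nil then show ?thesis using K_Nil[of y i j] y WK by auto
        next
          case (Cons s u)
          have "slice Dn y u = 0" "slice Emp y u = 0" using y by simp_all
          then show ?thesis using Cons by (cases s) (auto simp: slice_def)
        qed
      qed
      then have "ext Up (slice Up y) \<in> rad i (Suc j)" using y by simp
      then have "slice Up y \<in> rad (i - 1) j"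
        using rad_ext_Up[OF _ up] 3 by simp
      then show ?thesis using rad_odd[of "i - 1" j] 3 assms(1) by auto
    qed
    then have "slice Up ` ?W2 = {0}"
      using fn.subspace_0[OF flinear_subspace_image[OF slice_linear S(3), of Up]] by blast
    then show ?thesis using S(1) 1 2 Suc.IH[OF 3(2)] 3 by simp
  qed
qed

section \<open>Ranks of the idempotents\<close>

definition epsw :: "nat \<Rightarrow> nat \<Rightarrow> gen list" where
  "epsw m j = map Dot [0..<m - j]"

text \<open>All coefficients of \<open>y\<close> at the base word, one for each word of generators.
  On \<open>K i m\<close> the kernel is the radical, so the image stands for the quotient by it. The
  value 0 on other words makes equality of such families depend on admissible words only.\<close>

definition theta :: "nat \<Rightarrow> nat \<Rightarrow> state \<Rightarrow> gen list \<Rightarrow> complex" where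
  "theta i m y = (\<lambda>ws. if set ws \<subseteq> gens m then ops ws y (base i m) else 0)"

text \<open>The number r(i, j): the dimension that the idempotent with \<open>j\<close> through
  strands leaves of \<open>cyc i m\<close> modulo the radical.\<close>

definition rk :: "nat \<Rightarrow> nat \<Rightarrow> nat \<Rightarrow> nat" where
  "rk i m j = fn.dim (theta i m ` ops (epsw m j) ` cyc i m)"

lemma epsw_gens: "set (epsw m j) \<subseteq> gens m"
  by (auto simp: epsw_def gens_def)

lemma ops_Dots: "ops (map Dot [0..<d]) y w = (if \<forall>k<d. w ! k = Emp then y w else 0)"
proof (induction d arbitrary: y)
  case (Suc d)
  have "ops (map Dot [0..<Suc d]) y w = ops (map Dot [0..<d]) (op (Dot d) y) w" by simp
  also have "\<dots> = (if \<forall>k<Suc d. w ! k = Emp then y w else 0)"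
    unfolding Suc by (auto simp: less_Suc_eq)
  finally show ?case .
qed simp

lemma ops_epsw: "ops (epsw m j) y w = (if \<forall>k<m - j. w ! k = Emp then y w else 0)"
  by (simp add: epsw_def ops_Dots)

definition cor :: "nat \<Rightarrow> nat \<Rightarrow> nat \<Rightarrow> state set" where
  "cor i m j = ops (epsw m j) ` K i m"

lemma cor_iff: "y \<in> cor i m j \<longleftrightarrow> y \<in> K i m \<and> (\<forall>w. y w \<noteq> 0 \<longrightarrow> (\<forall>k<m - j. w ! k = Emp))"
proof
  assume "y \<in> cor i m j"
  then show "y \<in> K i m \<and> (\<forall>w. y w \<noteq> 0 \<longrightarrow> (\<forall>k<m - j. w ! k = Emp))"
  proof -
    obtain z where z: "z \<in> K i m" "y = ops (epsw m j) z" using \<open>y \<in> cor i m j\<close> by (auto simp: cor_def)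
    show ?thesis unfolding z(2) using ops_K[OF epsw_gens z(1)] by (auto simp: ops_epsw split: if_splits)
  qed
next
  assume *: "y \<in> K i m \<and> (\<forall>w. y w \<noteq> 0 \<longrightarrow> (\<forall>k<m - j. w ! k = Emp))"
  then have "ops (epsw m j) y = y" by (auto simp: ops_epsw fun_eq_iff)
  then show "y \<in> cor i m j" using * by (metis cor_def image_eqI)
qed

lemma cor_subspace: "fn.subspace (cor i m j)"
  unfolding cor_def by (rule flinear_subspace_image[OF ops_linear K_subspace])

definition strip :: "nat \<Rightarrow> state \<Rightarrow> state" where
  "strip d y = (\<lambda>u. y (replicate d Emp @ u))"

lemma strip_linear: "flinear (strip d)"
  by (rule flinearI) (auto simp: strip_def)

lemma strip_Suc: "strip (Suc d) y = strip d (slice Emp y)"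
  by (auto simp: strip_def slice_def)

lemma strip_K: "y \<in> K i (d + j) \<Longrightarrow> strip d y \<in> K i j"
proof (induction d arbitrary: y)
  case 0 then show ?case by (simp add: strip_def)
next
  case (Suc d) then show ?case using slice_Emp_K by (simp add: strip_Suc)
qed

lemma strip_rad: "i \<le> j \<Longrightarrow> y \<in> rad i (d + j) \<Longrightarrow> strip d y \<in> rad i j"
proof (induction d arbitrary: y)
  case 0 then show ?case by (simp add: strip_def)
next
  case (Suc d) then show ?case using rad_slice_Emp[of i "d + j" y] by (simp add: strip_Suc)
qed

lemma strip_inj:
  assumes "j \<le> m" "y \<in> cor i m j" "strip (m - j) y = 0"
  shows "y = 0"
proof (rule HOL.ext, rule ccontr)
  fix w assume "y w \<noteq> 0 w"
  then have "length w = m" "\<forall>k<m - j. w ! k = Emp"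
    using assms(2) K_wordsD[of y i m w] by (auto simp: cor_iff words_def)
  then have "w = replicate (m - j) Emp @ drop (m - j) w"
    by (auto simp: list_eq_iff_nth_eq nth_append)
  then have "y w = strip (m - j) y (drop (m - j) w)" unfolding strip_def by metis
  then show False using assms(3) \<open>y w \<noteq> 0 w\<close> by simp
qed

lemma dim_strip:
  assumes "j \<le> m" "fn.subspace W" "W \<subseteq> cor i m j"
  shows "fn.dim W = fn.dim (strip (m - j) ` W)"
proof -
  have WK: "W \<subseteq> K i m" using assms(3) cor_iff by blast
  have "{y \<in> W. strip (m - j) y = 0} = {0}"
    using strip_inj[OF assms(1)] assms(3) fn.subspace_0[OF assms(2)]
    by (auto simp: strip_def zero_fun_def)
  then show ?thesis using fn_rank_nullity[OF strip_linear assms(2) WK, of "m - j"] by simp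
qed

lemma ext_Emp_pow_K:
  assumes "i \<le> j" "y \<in> K i j"
  shows "(ext Emp ^^ d) y \<in> K i (d + j)"
proof (induction d)
  case (Suc d)
  then show ?case using ext_Emp_cyc[of i "d + j"] cyc_eq_K assms(1) by simp
qed (use assms in simp)

lemma ext_Emp_pow_apply:
  "(ext Emp ^^ d) y (replicate d Emp @ u) = y u"
  "(ext Emp ^^ d) y w \<noteq> 0 \<Longrightarrow> k < d \<Longrightarrow> w ! k = Emp"
proof (induction d arbitrary: w k)
  case (Suc d)
  {
    case 1 then show ?case using Suc by simp
  next
    case 2 then show ?case using Suc(2) by (cases w; cases k) (auto split: if_splits)
  }
qed auto

text \<open>Cutting off the \<open>m - j\<close> leading empties identifies the corner with
  \<open>K i j\<close>. The inverse prepends empties; it stays inside \<open>K\<close> because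
  \<open>K\<close> is generated by the base vector.\<close>

lemma dim_cor:
  assumes "j \<le> m"
  shows "fn.dim (cor i m j) = mot j i"
proof -
  have sub: "strip (m - j) ` cor i m j \<subseteq> K i j"
    using strip_K[of _ i "m - j" j] assms by (auto simp: cor_iff)
  have eq: "strip (m - j) ` cor i m j = K i j"
  proof (cases "i \<le> j")
    case True
    have "y \<in> strip (m - j) ` cor i m j" if "y \<in> K i j" for y
    proof (rule image_eqI)
      show "y = strip (m - j) ((ext Emp ^^ (m - j)) y)"
        by (auto simp: strip_def ext_Emp_pow_apply)
      show "(ext Emp ^^ (m - j)) y \<in> cor i m j"
        using ext_Emp_pow_K[OF True that, of "m - j"] ext_Emp_pow_apply(2) assms by (auto simp: cor_iff)
    qed
    then show ?thesis using sub by blast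
  next
    case False
    have "w \<notin> words i j" for w using wt_le_length[of w] False by (auto simp: words_def)
    then have "words i j = {}" by blast
    then have "y w = 0" if "y \<in> K i j" for y w using K_wordsD[OF that, of w] by auto
    then have "K i j \<subseteq> {0}" by (auto simp: fun_eq_iff)
    then show ?thesis using sub fn.subspace_0[OF flinear_subspace_image[OF strip_linear cor_subspace]]
       fn.subspace_0[OF K_subspace, of i j] by blast
  qed
  have "fn.dim (K i j) = mot j i"
  proof (cases "i \<le> j")
    case False then show ?thesis using dim_K_le[of i j] by (simp add: mot_zero)
  qed (rule dim_K)
  then show ?thesis using dim_strip[OF assms cor_subspace subset_refl] eq by simp
qed

lemma theta_linear: "flinear (theta i m)"
  using ops_linear by (intro flinearI) (auto simp: theta_def fun_eq_iff linear_on_def plus_fun_def)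

lemma theta_zero_iff: "y \<in> K i m \<Longrightarrow> theta i m y = 0 \<longleftrightarrow> y \<in> rad i m"
  by (auto simp: theta_def rad_def fun_eq_iff)

lemma rk_eq:
  assumes "i \<le> m" "j \<le> m"
  shows "rk i m j + fn.dim (cor i m j \<inter> rad i m) = mot j i"
proof -
  have "{y \<in> cor i m j. theta i m y = 0} = cor i m j \<inter> rad i m"
    using theta_zero_iff cor_iff by blast
  moreover have CK: "cor i m j \<subseteq> K i m" using cor_iff by blast
  ultimately show ?thesis
    using fn_rank_nullity[OF theta_linear cor_subspace CK, of i m] dim_cor[OF assms(2), of i]
    by (simp add: rk_def cyc_eq_K[OF assms(1)] cor_def[symmetric])
qed

text \<open>Cutting off the empties embeds the part of the radical in the corner into
  \<open>rad i j\<close>, whose dimension is bounded by \<open>dim_rad\<close>.\<close>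

lemma low_le_rk:
  assumes "even i" "i \<le> m" "j \<le> m"
  shows "low j i \<le> rk i m j"
proof (cases "i \<le> j")
  case True
  have s: "fn.subspace (cor i m j \<inter> rad i m)"
    by (rule fn.subspace_inter[OF cor_subspace rad_subspace])
  have "strip (m - j) ` (cor i m j \<inter> rad i m) \<subseteq> rad i j"
    using strip_rad[OF True, of _ "m - j"] assms(3) by auto
  then have "fn.dim (cor i m j \<inter> rad i m) \<le> fn.dim (rad i j)"
    unfolding dim_strip[OF assms(3) s Int_lower1]
    by (intro fn_dim_mono[of _ _ i j] flinear_subspace_image strip_linear s rad_subspace) (auto dest: rad_K)
  then show ?thesis using rk_eq[OF assms(2,3)] dim_rad[OF assms(1) True] by linarith
qed (simp add: low_zero)

text \<open>\<open>dpow_op\<close> concerns words of matching length only. At other words both sides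
  vanish, since elements of \<open>K i m\<close> live on length \<open>m\<close>.\<close>

lemma dpow_ops_K:
  assumes "set ws \<subseteq> gens m" "y \<in> K i m"
  shows "(\<lambda>w. dpow w r (ops ws y)) = ops ws (\<lambda>w. dpow w r y)"
  using assms(1)
proof (induction ws)
  case (Cons g ws)
  let ?z = "ops ws y"
  have z: "?z \<in> K i m" "op g ?z \<in> K i m" using Cons.prems assms(2) ops_K op_K by auto
  have supp: "dpow w r x = 0" if "x \<in> K i m" "length w \<noteq> m" for x w
    by (rule dpow_length[of _ m]) (use that K_wordsD in \<open>auto simp: words_def\<close>)
  have "dpow w r (op g ?z) = op g (\<lambda>w. dpow w r ?z) w" for w
  proof (cases "length w = m")
    case True then show ?thesis using dpow_op Cons.prems by simp
  next
    case False
    have "op g (\<lambda>w. dpow w r ?z) w = 0"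
      using op_support[of g "\<lambda>w. dpow w r ?z" w] supp[OF z(1)] False by (metis length_list_update)
    then show ?thesis using supp[OF z(2) False] by simp
  qed
  then show ?case using Cons by simp
qed simp

text \<open>Lowering one of two leading \<open>Up\<close>s gives \<open>- \<i>\<close> times the cup
  without its entry at two empties, that is, a hook minus the identity on \<open>Emp # Emp\<close>.
  The sign of the last term is the square of \<open>alpha Up\<close>.\<close>

lemma dpow1_Up_Up:
  "(\<lambda>w. dpow w 1 (ext Up (ext Up z))) =
     (\<lambda>w. - \<i> * (op (Hook 0) (ext Emp (ext Emp z)) w - ext Emp (ext Emp z) w)
        - ext Up (ext Up (\<lambda>w. dpow w 1 z)) w)"
proof
  have d0: "dpow w 0 x = x w" for w x by (induction w arbitrary: x) (auto simp: slice_def)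
  fix w :: "lab list"
  consider "w = []" | s where "w = [s]" | s t v where "w = s # t # v" by (metis list.exhaust)
  then show "dpow w 1 (ext Up (ext Up z)) = - \<i> * (op (Hook 0) (ext Emp (ext Emp z)) w - ext Emp (ext Emp z) w)
        - ext Up (ext Up (\<lambda>w. dpow w 1 z)) w"
  proof cases
    case (2 s) then show ?thesis by (cases s) (auto simp: slice_def)
  next
    case (3 s t v) then show ?thesis by (cases s; cases t) (auto simp: d0)
  qed auto
qed


text \<open>The letters are taken off in pairs by \<open>dpow1_Up_Up\<close>, hence the even number.
  Each term is reached from the base vector of height \<open>n\<close> by generators.\<close>

lemma dpow1_delta_Up:
  "even n \<Longrightarrow> (\<lambda>w. dpow w 1 (delta (replicate (n + 2) Up))) \<in> cyc n (n + 2)"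
proof (induction n rule: less_induct)
  case (less n)
  let ?z = "delta (replicate n Up) :: state"
  have y: "delta (replicate (n + 2) Up) = ext Up (ext Up ?z)" by (simp add: ext_delta)
  have b: "ext Emp (ext Emp ?z) = delta (base n (n + 2))"
    by (simp add: ext_delta base_def numeral_2_eq_2)
  have e: "ext Emp (ext Emp ?z) \<in> cyc n (n + 2)" unfolding b by (rule cyc_base)
  have third: "ext Up (ext Up (\<lambda>w. dpow w 1 ?z)) \<in> cyc n (n + 2)"
  proof (cases "n = 0")
    case True
    have "dpow w 1 ?z = 0" for w
      using True by (cases w) (auto simp: delta_def slice_def)
    then have "ext Up (ext Up (\<lambda>w. dpow w 1 ?z)) = 0" by (auto simp: fun_eq_iff ext_def split: list.splits)
    then show ?thesis using fn.subspace_0[OF cyc_subspace] by simp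
  next
    case False
    define k where "k = n - 2"
    have n: "n = k + 2" using False less.prems by (auto simp: k_def elim!: evenE)
    have "(\<lambda>w. dpow w 1 ?z) \<in> cyc k (k + 2)" using less.IH[of k] less.prems n by simp
    then have "ext Up (ext Up (\<lambda>w. dpow w 1 ?z)) \<in> cyc (Suc (Suc k)) (Suc (Suc (k + 2)))"
      by (intro ext_Up_cyc) auto
    then show ?thesis using n by simp
  qed
  have h: "op (Hook 0) (ext Emp (ext Emp ?z)) \<in> cyc n (n + 2)"
    by (rule op_cyc[OF _ e]) (simp add: gens_def)
  have "(\<lambda>w. - \<i> * (op (Hook 0) (ext Emp (ext Emp ?z)) - ext Emp (ext Emp ?z)) w)
      - ext Up (ext Up (\<lambda>w. dpow w 1 ?z)) \<in> cyc n (n + 2)"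
    by (intro fn.subspace_diff[OF cyc_subspace] fn.subspace_scale[OF cyc_subspace] h e third)
  then show ?case unfolding y dpow1_Up_Up by (simp add: fun_diff_def)
qed

lemma dpow1_ext_Emp: "(\<lambda>w. dpow w 1 (ext Emp y)) = ext Emp (\<lambda>w. dpow w 1 y)"
proof
  have d0: "dpow w 0 x = x w" for w x by (induction w arbitrary: x) (auto simp: slice_def)
  fix w show "dpow w 1 (ext Emp y) = ext Emp (\<lambda>w. dpow w 1 y) w"
  proof (cases w)
    case (Cons s u) then show ?thesis by (cases s) (auto simp: d0 zero_fun_def)
  qed auto
qed

lemma dpow1_delta_base:
  assumes "even i" "i + 2 \<le> m"
  shows "(\<lambda>w. dpow w 1 (delta (base (i + 2) m))) \<in> cyc i m"
proof -
  have "(\<lambda>w. dpow w 1 (delta (base (i + 2) (i + 2 + d)))) \<in> cyc i (i + 2 + d)" for d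
  proof (induction d)
    case 0 then show ?case using dpow1_delta_Up[OF assms(1)] by (simp add: base_def)
  next
    case (Suc d)
    have "delta (base (i + 2) (i + 2 + Suc d)) = ext Emp (delta (base (i + 2) (i + 2 + d)))"
      using base_Suc[of "i + 2" "i + 2 + d"] by (simp add: ext_delta)
    then show ?case using ext_Emp_cyc[OF _ Suc] by (simp only: dpow1_ext_Emp) simp
  qed
  moreover obtain d where "m = i + 2 + d" using assms(2) le_Suc_ex by blast
  ultimately show ?thesis by blast
qed

text \<open>Lowering once maps the corner at height \<open>i + 2\<close> into the radical part of
  the corner at height \<open>i\<close>, and its kernel is contained in the radical at height
  \<open>i + 2\<close>. So the rank at \<open>i + 2\<close> is at most the loss of rank at
  \<open>i\<close>.\<close>

lemma rk_step:
  assumes "even i" "i + 2 \<le> m" "j \<le> m"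
  shows "rk i m j + rk (i + 2) m j \<le> mot j i"
proof -
  let ?J = "i + 2" and ?F = "\<lambda>(y::state) w. dpow w 1 y"
  have iJ: "i \<le> m" "?J \<le> m" using assms by auto
  have Fcyc: "?F y \<in> cyc i m" if "y \<in> K ?J m" for y
  proof (rule linear_into_cyc[OF dpow_linear])
    show "y \<in> cyc ?J m" using that cyc_eq_K[OF iJ(2)] by simp
    fix ws assume ws: "set ws \<subseteq> gens m"
    show "?F (ops ws (delta (base ?J m))) \<in> cyc i m"
      unfolding dpow_ops_K[OF ws delta_base_K[OF iJ(2)]]
      by (rule ops_cyc[OF ws dpow1_delta_base[OF assms(1,2)]])
  qed
  have noDn: "Dn \<notin> set (base i m)" by (auto simp: base_def)
  \<comment> \<open>Lowering leaves a \<open>Dn\<close>, and the base word has none; since lowering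
    commutes with the generators, all coefficients at the base word vanish.\<close>
  have Frad: "?F y \<in> rad i m" if y: "y \<in> K ?J m" for y
  proof -
    have "ops ws (?F y) (base i m) = 0" if "set ws \<subseteq> gens m" for ws
      unfolding dpow_ops_K[OF that y, symmetric] by (rule dpow_no_Dn[OF noDn]) simp
    then show ?thesis using Fcyc[OF y] cyc_eq_K[OF iJ(1)] by (simp add: rad_def)
  qed
  have Fcor: "?F ` cor ?J m j \<subseteq> cor i m j \<inter> rad i m"
  proof clarify
    fix y assume y: "y \<in> cor ?J m j"
    then have yK: "y \<in> K ?J m" by (simp add: cor_iff)
    have "ops (epsw m j) y = y" using y by (auto simp: ops_epsw fun_eq_iff cor_iff)
    then have "?F y = ops (epsw m j) (?F y)" using dpow_ops_K[OF epsw_gens yK, of 1 j] by simp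
    then have "?F y \<in> cor i m j" unfolding cor_def using rad_K[OF Frad[OF yK]] by blast
    then show "?F y \<in> cor i m j \<inter> rad i m" using Frad[OF yK] by blast
  qed
  \<comment> \<open>If lowering kills \<open>y\<close>, it also kills what the word
    \<open>ws\<close> and then the idempotent make of \<open>y\<close>. That is a multiple of the
    base vector, which lowering does not kill, so the multiple is zero.\<close>
  have ker: "{y \<in> cor ?J m j. ?F y = 0} \<subseteq> {y \<in> cor ?J m j. theta ?J m y = 0}"
  proof clarify
    fix y assume y: "y \<in> cor ?J m j" "?F y = 0"
    then have yK: "y \<in> K ?J m" by (simp add: cor_iff)
    have "ops ws y (base ?J m) = 0" if ws: "set ws \<subseteq> gens m" for ws
    proof -
      let ?x = "ops ws y"
      have xK: "?x \<in> K ?J m" by (rule ops_K[OF ws yK])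
      \<comment> \<open>The base word is the only word of weight \<open>i + 2\<close> whose letters
        outside the last \<open>i + 2\<close> places are empty.\<close>
      have e: "ops (epsw m ?J) ?x = (\<lambda>w. ?x (base ?J m) * delta (base ?J m) w)"
      proof
        fix w
        show "ops (epsw m ?J) ?x w = ?x (base ?J m) * delta (base ?J m) w"
        proof (cases "w \<in> words ?J m \<and> (\<forall>k<m - ?J. w ! k = Emp)")
          case True
          let ?u = "drop (m - ?J) w"
          have w: "w = replicate (m - ?J) Emp @ ?u"
            using True by (auto simp: list_eq_iff_nth_eq nth_append words_def)
          have "wt w = wt ?u" by (subst w) simp
          then have "?u = replicate ?J Up"
            using wt_eq_length[of ?u] True assms(2) by (simp add: words_def)
          then have "w = base ?J m" using w by (simp add: base_def)
          then show ?thesis using True by (simp add: ops_epsw delta_def)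
        next
          case False
          then have "\<not> (\<forall>k<m - ?J. w ! k = Emp) \<or> ?x w = 0" using K_wordsD[OF xK] by blast
          moreover have "w \<noteq> base ?J m"
            using False base_words[OF iJ(2)] by (auto simp: base_def nth_append)
          ultimately show ?thesis by (auto simp: ops_epsw delta_def)
        qed
      qed
      have z: "ops vs (\<lambda>w. 0) = (\<lambda>w. 0)" for vs
      proof -
        have "ops vs (\<lambda>w. 0 * y w) = (\<lambda>w. 0 * ops vs y w)"
          using ops_linear[of vs] unfolding linear_on_def by blast
        then show ?thesis by simp
      qed
      have "?F (ops (epsw m ?J) ?x) = ops (epsw m ?J @ ws) (?F y)"
        using dpow_ops_K[of "epsw m ?J @ ws" m y ?J 1] ws epsw_gens yK by simp
      then have "?F (ops (epsw m ?J) ?x) = (\<lambda>w. 0)" using y(2) z by (simp add: zero_fun_def)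
      then have c: "?x (base ?J m) * dpow w 1 (delta (base ?J m)) = 0" for w
        unfolding e dpow_scale by (metis)
      \<comment> \<open>A witness that the base vector survives lowering: its value where the first
        \<open>Up\<close> has become \<open>Dn\<close> is 1, because only empties precede that
        place.\<close>
      have "dpow (replicate d Emp @ Dn # v) 1 (delta (replicate d Emp @ Up # v)) = 1" for d v
      proof (induction d)
        case 0
        have d0: "dpow w 0 x = x w" for w x by (induction w arbitrary: x) (auto simp: slice_def)
        have "slice Dn (delta (Up # v)) = (\<lambda>w. 0)" "slice Up (delta (Up # v)) = delta v"
          by (auto simp: slice_def delta_def)
        then show ?case by (simp add: d0) (simp add: delta_def)
      next
        case (Suc d)
        have "slice Emp (delta (Emp # replicate d Emp @ Up # v)) = delta (replicate d Emp @ Up # v)"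
          by (auto simp: slice_def delta_def)
        then show ?case using Suc by simp
      qed
      from this[of "m - ?J" "replicate (Suc i) Up"]
      have "dpow (replicate (m - ?J) Emp @ Dn # replicate (Suc i) Up) 1 (delta (base ?J m)) = 1"
        by (simp add: base_def)
      then show ?thesis using c by (metis mult.right_neutral)
    qed
    then show "theta ?J m y = 0" by (auto simp: theta_def)
  qed
  have JK: "cor ?J m j \<subseteq> K ?J m" using cor_iff by blast
  have "fn.dim {y \<in> cor ?J m j. ?F y = 0} \<le> fn.dim {y \<in> cor ?J m j. theta ?J m y = 0}"
    by (rule fn_dim_mono[of _ _ ?J m])
      (use ker JK in \<open>auto intro!: flinear_subspace_kernel dpow_linear theta_linear cor_subspace\<close>)
  moreover have "fn.dim (?F ` cor ?J m j) \<le> fn.dim (cor i m j \<inter> rad i m)"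
    by (rule fn_dim_mono[OF flinear_subspace_image[OF dpow_linear cor_subspace] _ Fcor, of i m])
      (auto intro!: fn.subspace_inter cor_subspace rad_subspace dest: rad_K)
  moreover have "rk ?J m j = fn.dim (theta ?J m ` cor ?J m j)"
    unfolding rk_def cyc_eq_K[OF iJ(2)] cor_def ..
  ultimately have "rk ?J m j \<le> fn.dim (cor i m j \<inter> rad i m)"
    using fn_rank_nullity[OF dpow_linear cor_subspace JK, of 1] fn_rank_nullity[OF theta_linear cor_subspace JK, of ?J m]
    by linarith
  then show ?thesis using rk_eq[OF iJ(1) assms(3)] by linarith
qed

theorem rk_odd: "odd i \<Longrightarrow> i \<le> m \<Longrightarrow> j \<le> m \<Longrightarrow> rk i m j = mot j i"
  using rk_eq[of i m j] rad_odd[of i m] fn.subspace_0[OF cor_subspace, of i m j] by simp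

text \<open>The upper bound \<open>rk_step\<close> for the sum of the ranks at \<open>i\<close> and
  \<open>i + 2\<close> equals the sum of the lower bounds \<open>low_le_rk\<close>, by
  \<open>low_add\<close>. If \<open>i + 2\<close> exceeds \<open>m\<close>, then
  \<open>low j (i + 2)\<close> is zero and the lower bound at \<open>i\<close> is already
  \<open>mot j i\<close>.\<close>

theorem rk_even:
  assumes "even i" "i \<le> m" "j \<le> m"
  shows "rk i m j + (if i + 2 \<le> m then rk (i + 2) m j else 0) = mot j i"
proof (cases "i + 2 \<le> m")
  case True
  then show ?thesis
    using rk_step[OF assms(1) True assms(3)] low_le_rk[OF assms] low_le_rk[of "i + 2" m j] low_add[OF assms(1), of j]
      assms by simp
next
  case False
  then have "low j (i + 2) = 0" using assms by (intro low_zero) simp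
  then show ?thesis
    using False low_le_rk[OF assms] rk_eq[OF assms(2,3)] low_add[OF assms(1), of j] by simp
qed

subsection \<open>The matrix of coefficients\<close>

abbreviation quad :: "rat fps" where
  "quad \<equiv> 1 + fps_X + fps_X ^ 2"

lemma quad_mult_nth: "fps_nth (quad * f) i = fps_nth f i + (if i = 0 then 0 else fps_nth f (i - 1))
    + (if i < 2 then 0 else fps_nth f (i - 2))"
  by (simp add: distrib_right fps_X_power_mult_nth)

lemma quad_inverse: "quad * inverse quad = 1"
  by (rule inverse_mult_eq_1') simp

text \<open>Shifting by a power of x absorbs the difference of the indices and the case in which it
  would be negative.\<close>

lemma S_inv_eq_nth: "S_inv j i = fps_nth (fps_X ^ j * inverse quad ^ Suc j) i"
  by (simp add: S_inv_def fps_X_power_mult_nth fps_inverse_power del: power_Suc)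

text \<open>Multiplication by \<open>quad\<close> cancels one of the inverse factors; one power of x
  then shifts the index.\<close>

lemma S_inv_recursion: "S_inv j i + (if i = 0 then 0 else S_inv j (i - 1)) + (if i < 2 then 0 else S_inv j (i - 2))
    = (case j of 0 \<Rightarrow> if i = 0 then 1 else 0 | Suc j' \<Rightarrow> if i = 0 then 0 else S_inv j' (i - 1))"
proof -
  have *: "S_inv j i + (if i = 0 then 0 else S_inv j (i - 1)) + (if i < 2 then 0 else S_inv j (i - 2))
      = fps_nth (quad * (fps_X ^ j * inverse quad ^ Suc j)) i"
    unfolding S_inv_eq_nth by (rule quad_mult_nth[symmetric])
  have "quad * (fps_X ^ j * inverse quad ^ Suc j) = (quad * inverse quad) * (fps_X ^ j * inverse quad ^ j)"
    by (simp only: power_Suc mult_ac)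
  also have "\<dots> = fps_X ^ j * inverse quad ^ j" by (simp only: quad_inverse mult_1_left)
  finally have **: "fps_nth (quad * (fps_X ^ j * inverse quad ^ Suc j)) i = fps_nth (fps_X ^ j * inverse quad ^ j) i" by (rule arg_cong)
  show ?thesis
  proof (cases j)
    case 0 then show ?thesis unfolding * ** by simp
  next
    case (Suc k)
    have "fps_X ^ j * inverse quad ^ j = fps_X * (fps_X ^ k * inverse quad ^ Suc k)"
      unfolding Suc by (simp only: power_Suc mult_ac)
    then have "fps_nth (fps_X ^ j * inverse quad ^ j) i = (if i = 0 then 0 else S_inv k (i - 1))"
      unfolding S_inv_eq_nth by (simp only: fps_X_mult_nth)
    then show ?thesis unfolding * ** using Suc by simp
  qed
qed

lemma S_inv_mot_extend: "i \<le> N \<Longrightarrow> (\<Sum>j\<le>N. S_inv j i * of_nat (mot j k)) = (\<Sum>j\<le>i. S_inv j i * of_nat (mot j k))"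
  by (rule sum.mono_neutral_right) (auto simp: S_inv_def)

text \<open>Induction on the column \<open>i\<close>. The recursion of \<open>S_inv\<close> turns
  row \<open>j\<close> into row \<open>j - 1\<close>, and after reindexing the recursion of
  \<open>mot\<close> applies; the bound \<open>N\<close> is kept general because this reindexing
  changes it by one.\<close>

lemma S_inv_mot:
  assumes "i \<le> N"
  shows "(\<Sum>j\<le>N. S_inv j i * of_nat (mot j k)) = (if i = k then 1 else 0)"
  using assms
proof (induction i arbitrary: N k rule: less_induct)
  case (less i)
  let ?P = "\<lambda>N i k. \<Sum>j\<le>N. S_inv j i * of_nat (mot j k)"
  show ?case
  proof (cases i)
    case 0
    have "?P N 0 k = S_inv 0 0 * of_nat (mot 0 k)" using S_inv_mot_extend[of 0 N k] by simp
    moreover have "S_inv 0 0 = 1" using S_inv_recursion[of 0 0] by simp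
    ultimately show ?thesis using 0 by auto
  next
    case (Suc i')
    have i1: "?P (Suc N) (i - 1) k = (if i - 1 = k then 1 else 0)" for k
      by (rule less.IH) (use Suc less.prems in auto)
    have i1': "?P N (i - 1) k = (if i - 1 = k then 1 else 0)" for k
      by (rule less.IH) (use Suc less.prems in auto)
    have i2: "(if i < 2 then 0 else ?P (Suc N) (i - 2) k) = (if i = k + 2 then 1 else 0)"
      using less.IH[of "i - 2" "Suc N" k] less.prems Suc by auto
    have "?P (Suc N) i k + ?P (Suc N) (i - 1) k + (if i < 2 then 0 else ?P (Suc N) (i - 2) k)
        = (\<Sum>j\<le>Suc N. (S_inv j i + S_inv j (i - 1) + (if i < 2 then 0 else S_inv j (i - 2))) * of_nat (mot j k))"
      by (simp only: distrib_right sum.distrib if_distrib[of "\<lambda>x. x * _"] mult_zero_left)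
        (simp del: sum.atMost_Suc)
    also have "\<dots> = (\<Sum>j\<le>Suc N. (case j of 0 \<Rightarrow> 0 | Suc j' \<Rightarrow> S_inv j' (i - 1)) * of_nat (mot j k))"
    proof (rule sum.cong[OF refl])
      fix j
      show "(S_inv j i + S_inv j (i - 1) + (if i < 2 then 0 else S_inv j (i - 2))) * of_nat (mot j k)
        = (case j of 0 \<Rightarrow> 0 | Suc j' \<Rightarrow> S_inv j' (i - 1)) * of_nat (mot j k)"
        using S_inv_recursion[of j i] Suc by (cases j) simp_all
    qed
    also have "\<dots> = (\<Sum>j\<le>N. S_inv j (i - 1) * of_nat (mot (Suc j) k))"
      by (simp add: sum.atMost_Suc_shift del: sum.atMost_Suc mot.simps)
    also have "\<dots> = (\<Sum>j\<le>N. S_inv j (i - 1) * of_nat (if k = 0 then 0 else mot j (k - 1))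
        + S_inv j (i - 1) * of_nat (mot j k) + S_inv j (i - 1) * of_nat (mot j (k + 1)))"
      by (rule sum.cong) (auto simp: distrib_left)
    also have "\<dots> = (if k = 0 then 0 else ?P N (i - 1) (k - 1)) + ?P N (i - 1) k + ?P N (i - 1) (k + 1)"
      by (simp add: sum.distrib)
    finally have "?P (Suc N) i k = (if i = k then 1 else 0)"
      unfolding i1 i1' i2 using Suc by (auto split: if_splits)
    then show ?thesis using S_inv_mot_extend[of i N k] S_inv_mot_extend[of i "Suc N" k] less.prems by simp
  qed
qed

text \<open>The coefficient of a^k b^r in (1 + a + b)^(-(i + 1)); the closed form comes from a = x
  and b = x^2.\<close>

definition tri :: "nat \<Rightarrow> nat \<Rightarrow> nat \<Rightarrow> rat" where
  "tri i r k = (- 1) ^ (r + k) * of_nat ((i + r) choose r) * of_nat ((i + r + k) choose k)"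

text \<open>Multiplication by 1 + a + b, coefficient by coefficient; at the bottom,
  \<open>tri_pascal_0\<close>, the product is 1.\<close>

lemma tri_pascal:
  "tri (Suc i) r k + (if k = 0 then 0 else tri (Suc i) r (k - 1)) + (if r = 0 then 0 else tri (Suc i) (r - 1) k)
    = tri i r k"
proof (cases k; cases r)
  fix k' r' assume k: "k = Suc k'" and r: "r = Suc r'"
  have e: "Suc i + r + k' = i + r + k" "Suc i + r' = i + r" using k r by simp_all
  have b: "(Suc i + r + k choose k) = (i + r + k choose k') + (i + r + k choose k)"
    "(Suc i + r choose r) = (i + r choose r') + (i + r choose r)" using k r by simp_all
  have s: "(- 1) ^ (r + k') = - ((- 1) ^ (r + k) :: rat)" "(- 1) ^ (r' + k) = - ((- 1) ^ (r + k) :: rat)"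
    using k r by simp_all
  have kr: "k \<noteq> 0" "r \<noteq> 0" "k - 1 = k'" "r - 1 = r'" using k r by simp_all
  show ?thesis unfolding tri_def if_not_P[OF kr(1)] if_not_P[OF kr(2)] kr(3,4) e s b of_nat_add
    by (simp add: algebra_simps)
qed (auto simp: tri_def algebra_simps)

lemma tri_pascal_0:
  "tri 0 r k + (if k = 0 then 0 else tri 0 r (k - 1)) + (if r = 0 then 0 else tri 0 (r - 1) k)
    = (if r = 0 \<and> k = 0 then 1 else 0)"
proof (cases k; cases r)
  fix k' r' assume k: "k = Suc k'" and r: "r = Suc r'"
  have s: "(- 1) ^ (r + k') = - ((- 1) ^ (r + k) :: rat)" "(- 1) ^ (r' + k) = - ((- 1) ^ (r + k) :: rat)"
    using k r by simp_all
  have "(r + k choose k) = (r + k' choose k') + (r' + k choose k)" using k r by simp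
  then have "(of_nat (r + k choose k) :: rat) = of_nat (r + k' choose k') + of_nat (r' + k choose k)"
    by (simp only: of_nat_add)
  then show ?thesis using k r s by (simp add: tri_def algebra_simps del: binomial_Suc_Suc)
qed (auto simp: tri_def)

text \<open>A guard in place of the upper limit \<open>d div 2\<close> keeps the index shifts free
  of division.\<close>

definition tri_fps :: "nat \<Rightarrow> rat fps" where
  "tri_fps i = Abs_fps (\<lambda>d. \<Sum>r\<le>d. if 2 * r \<le> d then tri i r (d - 2 * r) else 0)"

lemma tri_fps_mult_nth: "fps_nth (quad * tri_fps i) d = (\<Sum>r\<le>d. if 2 * r \<le> d then
    tri i r (d - 2 * r) + (if d - 2 * r = 0 then 0 else tri i r (d - 2 * r - 1))
    + (if r = 0 then 0 else tri i (r - 1) (d - 2 * r)) else 0)"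
proof -
  have 1: "(if d = 0 then 0 else fps_nth (tri_fps i) (d - 1))
      = (\<Sum>r\<le>d. if 2 * r \<le> d \<and> d - 2 * r \<noteq> 0 then tri i r (d - 2 * r - 1) else 0)"
  proof (cases d)
    case (Suc c)
    have "(\<Sum>r\<le>d. if 2 * r \<le> d \<and> d - 2 * r \<noteq> 0 then tri i r (d - 2 * r - 1) else 0)
        = (\<Sum>r\<le>c. if 2 * r \<le> d \<and> d - 2 * r \<noteq> 0 then tri i r (d - 2 * r - 1) else 0)"
      by (rule sum.mono_neutral_right) (use Suc in auto)
    also have "\<dots> = (\<Sum>r\<le>c. if 2 * r \<le> c then tri i r (c - 2 * r) else 0)"
    proof (rule sum.cong[OF refl])
      fix r
      have "(2 * r \<le> d \<and> d - 2 * r \<noteq> 0) = (2 * r \<le> c)" "d - 2 * r - 1 = c - 2 * r" using Suc by auto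
      then show "(if 2 * r \<le> d \<and> d - 2 * r \<noteq> 0 then tri i r (d - 2 * r - 1) else 0)
          = (if 2 * r \<le> c then tri i r (c - 2 * r) else 0)" by presburger
    qed
    finally show ?thesis using Suc by (simp add: tri_fps_def)
  qed simp
  have 2: "(if d < 2 then 0 else fps_nth (tri_fps i) (d - 2))
      = (\<Sum>r\<le>d. if 2 * r \<le> d \<and> r \<noteq> 0 then tri i (r - 1) (d - 2 * r) else 0)"
  proof (cases "d < 2")
    case True
    then have "(\<Sum>r\<le>d. if 2 * r \<le> d \<and> r \<noteq> 0 then tri i (r - 1) (d - 2 * r) else 0) = 0"
      by (intro sum.neutral) auto
    then show ?thesis using True by simp
  next
    case False
    then obtain c where c: "d = Suc (Suc c)" by (metis add_2_eq_Suc le_Suc_ex not_less)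
    have "(\<Sum>r\<le>d. if 2 * r \<le> d \<and> r \<noteq> 0 then tri i (r - 1) (d - 2 * r) else 0)
       = (\<Sum>r\<le>Suc c. if 2 * Suc r \<le> d then tri i r (d - 2 * Suc r) else 0)"
      unfolding c sum.atMost_Suc_shift[of _ "Suc c"] by (simp del: sum.atMost_Suc cong: if_cong)
    also have "\<dots> = (\<Sum>r\<le>c. if 2 * Suc r \<le> d then tri i r (d - 2 * Suc r) else 0)"
      by (rule sum.mono_neutral_right) (use c in auto)
    also have "\<dots> = (\<Sum>r\<le>c. if 2 * r \<le> c then tri i r (c - 2 * r) else 0)"
      by (rule sum.cong) (auto simp: c)
    finally show ?thesis using False c by (simp add: tri_fps_def)
  qed
  have "fps_nth (quad * tri_fps i) d = (\<Sum>r\<le>d. (if 2 * r \<le> d then tri i r (d - 2 * r) else 0)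
    + (if 2 * r \<le> d \<and> d - 2 * r \<noteq> 0 then tri i r (d - 2 * r - 1) else 0)
    + (if 2 * r \<le> d \<and> r \<noteq> 0 then tri i (r - 1) (d - 2 * r) else 0))"
    unfolding quad_mult_nth 1 2 sum.distrib by (simp add: tri_fps_def)
  also have "\<dots> = (\<Sum>r\<le>d. if 2 * r \<le> d then
    tri i r (d - 2 * r) + (if d - 2 * r = 0 then 0 else tri i r (d - 2 * r - 1))
    + (if r = 0 then 0 else tri i (r - 1) (d - 2 * r)) else 0)"
    by (rule sum.cong) auto
  finally show ?thesis .
qed

lemma tri_fps_eq: "tri_fps i = inverse quad ^ Suc i"
proof (induction i)
  case 0
  have "quad * tri_fps 0 = 1"
  proof (rule fps_ext)
    fix d
    have "fps_nth (quad * tri_fps 0) d = (\<Sum>r\<le>d. if 2 * r \<le> d then if r = 0 \<and> d - 2 * r = 0 then 1 else 0 else 0)"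
      unfolding tri_fps_mult_nth tri_pascal_0 ..
    also have "\<dots> = (\<Sum>r\<le>d. if r = 0 then if d = 0 then 1 else 0 else 0)" by (rule sum.cong) auto
    also have "\<dots> = fps_nth 1 d" by (simp add: sum.delta)
    finally show "fps_nth (quad * tri_fps 0) d = fps_nth 1 d" .
  qed
  then have "inverse quad * (quad * tri_fps 0) = inverse quad" by (simp only: mult_1_right)
  moreover have "inverse quad * (quad * tri_fps 0) = (quad * inverse quad) * tri_fps 0" by (simp only: mult_ac)
  ultimately show ?case by (simp only: quad_inverse mult_1_left power_Suc power_0 mult_1_right)
next
  case (Suc i)
  have "quad * tri_fps (Suc i) = tri_fps i"
  proof (rule fps_ext)
    fix d
    have "fps_nth (quad * tri_fps (Suc i)) d = (\<Sum>r\<le>d. if 2 * r \<le> d then tri i r (d - 2 * r) else 0)"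
      unfolding tri_fps_mult_nth tri_pascal ..
    then show "fps_nth (quad * tri_fps (Suc i)) d = fps_nth (tri_fps i) d" by (simp add: tri_fps_def)
  qed
  then have "inverse quad * (quad * tri_fps (Suc i)) = inverse quad ^ Suc (Suc i)" unfolding Suc by (simp only: power_Suc)
  moreover have "inverse quad * (quad * tri_fps (Suc i)) = (quad * inverse quad) * tri_fps (Suc i)" by (simp only: mult_ac)
  ultimately show ?case by (simp only: quad_inverse mult_1_left)
qed

lemma S_inv_closed_form:
  assumes "i \<le> j"
  shows "S_inv i j = (- 1) ^ (j - i) *
          (\<Sum>r = 0..(j - i) div 2.
             (- 1) ^ r * of_nat ((i + r) choose r) * of_nat ((j - r) choose (j - i - 2 * r)))"
proof -
  let ?d = "j - i"
  have "S_inv i j = fps_nth (tri_fps i) ?d"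
    using assms by (simp add: S_inv_def fps_inverse_power tri_fps_eq del: power_Suc)
  also have "\<dots> = (\<Sum>r\<le>?d. if 2 * r \<le> ?d then tri i r (?d - 2 * r) else 0)" by (simp add: tri_fps_def)
  also have "\<dots> = (\<Sum>r = 0..?d div 2. if 2 * r \<le> ?d then tri i r (?d - 2 * r) else 0)"
    by (rule sum.mono_neutral_right) auto
  also have "\<dots> = (\<Sum>r = 0..?d div 2. (- 1) ^ ?d *
             ((- 1) ^ r * of_nat ((i + r) choose r) * of_nat ((j - r) choose (j - i - 2 * r))))"
  proof (rule sum.cong[OF refl])
    fix r assume "r \<in> {0..?d div 2}"
    then have r: "2 * r \<le> ?d" by auto
    then obtain k where k: "?d = k + 2 * r" by (metis add.commute le_Suc_ex)
    then have j: "j = i + k + 2 * r" using assms by linarith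
    have "(- 1) ^ ?d = ((- 1) ^ k :: rat)" unfolding k by (simp add: power_add power_mult)
    moreover have "j - r = i + r + k" "j - i - 2 * r = k" "?d - 2 * r = k" using j by simp_all
    ultimately show "(if 2 * r \<le> ?d then tri i r (?d - 2 * r) else 0) = (- 1) ^ ?d *
             ((- 1) ^ r * of_nat ((i + r) choose r) * of_nat ((j - r) choose (j - i - 2 * r)))"
      using r by (simp add: tri_def power_add)
  qed
  finally show ?thesis by (simp only: sum_distrib_left)
qed

subsection \<open>Tensor powers\<close>

lemma sum_fun_apply: "(\<Sum>x\<in>S. h x) z = (\<Sum>x\<in>S. h x z)"
  by (induction S rule: infinite_finite_induct) auto

lemma fn_dual_independent:
  assumes "\<And>x y. x \<in> L \<Longrightarrow> y \<in> L \<Longrightarrow> t x (g y) = (if x = y then 1 else 0 :: complex)"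
  shows "inj_on t L" "fn.independent (t ` L)"
proof -
  show inj: "inj_on t L"
  proof (rule inj_onI)
    fix x y assume x: "x \<in> L" and y: "y \<in> L" and e: "t x = t y"
    have "t y (g x) = 1" using assms[OF x x] by (simp only: e[symmetric] if_True refl)
    then show "x = y" using assms[OF y x] by (cases "x = y") simp_all
  qed
  show "fn.independent (t ` L)"
    unfolding fn.independent_explicit_module
  proof (intro allI impI)
    fix S u w assume S: "finite S" "S \<subseteq> t ` L" and s: "(\<Sum>v\<in>S. (\<lambda>x. u v * v x)) = 0" and w: "w \<in> S"
    obtain y where y: "y \<in> L" "w = t y" using S w by blast
    have "0 = (\<Sum>v\<in>S. u v * v (g y))" using fun_cong[OF s, of "g y"] by (simp add: sum_fun_apply)
    also have "\<dots> = (\<Sum>v\<in>S. if v = w then u v else 0)"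
    proof (rule sum.cong[OF refl])
      fix v assume "v \<in> S"
      then obtain x where x: "x \<in> L" "v = t x" using S by blast
      have "v = w \<longleftrightarrow> x = y" using inj_on_eq_iff[OF inj x(1) y(1)] x y by simp
      then show "u v * v (g y) = (if v = w then u v else 0)" using assms[OF x(1) y(1)] x by simp
    qed
    also have "\<dots> = u w" using S(1) w by simp
    finally show "u w = 0" by simp
  qed
qed

lemma multilinear_formD:
  assumes "multilinear_form n V f" "length vs = n" "set vs \<subseteq> vecs V" "k < n" "x \<in> vecs V"
  shows "y \<in> vecs V \<Longrightarrow> f (vs[k := x + y]) = f (vs[k := x]) + f (vs[k := y])"
    and "f (vs[k := smul V c x]) = c * f (vs[k := x])"
  using assms unfolding multilinear_form_def by blast+

locale tensor_module =
  fixes M :: "('a, 'b) monoid_scheme" and V :: "('a, 'v::ab_group_add) cmodule" and n :: nat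
  assumes mod: "monoid_module M V" and fin: "fin_dim V"
begin

sublocale vs: vector_space "smul V"
  using mod by (rule monoid_module.vector_space)

lemmas vecs_subspace = monoid_module.subspace[OF mod]
  and act_mem = monoid_module.act_closed[OF mod]
  and act_add = monoid_module.act_add[OF mod]
  and act_smul = monoid_module.act_smul[OF mod]

lemma subset_update: "set vs \<subseteq> vecs V \<Longrightarrow> x \<in> vecs V \<Longrightarrow> set (vs[k := x]) \<subseteq> vecs V"
  using set_update_subset_insert[of vs k x] by auto

text \<open>Forms are arbitrary outside lists over \<open>vecs V\<close>, so forms that agree where
  it matters can still be different functions.\<close>

lemma multilinear_cong:
  assumes f: "multilinear_form n V f"
    and eq: "\<And>vs. length vs = n \<Longrightarrow> set vs \<subseteq> vecs V \<Longrightarrow> f vs = g vs"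
  shows "multilinear_form n V g"
  unfolding multilinear_form_def
proof (intro allI impI conjI ballI)
  fix vs k x y assume vs: "length vs = n \<and> set vs \<subseteq> vecs V" and k: "k < n" and x: "x \<in> vecs V" and y: "y \<in> vecs V"
  have e: "g (vs[k := z]) = f (vs[k := z])" if "z \<in> vecs V" for z
    using eq[of "vs[k := z]"] vs subset_update that by simp
  show "g (vs[k := x + y]) = g (vs[k := x]) + g (vs[k := y])"
    using multilinear_formD(1)[OF f _ _ k x y] vs e x y vs.subspace_add[OF vecs_subspace x y] by simp
next
  fix vs k x c assume vs: "length vs = n \<and> set vs \<subseteq> vecs V" and k: "k < n" and x: "x \<in> vecs V"
  have e: "g (vs[k := z]) = f (vs[k := z])" if "z \<in> vecs V" for z
    using eq[of "vs[k := z]"] vs subset_update that by simp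
  show "g (vs[k := smul V c x]) = c * g (vs[k := x])"
    using multilinear_formD(2)[OF f _ _ k x] vs e x vs.subspace_scale[OF vecs_subspace x] by simp
qed

lemma multilinear_pullback:
  assumes a: "a \<in> carrier M" and f: "multilinear_form n V f"
  shows "multilinear_form n V (\<lambda>vs. f (map (act V a) vs))"
  unfolding multilinear_form_def[of n V "\<lambda>vs. f (map (act V a) vs)"]
proof (intro allI impI conjI ballI)
  fix vs k x y assume vs: "length vs = n \<and> set vs \<subseteq> vecs V" and k: "k < n" and x: "x \<in> vecs V" and y: "y \<in> vecs V"
  have m: "length (map (act V a) vs) = n" "set (map (act V a) vs) \<subseteq> vecs V" using vs act_mem[OF a] by auto
  show "f (map (act V a) (vs[k := x + y])) = f (map (act V a) (vs[k := x])) + f (map (act V a) (vs[k := y]))"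
    using multilinear_formD(1)[OF f m k act_mem[OF a x] act_mem[OF a y]] by (simp add: map_update act_add[OF a x y])
next
  fix vs k x c assume vs: "length vs = n \<and> set vs \<subseteq> vecs V" and k: "k < n" and x: "x \<in> vecs V"
  have m: "length (map (act V a) vs) = n" "set (map (act V a) vs) \<subseteq> vecs V" using vs act_mem[OF a] by auto
  show "f (map (act V a) (vs[k := smul V c x])) = c * f (map (act V a) (vs[k := x]))"
    using multilinear_formD(2)[OF f m k act_mem[OF a x]] by (simp add: map_update act_smul[OF a x])
qed

definition pures :: "'v set \<Rightarrow> (('v list \<Rightarrow> complex) \<Rightarrow> complex) set" where
  "pures C = pure_tensor V ` {vs. length vs = n \<and> set vs \<subseteq> C}"

abbreviation T :: "('a, ('v list \<Rightarrow> complex) \<Rightarrow> complex) cmodule" where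
  "T \<equiv> tensor_power n V"

lemma vecs_T: "vecs T = fn.span (pures (vecs V))"
  by (simp add: tensor_power_def pures_def)

lemma smul_T: "smul T = (\<lambda>c t f. c * t f)"
  by (simp add: tensor_power_def)

lemma act_T: "act T a t = (\<lambda>f. if multilinear_form n V f then t (\<lambda>vs. f (map (act V a) vs)) else 0)"
  by (simp add: tensor_power_def)

lemma pure_eq: "length vs = n \<Longrightarrow> pure_tensor V vs f = (if multilinear_form n V f then f vs else 0)"
  by (simp add: pure_tensor_def)

lemma pure_add:
  assumes "length vs = n" "set vs \<subseteq> vecs V" "k < n" "x \<in> vecs V" "y \<in> vecs V"
  shows "pure_tensor V (vs[k := x + y]) = pure_tensor V (vs[k := x]) + pure_tensor V (vs[k := y])"
  by (rule HOL.ext) (simp add: pure_eq assms multilinear_formD(1)[OF _ assms])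

lemma pure_scale:
  assumes "length vs = n" "set vs \<subseteq> vecs V" "k < n" "x \<in> vecs V"
  shows "pure_tensor V (vs[k := smul V c x]) = (\<lambda>f. c * pure_tensor V (vs[k := x]) f)"
  by (rule HOL.ext) (simp add: pure_eq assms multilinear_formD(2)[OF _ assms])

lemma pure_in_span:
  assumes C: "C \<subseteq> vecs V" and "length vs = n" "set vs \<subseteq> vs.span C"
  shows "pure_tensor V vs \<in> fn.span (pures C)"
proof -
  have sC: "vs.span C \<subseteq> vecs V" by (rule vs.span_minimal[OF C vecs_subspace])
  \<comment> \<open>\<open>k\<close> counts the leading entries that may already range over the
    span, while the others still lie in \<open>C\<close>. Entries are freed one at a time by
    linearity in that place.\<close>
  have "pure_tensor V vs \<in> fn.span (pures C)"
    if "k \<le> n" "length vs = n" "\<forall>j<n. vs ! j \<in> (if j < k then vs.span C else C)" for k vs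
    using that
  proof (induction k arbitrary: vs)
    case 0
    then have "set vs \<subseteq> C" by (auto simp: in_set_conv_nth)
    then show ?case using 0 by (intro fn.span_base) (auto simp: pures_def)
  next
    case (Suc k)
    let ?X = "{x \<in> vecs V. pure_tensor V (vs[k := x]) \<in> fn.span (pures C)}"
    have k: "k < n" using Suc.prems(1) by simp
    have vV: "set vs \<subseteq> vecs V"
    proof
      fix x assume "x \<in> set vs"
      then obtain j where j: "j < n" "x = vs ! j" using Suc.prems(2) by (auto simp: in_set_conv_nth)
      then have "x \<in> (if j < Suc k then vs.span C else C)" using Suc.prems(3) by simp
      then show "x \<in> vecs V" using sC C by (auto split: if_splits)
    qed
    note pa = pure_add[OF Suc.prems(2) vV k] and ps = pure_scale[OF Suc.prems(2) vV k]
    have "vs.subspace ?X"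
    proof (rule vs.subspaceI)
      have "0 \<in> vecs V" by (rule vs.subspace_0[OF vecs_subspace])
      moreover have "pure_tensor V (vs[k := 0]) = (\<lambda>f. 0 * pure_tensor V (vs[k := 0]) f)"
        using ps[OF calculation, of 0] by (simp only: vs.scale_zero_right)
      ultimately show "0 \<in> ?X" using fn.span_zero by (simp add: zero_fun_def)
      show "x + y \<in> ?X" if "x \<in> ?X" "y \<in> ?X" for x y
        using that pa[of x y] fn.span_add vs.subspace_add[OF vecs_subspace] by auto
      show "smul V c x \<in> ?X" if "x \<in> ?X" for c x
        using that ps[of x c] fn.span_scale vs.subspace_scale[OF vecs_subspace] by auto
    qed
    moreover have "C \<subseteq> ?X"
    proof
      fix x assume x: "x \<in> C"
      have "\<forall>j<n. vs[k := x] ! j \<in> (if j < k then vs.span C else C)"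
      proof (intro allI impI)
        fix j assume j: "j < n"
        show "vs[k := x] ! j \<in> (if j < k then vs.span C else C)"
          using Suc.prems(3)[rule_format, OF j] Suc.prems(2) x j by (cases "j = k") (auto simp: nth_list_update)
      qed
      then show "x \<in> ?X" using Suc.IH[of "vs[k := x]"] Suc.prems(1,2) x C by auto
    qed
    ultimately have "vs.span C \<subseteq> ?X" using vs.span_minimal by blast
    moreover have "vs ! k \<in> vs.span C" using Suc.prems(3)[rule_format, OF k] by simp
    ultimately have "vs ! k \<in> ?X" by (rule subsetD)
    then show ?case by simp
  qed
  note * = this[OF order_refl assms(2)]
  show ?thesis
  proof (rule *, intro allI impI)
    fix j assume "j < n"
    then have "vs ! j \<in> vs.span C" using assms(2) by (intro subsetD[OF assms(3) nth_mem]) simp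
    then show "vs ! j \<in> (if j < n then vs.span C else C)" using \<open>j < n\<close> by simp
  qed
qed

lemma span_pures:
  assumes "C \<subseteq> vecs V" "vs.span C = E"
  shows "fn.span (pures E) = fn.span (pures C)"
proof
  show "fn.span (pures E) \<subseteq> fn.span (pures C)"
    by (rule fn.span_minimal[OF _ fn.subspace_span]) (use pure_in_span[OF assms(1)] assms(2) in \<open>auto simp: pures_def\<close>)
  show "fn.span (pures C) \<subseteq> fn.span (pures E)"
    by (rule fn.span_mono) (use assms(2) vs.span_superset in \<open>auto simp: pures_def\<close>)
qed

lemma finite_pures: "finite C \<Longrightarrow> finite (pures C)"
  using finite_lists_length_eq[of C n] by (simp add: pures_def conj_commute)

text \<open>Products of coordinate functionals form a system dual to the pure tensors of basis vectors.\<close>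

lemma dim_span_pures:
  assumes B: "vs.independent B" "vs.span B = vecs V" and C: "C \<subseteq> B" "finite C"
  shows "fn.dim (fn.span (pures C)) = card C ^ n"
proof -
  let ?L = "{vs. length vs = n \<and> set vs \<subseteq> C}"
  let ?R = "vs.representation B"
  define g where "g bs = (\<lambda>vs. \<Prod>k<n. ?R (vs ! k) (bs ! k))" for bs :: "'v list"
  have upd: "g bs (vs[k := z]) = ?R z (bs ! k) * (\<Prod>j\<in>{..<n} - {k}. ?R (vs ! j) (bs ! j))"
    if "length vs = n" "k < n" for bs vs k z
  proof -
    have "g bs (vs[k := z]) = ?R (vs[k := z] ! k) (bs ! k) * (\<Prod>j\<in>{..<n} - {k}. ?R (vs[k := z] ! j) (bs ! j))"
      unfolding g_def by (rule prod.remove) (use that in auto)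
    also have "(\<Prod>j\<in>{..<n} - {k}. ?R (vs[k := z] ! j) (bs ! j)) = (\<Prod>j\<in>{..<n} - {k}. ?R (vs ! j) (bs ! j))"
      by (rule prod.cong) auto
    finally show ?thesis using that by simp
  qed
  have ml: "multilinear_form n V (g bs)" for bs
    unfolding multilinear_form_def
  proof (intro allI impI conjI ballI)
    fix vs k x y assume vs: "length vs = n \<and> set vs \<subseteq> vecs V" and k: "k < n" and x: "x \<in> vecs V" and y: "y \<in> vecs V"
    show "g bs (vs[k := x + y]) = g bs (vs[k := x]) + g bs (vs[k := y])"
      using upd[of vs k] vs k vs.representation_add[OF B(1), of y x] x y B(2) by (simp add: distrib_right add.commute)
  next
    fix vs k x c assume vs: "length vs = n \<and> set vs \<subseteq> vecs V" and k: "k < n" and x: "x \<in> vecs V"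
    show "g bs (vs[k := smul V c x]) = c * g bs (vs[k := x])"
      using upd[of vs k] vs k vs.representation_scale[OF B(1), of x c] x B(2) by simp
  qed
  have dual: "pure_tensor V ws (g bs) = (if ws = bs then 1 else 0)" if ws: "ws \<in> ?L" and bs: "bs \<in> ?L" for ws bs
  proof -
    have "ws ! k \<in> B" if "k < n" for k
    proof (rule subsetD[OF C(1)])
      have "length ws = n" "set ws \<subseteq> C" using \<open>ws \<in> ?L\<close> by simp_all
      then show "ws ! k \<in> C" using nth_mem[of k ws] that by blast
    qed
    then have "g bs ws = (\<Prod>k<n. if bs ! k = ws ! k then 1 else 0)"
      unfolding g_def using vs.representation_basis[OF B(1)] by (intro prod.cong) auto
    also have "\<dots> = (if ws = bs then 1 else 0)"
    proof (cases "ws = bs")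
      case False
      then obtain k where "k < n" "bs ! k \<noteq> ws ! k"
        using ws bs by (metis (mono_tags, lifting) mem_Collect_eq nth_equalityI)
      then have "\<exists>k\<in>{..<n}. (if bs ! k = ws ! k then 1 else 0) = (0::complex)" by auto
      then show ?thesis using False by (simp only: prod_zero[OF finite_lessThan] if_False)
    qed simp
    finally show ?thesis using ws ml by (simp add: pure_eq)
  qed
  note ind = fn_dual_independent[of ?L "pure_tensor V" g, OF dual]
  have "fn.dim (fn.span (pures C)) = card (pures C)"
    using fn.dim_span_eq_card_independent[OF ind(2)] by (simp add: pures_def)
  also have "\<dots> = card ?L" unfolding pures_def by (rule card_image[OF ind(1)])
  also have "\<dots> = card C ^ n" using card_lists_length_eq[OF C(2), of n] by (simp add: conj_commute)
  finally show ?thesis .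
qed

lemma act_T_linear: "linear_on (\<lambda>c t f. c * t f) (\<lambda>c t f. c * t f) UNIV (act T a)"
  by (rule linear_onI; rule HOL.ext) (simp_all add: act_T)

lemma act_T_span: "act T a ` fn.span S = fn.span (act T a ` S)"
proof -
  interpret l: linear_on_subspace "\<lambda>c t f. c * t f" "\<lambda>c t f. c * t f" UNIV "act T a"
    by (rule flinear_onI[OF act_T_linear fn.subspace_UNIV])
  show ?thesis by (rule l.map_span) simp
qed

lemma act_pure: "a \<in> carrier M \<Longrightarrow> length vs = n \<Longrightarrow> act T a (pure_tensor V vs) = pure_tensor V (map (act V a) vs)"
  by (rule HOL.ext) (simp add: act_T pure_eq multilinear_pullback)

lemma act_pures:
  assumes a: "a \<in> carrier M"
  shows "act T a ` pures (vecs V) = pures (act V a ` vecs V)"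
proof
  show "act T a ` pures (vecs V) \<subseteq> pures (act V a ` vecs V)"
  proof
    fix t assume "t \<in> act T a ` pures (vecs V)"
    then obtain vs where vs: "t = act T a (pure_tensor V vs)" "length vs = n" "set vs \<subseteq> vecs V"
      by (auto simp: pures_def)
    then have "t = pure_tensor V (map (act V a) vs)" using act_pure[OF a vs(2)] by simp
    moreover have "length (map (act V a) vs) = n" "set (map (act V a) vs) \<subseteq> act V a ` vecs V" using vs by auto
    ultimately show "t \<in> pures (act V a ` vecs V)" unfolding pures_def by blast
  qed
  show "pures (act V a ` vecs V) \<subseteq> act T a ` pures (vecs V)"
  proof
    fix t assume "t \<in> pures (act V a ` vecs V)"
    then obtain ws where ws: "t = pure_tensor V ws" "length ws = n" "set ws \<subseteq> act V a ` vecs V"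
      by (auto simp: pures_def)
    let ?vs = "map (inv_into (vecs V) (act V a)) ws"
    have "map (act V a) ?vs = ws" using ws(3) by (auto simp: map_idI f_inv_into_f subset_iff)
    then have "t = act T a (pure_tensor V ?vs)" using act_pure[OF a, of ?vs] ws by simp
    moreover have "set ?vs \<subseteq> vecs V" using ws(3) by (auto intro: inv_into_into)
    ultimately show "t \<in> act T a ` pures (vecs V)" using ws(2) by (auto simp: pures_def)
  qed
qed

text \<open>The laws of the action hold on \<open>vecs V\<close> only, so the module laws of the
  tensor power compare forms that agree merely on lists over \<open>vecs V\<close>.\<close>

lemma T_eqI:
  assumes "t \<in> vecs T" "\<And>vs. length vs = n \<Longrightarrow> set vs \<subseteq> vecs V \<Longrightarrow> f vs = g vs"
  shows "t f = t g"
proof -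
  have "pures (vecs V) \<subseteq> {t. t f = t g}"
  proof
    fix t assume "t \<in> pures (vecs V)"
    then obtain vs where vs: "t = pure_tensor V vs" "length vs = n" "set vs \<subseteq> vecs V" by (auto simp: pures_def)
    have "multilinear_form n V f \<longleftrightarrow> multilinear_form n V g"
      using multilinear_cong[of f g] multilinear_cong[of g f] assms(2) by metis
    then show "t \<in> {t. t f = t g}" using vs assms(2)[OF vs(2,3)] by (simp add: pure_eq)
  qed
  moreover have "fn.subspace {t. t f = t g}" by (rule fn.subspaceI) auto
  ultimately show ?thesis using assms(1) fn.span_minimal unfolding vecs_T by blast
qed

lemma T_not_multilinear:
  assumes "t \<in> vecs T" "\<not> multilinear_form n V f"
  shows "t f = 0"
proof -
  have "pures (vecs V) \<subseteq> {t. t f = 0}" using assms(2) by (auto simp: pures_def pure_eq)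
  moreover have "fn.subspace {t. t f = 0}" by (rule fn.subspaceI) auto
  ultimately show ?thesis using assms(1) fn.span_minimal unfolding vecs_T by blast
qed

theorem tensor_monoid_module: "monoid_module M T"
proof (rule monoid_module.intro)
  show "vector_space (smul T)" unfolding smul_T by (rule fn.vector_space_axioms)
  show "module.subspace (smul T) (vecs T)" unfolding smul_T vecs_T by (rule fn.subspace_span)
  show "act T a t \<in> vecs T" if a: "a \<in> carrier M" and t: "t \<in> vecs T" for a t
  proof -
    have "act T a t \<in> act T a ` fn.span (pures (vecs V))" using t unfolding vecs_T by (rule imageI)
    then have "act T a t \<in> fn.span (pures (act V a ` vecs V))" by (simp only: act_T_span act_pures[OF a])
    moreover have "pures (act V a ` vecs V) \<subseteq> pures (vecs V)"
    proof -
      have "act V a ` vecs V \<subseteq> vecs V" using act_mem[OF a] by blast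
      then show ?thesis unfolding pures_def by (intro image_mono) blast
    qed
    ultimately show ?thesis unfolding vecs_T using fn.span_mono by blast
  qed
  show "act T a (t + s) = act T a t + act T a s" for a t s
    by (rule HOL.ext) (simp add: act_T)
  show "act T a (smul T c t) = smul T c (act T a t)" for a c t
    unfolding smul_T by (rule HOL.ext) (simp add: act_T)
  show "act T \<one>\<^bsub>M\<^esub> t = t" if t: "t \<in> vecs T" for t
  proof (rule HOL.ext)
    fix f
    have "t (\<lambda>vs. f (map (act V \<one>\<^bsub>M\<^esub>) vs)) = t f"
    proof (rule T_eqI[OF t])
      fix vs assume "set vs \<subseteq> vecs V"
      then have "map (act V \<one>\<^bsub>M\<^esub>) vs = vs" using monoid_module.act_one[OF mod] by (intro map_idI) auto
      then show "f (map (act V \<one>\<^bsub>M\<^esub>) vs) = f vs" by simp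
    qed
    then show "act T \<one>\<^bsub>M\<^esub> t f = t f" using T_not_multilinear[OF t] by (auto simp: act_T)
  qed
  show "act T (a \<otimes>\<^bsub>M\<^esub> b) t = act T a (act T b t)"
    if a: "a \<in> carrier M" and b: "b \<in> carrier M" and t: "t \<in> vecs T" for a b t
  proof (rule HOL.ext)
    fix f
    have "t (\<lambda>vs. f (map (act V (a \<otimes>\<^bsub>M\<^esub> b)) vs)) = t (\<lambda>vs. f (map (act V a) (map (act V b) vs)))"
    proof (rule T_eqI[OF t])
      fix vs assume "set vs \<subseteq> vecs V"
      then have "map (act V (a \<otimes>\<^bsub>M\<^esub> b)) vs = map (act V a) (map (act V b) vs)"
        using monoid_module.act_mult[OF mod a b] by auto
      then show "f (map (act V (a \<otimes>\<^bsub>M\<^esub> b)) vs) = f (map (act V a) (map (act V b) vs))" by (rule arg_cong)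
    qed
    then show "act T (a \<otimes>\<^bsub>M\<^esub> b) t f = act T a (act T b t) f"
      using multilinear_pullback[OF a] by (auto simp: act_T)
  qed
qed

lemma basis_obtain:
  assumes "vs.subspace E" "E \<subseteq> vecs V"
  obtains B C where "C \<subseteq> B" "finite B" "vs.independent B" "vs.span B = vecs V" "vs.span C = E" "card C = vs.dim E" "B \<subseteq> vecs V"
proof -
  obtain B0 where B0: "finite B0" "vs.span B0 = vecs V" using fin unfolding fin_dim_def by blast
  have E: "E \<subseteq> vs.span B0" using assms(2) B0(2) by simp
  obtain C where "{} \<subseteq> C" and C: "C \<subseteq> E" "vs.independent C" "finite C" "vs.span C = E" "card C = vs.dim E"
    by (rule vs.subspace_basis_extend[OF assms(1) E B0(1) empty_subsetI vs.independent_empty])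
  obtain B where B: "C \<subseteq> B" "B \<subseteq> vecs V" "vs.independent B" "finite B" "vs.span B = vecs V"
  proof (rule vs.subspace_basis_extend[OF vecs_subspace _ B0(1) _ C(2)])
    show "vecs V \<subseteq> vs.span B0" using B0(2) by simp
    show "C \<subseteq> vecs V" using C(1) assms(2) by (rule subset_trans)
  qed
  show thesis by (rule that[OF B(1,4,3,5) C(4,5) B(2)])
qed

theorem tensor_fin_dim: "fin_dim T"
proof -
  obtain B C where B: "finite B" "vs.span B = vecs V" "B \<subseteq> vecs V"
    using basis_obtain[OF vecs_subspace subset_refl] by metis
  have "pures B \<subseteq> vecs T" using B(3) unfolding vecs_T by (intro subset_trans[OF _ fn.span_superset]) (auto simp: pures_def)
  moreover have "fn.span (pures B) = vecs T" using span_pures[OF B(3,2)] by (simp add: vecs_T)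
  ultimately show ?thesis unfolding fin_dim_def smul_T using finite_pures[OF B(1)] by blast
qed

text \<open>The image of the diagonal action is the tensor power of the image. A basis of that image
  is extended to one of \<open>vecs V\<close>, which supplies the dual forms for counting.\<close>

theorem dim_act_tensor:
  assumes a: "a \<in> carrier M"
  shows "fn.dim (act T a ` vecs T) = vs.dim (act V a ` vecs V) ^ n"
proof -
  let ?E = "act V a ` vecs V"
  interpret l: linear_on_subspace "smul V" "smul V" "vecs V" "act V a"
    by unfold_locales (auto simp: linear_on_def vecs_subspace act_add[OF a] act_smul[OF a])
  have E: "vs.subspace ?E" "?E \<subseteq> vecs V" using l.subspace_image[OF vecs_subspace] act_mem[OF a] by auto
  obtain B C where BC: "C \<subseteq> B" "finite B" "vs.independent B" "vs.span B = vecs V" "vs.span C = ?E" "card C = vs.dim ?E"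
      "B \<subseteq> vecs V" using basis_obtain[OF E] by metis
  have "act T a ` vecs T = fn.span (pures ?E)" unfolding vecs_T by (simp only: act_T_span act_pures[OF a])
  also have "\<dots> = fn.span (pures C)" using BC by (intro span_pures) auto
  finally show ?thesis using dim_span_pures[OF BC(3,4,1) finite_subset[OF BC(1,2)]] BC(6) by simp
qed

end

subsection \<open>Diagrams of the generators\<close>

declare split_paired_Ex [simp del] split_paired_All [simp del]

lemma partial_matchingD:
  assumes "partial_matching m D" "{u, v} \<in> D"
  shows "u \<noteq> v" "u \<in> vertices m" "v \<in> vertices m"
  using assms by (auto simp: partial_matching_def card_2_iff)

lemma partial_matching_unique:
  assumes "partial_matching m D" "{u, v} \<in> D" "{u, w} \<in> D"
  shows "v = w"
proof (rule ccontr)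
  assume "v \<noteq> w"
  then have "{u, v} \<noteq> {u, w}" by (auto simp: doubleton_eq_iff)
  have "\<forall>e\<in>D. \<forall>e'\<in>D. e \<noteq> e' \<longrightarrow> e \<inter> e' = {}"
    using assms(1) unfolding partial_matching_def by (rule conjunct2)
  from this[rule_format, OF assms(2,3) \<open>{u, v} \<noteq> {u, w}\<close>] have "{u, v} \<inter> {u, w} = {}" .
  then show False by auto
qed

lemma partial_matching_cases:
  assumes "partial_matching m D" "e \<in> D"
  obtains u v where "e = {u, v}" "u \<noteq> v" "u \<in> vertices m" "v \<in> vertices m"
proof -
  have e: "e \<subseteq> vertices m" "card e = 2"
    using assms unfolding partial_matching_def by blast+
  then obtain u v where "e = {u, v}" "u \<noteq> v" by (meson card_2_iff)
  then show thesis using that e(1) by simp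
qed

lemma partial_matchingI:
  assumes "\<And>e. e \<in> D \<Longrightarrow> \<exists>u v. e = {u, v} \<and> u \<noteq> v \<and> u \<in> vertices m \<and> v \<in> vertices m"
    and "\<And>u v w. {u, v} \<in> D \<Longrightarrow> {u, w} \<in> D \<Longrightarrow> v = w"
  shows "partial_matching m D"
  unfolding partial_matching_def
proof (intro conjI ballI impI)
  fix e assume "e \<in> D"
  then obtain u v where "e = {u, v}" "u \<noteq> v" "u \<in> vertices m" "v \<in> vertices m"
    using assms(1) by blast
  then show "e \<subseteq> vertices m" "card e = 2" by simp_all
next
  fix e e' assume e: "e \<in> D" "e' \<in> D" "e \<noteq> e'"
  show "e \<inter> e' = {}"
  proof (rule ccontr)
    assume "e \<inter> e' \<noteq> {}"
    then obtain u where u: "u \<in> e" "u \<in> e'" by blast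
    have "\<exists>v. e = {u, v}" "\<exists>v. e' = {u, v}" using u assms(1)[OF e(1)] assms(1)[OF e(2)] by auto
    then show False using assms(2) e by blast
  qed
qed

lemma finite_partial_matching:
  assumes "partial_matching m D"
  shows "finite D"
proof (rule finite_subset)
  show "D \<subseteq> Pow (vertices m)" using assms by (auto simp: partial_matching_def)
qed (simp add: vertices_def)

lemma vertex_fst: "v \<in> vertices m \<Longrightarrow> fst v = 0 \<or> fst v = 1"
  by (auto simp: vertices_def)

section \<open>Left multiplication of a diagram by a generator\<close>

definition del :: "vertex \<Rightarrow> diagram \<Rightarrow> diagram" where
  "del v D = {e \<in> D. v \<notin> e}"

definition swv :: "nat \<Rightarrow> vertex \<Rightarrow> vertex" where
  "swv k v = (if v = (0, k) then (0, Suc k) else if v = (0, Suc k) then (0, k) else v)"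

text \<open>An explicit form of the product with a generator on top, justified by
  \<open>gd_mult\<close>. A shift first removes the block at the vertex that loses its connection
  and then exchanges two places; the last set for \<open>Hook k\<close> joins the former partners of
  the two capped vertices.\<close>

primrec lact :: "gen \<Rightarrow> diagram \<Rightarrow> diagram" where
  "lact (Dot k) D = del (0, k) D"
| "lact (Shr k) D = (`) (swv k) ` del (0, k) D"
| "lact (Shl k) D = (`) (swv k) ` del (0, Suc k) D"
| "lact (Hook k) D = del (0, k) (del (0, Suc k) D) \<union> {{(0, k), (0, Suc k)}} \<union>
     {{a, b} | a b. {a, (0, k)} \<in> D \<and> {b, (0, Suc k)} \<in> D \<and> a \<noteq> (0, Suc k) \<and> b \<noteq> (0, k)}"

fun rho :: "gen \<Rightarrow> nat \<Rightarrow> nat option" where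
  "rho (Dot k) l = (if l = k then None else Some l)"
| "rho (Shr k) l = (if l = k then Some (Suc k) else if l = Suc k then None else Some l)"
| "rho (Shl k) l = (if l = Suc k then Some k else if l = k then None else Some l)"
| "rho (Hook k) l = (if l = k \<or> l = Suc k then None else Some l)"

definition hooks :: "gen \<Rightarrow> diagram" where
  "hooks g = (case g of Hook k \<Rightarrow> {{(0, k), (0, Suc k)}, {(1, k), (1, Suc k)}} | _ \<Rightarrow> {})"

text \<open>\<open>rho g\<close> is the partial injection from the top to the bottom line along the through strands.\<close>

definition gd :: "nat \<Rightarrow> gen \<Rightarrow> diagram" where
  "gd m g = {{(0, l), (1, l')} | l l'. l < m \<and> rho g l = Some l'} \<union> hooks g"

definition lift :: "vertex \<Rightarrow> vertex" where
  "lift = (\<lambda>(l, k). (l + 1, k))"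

lemma lift_inj: "lift u = lift v \<longleftrightarrow> u = v"
  by (cases u; cases v) (auto simp: lift_def)

lemma lift_image_doubleton:
  assumes "\<And>e. e \<in> D \<Longrightarrow> \<exists>u v. e = {u, v}"
  shows "{a, b} \<in> (`) lift ` D \<longleftrightarrow> (\<exists>u v. a = lift u \<and> b = lift v \<and> {u, v} \<in> D)"
proof
  assume "{a, b} \<in> (`) lift ` D"
  then obtain e where e: "e \<in> D" "{a, b} = lift ` e" by blast
  obtain u v where uv: "e = {u, v}" using assms e by blast
  then have "a = lift u \<and> b = lift v \<or> a = lift v \<and> b = lift u"
    using e(2) by (simp add: doubleton_eq_iff)
  moreover have "{u, v} \<in> D" "{v, u} \<in> D" using e uv by (simp_all add: insert_commute)
  ultimately show "\<exists>u v. a = lift u \<and> b = lift v \<and> {u, v} \<in> D" by blast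
next
  assume "\<exists>u v. a = lift u \<and> b = lift v \<and> {u, v} \<in> D"
  then obtain u v where "a = lift u" "b = lift v" "{u, v} \<in> D" by blast
  then show "{a, b} \<in> (`) lift ` D" by (intro image_eqI[of _ _ "{u, v}"]) simp_all
qed

lemma diagram_mult_eqI:
  assumes A: "\<And>e. e \<in> A \<Longrightarrow> \<exists>u v. e = {squash u, squash v} \<and> fst u \<in> {0, 2} \<and> fst v \<in> {0, 2} \<and> u \<noteq> v
      \<and> (u, v) \<in> {(x, y). {x, y} \<in> stack D E}\<^sup>*"
    and B: "\<And>u v. (u, v) \<in> {(x, y). {x, y} \<in> stack D E}\<^sup>* \<Longrightarrow> fst u \<in> {0, 2} \<Longrightarrow> fst v \<in> {0, 2} \<Longrightarrow> u \<noteq> v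
      \<Longrightarrow> {squash u, squash v} \<in> A"
  shows "diagram_mult D E = A"
  unfolding diagram_mult_def using A B by blast

lemma rtrancl_const:
  assumes "(u, v) \<in> R\<^sup>*" "\<And>x y. (x, y) \<in> R \<Longrightarrow> cl x = cl y"
  shows "cl u = cl v"
  using assms(1) by (induction rule: rtrancl_induct) (auto dest: assms(2))

lemma image_swv_doubleton: "{u, v} \<in> (`) (swv k) ` D \<longleftrightarrow> {swv k u, swv k v} \<in> D"
proof
  have inv: "swv k (swv k x) = x" for x by (auto simp: swv_def)
  have inv2: "swv k ` swv k ` e = e" for e by (simp add: image_image inv)
  show "{swv k u, swv k v} \<in> D" if "{u, v} \<in> (`) (swv k) ` D"
  proof -
    obtain e where e: "e \<in> D" "{u, v} = swv k ` e" using \<open>{u, v} \<in> (`) (swv k) ` D\<close> by blast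
    have "swv k ` {u, v} = e" unfolding e(2) by (rule inv2)
    then show ?thesis using e(1) by simp
  qed
  show "{u, v} \<in> (`) (swv k) ` D" if "{swv k u, swv k v} \<in> D"
    using that by (intro image_eqI[of _ _ "{swv k u, swv k v}"]) (simp_all add: inv)
qed

text \<open>The vertex of \<open>D\<close> that an outer vertex of the product continues to;
  \<open>None\<close> if the generator isolates it.\<close>

definition pull :: "gen \<Rightarrow> vertex \<Rightarrow> vertex option" where
  "pull g v = (if fst v = 0 then map_option (Pair 0) (rho g (snd v)) else Some v)"

lemma lact_pull:
  assumes "\<forall>k. g \<noteq> Hook k"
  shows "{u, v} \<in> lact g D \<longleftrightarrow> (\<exists>u' v'. pull g u = Some u' \<and> pull g v = Some v' \<and> {u', v'} \<in> D)"
proof (cases g)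
  case (Dot k)
  have "pull g x = (if x = (0, k) then None else Some x)" for x
    using Dot by (cases x) (simp add: pull_def)
  then show ?thesis using Dot by (auto simp: del_def simp del: split_paired_Ex)
next
  case (Shr k)
  have "pull g x = (if swv k x = (0, k) then None else Some (swv k x))" for x
    using Shr by (cases x) (simp add: pull_def swv_def)
  then show ?thesis using Shr by (auto simp: image_swv_doubleton del_def simp del: split_paired_Ex)
next
  case (Shl k)
  have "pull g x = (if swv k x = (0, Suc k) then None else Some (swv k x))" for x
    using Shl by (cases x) (simp add: pull_def swv_def)
  then show ?thesis using Shl by (auto simp: image_swv_doubleton del_def simp del: split_paired_Ex)
qed (use assms in auto)

lemma lact_doubletons:
  assumes "\<And>e. e \<in> D \<Longrightarrow> \<exists>u v. e = {u, v}" "e \<in> lact g D"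
  shows "\<exists>u v. e = {u, v}"
proof (cases g)
  case (Dot k) then show ?thesis using assms by (auto simp: del_def)
next
  case (Shr k)
  then obtain e' where "e' \<in> D" "e = swv k ` e'" using assms(2) by (auto simp: del_def)
  then show ?thesis using assms(1)[of e'] by (metis image_empty image_insert)
next
  case (Shl k)
  then obtain e' where "e' \<in> D" "e = swv k ` e'" using assms(2) by (auto simp: del_def)
  then show ?thesis using assms(1)[of e'] by (metis image_empty image_insert)
next
  case (Hook k) then show ?thesis using assms by (auto simp: del_def) 
qed

lemma rho_inj: "rho g l = Some x \<Longrightarrow> rho g l' = Some x \<Longrightarrow> l = l'"
  by (cases g) (auto split: if_splits)

text \<open>Connectedness in the stacked graph is bounded from above by a quantity that is constant
  along edges, and from below by explicit walks.\<close>

lemma gd_mult: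
  assumes D: "partial_matching m D" and g: "g \<in> gens m"
  shows "diagram_mult (gd m g) D = lact g D"
proof -
  define F where "F = (`) lift ` D"
  have dbl: "\<exists>u v. e = {u, v}" if "e \<in> D" for e
    using partial_matching_cases[OF D that] by blast
  have F_iff: "{a, b} \<in> F \<longleftrightarrow> (\<exists>u v. a = lift u \<and> b = lift v \<and> {u, v} \<in> D)" for a b
    unfolding F_def by (rule lift_image_doubleton) (rule dbl)
  let ?C = "{(x, y). {x, y} \<in> stack (gd m g) D}"
  have stack: "{x, y} \<in> stack (gd m g) D \<longleftrightarrow> {x, y} \<in> gd m g \<or> {x, y} \<in> F" for x y
    by (auto simp: stack_def F_def lift_def)
  have F_uniq: "b = c" if "{a, b} \<in> F" "{a, c} \<in> F" for a b c
  proof -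
    from F_iff[THEN iffD1, OF \<open>{a, b} \<in> F\<close>]
    obtain u v where 1: "a = lift u" "b = lift v" "{u, v} \<in> D" by blast
    from F_iff[THEN iffD1, OF \<open>{a, c} \<in> F\<close>]
    obtain u' w where 2: "a = lift u'" "c = lift w" "{u', w} \<in> D" by blast
    have "u' = u" using 1(1) 2(1) lift_inj by metis
    then have "v = w" using partial_matching_unique[OF D 1(3)] 2(3) by simp
    then show ?thesis using 1 2 by simp
  qed
  have F_line: "fst a \<noteq> 0" "fst b \<noteq> 0" if "{a, b} \<in> F" for a b
    using that by (auto simp: F_iff lift_def split: prod.splits)
  have sym: "(x, y) \<in> ?C \<longleftrightarrow> (y, x) \<in> ?C" for x y by (simp add: insert_commute)
  have outer: "v = lift (squash v)" if "fst v = 2" for v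
    using that by (cases v) (auto simp: lift_def squash_def)
  show ?thesis
  proof (cases "\<exists>k. g = Hook k")
    case False
    define f where "f = (\<lambda>v::vertex. if fst v = 0 then map_option (Pair 1) (rho g (snd v)) else Some v)"
    have f_pull: "f v = map_option lift (pull g (squash v))" if "fst v \<in> {0, 2}" for v
      using that by (cases v) (auto simp: f_def pull_def squash_def lift_def map_option.compositionality o_def)
    have h: "hooks g = {}" using False by (cases g) (auto simp: hooks_def)
    have fe: "f x = f y \<and> f x \<noteq> None" if "{x, y} \<in> gd m g" for x y
      using that h by (auto simp: gd_def f_def doubleton_eq_iff)
    \<comment> \<open>\<open>f\<close> slides a vertex along the generator onto the lower copy.
      Since \<open>F\<close> is a matching, a walk ends at a vertex that slides to the same place or
      to the other end of the same block.\<close>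
    have key: "u = v \<or> (\<exists>a b. f u = Some a \<and> f v = Some b \<and> (a = b \<or> {a, b} \<in> F))"
      if "(u, v) \<in> ?C\<^sup>*" for u v
      using that
    proof (induction rule: rtrancl_induct)
      case (step v w)
      from step(2) have "{v, w} \<in> gd m g \<or> {v, w} \<in> F" by (simp add: stack)
      then show ?case
      proof
        assume "{v, w} \<in> gd m g"
        then have "f v = f w" "f v \<noteq> None" using fe by blast+
        then show ?thesis using step.IH by (metis not_None_eq)
      next
        assume vw: "{v, w} \<in> F"
        then have "f v = Some v" "f w = Some w" using F_line[OF vw] by (simp_all add: f_def)
        moreover have "a = w" if "{a, v} \<in> F" for a
          using F_uniq[of v a w] that vw by (simp add: insert_commute)
        ultimately show ?thesis using step.IH vw by (metis option.sel)
      qed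
    qed simp
    have toF: "(u, a) \<in> ?C\<^sup>*" if "f u = Some a" "fst u \<in> {0, 2}" "fst u = 0 \<longrightarrow> snd u < m" for u a
    proof (cases "fst u = 0")
      case True
      then have "{u, a} \<in> gd m g" using that by (cases u) (auto simp: f_def gd_def)
      then show ?thesis by (auto simp: stack)
    qed (use that in \<open>auto simp: f_def\<close>)
    show ?thesis
    proof (rule diagram_mult_eqI)
      fix e assume e: "e \<in> lact g D"
      then obtain u v where uv: "e = {u, v}" using lact_doubletons[OF dbl] by blast
      have "\<exists>u' v'. pull g u = Some u' \<and> pull g v = Some v' \<and> {u', v'} \<in> D"
        using e uv lact_pull False by blast
      then obtain u' v' where p: "pull g u = Some u'" "pull g v = Some v'" "{u', v'} \<in> D" by blast
      note V = partial_matchingD[OF D p(3)]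
      define un where "un = (\<lambda>v::vertex. (2 * fst v, snd v))"
      have line: "fst u \<le> 1" "fst v \<le> 1"
        using p V by (auto simp: pull_def vertices_def split: if_splits)
      have sq: "squash (un x) = x" "fst (un x) \<in> {0, 2}" if "fst x \<le> 1" for x
        using that by (cases x; auto simp: un_def squash_def)+
      have rng: "rho g l = Some l' \<Longrightarrow> l' < m \<Longrightarrow> l < m" for l l'
        using g by (cases g) (auto simp: gens_def split: if_splits)
      have rg: "fst (un x) = 0 \<longrightarrow> snd (un x) < m" if "pull g x = Some x'" "x' \<in> vertices m" for x x'
        using that rng by (auto simp: un_def pull_def vertices_def split: if_splits)
      have "f (un u) = Some (lift u')" "f (un v) = Some (lift v')"
        using f_pull sq line p by auto
      then have "(un u, lift u') \<in> ?C\<^sup>*" "(un v, lift v') \<in> ?C\<^sup>*"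
        using toF sq line rg p V by blast+
      moreover have "{lift u', lift v'} \<in> F" using p(3) F_iff by blast
      then have "(lift u', lift v') \<in> ?C" by (simp add: stack)
      moreover have "(lift v', un v) \<in> ?C\<^sup>*"
        using \<open>(un v, lift v') \<in> ?C\<^sup>*\<close> by (rule symD[OF sym_rtrancl, rotated]) (auto simp: sym_def insert_commute)
      ultimately have "(un u, un v) \<in> ?C\<^sup>*" by (meson rtrancl.rtrancl_into_rtrancl rtrancl_trans)
      moreover have "u \<noteq> v" using p(1,2) V(1) by auto
      then have "un u \<noteq> un v" using sq(1)[OF line(1)] sq(1)[OF line(2)] by auto
      ultimately show "\<exists>u v. e = {squash u, squash v} \<and> fst u \<in> {0, 2} \<and> fst v \<in> {0, 2} \<and> u \<noteq> v \<and> (u, v) \<in> ?C\<^sup>*"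
        using uv sq line by (intro exI[of _ "un u"] exI[of _ "un v"]) auto
    next
      fix u v assume uv: "(u, v) \<in> ?C\<^sup>*" "fst u \<in> {0, 2}" "fst v \<in> {0, 2}" "u \<noteq> v"
      then obtain a b where ab: "f u = Some a" "f v = Some b" "a = b \<or> {a, b} \<in> F" using key by blast
      have "a \<noteq> b"
        using ab uv rho_inj by (cases u; cases v) (auto simp: f_def split: if_splits)
      then have "{a, b} \<in> F" using ab by blast
      then obtain a' b' where "a = lift a'" "b = lift b'" "{a', b'} \<in> D" by (auto simp: F_iff)
      then show "{squash u, squash v} \<in> lact g D"
        using ab f_pull uv lact_pull[of g "squash u" "squash v" D] False by (auto simp: lift_inj)
    qed
  next
    case True
    then obtain k where k: "g = Hook k" by blast
    have km: "Suc k < m" using g k by (auto simp: gens_def)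
    let ?K = "(1, k) :: vertex" and ?K' = "(1, Suc k) :: vertex"
    \<comment> \<open>The component of the lower arc of the hook: its two ends and at most one
      \<open>F\<close>-neighbour of each.\<close>
    define J where "J = {a. a = ?K \<or> a = ?K' \<or> {a, ?K} \<in> F \<or> {a, ?K'} \<in> F}"
    define cl where "cl = (\<lambda>a. if a \<in> J then J else {b. b = a \<or> {a, b} \<in> F})"
    define down where "down = (\<lambda>v::vertex. if fst v = 0 then (1, snd v) else v)"
    define top where "top = {(0, k), (0, Suc k) :: vertex}"
    \<comment> \<open>The candidate for the component of a vertex, up to the projection
      \<open>down\<close> along vertical strands. The two top ends of the hook form a component of
      their own.\<close>
    define cl' where "cl' = (\<lambda>v. if v \<in> top then top else cl (down v))"
    have gdk: "{x, y} \<in> gd m g \<longleftrightarrow> (\<exists>l<m. l \<noteq> k \<and> l \<noteq> Suc k \<and> {x, y} = {(0, l), (1, l)})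
        \<or> {x, y} = top \<or> {x, y} = {?K, ?K'}" for x y
    proof -
      have "gd m g = {{(0, l), (1, l)} | l. l < m \<and> l \<noteq> k \<and> l \<noteq> Suc k} \<union> {top, {?K, ?K'}}"
        unfolding gd_def hooks_def k top_def by auto
      then show ?thesis by blast
    qed
    have half: "b \<in> J" if aJ: "a \<in> J" and f: "{a, b} \<in> F" for a b
    proof -
      from aJ consider "a = ?K" | "a = ?K'" | "{a, ?K} \<in> F" | "{a, ?K'} \<in> F"
        unfolding J_def by blast
      then show ?thesis
      proof cases
        case 1 then show ?thesis using f by (simp add: J_def insert_commute)
      next
        case 2 then show ?thesis using f by (simp add: J_def insert_commute)
      next
        case 3 then show ?thesis using F_uniq[OF f 3] by (simp add: J_def)
      next
        case 4 then show ?thesis using F_uniq[OF f 4] by (simp add: J_def)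
      qed
    qed
    have clF: "cl a = cl b" if ab: "{a, b} \<in> F" for a b
    proof -
      have ba: "{b, a} \<in> F" using ab by (simp add: insert_commute)
      have "a \<in> J \<longleftrightarrow> b \<in> J" using half ab ba by blast
      moreover have "{c. c = a \<or> {a, c} \<in> F} = {a, b}" using F_uniq[OF ab] ab by blast
      moreover have "{c. c = b \<or> {b, c} \<in> F} = {a, b}" using F_uniq[OF ba] ba by blast
      ultimately show ?thesis by (simp add: cl_def)
    qed
    have const: "cl' x = cl' y" if "(x, y) \<in> ?C" for x y
    proof -
      from that have "{x, y} \<in> gd m g \<or> {x, y} \<in> F" by (simp add: stack)
      then show ?thesis
      proof
        assume F: "{x, y} \<in> F"
        then have "x \<notin> top" "y \<notin> top" "down x = x" "down y = y"
          using F_line[OF F] by (auto simp: top_def down_def)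
        then show ?thesis using clF[OF F] by (simp add: cl'_def)
      next
        assume xy: "{x, y} \<in> gd m g"
        have e: "cl' (0, l) = cl' (1, l)" if "l \<noteq> k" "l \<noteq> Suc k" for l
          using that by (simp add: cl'_def top_def down_def)
        have "cl' (0, k) = cl' (0, Suc k)" by (simp add: cl'_def top_def)
        moreover have "cl' ?K = cl' ?K'" by (simp add: cl'_def top_def down_def cl_def J_def)
        ultimately show ?thesis using xy[unfolded gdk top_def doubleton_eq_iff] e
          by (elim disjE exE conjE) simp_all
      qed
    qed
    define un where "un = (\<lambda>v::vertex. (2 * fst v, snd v))"
    have sq: "squash (un x) = x" "fst (un x) \<in> {0, 2}" if "x \<in> vertices m" for x
      using that by (cases x; auto simp: un_def squash_def vertices_def)+
    have symC: "(x, y) \<in> ?C\<^sup>* \<Longrightarrow> (y, x) \<in> ?C\<^sup>*" for x y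
      by (rule symD[OF sym_rtrancl, rotated]) (auto simp: sym_def insert_commute)
    have toF: "(un x, lift x) \<in> ?C\<^sup>*" if "x \<in> vertices m" "x \<noteq> (0, k)" "x \<noteq> (0, Suc k)" for x
    proof (cases "fst x = 0")
      case True
      then have "un x = (0, snd x)" "lift x = (1, snd x)" "x = (0, snd x)" "snd x < m"
        using that(1) by (cases x; simp add: un_def lift_def vertices_def)+
      moreover have "snd x \<noteq> k" "snd x \<noteq> Suc k" using that(2,3) \<open>x = (0, snd x)\<close> by auto
      ultimately have "{un x, lift x} \<in> gd m g" unfolding gdk by metis
      then show ?thesis by (simp add: stack r_into_rtrancl)
    next
      case False
      then have "un x = lift x" using that by (cases x) (auto simp: un_def lift_def vertices_def)
      then show ?thesis by simp
    qed
    have unne: "un x \<noteq> un y" if "x \<noteq> y" for x y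
      using that by (cases x; cases y) (auto simp: un_def)
    have KK: "(?K, ?K') \<in> ?C" "(?K', ?K) \<in> ?C" 
    proof -
      have "{?K, ?K'} \<in> gd m g" unfolding gdk by blast
      then show "(?K, ?K') \<in> ?C" "(?K', ?K) \<in> ?C" by (simp_all add: stack insert_commute)
    qed
    show ?thesis
    proof (rule diagram_mult_eqI)
      fix e assume "e \<in> lact g D"
      then consider "e = {(0, k), (0, Suc k)}" | "e \<in> D" "(0, k) \<notin> e" "(0, Suc k) \<notin> e"
        | a b where "e = {a, b}" "{a, (0, k)} \<in> D" "{b, (0, Suc k)} \<in> D" "a \<noteq> (0, Suc k)" "b \<noteq> (0, k)"
        unfolding k lact.simps del_def by blast
      then have "\<exists>u\<in>vertices m. \<exists>v\<in>vertices m. e = {u, v} \<and> u \<noteq> v \<and> (un u, un v) \<in> ?C\<^sup>*"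
      proof cases
        case 1
        have "{un (0, k), un (0, Suc k)} \<in> gd m g" unfolding gdk top_def by (simp add: un_def)
        then have "(un (0, k), un (0, Suc k)) \<in> ?C" by (simp add: stack)
        then show ?thesis using 1 km by (intro bexI[of _ "(0, k)"] bexI[of _ "(0, Suc k)"]) (auto simp: vertices_def)
      next
        case 2
        from partial_matching_cases[OF D 2(1)] obtain u v
          where uv: "e = {u, v}" "u \<noteq> v" "u \<in> vertices m" "v \<in> vertices m" .
        have "{lift u, lift v} \<in> F" using 2 uv F_iff by blast
        then have "(lift u, lift v) \<in> ?C" by (simp add: stack)
        then have "(un u, un v) \<in> ?C\<^sup>*"
        proof -
          have "u \<noteq> (0, k)" "u \<noteq> (0, Suc k)" "v \<noteq> (0, k)" "v \<noteq> (0, Suc k)" using 2 uv(1) by auto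
          then have "(un u, lift u) \<in> ?C\<^sup>*" "(lift v, un v) \<in> ?C\<^sup>*"
            using toF[OF uv(3)] symC[OF toF[OF uv(4)]] by blast+
          then show ?thesis using \<open>(lift u, lift v) \<in> ?C\<close>
            by (meson rtrancl.rtrancl_into_rtrancl rtrancl_trans)
        qed
        then show ?thesis using uv by blast
      next
        case (3 a b)
        note Va = partial_matchingD[OF D 3(2)] and Vb = partial_matchingD[OF D 3(3)]
        have l: "lift (0, k) = ?K" "lift (0, Suc k) = ?K'" by (auto simp: lift_def)
        have "{lift a, lift (0, k)} \<in> F" "{lift b, lift (0, Suc k)} \<in> F" using 3 F_iff by blast+
        then have "(lift a, ?K) \<in> ?C" "(?K', lift b) \<in> ?C"
          unfolding l by (simp_all add: stack insert_commute)
        moreover have "(un a, lift a) \<in> ?C\<^sup>*" using toF Va 3 by blast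
        moreover have "(lift b, un b) \<in> ?C\<^sup>*" using symC[OF toF] Vb 3 by blast
        ultimately have "(un a, un b) \<in> ?C\<^sup>*" using KK(1)
          by (meson rtrancl.rtrancl_into_rtrancl rtrancl_trans)
        moreover have "a \<noteq> b" using 3 partial_matching_unique[OF D, of a "(0, k)" "(0, Suc k)"] by auto
        ultimately show ?thesis using 3 Va Vb by blast
      qed
      then show "\<exists>u v. e = {squash u, squash v} \<and> fst u \<in> {0, 2} \<and> fst v \<in> {0, 2} \<and> u \<noteq> v \<and> (u, v) \<in> ?C\<^sup>*"
        using sq unne by metis
    next
      fix u v assume uv: "(u, v) \<in> ?C\<^sup>*" "fst u \<in> {0, 2}" "fst v \<in> {0, 2}" "u \<noteq> v"
      have eq: "cl' u = cl' v" by (rule rtrancl_const[OF uv(1) const])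
      have dl: "down x = lift (squash x)" if "fst x \<in> {0, 2}" for x
        using that by (cases x) (auto simp: down_def lift_def squash_def)
      have dne: "down u \<noteq> down v" using uv(2-4) by (auto simp: down_def prod_eq_iff split: if_splits)
      have self: "x \<in> cl x" for x by (auto simp: cl_def)
      have tcl: "top \<noteq> cl (down x)" for x
      proof
        assume t: "top = cl (down x)"
        have "down x \<in> top" unfolding t by (rule self)
        then have "fst (down x) = 0" unfolding top_def by auto
        moreover have "fst (down x) \<noteq> 0" by (simp add: down_def)
        ultimately show False by simp
      qed
      show "{squash u, squash v} \<in> lact g D"
      proof (cases "u \<in> top")
        case True
        then have "v \<in> top" using eq tcl by (metis cl'_def)
        then have "{squash u, squash v} = {(0, k), (0, Suc k)}"
          using True uv(4) unfolding top_def by (auto simp: squash_def)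
        then show ?thesis unfolding k lact.simps by blast
      next
        case False
        then have vt: "v \<notin> top" using eq tcl by (metis cl'_def)
        then have clq: "cl (down u) = cl (down v)" using eq False by (simp add: cl'_def)
        have nK: "down x \<noteq> ?K" "down x \<noteq> ?K'" if "x \<notin> top" "fst x \<in> {0, 2}" for x
          using that by (cases x; auto simp: down_def top_def)+
        have st: "squash x \<noteq> (0, k)" "squash x \<noteq> (0, Suc k)" if "x \<notin> top" "fst x \<in> {0, 2}" for x
          using that by (cases x; auto simp: squash_def top_def)+
        let ?u = "squash u" and ?v = "squash v"
        have Fl: "{lift a, lift b} \<in> F \<longleftrightarrow> {a, b} \<in> D" for a b
          unfolding F_iff lift_inj by blast
        have lK: "{x, (0, k)} \<in> D \<longleftrightarrow> {lift x, ?K} \<in> F" "{x, (0, Suc k)} \<in> D \<longleftrightarrow> {lift x, ?K'} \<in> F" for x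
        proof -
          have "?K = lift (0, k)" "?K' = lift (0, Suc k)" by (auto simp: lift_def)
          then show "{x, (0, k)} \<in> D \<longleftrightarrow> {lift x, ?K} \<in> F" "{x, (0, Suc k)} \<in> D \<longleftrightarrow> {lift x, ?K'} \<in> F"
            by (simp_all only: Fl)
        qed
        show ?thesis
        proof (cases "down u \<in> J")
          case True
          then have "down v \<in> J" using clq self[of "down v"] by (auto simp: cl_def)
          then have "({down u, ?K} \<in> F \<or> {down u, ?K'} \<in> F) \<and> ({down v, ?K} \<in> F \<or> {down v, ?K'} \<in> F)"
            using True nK[OF False uv(2)] nK[OF vt uv(3)] unfolding J_def by blast
          moreover have "\<not> ({down u, ?K} \<in> F \<and> {down v, ?K} \<in> F)" "\<not> ({down u, ?K'} \<in> F \<and> {down v, ?K'} \<in> F)"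
          proof -
            have "{x, y} \<in> F \<Longrightarrow> {y, x} \<in> F" for x y by (simp add: insert_commute)
            then show "\<not> ({down u, ?K} \<in> F \<and> {down v, ?K} \<in> F)"
                "\<not> ({down u, ?K'} \<in> F \<and> {down v, ?K'} \<in> F)"
              using F_uniq[of ?K "down u" "down v"] F_uniq[of ?K' "down u" "down v"] dne by blast+
          qed
          ultimately have "({?u, (0, k)} \<in> D \<and> {?v, (0, Suc k)} \<in> D) \<or> ({?v, (0, k)} \<in> D \<and> {?u, (0, Suc k)} \<in> D)"
            unfolding lK dl[OF uv(2), symmetric] dl[OF uv(3), symmetric] by blast
          moreover have "?u \<noteq> (0, Suc k)" "?v \<noteq> (0, Suc k)" "?u \<noteq> (0, k)" "?v \<noteq> (0, k)"
            using st False vt uv by blast+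
          moreover have "{?u, ?v} = {?v, ?u}" by (rule insert_commute)
          ultimately show ?thesis unfolding k lact.simps by blast
        next
          case F: False
          then have "down v \<notin> J" using clq self[of "down u"] by (auto simp: cl_def split: if_splits)
          have "down v \<in> cl (down u)" unfolding clq by (rule self)
          then have "{down u, down v} \<in> F" using F dne by (simp add: cl_def)
          then have "{?u, ?v} \<in> D" using dl[OF uv(2)] dl[OF uv(3)] by (simp only: Fl)
          moreover have "?u \<noteq> (0, Suc k)" "?v \<noteq> (0, Suc k)" "?u \<noteq> (0, k)" "?v \<noteq> (0, k)"
            using st False vt uv by blast+
          ultimately show ?thesis unfolding k lact.simps del_def by simp
        qed
      qed
    qed
  qed
qed

lemma partial_matching_disjoint:
  assumes "partial_matching m D" "e \<in> D" "e' \<in> D" "v \<in> e" "v \<in> e'"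
  shows "e = e'"
proof (rule ccontr)
  assume ne: "e \<noteq> e'"
  have "\<forall>e\<in>D. \<forall>e'\<in>D. e \<noteq> e' \<longrightarrow> e \<inter> e' = {}"
    using assms(1) unfolding partial_matching_def by (rule conjunct2)
  from this[rule_format, OF assms(2,3) ne] show False using assms(4,5) by blast
qed

section \<open>Planarity is preserved by the generators\<close>

definition mo :: "nat \<Rightarrow> diagram set" where
  "mo m = {D. partial_matching m D \<and> crossingless m D}"

lemma mo_pm: "D \<in> mo m \<Longrightarrow> partial_matching m D"
  by (simp add: mo_def)

lemma bp_simps [simp]: "boundary_pos m (0, k) = k" "boundary_pos m (Suc l, k) = 2 * m - 1 - k"
  by (auto simp: boundary_pos_def)

lemma bp_inj: "u \<in> vertices m \<Longrightarrow> v \<in> vertices m \<Longrightarrow> boundary_pos m u = boundary_pos m v \<longleftrightarrow> u = v"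
  by (cases u; cases v) (auto simp: vertices_def boundary_pos_def)

lemma crossingless_iff:
  "crossingless m D \<longleftrightarrow> (\<forall>a b c d. {a, b} \<in> D \<longrightarrow> {c, d} \<in> D \<longrightarrow>
     \<not> (boundary_pos m a < boundary_pos m c \<and> boundary_pos m c < boundary_pos m b
       \<and> boundary_pos m b < boundary_pos m d))"
  unfolding crossingless_def by blast

lemma mo_crossD:
  assumes "D \<in> mo m" "{a, b} \<in> D" "{c, d} \<in> D"
  shows "\<not> (boundary_pos m a < boundary_pos m c \<and> boundary_pos m c < boundary_pos m b
       \<and> boundary_pos m b < boundary_pos m d)"
  using assms unfolding mo_def crossingless_iff by blast

lemma mo_subset:
  assumes "D \<in> mo m" "E \<subseteq> D"
  shows "E \<in> mo m"
proof -
  have "partial_matching m E" using mo_pm[OF assms(1)] assms(2) unfolding partial_matching_def by blast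
  moreover have "crossingless m E" using assms unfolding mo_def crossingless_def by blast
  ultimately show ?thesis by (simp add: mo_def)
qed

lemma del_subset: "del v D \<subseteq> D"
  by (auto simp: del_def)

lemma swv_swv [simp]: "swv k (swv k v) = v"
  by (auto simp: swv_def)

lemma swv_inj: "inj (swv k)"
  by (metis injI swv_swv)

lemma swv_vertices: "Suc k < m \<Longrightarrow> swv k v \<in> vertices m \<longleftrightarrow> v \<in> vertices m"
  by (auto simp: swv_def vertices_def)

text \<open>Exchanging two neighbouring places does not change the order of the others relative to
  them; with one of the two places vacant, no comparison between them arises.\<close>

lemma swv_mono:
  assumes "Suc k < m" "v = (0, k) \<or> v = (0, Suc k)" "x \<noteq> v" "y \<noteq> v" "x \<in> vertices m" "y \<in> vertices m"
  shows "boundary_pos m (swv k x) < boundary_pos m (swv k y) \<longleftrightarrow> boundary_pos m x < boundary_pos m y"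
proof -
  let ?p = "boundary_pos m"
  have px: "?p (swv k z) = (if z = (0, k) then Suc k else if z = (0, Suc k) then k else ?p z)" for z
    by (simp add: swv_def)
  have KV: "(0, k) \<in> vertices m" "(0, Suc k) \<in> vertices m" using assms(1) by (simp_all add: vertices_def)
  have ne: "?p z < k \<or> Suc k < ?p z" if "z \<noteq> (0, k)" "z \<noteq> (0, Suc k)" "z \<in> vertices m" for z
  proof -
    have "?p z \<noteq> k" "?p z \<noteq> Suc k"
      using bp_inj[OF that(3) KV(1)] bp_inj[OF that(3) KV(2)] that(1,2) by simp_all
    then show ?thesis by linarith
  qed
  consider "x = (0, k)" | "x = (0, Suc k)" | "x \<noteq> (0, k)" "x \<noteq> (0, Suc k)" by blast
  note cx = this
  consider "y = (0, k)" | "y = (0, Suc k)" | "y \<noteq> (0, k)" "y \<noteq> (0, Suc k)" by blast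
  then show ?thesis
  proof cases
    case 1 show ?thesis using cx
    proof cases
      case 3 then show ?thesis using \<open>y = (0, k)\<close> ne[of x] assms by (simp add: px; linarith)
    qed (use \<open>y = (0, k)\<close> assms in \<open>auto simp: px\<close>)
  next
    case 2 show ?thesis using cx
    proof cases
      case 3 then show ?thesis using \<open>y = (0, Suc k)\<close> ne[of x] assms by (simp add: px; linarith)
    qed (use \<open>y = (0, Suc k)\<close> assms in \<open>auto simp: px\<close>)
  next
    case y: 3 show ?thesis using cx
    proof cases
      case 3 then show ?thesis using y by (simp add: px)
    next
      case 1 then show ?thesis using y ne[of y] assms by (simp add: px; linarith)
    next
      case 2 then show ?thesis using y ne[of y] assms by (simp add: px; linarith)
    qed
  qed
qed

lemma swap_mo:
  assumes "D \<in> mo m" "Suc k < m" "v = (0, k) \<or> v = (0, Suc k)" "v \<notin> \<Union> D"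
  shows "(`) (swv k) ` D \<in> mo m"
proof -
  note D = mo_pm[OF assms(1)]
  have pm: "partial_matching m ((`) (swv k) ` D)"
  proof (rule partial_matchingI)
    fix e assume "e \<in> (`) (swv k) ` D"
    then obtain e' where e': "e' \<in> D" "e = swv k ` e'" by blast
    from partial_matching_cases[OF D e'(1)] obtain u w
      where uw: "e' = {u, w}" "u \<noteq> w" "u \<in> vertices m" "w \<in> vertices m" .
    have "e = {swv k u, swv k w}" using e' uw by simp
    moreover have "swv k u \<noteq> swv k w" using uw(2) by (metis swv_swv)
    ultimately show "\<exists>u v. e = {u, v} \<and> u \<noteq> v \<and> u \<in> vertices m \<and> v \<in> vertices m"
      using uw swv_vertices[OF assms(2)] by blast
  next
    fix u w w' assume "{u, w} \<in> (`) (swv k) ` D" "{u, w'} \<in> (`) (swv k) ` D"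
    then show "w = w'" using partial_matching_unique[OF D] by (metis image_swv_doubleton swv_swv)
  qed
  have *: "swv k u \<noteq> v \<and> swv k u \<in> vertices m" if "{u, w} \<in> (`) (swv k) ` D \<or> {w, u} \<in> (`) (swv k) ` D" for u w
  proof -
    have "{swv k u, swv k w} \<in> D" using that by (simp add: image_swv_doubleton insert_commute)
    then show ?thesis using assms(4) partial_matchingD[OF D] by blast
  qed
  have ord: "boundary_pos m (swv k u) < boundary_pos m (swv k w) \<longleftrightarrow> boundary_pos m u < boundary_pos m w"
    if "swv k u \<noteq> v" "swv k w \<noteq> v" "swv k u \<in> vertices m" "swv k w \<in> vertices m" for u w
    using swv_mono[OF assms(2,3) that] by simp
  have "crossingless m ((`) (swv k) ` D)"
    unfolding crossingless_iff
  proof (intro allI impI)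
    fix a b c d assume e: "{a, b} \<in> (`) (swv k) ` D" "{c, d} \<in> (`) (swv k) ` D"
    then have "{swv k a, swv k b} \<in> D" "{swv k c, swv k d} \<in> D" by (simp_all add: image_swv_doubleton)
    from mo_crossD[OF assms(1) this]
    show "\<not> (boundary_pos m a < boundary_pos m c \<and> boundary_pos m c < boundary_pos m b
       \<and> boundary_pos m b < boundary_pos m d)"
      using ord *[of a b] *[of b a] *[of c d] *[of d c] e by blast
  qed
  then show ?thesis using pm by (simp add: mo_def)
qed

lemma hook_iff:
  assumes D: "partial_matching m D"
  shows "{u, v} \<in> lact (Hook k) D \<longleftrightarrow> {u, v} = {(0, k), (0, Suc k)} \<or>
    (u \<noteq> (0, k) \<and> u \<noteq> (0, Suc k) \<and> v \<noteq> (0, k) \<and> v \<noteq> (0, Suc k) \<and>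
      ({u, v} \<in> D \<or> {u, (0, k)} \<in> D \<and> {v, (0, Suc k)} \<in> D \<or> {v, (0, k)} \<in> D \<and> {u, (0, Suc k)} \<in> D))"
proof -
  have n: "a \<noteq> (0, k)" if "{a, (0, k)} \<in> D" for a using partial_matchingD(1)[OF D that] .
  have n': "a \<noteq> (0, Suc k)" if "{a, (0, Suc k)} \<in> D" for a using partial_matchingD(1)[OF D that] .
  have "{u, v} \<in> {{a, b} | a b. {a, (0, k)} \<in> D \<and> {b, (0, Suc k)} \<in> D \<and> a \<noteq> (0, Suc k) \<and> b \<noteq> (0, k)}
    \<longleftrightarrow> (u \<noteq> (0, k) \<and> u \<noteq> (0, Suc k) \<and> v \<noteq> (0, k) \<and> v \<noteq> (0, Suc k) \<and>
      ({u, (0, k)} \<in> D \<and> {v, (0, Suc k)} \<in> D \<or> {v, (0, k)} \<in> D \<and> {u, (0, Suc k)} \<in> D))"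
    using n n' by (simp add: doubleton_eq_iff del: split_paired_Ex) blast
  then show ?thesis by (simp add: del_def del: split_paired_Ex) blast
qed

text \<open>The only block that is not simple to trace joins the former partners of \<open>k\<close>
  and \<open>Suc k\<close>. No place lies between these two, so a block crossing it would have
  crossed one of the two old blocks.\<close>

lemma hook_mo:
  assumes "D \<in> mo m" "Suc k < m"
  shows "lact (Hook k) D \<in> mo m"
proof -
  note D = mo_pm[OF assms(1)]
  let ?K = "(0, k) :: vertex" and ?K' = "(0, Suc k) :: vertex"
  note iff = hook_iff[OF D, of _ _ k]
  have dbl: "\<exists>u v. e = {u, v}" if "e \<in> D" for e
    using partial_matching_cases[OF D that] by blast
  have KV: "?K \<in> vertices m" "?K' \<in> vertices m" using assms(2) by (auto simp: vertices_def)
  note uq = partial_matching_unique[OF D] and dd = partial_matchingD[OF D]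
  have uv: "u \<noteq> v \<and> u \<in> vertices m \<and> v \<in> vertices m" if "{u, v} \<in> lact (Hook k) D" for u v
    using that[unfolded iff]
  proof (elim disjE conjE)
    assume "{u, v} = {?K, ?K'}" then show ?thesis using KV by (auto simp: doubleton_eq_iff)
  next
    assume "{u, v} \<in> D" then show ?thesis using dd by blast
  next
    assume *: "{u, ?K} \<in> D" "{v, ?K'} \<in> D"
    have "u \<noteq> v" using uq[of u ?K ?K'] * by auto
    then show ?thesis using * dd by blast
  next
    assume *: "{v, ?K} \<in> D" "{u, ?K'} \<in> D"
    have "u \<noteq> v" using uq[of u ?K ?K'] * by auto
    then show ?thesis using * dd by blast
  qed
  have pm: "partial_matching m (lact (Hook k) D)"
  proof (rule partial_matchingI)
    fix e assume e: "e \<in> lact (Hook k) D"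
    from lact_doubletons[OF dbl e] obtain u v where "e = {u, v}" by blast
    then show "\<exists>u v. e = {u, v} \<and> u \<noteq> v \<and> u \<in> vertices m \<and> v \<in> vertices m" using uv e by blast
  next
    fix u v w assume 1: "{u, v} \<in> lact (Hook k) D" "{u, w} \<in> lact (Hook k) D"
    have sw: "{x, y} \<in> D \<Longrightarrow> {y, x} \<in> D" for x y by (simp add: insert_commute)
    show "v = w"
    proof (cases "u = ?K \<or> u = ?K'")
      case True
      then show ?thesis using 1[unfolded iff] by (auto simp: doubleton_eq_iff)
    next
      case False
      have v: "v \<noteq> ?K" "v \<noteq> ?K'" "w \<noteq> ?K" "w \<noteq> ?K'"
        using 1[unfolded iff] False by (auto simp: doubleton_eq_iff)
      have c: "{u, x} \<in> D \<or> {u, ?K} \<in> D \<and> {x, ?K'} \<in> D \<or> {x, ?K} \<in> D \<and> {u, ?K'} \<in> D"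
        if "{u, x} \<in> lact (Hook k) D" for x
        using that[unfolded iff] False by (auto simp: doubleton_eq_iff)
      have KK: "?K \<noteq> ?K'" by simp
      have h: "\<not> ({u, ?K} \<in> D \<and> {u, ?K'} \<in> D)" using uq[of u ?K ?K'] KK by blast
      have h1: "\<not> ({u, x} \<in> D \<and> {u, y} \<in> D)" if "x \<noteq> y" for x y using uq[of u x y] that by blast
      have h2: "x = y" if "{x, z} \<in> D" "{y, z} \<in> D" for x y z using uq[OF sw[OF that(1)] sw[OF that(2)]] .
      from c[OF 1(1)] show ?thesis
      proof (elim disjE conjE)
        assume uv: "{u, v} \<in> D"
        then have "{u, w} \<in> D" using c[OF 1(2)] h1[of v ?K] h1[of v ?K'] v by argo
        then show ?thesis using uq uv by blast
      next
        assume uv: "{u, ?K} \<in> D" "{v, ?K'} \<in> D"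
        then have "{w, ?K'} \<in> D" using c[OF 1(2)] h1[of w ?K] h v by argo
        then show ?thesis using h2 uv by blast
      next
        assume uv: "{v, ?K} \<in> D" "{u, ?K'} \<in> D"
        then have "{w, ?K} \<in> D" using c[OF 1(2)] h1[of w ?K'] h v by argo
        then show ?thesis using h2 uv by blast
      qed
    qed
  qed
  have cross: "\<not> (boundary_pos m a < boundary_pos m c \<and> boundary_pos m c < boundary_pos m b
       \<and> boundary_pos m b < boundary_pos m d)"
    if ab: "{a, b} \<in> lact (Hook k) D" and cd: "{c, d} \<in> lact (Hook k) D" for a b c d
  proof
    let ?p = "boundary_pos m"
    assume x: "?p a < ?p c \<and> ?p c < ?p b \<and> ?p b < ?p d"
    have inj: "?p x = ?p y \<longleftrightarrow> x = y" if "x \<in> vertices m" "y \<in> vertices m" for x y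
      by (rule bp_inj[OF that])
    note V = uv[OF ab] uv[OF cd]
    have pK: "?p ?K' = Suc (?p ?K)" by simp
    have sw: "{x, y} \<in> D \<Longrightarrow> {y, x} \<in> D" for x y by (simp add: insert_commute)
    have "{a, b} \<noteq> {?K, ?K'}" using x pK by (auto simp: doubleton_eq_iff)
    moreover have "{c, d} \<noteq> {?K, ?K'}" using x pK by (auto simp: doubleton_eq_iff)
    ultimately have A: "{a, b} \<in> D \<or> {a, ?K} \<in> D \<and> {b, ?K'} \<in> D \<or> {b, ?K} \<in> D \<and> {a, ?K'} \<in> D"
      and C: "{c, d} \<in> D \<or> {c, ?K} \<in> D \<and> {d, ?K'} \<in> D \<or> {d, ?K} \<in> D \<and> {c, ?K'} \<in> D"
      and ne: "a \<noteq> ?K" "a \<noteq> ?K'" "b \<noteq> ?K" "b \<noteq> ?K'" "c \<noteq> ?K" "c \<noteq> ?K'" "d \<noteq> ?K" "d \<noteq> ?K'"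
      using ab cd iff[of a b] iff[of c d] by simp_all
    have pne: "?p x \<noteq> ?p ?K \<and> ?p x \<noteq> ?p ?K'" if "x \<in> {a, b, c, d}" for x
    proof -
      have "x \<in> vertices m" "x \<noteq> ?K" "x \<noteq> ?K'" using that V ne by blast+
      then show ?thesis using inj[OF _ KV(1)] inj[OF _ KV(2)] by blast
    qed
    have nc: "\<not> (?p x < ?p z \<and> ?p z < ?p y \<and> ?p y < ?p w)" "\<not> (?p y < ?p z \<and> ?p z < ?p x \<and> ?p x < ?p w)"
      "\<not> (?p x < ?p w \<and> ?p w < ?p y \<and> ?p y < ?p z)" "\<not> (?p y < ?p w \<and> ?p w < ?p x \<and> ?p x < ?p z)"
      if xy: "{x, y} \<in> D" and zw: "{z, w} \<in> D" for x y z w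
      by (rule mo_crossD[OF assms(1) xy zw], rule mo_crossD[OF assms(1) sw[OF xy] zw],
          rule mo_crossD[OF assms(1) xy sw[OF zw]], rule mo_crossD[OF assms(1) sw[OF xy] sw[OF zw]])
    \<comment> \<open>If the ends \<open>z\<close>, \<open>w\<close> interlace with the new pair
      \<open>x\<close>, \<open>y\<close>, then they interlace with \<open>x\<close>,
      \<open>k\<close> or with \<open>y\<close>, \<open>Suc k\<close>, according to the side of the
      hook on which \<open>z\<close> and \<open>w\<close> lie.\<close>
    have new: False if n: "{x, ?K} \<in> D" "{y, ?K'} \<in> D" and o: "{z, w} \<in> D"
      and o2: "?p x < ?p z \<and> ?p z < ?p y \<and> ?p y < ?p w \<or> ?p y < ?p z \<and> ?p z < ?p x \<and> ?p x < ?p w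
        \<or> ?p z < ?p x \<and> ?p x < ?p w \<and> ?p w < ?p y \<or> ?p z < ?p y \<and> ?p y < ?p w \<and> ?p w < ?p x"
      and p: "?p z \<noteq> ?p ?K" "?p z \<noteq> ?p ?K'" "?p w \<noteq> ?p ?K" "?p w \<noteq> ?p ?K'" for x y z w
    proof -
      have pK: "?p ?K = k" "?p ?K' = Suc k" by simp_all
      note N = nc[OF n(1) o, unfolded pK] nc[OF o n(1), unfolded pK] nc[OF n(2) o, unfolded pK]
        nc[OF o n(2), unfolded pK]
      have "?p z < ?p w" using o2 by linarith
      then consider "?p z < k" "k < ?p w" "?p z < Suc k" "Suc k < ?p w" | "k < ?p z" "Suc k < ?p z"
        | "?p w < k" "?p w < Suc k"
        using p[unfolded pK] by linarith
      then show False
      proof cases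
        case 1 then show ?thesis using o2 N by (elim disjE conjE) simp_all
      next
        case 2 then show ?thesis using o2 N by (elim disjE conjE) simp_all
      next
        case 3 then show ?thesis using o2 N by (elim disjE conjE) simp_all
      qed
    qed
    from A C show False
    proof (elim disjE conjE)
      assume "{a, b} \<in> D" "{c, d} \<in> D" then show False using nc x by blast
    next
      assume "{a, b} \<in> D" "{c, ?K} \<in> D" "{d, ?K'} \<in> D"
      then show False using new[of c d a b] x pne by blast
    next
      assume "{a, b} \<in> D" "{d, ?K} \<in> D" "{c, ?K'} \<in> D"
      then show False using new[of d c a b] x pne by blast
    next
      assume "{a, ?K} \<in> D" "{b, ?K'} \<in> D" "{c, d} \<in> D"
      then show False using new[of a b c d] x pne by blast
    next
      assume "{b, ?K} \<in> D" "{a, ?K'} \<in> D" "{c, d} \<in> D"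
      then show False using new[of b a c d] x pne by blast
    next
      assume *: "{a, ?K} \<in> D" "{b, ?K'} \<in> D" "{c, ?K} \<in> D" "{d, ?K'} \<in> D"
      then have "a = c" using uq[OF sw[OF *(1)] sw[OF *(3)]] by simp
      then show False using x by auto
    next
      assume *: "{a, ?K} \<in> D" "{b, ?K'} \<in> D" "{d, ?K} \<in> D" "{c, ?K'} \<in> D"
      then have "a = d" using uq[OF sw[OF *(1)] sw[OF *(3)]] by simp
      then show False using x by auto
    next
      assume *: "{b, ?K} \<in> D" "{a, ?K'} \<in> D" "{c, ?K} \<in> D" "{d, ?K'} \<in> D"
      then have "b = c" using uq[OF sw[OF *(1)] sw[OF *(3)]] by simp
      then show False using x by auto
    next
      assume *: "{b, ?K} \<in> D" "{a, ?K'} \<in> D" "{d, ?K} \<in> D" "{c, ?K'} \<in> D"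
      then have "b = d" using uq[OF sw[OF *(1)] sw[OF *(3)]] by simp
      then show False using x by auto
    qed
  qed
  then show ?thesis using pm by (simp add: mo_def crossingless_iff)
qed

lemma lact_mo:
  assumes "D \<in> mo m" "g \<in> gens m"
  shows "lact g D \<in> mo m"
proof (cases g)
  case (Dot k) then show ?thesis using mo_subset[OF assms(1) del_subset] by simp
next
  case (Hook k) then show ?thesis using hook_mo assms by (auto simp: gens_def)
next
  case (Shr k)
  then show ?thesis using swap_mo[OF mo_subset[OF assms(1) del_subset], of k "(0, k)" "(0, k)"] assms(2)
    by (auto simp: gens_def del_def)
next
  case (Shl k)
  then show ?thesis using swap_mo[OF mo_subset[OF assms(1) del_subset], of k "(0, Suc k)" "(0, Suc k)"] assms(2)
    by (auto simp: gens_def del_def)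
qed

lemma lact_list_mo: "D \<in> mo m \<Longrightarrow> set ws \<subseteq> gens m \<Longrightarrow> foldr lact ws D \<in> mo m"
  by (induction ws) (auto intro: lact_mo)

text \<open>\<open>Psi m D\<close> is the matrix of \<open>D\<close> in the model with the bottom line bent up: every block contributes a
  cup on the labels of its ends, read along the boundary, and isolated vertices are labelled \<open>Emp\<close>.\<close>

definition bweight :: "nat \<Rightarrow> vertex set \<Rightarrow> (vertex \<Rightarrow> lab) \<Rightarrow> complex" where
  "bweight m e f = (case SOME p. e = {fst p, snd p} \<and> boundary_pos m (fst p) < boundary_pos m (snd p)
     of (u, v) \<Rightarrow> cup (f u) (f v))"

lemma bweight_eq:
  assumes "boundary_pos m u < boundary_pos m v"
  shows "bweight m {u, v} f = cup (f u) (f v)"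
proof -
  have "(SOME p. {u, v} = {fst p, snd p} \<and> boundary_pos m (fst p) < boundary_pos m (snd p)) = (u, v)"
    by (rule some_equality) (use assms in \<open>auto simp: doubleton_eq_iff\<close>)
  then show ?thesis by (simp add: bweight_def)
qed

definition Psi :: "nat \<Rightarrow> diagram \<Rightarrow> (vertex \<Rightarrow> lab) \<Rightarrow> complex" where
  "Psi m D f = (if \<forall>v\<in>vertices m. v \<notin> \<Union> D \<longrightarrow> f v = Emp then \<Prod>e\<in>D. bweight m e f else 0)"

section \<open>Products with generators in the model\<close>

lemma bweight_cong:
  assumes "\<And>x. x \<in> e \<Longrightarrow> f x = g x" "e = {u, v}" "u \<in> vertices m" "v \<in> vertices m" "u \<noteq> v"
  shows "bweight m e f = bweight m e g"
proof (cases "boundary_pos m u < boundary_pos m v")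
  case True then show ?thesis using assms by (simp add: bweight_eq)
next
  case False
  then have "boundary_pos m v < boundary_pos m u" using bp_inj assms by (metis linorder_neqE_nat)
  moreover have "e = {v, u}" using assms(2) by (simp add: insert_commute)
  ultimately show ?thesis using assms(1) by (simp add: bweight_eq)
qed

text \<open>A cup with one end labelled \<open>Emp\<close> has value 1 if the other end is
  \<open>Emp\<close> and 0 otherwise, which is the very condition imposed on isolated
  vertices.\<close>

lemma Psi_del:
  assumes D: "partial_matching m D" and v: "v \<in> vertices m"
  shows "Psi m (del v D) f = (if f v = Emp then Psi m D f else 0)"
proof (cases "v \<in> \<Union> D")
  case False
  then have "del v D = D" by (auto simp: del_def)
  then show ?thesis using False v by (auto simp: Psi_def)
next
  case True
  then obtain e where e: "e \<in> D" "v \<in> e" by blast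
  obtain a where a: "e = {v, a}" "a \<noteq> v" "a \<in> vertices m"
  proof -
    from partial_matching_cases[OF D e(1)] obtain p q
      where pq: "e = {p, q}" "p \<noteq> q" "p \<in> vertices m" "q \<in> vertices m" .
    then have "v = p \<or> v = q" using e(2) by blast
    then show thesis using that[of p] that[of q] pq by (auto simp: insert_commute)
  qed
  let ?R = "del v D"
  have DR: "D = insert {v, a} ?R"
  proof -
    have "e' = {v, a}" if "e' \<in> D" "v \<in> e'" for e'
      using partial_matching_disjoint[OF D that(1) e(1) that(2) e(2)] a(1) by simp
    then have "D \<subseteq> insert {v, a} ?R" unfolding del_def by blast
    moreover have "insert {v, a} ?R \<subseteq> D" using e(1) a(1) del_subset by blast
    ultimately show ?thesis by (rule subset_antisym)
  qed
  have aR: "a \<notin> \<Union> ?R"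
  proof
    assume "a \<in> \<Union> ?R"
    then obtain e' where e': "e' \<in> D" "v \<notin> e'" "a \<in> e'" by (auto simp: del_def)
    have "a \<in> e" using a(1) by simp
    then show False using partial_matching_disjoint[OF D e'(1) e(1) e'(3)] e'(2) e(2) by blast
  qed
  have vR: "v \<notin> \<Union> ?R" by (auto simp: del_def)
  have fin: "finite ?R" using finite_partial_matching[OF D] DR by (metis finite_insert)
  have notin: "{v, a} \<notin> ?R" using vR by blast
  have w: "bweight m {v, a} f = (if f a = Emp then 1 else 0)" if "f v = Emp"
  proof (cases "boundary_pos m v < boundary_pos m a")
    case True then show ?thesis using that by (cases "f a") (simp_all add: bweight_eq)
  next
    case False
    then have "boundary_pos m a < boundary_pos m v" using bp_inj[OF v a(3)] a(2) by simp
    then show ?thesis using that by (cases "f a") (simp_all add: insert_commute bweight_eq)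
  qed
  show ?thesis
  proof (cases "f v = Emp")
    case True
    have 1: "(\<forall>x\<in>vertices m. x \<notin> \<Union> ?R \<longrightarrow> f x = Emp) \<longleftrightarrow>
        (\<forall>x\<in>vertices m. x \<notin> \<Union> D \<longrightarrow> f x = Emp) \<and> f a = Emp"
      using True aR a(3) by (subst (2) DR) auto
    have "Psi m D f = (if \<forall>x\<in>vertices m. x \<notin> \<Union> D \<longrightarrow> f x = Emp
        then bweight m {v, a} f * (\<Prod>e\<in>?R. bweight m e f) else 0)"
      unfolding Psi_def by (subst (2) DR, subst prod.insert[OF fin notin]) simp
    then show ?thesis using True w[OF True] unfolding Psi_def[of m ?R] 1
      by (cases "\<forall>x\<in>vertices m. x \<notin> \<Union> D \<longrightarrow> f x = Emp"; cases "f a = Emp") (simp_all only: simp_thms if_True if_False mult_1 mult_zero_left if_cancel)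
  next
    case False
    then show ?thesis using vR v by (auto simp: Psi_def)
  qed
qed

lemma Psi_swap:
  assumes D: "partial_matching m D" and k: "Suc k < m" "v = (0, k) \<or> v = (0, Suc k)" "v \<notin> \<Union> D"
  shows "Psi m ((`) (swv k) ` D) f = Psi m D (f \<circ> swv k)"
proof -
  have inj: "inj_on ((`) (swv k)) D" using swv_inj by (metis inj_on_subset inj_image_eq_iff inj_onI subset_UNIV)
  have w: "bweight m (swv k ` e) f = bweight m e (f \<circ> swv k)" if e: "e \<in> D" for e
  proof -
    from partial_matching_cases[OF D e] obtain a b where
      ab: "e = {a, b}" "a \<noteq> b" "a \<in> vertices m" "b \<in> vertices m" .
    have *: "bweight m (swv k ` {x, y}) f = bweight m {x, y} (f \<circ> swv k)"
      if "boundary_pos m x < boundary_pos m y" "{x, y} = e" for x y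
    proof -
      have xy: "x \<in> e" "y \<in> e" using that(2) by auto
      have "x \<noteq> v" "y \<noteq> v" using xy e k(3) by blast+
      moreover have "x \<in> vertices m" "y \<in> vertices m" using xy ab by auto
      ultimately have "boundary_pos m (swv k x) < boundary_pos m (swv k y)"
        using swv_mono[OF k(1,2)] that(1) by blast
      then show ?thesis using that(1) by (simp add: bweight_eq)
    qed
    show ?thesis
    proof (cases "boundary_pos m a < boundary_pos m b")
      case True then show ?thesis using *[of a b] ab by simp
    next
      case False
      then have "boundary_pos m b < boundary_pos m a" using bp_inj[OF ab(3,4)] ab(2) by simp
      then show ?thesis using *[of b a] ab by (simp add: insert_commute)
    qed
  qed
  have un: "x \<in> \<Union> ((`) (swv k) ` D) \<longleftrightarrow> swv k x \<in> \<Union> D" for x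
  proof
    assume "x \<in> \<Union> ((`) (swv k) ` D)" then show "swv k x \<in> \<Union> D" by auto
  next
    assume "swv k x \<in> \<Union> D"
    then obtain e where "e \<in> D" "swv k x \<in> e" by blast
    then have "x \<in> swv k ` e" by (metis image_eqI swv_swv)
    then show "x \<in> \<Union> ((`) (swv k) ` D)" using \<open>e \<in> D\<close> by blast
  qed
  have "(\<forall>x\<in>vertices m. swv k x \<notin> \<Union> D \<longrightarrow> f x = Emp) \<longleftrightarrow> (\<forall>x\<in>vertices m. x \<notin> \<Union> D \<longrightarrow> (f \<circ> swv k) x = Emp)"
    using swv_vertices[OF k(1)] by (metis comp_apply swv_swv)
  moreover have "(\<Prod>e\<in>(`) (swv k) ` D. bweight m e f) = (\<Prod>e\<in>D. bweight m e (f \<circ> swv k))"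
    by (simp add: prod.reindex[OF inj] w)
  ultimately show ?thesis
    unfolding Psi_def un by (simp only:)
qed

text \<open>Localisation: a change of blocks inside the vertex set \<open>Y\<close> affects only the
  first factor.\<close>

lemma Psi_blocks:
  assumes "finite R" "finite B" "R \<inter> B = {}" "Y \<subseteq> vertices m" "Y \<inter> \<Union> R = {}" "\<Union> B \<subseteq> Y"
  shows "Psi m (R \<union> B) f = (if \<forall>v\<in>Y - \<Union> B. f v = Emp then \<Prod>e\<in>B. bweight m e f else 0) *
     (if \<forall>v\<in>vertices m - Y. v \<notin> \<Union> R \<longrightarrow> f v = Emp then \<Prod>e\<in>R. bweight m e f else 0)"
proof -
  have eq: "(\<forall>v\<in>vertices m. v \<notin> \<Union> (R \<union> B) \<longrightarrow> f v = Emp) \<longleftrightarrow>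
     (\<forall>v\<in>Y - \<Union> B. f v = Emp) \<and> (\<forall>v\<in>vertices m - Y. v \<notin> \<Union> R \<longrightarrow> f v = Emp)"
    unfolding Union_Un_distrib using assms(4-6) by blast
  have aux: "(if P \<and> Q then q * p else 0) = (if P then p else 0) * (if Q then q else 0)"
    for P Q and p q :: complex by simp
  show ?thesis unfolding Psi_def prod.union_disjoint[OF assms(1-3)] eq by (rule aux)
qed

text \<open>The cap of the model is applied to the labels at \<open>KK\<close> and
  \<open>KK'\<close>, with one case for each way in which \<open>D\<close> can connect these two
  vertices. The case of two different partners contains the zigzag relations.\<close>

lemma Psi_hook:
  assumes Dm: "D \<in> mo m" and km: "Suc k < m"
  defines "KK \<equiv> (0, k) :: vertex" and "KK' \<equiv> (0, Suc k) :: vertex"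
  shows "Psi m (lact (Hook k) D) f = cup (f KK) (f KK') *
    (Psi m D (f(KK := Emp, KK' := Emp)) - \<i> * Psi m D (f(KK := Up, KK' := Dn))
      + Psi m D (f(KK := Dn, KK' := Up)))"
proof -
  note D = mo_pm[OF Dm]
  define R where "R = del KK (del KK' D)"
  define G where "G = (\<lambda>Y f. if \<forall>v\<in>vertices m - Y. v \<notin> \<Union> R \<longrightarrow> f v = Emp then \<Prod>e\<in>R. bweight m e f else 0)"
  define N where "N = {{a, b} | a b. {a, KK} \<in> D \<and> {b, KK'} \<in> D \<and> a \<noteq> KK' \<and> b \<noteq> KK}"
  have finD: "finite D" by (rule finite_partial_matching[OF D])
  have RD: "R \<subseteq> D" by (auto simp: R_def del_def)
  have finR: "finite R" using finite_subset[OF RD finD] .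
  have KV: "KK \<in> vertices m" "KK' \<in> vertices m" and ne: "KK \<noteq> KK'"
    using km by (auto simp: KK_def KK'_def vertices_def)
  have R_iff: "e \<in> R \<longleftrightarrow> e \<in> D \<and> KK \<notin> e \<and> KK' \<notin> e" for e
    by (auto simp: R_def del_def)
  have lactD: "lact (Hook k) D = R \<union> ({{KK, KK'}} \<union> N)"
    by (simp add: R_def N_def KK_def KK'_def Un_assoc)
  have notR: "a \<notin> \<Union> R" if "{KK, a} \<in> D \<or> {KK', a} \<in> D" for a
  proof
    assume "a \<in> \<Union> R"
    then obtain e where e: "e \<in> D" "KK \<notin> e" "KK' \<notin> e" "a \<in> e" using R_iff by blast
    from that show False
    proof
      assume "{KK, a} \<in> D"
      from partial_matching_disjoint[OF D e(1) this e(4)] show False using e(2) by simp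
    next
      assume "{KK', a} \<in> D"
      from partial_matching_disjoint[OF D e(1) this e(4)] show False using e(3) by simp
    qed
  qed
  have KR: "KK \<notin> \<Union> R" "KK' \<notin> \<Union> R" by (auto simp: R_iff)
  have Gcong: "G Y g = G Y h" if "\<And>v. v \<notin> Y \<Longrightarrow> g v = h v" "Y \<inter> \<Union> R = {}" for Y g h
  proof -
    have "bweight m e g = bweight m e h" if e: "e \<in> R" for e
    proof -
      from partial_matching_cases[OF D subsetD[OF RD e]] obtain u v
        where uv: "e = {u, v}" "u \<noteq> v" "u \<in> vertices m" "v \<in> vertices m" .
      have "x \<notin> Y" if "x \<in> e" for x using that e \<open>Y \<inter> \<Union> R = {}\<close> by blast
      then show ?thesis using \<open>\<And>v. v \<notin> Y \<Longrightarrow> g v = h v\<close> uv by (intro bweight_cong) auto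
    qed
    moreover have "(\<forall>v\<in>vertices m - Y. v \<notin> \<Union> R \<longrightarrow> g v = Emp) \<longleftrightarrow>
        (\<forall>v\<in>vertices m - Y. v \<notin> \<Union> R \<longrightarrow> h v = Emp)"
      using \<open>\<And>v. v \<notin> Y \<Longrightarrow> g v = h v\<close> by auto
    ultimately show ?thesis unfolding G_def by (metis (no_types, lifting) prod.cong)
  qed
  have P: "Psi m (R \<union> B) g = (if \<forall>v\<in>Y - \<Union> B. g v = Emp then \<Prod>e\<in>B. bweight m e g else 0) * G Y g"
    if "finite B" "Y \<subseteq> vertices m" "Y \<inter> \<Union> R = {}" "\<Union> B \<subseteq> Y" "{} \<notin> B" for B Y g
    unfolding G_def
  proof (rule Psi_blocks[OF finR that(1) _ that(2-4)])
    show "R \<inter> B = {}"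
    proof (rule ccontr)
      assume "R \<inter> B \<noteq> {}"
      then obtain e x where "e \<in> R" "e \<in> B" "x \<in> e" using \<open>{} \<notin> B\<close> by (metis Int_iff ex_in_conv)
      then show False using that(3,4) by blast
    qed
  qed
  have bwK: "bweight m {KK, KK'} g = cup (g KK) (g KK')" for g
    by (rule bweight_eq) (simp add: KK_def KK'_def)
  have posK: "boundary_pos m KK = k" "boundary_pos m KK' = Suc k" by (simp_all add: KK_def KK'_def)
  have pos: "boundary_pos m a < k \<or> Suc k < boundary_pos m a" if "a \<in> vertices m" "a \<noteq> KK" "a \<noteq> KK'" for a
    using bp_inj[OF that(1) KV(1)] bp_inj[OF that(1) KV(2)] that(2,3) posK by linarith
  have sw: "{a, b} \<in> D \<longleftrightarrow> {b, a} \<in> D" for a b by (simp add: insert_commute)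
  let ?g = "\<lambda>s t. f(KK := s, KK' := t)"
  have gK: "?g s t KK = s" "?g s t KK' = t" for s t using ne by simp_all
  have go: "?g s t v = f v" if "v \<noteq> KK" "v \<noteq> KK'" for s t v using that by simp
  have eK: "e = {KK, a}" if "e \<in> D" "KK \<in> e" "{KK, a} \<in> D" for e a
    using partial_matching_disjoint[OF D that(1,3,2)] by simp
  have eK': "e = {KK', a}" if "e \<in> D" "KK' \<in> e" "{KK', a} \<in> D" for e a
    using partial_matching_disjoint[OF D that(1,3,2)] by simp
  have exK: "\<exists>a. e = {w, a}" if "e \<in> D" "w \<in> e" for e w
  proof -
    from partial_matching_cases[OF D that(1)] obtain u v where "e = {u, v}" .
    then show ?thesis using that(2) by (auto simp: insert_commute)
  qed
  have DBI: "D = R \<union> B" if B: "B \<subseteq> D" and cov: "\<And>e. e \<in> D \<Longrightarrow> KK \<in> e \<or> KK' \<in> e \<Longrightarrow> e \<in> B" for B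
  proof (rule subset_antisym)
    show "D \<subseteq> R \<union> B" using cov R_iff by blast
  qed (use B RD in blast)
  consider (loop) "{KK, KK'} \<in> D"
    | (none) "KK \<notin> \<Union> D" "KK' \<notin> \<Union> D"
    | (left) a where "{KK, a} \<in> D" "a \<noteq> KK'" "KK' \<notin> \<Union> D"
    | (right) b where "KK \<notin> \<Union> D" "{KK', b} \<in> D" "b \<noteq> KK"
    | (both) a b where "{KK, a} \<in> D" "{KK', b} \<in> D" "a \<noteq> KK'" "b \<noteq> KK"
  proof -
    assume *: "{KK, KK'} \<in> D \<Longrightarrow> thesis" "KK \<notin> \<Union> D \<Longrightarrow> KK' \<notin> \<Union> D \<Longrightarrow> thesis"
     "\<And>a. {KK, a} \<in> D \<Longrightarrow> a \<noteq> KK' \<Longrightarrow> KK' \<notin> \<Union> D \<Longrightarrow> thesis"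
     "\<And>b. KK \<notin> \<Union> D \<Longrightarrow> {KK', b} \<in> D \<Longrightarrow> b \<noteq> KK \<Longrightarrow> thesis"
     "\<And>a b. {KK, a} \<in> D \<Longrightarrow> {KK', b} \<in> D \<Longrightarrow> a \<noteq> KK' \<Longrightarrow> b \<noteq> KK \<Longrightarrow> thesis"
    have 1: "KK \<in> \<Union> D \<Longrightarrow> \<exists>a. {KK, a} \<in> D" using exK by (metis UnionE)
    have 2: "KK' \<in> \<Union> D \<Longrightarrow> \<exists>a. {KK', a} \<in> D" using exK by (metis UnionE)
    show thesis using * 1 2 sw by metis
  qed
  then show ?thesis
  proof cases
    \<comment> \<open>The cap meets the cup of a closed loop, whose value is 1, as the product that
      discards it requires.\<close>
    case loop
    have DB: "D = R \<union> {{KK, KK'}}"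
    proof (rule DBI)
      fix e assume e: "e \<in> D" "KK \<in> e \<or> KK' \<in> e"
      have "{KK', KK} \<in> D" using loop sw by blast
      then have "e = {KK, KK'}" using e eK[OF e(1) _ loop] eK'[OF e(1), of KK] by (metis insert_commute)
      then show "e \<in> {{KK, KK'}}" by simp
    qed (use loop in simp)
    have "a = KK'" if "{a, KK} \<in> D" for a
      using partial_matching_unique[OF D, of KK a KK'] that loop sw by blast
    then have N: "N = {}" unfolding N_def by blast
    have P1: "Psi m (R \<union> {{KK, KK'}}) g = cup (g KK) (g KK') * G {KK, KK'} g" for g
      using P[of "{{KK, KK'}}" "{KK, KK'}" g] KV KR by (simp add: bwK)
    have "G {KK, KK'} (?g s t) = G {KK, KK'} f" for s t using KR by (intro Gcong) auto
    then show ?thesis unfolding lactD N Un_empty_right using P1[of f] P1[of "?g _ _"]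
      by (simp only: DB[symmetric] gK) simp
  next
    case none
    have DB: "D = R \<union> {}" by (rule DBI) (use none in blast)+
    have N: "N = {}" using none unfolding N_def by blast
    have P0: "Psi m D g = (if g KK = Emp \<and> g KK' = Emp then 1 else 0) * G {KK, KK'} g" for g
      using P[of "{}" "{KK, KK'}" g] KV KR DB by simp
    have P1: "Psi m (R \<union> {{KK, KK'}}) g = cup (g KK) (g KK') * G {KK, KK'} g" for g
      using P[of "{{KK, KK'}}" "{KK, KK'}" g] KV KR by (simp add: bwK)
    have "G {KK, KK'} (?g s t) = G {KK, KK'} f" for s t using KR by (intro Gcong) auto
    then show ?thesis unfolding lactD N Un_empty_right P0 P1 gK by simp
  next
    case (left a)
    note a = partial_matchingD[OF D left(1)]
    have DB: "D = R \<union> {{KK, a}}" 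
    proof (rule DBI)
      fix e assume e: "e \<in> D" "KK \<in> e \<or> KK' \<in> e"
      then have "KK \<in> e" using left(3) by blast
      then show "e \<in> {{KK, a}}" using eK[OF e(1) _ left(1)] by simp
    qed (use left in simp)
    have N: "N = {}" using left(3) unfolding N_def by blast
    have aR: "a \<notin> \<Union> R" using notR left by blast
    let ?Y = "{KK, KK', a}"
    have dj: "?Y - {KK, a} = {KK'}" using ne left(2) by auto
    have dj2: "?Y - {KK, KK'} = {a}" using a(1) left(2) by auto
    have P0: "Psi m D g = (if g KK' = Emp then bweight m {KK, a} g else 0) * G ?Y g" for g
      using P[of "{{KK, a}}" ?Y g] KV KR DB a aR dj by simp
    have P1: "Psi m (R \<union> {{KK, KK'}}) g = (if g a = Emp then cup (g KK) (g KK') else 0) * G ?Y g" for g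
      using P[of "{{KK, KK'}}" ?Y g] KV KR a aR dj2 by (simp add: bwK)
    have GG: "G ?Y (?g s t) = G ?Y f" for s t using KR aR by (intro Gcong) auto
    have bw: "bweight m {KK, a} g = (if g a = Emp then 1 else 0)" if "g KK = Emp" for g
    proof (cases "boundary_pos m a < k")
      case True
      then have "bweight m {a, KK} g = cup (g a) (g KK)" by (intro bweight_eq) (simp add: posK)
      then show ?thesis using that by (cases "g a") (simp_all add: insert_commute)
    next
      case False
      then have "bweight m {KK, a} g = cup (g KK) (g a)" using pos[of a] a left by (intro bweight_eq) (simp add: posK)
      then show ?thesis using that by (cases "g a") simp_all
    qed
    show ?thesis unfolding lactD N Un_empty_right P0 P1 gK GG using bw[of "?g Emp Emp"] gK go[of a] a(1) left(2) by simp
  next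
    case (right b)
    note b = partial_matchingD[OF D right(2)]
    have DB: "D = R \<union> {{KK', b}}" 
    proof (rule DBI)
      fix e assume e: "e \<in> D" "KK \<in> e \<or> KK' \<in> e"
      then have "KK' \<in> e" using right(1) by blast
      then show "e \<in> {{KK', b}}" using eK'[OF e(1) _ right(2)] by simp
    qed (use right in simp)
    have N: "N = {}" using right(1) unfolding N_def by blast
    have bR: "b \<notin> \<Union> R" using notR right by blast
    let ?Y = "{KK, KK', b}"
    have dj: "?Y - {KK', b} = {KK}" using ne right(3) by auto
    have dj2: "?Y - {KK, KK'} = {b}" using b(1) right(3) by auto
    have P0: "Psi m D g = (if g KK = Emp then bweight m {KK', b} g else 0) * G ?Y g" for g
      using P[of "{{KK', b}}" ?Y g] KV KR DB b bR dj by simp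
    have P1: "Psi m (R \<union> {{KK, KK'}}) g = (if g b = Emp then cup (g KK) (g KK') else 0) * G ?Y g" for g
      using P[of "{{KK, KK'}}" ?Y g] KV KR b bR dj2 by (simp add: bwK)
    have GG: "G ?Y (?g s t) = G ?Y f" for s t using KR bR by (intro Gcong) auto
    have bw: "bweight m {KK', b} g = (if g b = Emp then 1 else 0)" if "g KK' = Emp" for g
    proof (cases "boundary_pos m b < k")
      case True
      then have "bweight m {b, KK'} g = cup (g b) (g KK')" by (intro bweight_eq) (simp add: posK)
      then show ?thesis using that by (cases "g b") (simp_all add: insert_commute)
    next
      case False
      then have "bweight m {KK', b} g = cup (g KK') (g b)" using pos[of b] b right by (intro bweight_eq) (simp add: posK)
      then show ?thesis using that by (cases "g b") simp_all
    qed
    show ?thesis unfolding lactD N Un_empty_right P0 P1 gK GG using bw[of "?g Emp Emp"] gK go[of b] b(1) right(3) by simp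
  next
    case (both a b)
    note a = partial_matchingD[OF D both(1)] and b = partial_matchingD[OF D both(2)]
    have ab: "a \<noteq> b" using partial_matching_unique[OF D, of a KK KK'] both ne sw by metis
    have DB: "D = R \<union> {{KK, a}, {KK', b}}"
    proof (rule DBI)
      fix e assume e: "e \<in> D" "KK \<in> e \<or> KK' \<in> e"
      then show "e \<in> {{KK, a}, {KK', b}}" using eK[OF e(1) _ both(1)] eK'[OF e(1) _ both(2)] by blast
    qed (use both in simp)
    have "x = a" if "{x, KK} \<in> D" for x using partial_matching_unique[OF D, of KK x a] that both sw by blast
    moreover have "x = b" if "{x, KK'} \<in> D" for x using partial_matching_unique[OF D, of KK' x b] that both sw by blast
    ultimately have N: "N = {{a, b}}" using both sw unfolding N_def by blast
    have abR: "a \<notin> \<Union> R" "b \<notin> \<Union> R" using notR both by blast+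
    let ?Y = "{KK, KK', a, b}"
    have e1: "{KK, a} \<noteq> {KK', b}" using ne both by (auto simp: doubleton_eq_iff)
    have e2: "{KK, KK'} \<noteq> {a, b}" using a both by (auto simp: doubleton_eq_iff)
    have dj: "?Y - \<Union> {{KK, a}, {KK', b}} = {}" "?Y - \<Union> {{KK, KK'}, {a, b}} = {}" by auto
    have YV: "?Y \<subseteq> vertices m" "?Y \<inter> \<Union> R = {}" using KV a b KR abR by auto
    have P0: "Psi m D g = bweight m {KK, a} g * bweight m {KK', b} g * G ?Y g" for g
      using P[of "{{KK, a}, {KK', b}}" ?Y g] YV DB dj e1 by simp
    have P1: "Psi m (R \<union> {{KK, KK'}, {a, b}}) g = cup (g KK) (g KK') * bweight m {a, b} g * G ?Y g" for g
      using P[of "{{KK, KK'}, {a, b}}" ?Y g] YV dj e2 by (simp add: bwK)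
    have GG: "G ?Y (?g s t) = G ?Y f" for s t using YV by (intro Gcong) auto
    have gab: "?g s t a = f a" "?g s t b = f b" for s t using go a b both by auto
    let ?p = "boundary_pos m"
    have pa: "?p a < k \<or> Suc k < ?p a" and pb: "?p b < k \<or> Suc k < ?p b" using pos a b both by auto
    have pab: "?p a \<noteq> ?p b" using bp_inj[OF a(3) b(3)] ab by simp
    \<comment> \<open>Planarity excludes three of the six orders of \<open>a\<close>,
      \<open>b\<close> and the hook. The other three are checked letter by letter in
      \<open>key\<close>.\<close>
    have c1: "\<not> (?p b < k \<and> Suc k < ?p a)"
      using mo_crossD[OF Dm, of b KK' KK a] both sw posK by auto
    have c2: "\<not> (?p a < ?p b \<and> ?p b < k)"
      using mo_crossD[OF Dm, of a KK b KK'] both sw posK by auto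
    have c3: "\<not> (Suc k < ?p a \<and> ?p a < ?p b)"
      using mo_crossD[OF Dm, of KK a KK' b] both sw posK by auto
    have key: "bweight m {a, b} f = bweight m {KK, a} (?g Emp Emp) * bweight m {KK', b} (?g Emp Emp)
        - \<i> * (bweight m {KK, a} (?g Up Dn) * bweight m {KK', b} (?g Up Dn))
        + bweight m {KK, a} (?g Dn Up) * bweight m {KK', b} (?g Dn Up)"
    proof -
      consider "?p a < k" "Suc k < ?p b" | "?p b < ?p a" "?p a < k" | "Suc k < ?p b" "?p b < ?p a"
        using pa pb pab c1 c2 c3 by linarith
      then show ?thesis
      proof cases
        case 1
        have "bweight m {KK, a} g = cup (g a) (g KK)" for g
          using 1 bweight_eq[of m a KK g] posK by (simp add: insert_commute)
        moreover have "bweight m {KK', b} g = cup (g KK') (g b)" for g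
          using 1 bweight_eq[of m KK' b g] posK by simp
        moreover have "bweight m {a, b} f = cup (f a) (f b)" using 1 by (intro bweight_eq) simp
        ultimately show ?thesis unfolding gK gab by (cases "f a"; cases "f b") (simp_all only: gK gab, simp_all)
      next
        case 2
        have "bweight m {KK, a} g = cup (g a) (g KK)" for g
          using 2 bweight_eq[of m a KK g] posK by (simp add: insert_commute)
        moreover have "bweight m {KK', b} g = cup (g b) (g KK')" for g
          using 2 bweight_eq[of m b KK' g] posK by (simp add: insert_commute)
        moreover have "bweight m {a, b} f = cup (f b) (f a)"
          using 2 bweight_eq[of m b a f] by (simp add: insert_commute)
        ultimately show ?thesis by (cases "f a"; cases "f b") (simp_all only: gK gab, simp_all)
      next
        case 3
        have "bweight m {KK, a} g = cup (g KK) (g a)" for g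
          using 3 bweight_eq[of m KK a g] posK by simp
        moreover have "bweight m {KK', b} g = cup (g KK') (g b)" for g
          using 3 bweight_eq[of m KK' b g] posK by simp
        moreover have "bweight m {a, b} f = cup (f b) (f a)"
          using 3 bweight_eq[of m b a f] by (simp add: insert_commute)
        ultimately show ?thesis by (cases "f a"; cases "f b") (simp_all only: gK gab, simp_all)
      qed
    qed
    have "{{KK, KK'}} \<union> {{a, b}} = {{KK, KK'}, {a, b}}" by auto
    then show ?thesis unfolding lactD N P0 GG key using P1[of f] key by (simp add: algebra_simps)
  qed
qed

definition lab_of :: "lab list \<Rightarrow> lab list \<Rightarrow> vertex \<Rightarrow> lab" where
  "lab_of w z v = (if fst v = 0 then w ! snd v else z ! snd v)"

lemma lab_of_update: "k < length w \<Longrightarrow> lab_of (w[k := s]) z = (lab_of w z)((0, k) := s)"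
  by (auto simp: lab_of_def fun_eq_iff nth_list_update)

text \<open>The labels \<open>z\<close> of the bottom line are spectators, so a product with a
  generator on top acts on the labels of the top line alone.\<close>

theorem Psi_op:
  assumes D: "D \<in> mo m" and g: "g \<in> gens m" and w: "length w = m"
  shows "Psi m (lact g D) (lab_of w z) = op g (\<lambda>w. Psi m D (lab_of w z)) w"
proof -
  have sw: "lab_of w z \<circ> swv k = lab_of (w[k := w ! Suc k, Suc k := w ! k]) z" if "Suc k < m" for k
    using that w by (auto simp: lab_of_def fun_eq_iff nth_list_update swv_def)
  note pm = mo_pm[OF D]
  show ?thesis
  proof (cases g)
    case (Dot k)
    then have "k < m" using g by (auto simp: gens_def)
    then show ?thesis using Psi_del[OF pm, of "(0, k)" "lab_of w z"] Dot
      by (simp add: vertices_def lab_of_def[of w z "(0, k)"])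
  next
    case (Hook k)
    then have k: "Suc k < m" using g by (auto simp: gens_def)
    show ?thesis using Psi_hook[OF D k, of "lab_of w z"] k w
      by (simp add: Hook lab_of_update lab_of_def[of w z "(0, k)"] lab_of_def[of w z "(0, Suc k)"])
  next
    case (Shr k)
    then have k: "Suc k < m" using g by (auto simp: gens_def)
    have V: "(0, k) \<in> vertices m" using k by (simp add: vertices_def)
    have "Psi m (lact g D) (lab_of w z) = Psi m (del (0, k) D) (lab_of w z \<circ> swv k)"
      unfolding Shr lact.simps using mo_pm[OF mo_subset[OF D del_subset]] k
      by (intro Psi_swap[of _ _ _ "(0, k)"]) (auto simp: del_def)
    also have "\<dots> = (if w ! Suc k = Emp then Psi m D (lab_of w z \<circ> swv k) else 0)"
      unfolding Psi_del[OF pm V] by (simp add: swv_def lab_of_def)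
    finally show ?thesis unfolding sw[OF k] by (auto simp: Shr)
  next
    case (Shl k)
    then have k: "Suc k < m" using g by (auto simp: gens_def)
    have V: "(0, Suc k) \<in> vertices m" using k by (simp add: vertices_def)
    have "Psi m (lact g D) (lab_of w z) = Psi m (del (0, Suc k) D) (lab_of w z \<circ> swv k)"
      unfolding Shl lact.simps using mo_pm[OF mo_subset[OF D del_subset]] k
      by (intro Psi_swap[of _ _ _ "(0, Suc k)"]) (auto simp: del_def)
    also have "\<dots> = (if w ! k = Emp then Psi m D (lab_of w z \<circ> swv k) else 0)"
      unfolding Psi_del[OF pm V] by (simp add: swv_def lab_of_def)
    finally show ?thesis unfolding sw[OF k] by (auto simp: Shl)
  qed
qed

subsection \<open>Mirror images\<close>

definition flipv :: "vertex \<Rightarrow> vertex" where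
  "flipv v = (if fst v = 0 then (1, snd v) else if fst v = 1 then (0, snd v) else v)"

definition flip :: "diagram \<Rightarrow> diagram" where
  "flip D = (`) flipv ` D"

lemma involution_image_doubleton:
  assumes "\<And>x. h (h x) = x"
  shows "{u, v} \<in> (`) h ` D \<longleftrightarrow> {h u, h v} \<in> D"
proof
  have inv2: "h ` h ` e = e" for e by (simp add: image_image assms)
  show "{h u, h v} \<in> D" if "{u, v} \<in> (`) h ` D"
  proof -
    obtain e where e: "e \<in> D" "{u, v} = h ` e" using \<open>{u, v} \<in> (`) h ` D\<close> by blast
    have "h ` {u, v} = e" unfolding e(2) by (rule inv2)
    then show ?thesis using e(1) by simp
  qed
  show "{u, v} \<in> (`) h ` D" if "{h u, h v} \<in> D"
    using that by (intro image_eqI[of _ _ "{h u, h v}"]) (simp_all add: assms)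
qed

lemma flipv_flipv [simp]: "flipv (flipv v) = v"
  by (cases v) (simp add: flipv_def)

lemma flipv_simps [simp]: "flipv (0, k) = (1, k)" "flipv (Suc 0, k) = (0, k)"
  by (simp_all add: flipv_def)

lemma flipv_vertices: "v \<in> vertices m \<Longrightarrow> flipv v \<in> vertices m"
  by (auto simp: vertices_def)

lemma flip_iff: "{u, v} \<in> flip D \<longleftrightarrow> {flipv u, flipv v} \<in> D"
  unfolding flip_def by (rule involution_image_doubleton) simp

lemma flip_flip [simp]: "flip (flip D) = D"
  unfolding flip_def by (simp add: image_image)

lemma bp_flipv: "v \<in> vertices m \<Longrightarrow> boundary_pos m (flipv v) = 2 * m - 1 - boundary_pos m v"
  by (auto simp: vertices_def boundary_pos_def)

lemma bp_less: "v \<in> vertices m \<Longrightarrow> boundary_pos m v < 2 * m"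
  by (auto simp: vertices_def boundary_pos_def)

lemma flip_mo:
  assumes "D \<in> mo m"
  shows "flip D \<in> mo m"
proof -
  note D = mo_pm[OF assms]
  have pm: "partial_matching m (flip D)"
  proof (rule partial_matchingI)
    fix e assume "e \<in> flip D"
    then obtain e' where e': "e' \<in> D" "e = flipv ` e'" unfolding flip_def by blast
    from partial_matching_cases[OF D e'(1)] obtain u w
      where uw: "e' = {u, w}" "u \<noteq> w" "u \<in> vertices m" "w \<in> vertices m" .
    have "e = {flipv u, flipv w}" using e' uw by simp
    moreover have "flipv u \<noteq> flipv w" using uw(2) by (metis flipv_flipv)
    ultimately show "\<exists>u v. e = {u, v} \<and> u \<noteq> v \<and> u \<in> vertices m \<and> v \<in> vertices m"
      using uw flipv_vertices by blast
  next
    fix u w w' assume "{u, w} \<in> flip D" "{u, w'} \<in> flip D"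
    then have "flipv w = flipv w'" using partial_matching_unique[OF D] unfolding flip_iff by blast
    then show "w = w'" by (metis flipv_flipv)
  qed
  have "crossingless m (flip D)"
    unfolding crossingless_iff
  proof (intro allI impI notI)
    fix a b c d assume e: "{a, b} \<in> flip D" "{c, d} \<in> flip D"
    assume x: "boundary_pos m a < boundary_pos m c \<and> boundary_pos m c < boundary_pos m b
       \<and> boundary_pos m b < boundary_pos m d"
    have V: "a \<in> vertices m" "b \<in> vertices m" "c \<in> vertices m" "d \<in> vertices m"
      using partial_matchingD[OF pm] e by blast+
    have "{flipv b, flipv a} \<in> D" "{flipv d, flipv c} \<in> D" using e by (simp_all add: flip_iff insert_commute)
    from mo_crossD[OF assms this(2,1)] show False
      using x bp_less[OF V(1)] bp_less[OF V(2)] bp_less[OF V(3)] bp_less[OF V(4)]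
      unfolding bp_flipv[OF V(1)] bp_flipv[OF V(2)] bp_flipv[OF V(3)] bp_flipv[OF V(4)] by linarith
  qed
  then show ?thesis using pm by (simp add: mo_def)
qed

text \<open>\<open>t\<close> turns the stacked graph upside down: it exchanges the outer lines and
  fixes the middle one.\<close>

lemma flip_mult:
  assumes D: "partial_matching m D" and E: "partial_matching m E"
  shows "diagram_mult (flip E) (flip D) = flip (diagram_mult D E)"
proof -
  define t where "t = (\<lambda>v::vertex. if fst v = 0 then (2, snd v) else if fst v = 2 then (0, snd v) else v)"
  have tt: "t (t v) = v" for v by (cases v) (simp add: t_def)
  have tl: "t (lift v) = flipv v" "t v = lift (flipv v)" if "v \<in> vertices m" for v
    using that by (auto simp: t_def lift_def vertices_def)
  have "(`) t ` (`) lift ` E = flip E"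
    unfolding flip_def image_image
  proof (rule image_cong[OF refl])
    fix e assume "e \<in> E"
    then have "e \<subseteq> vertices m" using E unfolding partial_matching_def by blast
    then show "(\<lambda>x. t (lift x)) ` e = flipv ` e" by (intro image_cong) (auto simp: tl)
  qed
  moreover have "(`) t ` D = (`) lift ` flip D"
    unfolding flip_def image_image
  proof (rule image_cong[OF refl])
    fix e assume "e \<in> D"
    then have "e \<subseteq> vertices m" using D unfolding partial_matching_def by blast
    then show "t ` e = (\<lambda>x. lift (flipv x)) ` e" by (intro image_cong) (auto simp: tl)
  qed
  ultimately have st: "stack (flip E) (flip D) = (`) t ` stack D E"
    unfolding stack_def lift_def[symmetric] by (simp add: image_Un Un_commute)
  let ?R = "{(x, y). {x, y} \<in> stack D E}" and ?R' = "{(x, y). {x, y} \<in> stack (flip E) (flip D)}"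
  have R: "(x, y) \<in> ?R' \<longleftrightarrow> (t x, t y) \<in> ?R" for x y
    unfolding st by (simp add: involution_image_doubleton[OF tt])
  have 1: "(t x, t y) \<in> ?R\<^sup>*" if "(x, y) \<in> ?R'\<^sup>*" for x y
    using that
  proof (induction rule: rtrancl_induct)
    case (step y z) then show ?case using R by (meson rtrancl.rtrancl_into_rtrancl)
  qed simp
  have 2: "(t x, t y) \<in> ?R'\<^sup>*" if "(x, y) \<in> ?R\<^sup>*" for x y
    using that
  proof (induction rule: rtrancl_induct)
    case (step y z)
    then have "(t y, t z) \<in> ?R'" using R[of "t y" "t z"] tt by simp
    then show ?case using step.IH by (meson rtrancl.rtrancl_into_rtrancl)
  qed simp
  have sq: "squash (t u) = flipv (squash u)" if "fst u \<in> {0, 2}" for u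
    using that by (cases u) (auto simp: t_def squash_def)
  have out: "fst (t u) \<in> {0, 2} \<longleftrightarrow> fst u \<in> {0, 2}" for u by (auto simp: t_def)
  have tne: "t u \<noteq> t v \<longleftrightarrow> u \<noteq> v" for u v by (metis tt)
  have sq2: "squash u = flipv (squash (t u))" if "fst u \<in> {0, 2}" for u
    using sq[OF that] by simp
  show ?thesis
  proof (rule subset_antisym)
    show "diagram_mult (flip E) (flip D) \<subseteq> flip (diagram_mult D E)"
    proof
      fix e assume "e \<in> diagram_mult (flip E) (flip D)"
      then obtain u v where uv: "e = {squash u, squash v}" "fst u \<in> {0, 2}" "fst v \<in> {0, 2}" "u \<noteq> v"
         "(u, v) \<in> ?R'\<^sup>*" unfolding diagram_mult_def by blast
      have "{squash (t u), squash (t v)} \<in> diagram_mult D E"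
        unfolding diagram_mult_def using uv out tne 1 by blast
      moreover have "e = flipv ` {squash (t u), squash (t v)}" using uv sq2 by simp
      ultimately show "e \<in> flip (diagram_mult D E)" unfolding flip_def by blast
    qed
    show "flip (diagram_mult D E) \<subseteq> diagram_mult (flip E) (flip D)"
    proof
      fix e assume "e \<in> flip (diagram_mult D E)"
      then obtain u v where uv: "e = flipv ` {squash u, squash v}" "fst u \<in> {0, 2}" "fst v \<in> {0, 2}" "u \<noteq> v"
         "(u, v) \<in> ?R\<^sup>*" unfolding flip_def diagram_mult_def by blast
      have "{squash (t u), squash (t v)} \<in> diagram_mult (flip E) (flip D)"
        unfolding diagram_mult_def using uv out tne 2 by blast
      moreover have "e = {squash (t u), squash (t v)}" using uv sq by simp
      ultimately show "e \<in> diagram_mult (flip E) (flip D)" by simp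
    qed
  qed
qed

fun tr :: "gen \<Rightarrow> gen" where
  "tr (Dot k) = Dot k" | "tr (Hook k) = Hook k" | "tr (Shr k) = Shl k" | "tr (Shl k) = Shr k"

lemma tr_tr [simp]: "tr (tr g) = g" by (cases g) auto

lemma tr_gens: "g \<in> gens m \<Longrightarrow> tr g \<in> gens m"
  by (cases g) (auto simp: gens_def)

lemma flip_gd:
  assumes "g \<in> gens m"
  shows "flip (gd m g) = gd m (tr g)"
proof -
  have h: "flip (hooks g) = hooks (tr g)"
    by (cases g) (auto simp: flip_def hooks_def)
  have r: "rho (tr g) l' = Some l \<and> l' < m \<longleftrightarrow> rho g l = Some l' \<and> l < m" for l l'
    using assms by (cases g) (auto simp: gens_def split: if_splits)
  have "flip {{(0, l), (1, l')} | l l'. l < m \<and> rho g l = Some l'} = {{(1, l), (0, l')} | l l'. l < m \<and> rho g l = Some l'}"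
    unfolding flip_def by (auto simp: image_iff) (metis image_insert image_empty flipv_simps One_nat_def)+
  also have "\<dots> = {{(0, l'), (1, l)} | l l'. l' < m \<and> rho (tr g) l' = Some l}"
    using r by (auto simp: insert_commute)
  finally show ?thesis
    unfolding gd_def using h by (simp add: flip_def image_Un) blast
qed

text \<open>The last strands are kept, to match the empties in front in \<open>base\<close> and the
  word \<open>epsw\<close>.\<close>

definition eps :: "nat \<Rightarrow> nat \<Rightarrow> diagram" where
  "eps m j = {{(0, k), (1, k)} | k. m - j \<le> k \<and> k < m}"

lemma eps_iff: "{u, v} \<in> eps m j \<longleftrightarrow> (\<exists>k. m - j \<le> k \<and> k < m \<and> (u = (0, k) \<and> v = (1, k) \<or> u = (1, k) \<and> v = (0, k)))"
  unfolding eps_def by (simp add: doubleton_eq_iff) blast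

lemma eps_mo: "eps m j \<in> mo m"
proof -
  have "partial_matching m (eps m j)"
  proof (rule partial_matchingI)
    fix e assume "e \<in> eps m j"
    then obtain k where "e = {(0, k), (1, k)}" "k < m" unfolding eps_def by blast
    then show "\<exists>u v. e = {u, v} \<and> u \<noteq> v \<and> u \<in> vertices m \<and> v \<in> vertices m"
      by (intro exI[of _ "(0, k)"] exI[of _ "(1, k)"]) (simp add: vertices_def)
  qed (auto simp: eps_iff)
  moreover have "crossingless m (eps m j)"
    unfolding crossingless_iff by (auto simp: eps_iff)
  ultimately show ?thesis by (simp add: mo_def)
qed

lemma one_eq_eps: "\<one>\<^bsub>motzkin m\<^esub> = eps m m"
  by (auto simp: motzkin_def eps_def)

lemma flip_eps [simp]: "flip (eps m j) = eps m j"
proof -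
  have "flipv ` {(0, k), (1, k)} = {(0, k), (1, k)}" for k by auto
  then show ?thesis unfolding flip_def eps_def setcompr_eq_image image_image by (simp only:)
qed

lemma epsw_del: "foldr lact (epsw m j) D = {e \<in> D. \<forall>k<m - j. (0, k) \<notin> e}"
proof -
  have "foldr lact (map Dot [0..<d]) D = {e \<in> D. \<forall>k<d. (0, k) \<notin> e}" for d D
  proof (induction d arbitrary: D)
    case (Suc d)
    have "foldr lact (map Dot [0..<Suc d]) D = foldr lact (map Dot [0..<d]) (del (0, d) D)" by simp
    also have "\<dots> = {e \<in> D. \<forall>k<Suc d. (0, k) \<notin> e}" unfolding Suc by (auto simp: del_def less_Suc_eq)
    finally show ?case .
  qed simp
  then show ?thesis unfolding epsw_def .
qed

lemma lact_epsw: "foldr lact (epsw m j) (eps m m) = eps m j"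
proof -
  have "{e \<in> eps m m. \<forall>k<m - j. (0, k) \<notin> e} = (\<lambda>k. {(0, k), (1, k)}) ` {k. m - j \<le> k \<and> k < m}"
  proof (rule subset_antisym; rule subsetI)
    fix e :: "vertex set" assume e: "e \<in> {e \<in> eps m m. \<forall>k<m - j. (0, k) \<notin> e}"
    then obtain k where k: "e = {(0, k), (1, k)}" "k < m" unfolding eps_def by auto
    have "\<not> k < m - j" using e k(1) by auto
    then show "e \<in> (\<lambda>k. {(0, k), (1, k)} :: vertex set) ` {k. m - j \<le> k \<and> k < m}"
      using k by (intro image_eqI[of _ _ k]) simp_all
  next
    fix e :: "vertex set" assume "e \<in> (\<lambda>k. {(0, k), (1, k)} :: vertex set) ` {k. m - j \<le> k \<and> k < m}"
    then obtain k where k: "e = {(0, k), (1, k)}" "m - j \<le> k" "k < m" by auto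
    then have "e \<in> eps m m" unfolding eps_def by auto
    moreover have "\<forall>l<m - j. (0, l) \<notin> e" using k by auto
    ultimately show "e \<in> {e \<in> eps m m. \<forall>k<m - j. (0, k) \<notin> e}" by simp
  qed
  then show ?thesis unfolding epsw_del eps_def[of m j] setcompr_eq_image .
qed

lemma doubleton_set_eqI:
  assumes "\<And>e. e \<in> A \<Longrightarrow> \<exists>u v. e = {u, v}" "\<And>e. e \<in> B \<Longrightarrow> \<exists>u v. e = {u, v}"
    and "\<And>u v. {u, v} \<in> A \<longleftrightarrow> {u, v} \<in> B"
  shows "A = B"
  using assms by (metis subsetI subset_antisym)

text \<open>Lets \<open>lact_mo\<close> show that the diagrams of the generators are planar
  matchings.\<close>

lemma gd_eq_lact_one:
  assumes "g \<in> gens m"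
  shows "gd m g = lact g (eps m m)"
proof (rule doubleton_set_eqI)
  note pm = mo_pm[OF eps_mo, of m m]
  show "\<exists>u v. e = {u, v}" if "e \<in> gd m g" for e
    using that by (cases g) (auto simp: gd_def hooks_def)
  have "\<exists>u v. e = {u, v}" if "e \<in> eps m m" for e using that unfolding eps_def by blast
  then show "\<exists>u v. e = {u, v}" if "e \<in> lact g (eps m m)" for e
    using lact_doubletons[OF _ that] by blast
  fix u v
  show "{u, v} \<in> gd m g \<longleftrightarrow> {u, v} \<in> lact g (eps m m)"
  proof (cases "\<exists>k. g = Hook k")
    case True
    then obtain k where k: "g = Hook k" by blast
    have km: "Suc k < m" using assms k by (auto simp: gens_def)
    have gdk: "{u, v} \<in> gd m g \<longleftrightarrow> (\<exists>l<m. l \<noteq> k \<and> l \<noteq> Suc k \<and> {u, v} = {(0, l), (1, l)})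
        \<or> {u, v} = {(0, k), (0, Suc k)} \<or> {u, v} = {(1, k), (1, Suc k)}"
    proof -
      have "gd m g = {{(0, l), (1, l)} | l. l < m \<and> l \<noteq> k \<and> l \<noteq> Suc k} \<union> {{(0, k), (0, Suc k)}, {(1, k), (1, Suc k)}}"
        unfolding gd_def hooks_def k by auto
      then show ?thesis by blast
    qed
    have K: "{x, (0, k)} \<in> eps m m \<longleftrightarrow> x = (1, k)" "{x, (0, Suc k)} \<in> eps m m \<longleftrightarrow> x = (1, Suc k)" for x
      using km by (auto simp: eps_iff)
    have eps: "{u, v} \<in> eps m m \<longleftrightarrow> (\<exists>l<m. {u, v} = {(0, l), (1, l)})"
      unfolding eps_iff by (simp add: doubleton_eq_iff)
    let ?T = "{(0, k), (0, Suc k)} :: vertex set"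
    let ?N = "u \<noteq> (0, k) \<and> u \<noteq> (0, Suc k) \<and> v \<noteq> (0, k) \<and> v \<noteq> (0, Suc k)"
    have L: "{u, v} \<in> lact g (eps m m) \<longleftrightarrow> {u, v} = ?T \<or> ?N \<and>
       ({u, v} \<in> eps m m \<or> u = (1, k) \<and> v = (1, Suc k) \<or> v = (1, k) \<and> u = (1, Suc k))"
      unfolding k hook_iff[OF pm] K conj_assoc by (rule refl)
    have e1: "?N \<and> {u, v} \<in> eps m m \<longleftrightarrow> (\<exists>l<m. l \<noteq> k \<and> l \<noteq> Suc k \<and> {u, v} = {(0, l), (1, l)})"
    proof
      assume a: "?N \<and> {u, v} \<in> eps m m"
      then obtain l where l: "l < m" "{u, v} = {(0, l), (1, l)}" using eps by metis
      then have "l \<noteq> k" "l \<noteq> Suc k" using a by (auto simp: doubleton_eq_iff)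
      then show "\<exists>l<m. l \<noteq> k \<and> l \<noteq> Suc k \<and> {u, v} = {(0, l), (1, l)}" using l by metis
    next
      assume "\<exists>l<m. l \<noteq> k \<and> l \<noteq> Suc k \<and> {u, v} = {(0, l), (1, l)}"
      then obtain l where l: "l < m" "l \<noteq> k" "l \<noteq> Suc k" "{u, v} = {(0, l), (1, l)}" by (elim exE conjE)
      have "{u, v} \<in> eps m m" using eps l by metis
      moreover have ?N using l by (auto simp: doubleton_eq_iff)
      ultimately show "?N \<and> {u, v} \<in> eps m m" by simp
    qed
    have e2: "?N \<and> (u = (1, k) \<and> v = (1, Suc k) \<or> v = (1, k) \<and> u = (1, Suc k)) \<longleftrightarrow> {u, v} = {(1, k), (1, Suc k)}"
      by (auto simp: doubleton_eq_iff)
    show ?thesis unfolding L gdk e1[symmetric] e2[symmetric] by argo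
  next
    case False
    have h: "hooks g = {}" using False by (cases g) (auto simp: hooks_def)
    have rng: "rho g l = Some l' \<Longrightarrow> l' < m \<longleftrightarrow> l < m" for l l'
      using assms by (cases g) (auto simp: gens_def split: if_splits)
    have L: "{u, v} \<in> gd m g \<longleftrightarrow> (\<exists>l l'. l < m \<and> rho g l = Some l' \<and> (u = (0, l) \<and> v = (1, l') \<or> u = (1, l') \<and> v = (0, l)))"
      unfolding gd_def h by (simp add: doubleton_eq_iff) blast
    have p: "pull g (0, l) = map_option (Pair 0) (rho g l)" "pull g (Suc n, l) = Some (Suc n, l)" for l n
      by (simp_all add: pull_def)
    have "{u, v} \<in> lact g (eps m m) \<longleftrightarrow> (\<exists>l'<m. pull g u = Some (0, l') \<and> pull g v = Some (1, l')
        \<or> pull g u = Some (1, l') \<and> pull g v = Some (0, l'))"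
      using lact_pull[of g u v "eps m m"] False unfolding eps_iff by fastforce
    also have "\<dots> \<longleftrightarrow> (\<exists>l l'. l < m \<and> rho g l = Some l' \<and> (u = (0, l) \<and> v = (1, l') \<or> u = (1, l') \<and> v = (0, l)))"
    proof -
      have p0: "pull g x = Some (0, l') \<longleftrightarrow> (\<exists>l. x = (0, l) \<and> rho g l = Some l')" for x l'
        by (cases x) (auto simp: pull_def)
      have p1: "pull g x = Some (1, l') \<longleftrightarrow> x = (1, l')" for x l'
        by (cases x) (auto simp: pull_def)
      show ?thesis unfolding p0 p1 using rng by blast
    qed
    finally show ?thesis using L by blast
  qed
qed

lemma gd_mo: "g \<in> gens m \<Longrightarrow> gd m g \<in> mo m"
  unfolding gd_eq_lact_one by (rule lact_mo[OF eps_mo])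

text \<open>Multiplication from below is the mirror image of multiplication from above, so no second
  case analysis of stacked graphs is made.\<close>

lemma mult_gd:
  assumes "D \<in> mo m" "g \<in> gens m"
  shows "diagram_mult D (gd m g) = flip (lact (tr g) (flip D))"
proof -
  have "diagram_mult D (gd m g) = flip (flip (diagram_mult D (gd m g)))" by simp
  also have "flip (diagram_mult D (gd m g)) = diagram_mult (flip (gd m g)) (flip D)"
    by (rule flip_mult[symmetric]) (use assms gd_mo mo_pm in auto)
  also have "\<dots> = lact (tr g) (flip D)"
    unfolding flip_gd[OF assms(2)] by (rule gd_mult) (use assms flip_mo mo_pm tr_gens in auto)
  finally show ?thesis .
qed

subsection \<open>Through strands\<close>

definition strands :: "diagram \<Rightarrow> (nat \<times> nat) set" where
  "strands D = {(a, b). {(0, a), (1, b)} \<in> D}"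

definition tops :: "diagram \<Rightarrow> nat set" where
  "tops D = {a. (0, a) \<in> \<Union> D}"

definition bots :: "diagram \<Rightarrow> nat set" where
  "bots D = {a. (1, a) \<in> \<Union> D}"

lemma strands_subset: "D \<in> mo m \<Longrightarrow> strands D \<subseteq> {..<m} \<times> {..<m}"
  using partial_matchingD[OF mo_pm] by (fastforce simp: strands_def vertices_def)

lemma finite_strands: "D \<in> mo m \<Longrightarrow> finite (strands D)"
  by (rule finite_subset[OF strands_subset]) auto

lemma strands_inj:
  assumes "D \<in> mo m"
  shows "inj_on fst (strands D)" "inj_on snd (strands D)"
proof -
  have u1: "b = b'" if "(a, b) \<in> strands D" "(a, b') \<in> strands D" for a b b'
    using that partial_matching_unique[OF mo_pm[OF assms], of "(0, a)" "(1, b)" "(1, b')"] by (simp add: strands_def)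
  have u2: "a = a'" if "(a, b) \<in> strands D" "(a', b) \<in> strands D" for a a' b
    using that partial_matching_unique[OF mo_pm[OF assms], of "(1, b)" "(0, a)" "(0, a')"]
    by (simp add: strands_def insert_commute)
  show "inj_on fst (strands D)" "inj_on snd (strands D)"
    using u1 u2 by (auto intro!: inj_onI)
qed

lemma through_strands_card:
  assumes "D \<in> mo m"
  shows "through_strands D = card (strands D)"
proof -
  define h where "h = (\<lambda>p. {(0, fst p), (1, snd p)} :: vertex set)"
  have "inj_on h (strands D)"
    by (rule inj_onI) (simp add: h_def doubleton_eq_iff prod_eq_iff)
  moreover have "h ` strands D = {e \<in> D. \<exists>k l. e = {(0, k), (1, l)}}"
  proof (rule subset_antisym; rule subsetI)
    fix e assume "e \<in> h ` strands D"
    then obtain p where p: "e = h p" "p \<in> strands D" by (rule imageE)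
    have "h p \<in> D" using p(2) by (simp add: strands_def h_def split_beta)
    moreover have "\<exists>k l. h p = {(0, k), (1, l)}" unfolding h_def by (intro exI) (rule refl)
    ultimately show "e \<in> {e \<in> D. \<exists>k l. e = {(0, k), (1, l)}}" unfolding p(1) mem_Collect_eq by (rule conjI)
  next
    fix e assume e: "e \<in> {e \<in> D. \<exists>k l. e = {(0, k), (1, l)}}"
    then have "\<exists>k l. e = {(0, k), (1, l)}" unfolding mem_Collect_eq by (rule conjunct2)
    then obtain a b where ab: "e = {(0, a), (1, b)}" by (elim exE)
    have "(a, b) \<in> strands D" using e unfolding ab strands_def by simp
    moreover have "e = h (a, b)" by (simp add: ab h_def)
    ultimately show "e \<in> h ` strands D" by (rule rev_image_eqI)
  qed
  ultimately show ?thesis unfolding through_strands_def using card_image by metis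
qed

lemma card_strands: "D \<in> mo m \<Longrightarrow> card (snd ` strands D) = through_strands D"
    "D \<in> mo m \<Longrightarrow> card (fst ` strands D) = through_strands D"
  using strands_inj card_image through_strands_card by metis+

lemma strands_flip: "strands (flip D) = prod.swap ` strands D"
proof -
  have "(a, b) \<in> strands (flip D) \<longleftrightarrow> (a, b) \<in> prod.swap ` strands D" for a b
    unfolding pair_in_swap_image by (simp add: strands_def flip_iff insert_commute)
  then show ?thesis by auto
qed

lemma through_strands_flip: "D \<in> mo m \<Longrightarrow> through_strands (flip D) = through_strands D"
  using through_strands_card[OF flip_mo, of D m] through_strands_card[of D m]
    card_image[OF inj_on_subset[OF inj_swap subset_UNIV], of "strands D"]
  by (simp add: strands_flip)

lemma snd_strands_bots: "snd ` strands D \<subseteq> bots D"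
  by (auto simp: strands_def bots_def)

lemma fst_strands_tops: "fst ` strands D \<subseteq> tops D"
  by (auto simp: strands_def tops_def)

text \<open>Multiplying on top can only reroute the top ends: a block at a bottom vertex of the
  product continues a block of \<open>D\<close> at that vertex.\<close>

lemma lact_bottom:
  assumes D: "D \<in> mo m" and e: "{(1, b), v} \<in> lact g D"
  shows "b \<in> bots D" "fst v = 0 \<Longrightarrow> b \<in> snd ` strands D"
proof -
  have "\<exists>v'. {(1, b), v'} \<in> D \<and> (fst v = 0 \<longrightarrow> fst v' = 0)"
  proof (cases "\<exists>k. g = Hook k")
    case True
    then obtain k where k: "g = Hook k" by blast
    from e[unfolded k hook_iff[OF mo_pm[OF D]]] show ?thesis
    proof (elim disjE conjE)
      assume "{(1, b), v} = {(0, k), (0, Suc k)}" then show ?thesis by (simp add: doubleton_eq_iff)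
    next
      assume "{(1, b), v} \<in> D" then show ?thesis by (intro exI[of _ v]) simp
    next
      assume "{(1, b), (0, k)} \<in> D" then show ?thesis by (intro exI[of _ "(0, k)"]) simp
    next
      assume "{(1, b), (0, Suc k)} \<in> D" then show ?thesis by (intro exI[of _ "(0, Suc k)"]) simp
    qed
  next
    case False
    then have "\<exists>u' v'. pull g (1, b) = Some u' \<and> pull g v = Some v' \<and> {u', v'} \<in> D"
      using lact_pull[of g "(1, b)" v D] e by metis
    then obtain u' v' where p: "pull g (1, b) = Some u'" "pull g v = Some v'" "{u', v'} \<in> D"
      by (elim exE conjE)
    have "u' = (1, b)" using p(1) by (simp add: pull_def)
    moreover have "fst v' = 0" if "fst v = 0"
      using p(2) that unfolding pull_def by (cases "rho g (snd v)") (simp, force)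
    ultimately show ?thesis using p(3) by (intro exI[of _ v']) simp
  qed
  then obtain v' where v': "{(1, b), v'} \<in> D" "fst v = 0 \<longrightarrow> fst v' = 0" by (elim exE conjE)
  have "(1, b) \<in> {(1, b), v'}" by simp
  then show "b \<in> bots D" using v'(1) unfolding bots_def by blast
  show "b \<in> snd ` strands D" if "fst v = 0"
  proof -
    have "v' = (0, snd v')" using v'(2) that by (simp add: prod_eq_iff)
    then have "(snd v', b) \<in> strands D" using v'(1) by (simp add: strands_def insert_commute)
    then show ?thesis by force
  qed
qed

lemma bots_lact:
  assumes "D \<in> mo m"
  shows "bots (lact g D) \<subseteq> bots D" "snd ` strands (lact g D) \<subseteq> snd ` strands D"
proof
  fix b assume "b \<in> bots (lact g D)"
  then obtain e where e: "e \<in> lact g D" "(1, b) \<in> e" unfolding bots_def by blast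
  have "\<And>e. e \<in> D \<Longrightarrow> \<exists>u v. e = {u, v}" using partial_matching_cases[OF mo_pm[OF assms]] by metis
  from lact_doubletons[OF this e(1)] obtain u v where "e = {u, v}" by blast
  then have "e = {(1, b), v} \<or> e = {(1, b), u}" using e(2) by (auto simp: insert_commute)
  then show "b \<in> bots D" using lact_bottom(1)[OF assms, of b _ g] e(1) by (elim disjE) simp_all
next
  show "snd ` strands (lact g D) \<subseteq> snd ` strands D"
  proof (rule subsetI)
    fix b assume "b \<in> snd ` strands (lact g D)"
    then obtain a where "(a, b) \<in> strands (lact g D)" by (metis imageE prod.collapse)
    then have "{(1, b), (0, a)} \<in> lact g D" by (simp add: strands_def insert_commute)
    from lact_bottom(2)[OF assms this] show "b \<in> snd ` strands D" by simp
  qed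
qed

lemma bots_lact_list:
  assumes "D \<in> mo m" "set ws \<subseteq> gens m"
  shows "bots (foldr lact ws D) \<subseteq> bots D \<and> snd ` strands (foldr lact ws D) \<subseteq> snd ` strands D"
  using assms(2)
proof (induction ws)
  case (Cons g ws)
  then have "foldr lact ws D \<in> mo m" using lact_list_mo[OF assms(1)] by simp
  note b = bots_lact[OF this, of g]
  have "bots (foldr lact ws D) \<subseteq> bots D" "snd ` strands (foldr lact ws D) \<subseteq> snd ` strands D"
    using Cons by simp_all
  from subset_trans[OF b(1) this(1)] subset_trans[OF b(2) this(2)] show ?case by (simp only: foldr.simps comp_apply)
qed simp

lemma through_lact_list:
  assumes "D \<in> mo m" "set ws \<subseteq> gens m"
  shows "through_strands (foldr lact ws D) \<le> through_strands D"
proof -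
  have "card (snd ` strands (foldr lact ws D)) \<le> card (snd ` strands D)"
    using bots_lact_list[OF assms] finite_strands[OF assms(1)] by (intro card_mono) auto
  then show ?thesis using card_strands(1)[OF assms(1)] card_strands(1)[OF lact_list_mo[OF assms]] by simp
qed

lemma mono_self_map_id:
  fixes f :: "nat \<Rightarrow> nat"
  assumes f: "\<And>x. x \<in> {a..<b} \<Longrightarrow> f x \<in> {a..<b}" and mono: "\<And>x y. x \<in> {a..<b} \<Longrightarrow> y \<in> {a..<b} \<Longrightarrow> x < y \<Longrightarrow> f x < f y"
    and x: "x \<in> {a..<b}"
  shows "f x = x"
proof -
  have ge: "a + d < b \<Longrightarrow> f (a + d) \<ge> a + d" for d
  proof (induction d)
    case 0 then show ?case using f[of a] by simp
  next
    case (Suc d) then show ?case using mono[of "a + d" "a + Suc d"] by simp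
  qed
  have le: "d < b - a \<Longrightarrow> f (b - Suc d) \<le> b - Suc d" for d
  proof (induction d)
    case 0 then show ?case using f[of "b - Suc 0"] by fastforce
  next
    case (Suc d) then show ?case using mono[of "b - Suc (Suc d)" "b - Suc d"] by fastforce
  qed
  have "f (a + (x - a)) \<ge> a + (x - a)" by (rule ge) (use x in auto)
  moreover have "f (b - Suc (b - Suc x)) \<le> b - Suc (b - Suc x)" by (rule le) (use x in auto)
  ultimately show ?thesis using x by simp
qed

text \<open>The strands fill the last \<open>j\<close> places of both lines and, by planarity,
  preserve their order. They are therefore vertical and leave no vertex for another block.\<close>

lemma eps_unique:
  assumes D: "D \<in> mo m" and j: "j \<le> m" and t: "fst ` strands D \<subseteq> {m - j..<m}" and b: "bots D \<subseteq> {m - j..<m}"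
    and s: "through_strands D \<ge> j" and tt: "tops D \<subseteq> {m - j..<m}"
  shows "D = eps m j"
proof -
  let ?A = "{m - j..<m}"
  have cA: "card ?A = j" using j by simp
  have snd: "snd ` strands D = ?A"
    by (rule card_seteq) (use snd_strands_bots[of D] b s card_strands(1)[OF D] cA in auto)
  have fst: "fst ` strands D = ?A"
    by (rule card_seteq) (use t s card_strands(2)[OF D] cA in auto)
  define f where "f a = (THE b. (a, b) \<in> strands D)" for a
  have f: "(a, f a) \<in> strands D" if a: "a \<in> ?A" for a
  proof -
    have "a \<in> fst ` strands D" using a fst by simp
    then obtain b where b: "(a, b) \<in> strands D" by force
    have "b' = b" if "(a, b') \<in> strands D" for b'
      using inj_onD[OF strands_inj(1)[OF D], of "(a, b')" "(a, b)"] that b by simp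
    then have "f a = b" unfolding f_def using b by blast
    then show ?thesis using b by simp
  qed
  have fA: "f a \<in> ?A" if "a \<in> ?A" for a using f[OF that] snd by force
  have mono: "f a < f a'" if "a \<in> ?A" "a' \<in> ?A" "a < a'" for a a'
  proof (rule ccontr)
    assume n: "\<not> f a < f a'"
    have "f a \<noteq> f a'"
    proof
      assume "f a = f a'"
      then have "(a, f a) = (a', f a')"
        using inj_onD[OF strands_inj(2)[OF D], of "(a, f a)" "(a', f a')"] f[OF that(1)] f[OF that(2)] by simp
      then show False using that(3) by simp
    qed
    then have "f a' < f a" using n by simp
    moreover have "{(0, a), (1, f a)} \<in> D" "{(0, a'), (1, f a')} \<in> D" using f that by (simp_all add: strands_def)
    from mo_crossD[OF D this] have "\<not> (a < a' \<and> a' < 2 * m - 1 - f a \<and> 2 * m - 1 - f a < 2 * m - 1 - f a')" by simp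
    ultimately show False using that fA[OF that(1)] by auto
  qed
  have id: "f a = a" if "a \<in> ?A" for a by (rule mono_self_map_id[of "m - j" m f]) (use fA mono that in auto)
  have sub: "eps m j \<subseteq> D"
  proof
    fix e assume "e \<in> eps m j"
    then obtain k where k: "k \<in> ?A" "e = {(0, k), (1, k)}" unfolding eps_def by auto
    then show "e \<in> D" using f[OF k(1)] id[OF k(1)] by (simp add: strands_def)
  qed
  moreover have "D \<subseteq> eps m j"
  proof
    fix e assume e: "e \<in> D"
    from partial_matching_cases[OF mo_pm[OF D] e] obtain u v
      where uv: "e = {u, v}" "u \<noteq> v" "u \<in> vertices m" "v \<in> vertices m" .
    have "snd u \<in> ?A"
    proof (cases "fst u = 0")
      case True
      then have "u = (0, snd u)" by (simp add: prod_eq_iff)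
      moreover have "u \<in> \<Union> D" using e uv(1) by (intro UnionI[of e]) simp_all
      ultimately have "snd u \<in> tops D" unfolding tops_def by simp
      then show ?thesis using tt by blast
    next
      case False
      then have "u = (1, snd u)" using vertex_fst[OF uv(3)] by (simp add: prod_eq_iff)
      moreover have "u \<in> \<Union> D" using e uv(1) by (intro UnionI[of e]) simp_all
      ultimately have "snd u \<in> bots D" unfolding bots_def by simp
      then show ?thesis using b by blast
    qed
    then have d: "{(0, snd u), (1, snd u)} \<in> eps m j" unfolding eps_def by auto
    have ue: "u \<in> e" using uv(1) by simp
    have "u \<in> {(0, snd u), (1, snd u)}" using vertex_fst[OF uv(3)] by (auto simp: prod_eq_iff)
    from partial_matching_disjoint[OF mo_pm[OF D] e subsetD[OF sub d] ue this]
    have "e = {(0, snd u), (1, snd u)}" .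
    then show "e \<in> eps m j" using d by simp
  qed
  ultimately show ?thesis by (intro subset_antisym)
qed

subsection \<open>Reduction to the idempotents\<close>

text \<open>The L-relation of Green, with words of generators as witnesses.\<close>

definition lequiv :: "nat \<Rightarrow> diagram \<Rightarrow> diagram \<Rightarrow> bool" where
  "lequiv m D E \<longleftrightarrow> (\<exists>ws. set ws \<subseteq> gens m \<and> E = foldr lact ws D) \<and> (\<exists>ws. set ws \<subseteq> gens m \<and> D = foldr lact ws E)"

lemma lequivI:
  assumes "set u \<subseteq> gens m" "E = foldr lact u D" "set w \<subseteq> gens m" "D = foldr lact w E"
  shows "lequiv m D E"
  unfolding lequiv_def by (intro conjI exI[of _ u] exI[of _ w]) (rule assms)+

lemma lequivE:
  assumes "lequiv m D E"
  obtains u w where "set u \<subseteq> gens m" "E = foldr lact u D" "set w \<subseteq> gens m" "D = foldr lact w E"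
  using assms unfolding lequiv_def by (elim conjE exE)

lemma lequiv_refl: "lequiv m D D"
  by (rule lequivI[of "[]" _ _ _ "[]"]) simp_all

lemma lequiv_trans:
  assumes "lequiv m D E" "lequiv m E F"
  shows "lequiv m D F"
proof -
  from assms(1) obtain u u' where u: "set u \<subseteq> gens m" "E = foldr lact u D" "set u' \<subseteq> gens m" "D = foldr lact u' E"
    by (rule lequivE)
  from assms(2) obtain v v' where v: "set v \<subseteq> gens m" "F = foldr lact v E" "set v' \<subseteq> gens m" "E = foldr lact v' F"
    by (rule lequivE)
  show ?thesis
  proof (rule lequivI)
    show "F = foldr lact (v @ u) D" by (simp only: foldr_append comp_def v(2)[symmetric] u(2)[symmetric])
    show "D = foldr lact (u' @ v') F" by (simp only: foldr_append comp_def v(4)[symmetric] u(4)[symmetric])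
  qed (simp_all only: set_append Un_least u(1,3) v(1,3))
qed

lemma lequiv_remove_arc:
  assumes D: "D \<in> mo m" and arc: "{(0, k), (0, Suc k)} \<in> D" and k: "Suc k < m"
  shows "D - {{(0, k), (0, Suc k)}} \<in> mo m" "lequiv m D (D - {{(0, k), (0, Suc k)}})"
proof -
  let ?e = "{(0, k), (0, Suc k)} :: vertex set" and ?E = "D - {{(0, k), (0, Suc k)}}"
  show "?E \<in> mo m" using mo_subset[OF D] by blast
  have notin: "(0, k) \<notin> e \<and> (0, Suc k) \<notin> e" if "e \<in> ?E" for e
    using partial_matching_disjoint[OF mo_pm[OF D] _ arc, of e] that by blast
  then have 1: "?E = foldr lact [Dot k, Dot (Suc k)] D" by (auto simp: del_def)
  have 2: "D = foldr lact [Hook k] ?E"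
  proof -
    have "del (0, k) (del (0, Suc k) ?E) = ?E" using notin by (auto simp: del_def)
    moreover have "{{a, b} | a b. {a, (0, k)} \<in> ?E \<and> {b, (0, Suc k)} \<in> ?E \<and> a \<noteq> (0, Suc k) \<and> b \<noteq> (0, k)} = {}"
      using notin by blast
    ultimately have "lact (Hook k) ?E = ?E \<union> {?e} \<union> {}" by (simp only: lact.simps)
    then show ?thesis using arc by auto
  qed
  have "set [Dot k, Dot (Suc k)] \<subseteq> gens m" "set [Hook k] \<subseteq> gens m" using k by (auto simp: gens_def)
  then show "lequiv m D ?E" using 1 2 by (intro lequivI)
qed

lemma swv_image_swv_image: "(`) (swv k) ` (`) (swv k) ` D = D"
  by (simp add: image_image)

lemma lequiv_swap:
  assumes D: "D \<in> mo m" and k: "Suc k < m" and v: "v = (0, k) \<or> v = (0, Suc k)" "v \<notin> \<Union> D"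
  shows "(`) (swv k) ` D \<in> mo m" "lequiv m D ((`) (swv k) ` D)"
proof -
  let ?E = "(`) (swv k) ` D"
  show "?E \<in> mo m" by (rule swap_mo[OF D k v])
  have un: "swv k v \<notin> \<Union> ?E"
  proof
    assume "swv k v \<in> \<Union> ?E"
    then obtain e where "e \<in> D" "swv k v \<in> swv k ` e" by blast
    then have "v \<in> e" by (metis imageE swv_swv)
    then show False using v(2) \<open>e \<in> D\<close> by blast
  qed
  have del: "del w F = F" if "w \<notin> \<Union> F" for w F using that by (auto simp: del_def)
  have g: "set [Shr k] \<subseteq> gens m" "set [Shl k] \<subseteq> gens m" using k by (auto simp: gens_def)
  from v(1) show "lequiv m D ?E"
  proof
    assume vk: "v = (0, k)"
    have "?E = foldr lact [Shr k] D" using del[OF v(2)] vk by simp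
    moreover have "D = foldr lact [Shl k] ?E"
    proof -
      have "swv k v = (0, Suc k)" using vk by (simp add: swv_def)
      then show ?thesis using del[OF un] by (simp add: swv_image_swv_image)
    qed
    ultimately show ?thesis using g by (intro lequivI)
  next
    assume vk: "v = (0, Suc k)"
    have "?E = foldr lact [Shl k] D" using del[OF v(2)] vk by simp
    moreover have "D = foldr lact [Shr k] ?E"
    proof -
      have "swv k v = (0, k)" using vk by (simp add: swv_def)
      then show ?thesis using del[OF un] by (simp add: swv_image_swv_image)
    qed
    ultimately show ?thesis using g by (intro lequivI)
  qed
qed

lemma used_partner:
  assumes D: "D \<in> mo m" and v: "v \<in> \<Union> D"
  obtains w where "{v, w} \<in> D"
proof -
  obtain e where e: "e \<in> D" "v \<in> e" using v by (rule UnionE)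
  from partial_matching_cases[OF mo_pm[OF D] e(1)] obtain p q where pq: "e = {p, q}" .
  then have "e = {v, q} \<or> e = {v, p}" using e(2) by (auto simp: insert_commute)
  then show thesis using that e(1) by (elim disjE) simp_all
qed

lemma used_iff:
  assumes "D \<in> mo m"
  shows "v \<in> \<Union> D \<longleftrightarrow> (\<exists>w. {v, w} \<in> D)"
proof
  assume "v \<in> \<Union> D"
  from used_partner[OF assms this] obtain w where "{v, w} \<in> D" .
  then show "\<exists>w. {v, w} \<in> D" by (rule exI)
next
  assume "\<exists>w. {v, w} \<in> D"
  then obtain w where "{v, w} \<in> D" by (rule exE)
  then show "v \<in> \<Union> D" by (rule UnionI) simp
qed

lemma used_swap: "v \<in> \<Union> ((`) (swv k) ` D) \<longleftrightarrow> swv k v \<in> \<Union> D"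
proof
  assume "v \<in> \<Union> ((`) (swv k) ` D)" then show "swv k v \<in> \<Union> D" by auto
next
  assume "swv k v \<in> \<Union> D"
  then obtain e where "e \<in> D" "swv k v \<in> e" by blast
  then have "v \<in> swv k ` e" by (metis image_eqI swv_swv)
  then show "v \<in> \<Union> ((`) (swv k) ` D)" using \<open>e \<in> D\<close> by blast
qed

text \<open>The right end of the arc moves left through isolated places until the ends are
  neighbours. Then two dots remove the arc, and a hook would restore it.\<close>

lemma reduce_empty_arc:
  assumes "D \<in> mo m" "{(0, k), (0, l)} \<in> D" "l = k + Suc d" "\<And>x. k < x \<Longrightarrow> x < l \<Longrightarrow> (0, x) \<notin> \<Union> D"
  shows "\<exists>E\<in>mo m. lequiv m D E \<and> card E < card D"
  using assms
proof (induction d arbitrary: D l)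
  case 0
  then have l: "l = Suc k" by simp
  have k: "Suc k < m" using partial_matchingD[OF mo_pm[OF 0(1)] 0(2)] l by (simp add: vertices_def)
  have arc: "{(0, k), (0, Suc k)} \<in> D" using 0(2) l by simp
  have "card (D - {{(0, k), (0, Suc k)}}) < card D"
    using arc finite_partial_matching[OF mo_pm[OF 0(1)]] by (intro psubset_card_mono) auto
  then show ?case using lequiv_remove_arc[OF 0(1) arc k] by blast
next
  case (Suc d)
  let ?x = "k + Suc d"
  have l: "l = Suc ?x" using Suc.prems by simp
  have x: "Suc ?x < m" using partial_matchingD[OF mo_pm[OF Suc.prems(1)] Suc.prems(2)] l by (simp add: vertices_def)
  have iso: "(0, ?x) \<notin> \<Union> D" using Suc.prems(4)[of ?x] l by simp
  let ?E = "(`) (swv ?x) ` D"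
  note E = lequiv_swap[OF Suc.prems(1) x disjI1[OF refl] iso]
  have "{(0, k), (0, ?x)} \<in> ?E"
    using Suc.prems(2) l by (simp add: image_swv_doubleton) (simp add: swv_def)
  moreover have "(0, y) \<notin> \<Union> ?E" if "k < y" "y < ?x" for y
    using Suc.prems(4)[of y] that l unfolding used_swap by (simp add: swv_def)
  ultimately obtain F where F: "F \<in> mo m" "lequiv m ?E F" "card F < card ?E"
    using Suc.IH[of ?E ?x] E(1) by blast
  have "card ?E \<le> card D" by (rule card_image_le[OF finite_partial_matching[OF mo_pm[OF Suc.prems(1)]]])
  then show ?case using F E(2) lequiv_trans by (metis order.strict_trans2)
qed

definition no_top_arc :: "diagram \<Rightarrow> bool" where
  "no_top_arc D \<longleftrightarrow> (\<forall>k l. {(0, k), (0, l)} \<notin> D)"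

lemma reduce_top_arcs:
  "D \<in> mo m \<Longrightarrow> \<exists>E\<in>mo m. lequiv m D E \<and> no_top_arc E"
proof (induction "card D" arbitrary: D rule: less_induct)
  case less
  show ?case
  proof (cases "no_top_arc D")
    case True then show ?thesis using less.prems lequiv_refl by blast
  next
    case False
    note D = mo_pm[OF less.prems]
    obtain a b where ab: "{(0, a), (0, b)} \<in> D"
      using False unfolding no_top_arc_def not_all not_not by (elim exE)
    \<comment> \<open>A shortest arc on the top line is chosen. The offset \<open>Suc d\<close>
      orients it and excludes length 0.\<close>
    have "\<exists>d k. {(0, k), (0, k + Suc d)} \<in> D"
    proof (cases "a < b")
      case True
      then have "{(0, a), (0, a + Suc (b - Suc a))} \<in> D" using ab by simp
      then show ?thesis by (intro exI)
    next
      case False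
      then have "b < a" using partial_matchingD(1)[OF D ab] by auto
      then have "{(0, b), (0, b + Suc (a - Suc b))} \<in> D" using ab by (simp add: insert_commute)
      then show ?thesis by (intro exI)
    qed
    then have "\<exists>d. (\<exists>k. {(0, k), (0, k + Suc d)} \<in> D) \<and> (\<forall>d'<d. \<not> (\<exists>k. {(0, k), (0, k + Suc d')} \<in> D))"
      by (rule exists_least_iff[THEN iffD1])
    then obtain d k where k: "{(0, k), (0, k + Suc d)} \<in> D"
      and min0: "\<forall>d'<d. \<not> (\<exists>k. {(0, k), (0, k + Suc d')} \<in> D)"
      by (elim exE conjE)
    have min: "{(0, k), (0, k + Suc d')} \<notin> D" if "d' < d" for d' k
    proof
      assume "{(0, k), (0, k + Suc d')} \<in> D"
      then have "\<exists>k. {(0, k), (0, k + Suc d')} \<in> D" by (rule exI)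
      then show False using min0 that by (elim allE[of _ d'] impE notE)
    qed
    let ?l = "k + Suc d"
    have lm: "?l < m" using partial_matchingD[OF D k] by (simp add: vertices_def)
    \<comment> \<open>By planarity a used vertex under the arc could only be joined to another one
      under it, which would be a shorter arc.\<close>
    have "(0, x) \<notin> \<Union> D" if x: "k < x" "x < ?l" for x
    proof
      assume "(0, x) \<in> \<Union> D"
      from used_partner[OF less.prems this] obtain v where v: "{(0, x), v} \<in> D" .
      have c1: "\<not> x < m \<or> \<not> ?l < boundary_pos m v"
        using mo_crossD[OF less.prems k v] x by simp
      have v': "{v, (0, x)} \<in> D" using v by (simp add: insert_commute)
      have c2: "\<not> boundary_pos m v < k" using mo_crossD[OF less.prems v' k] x by simp
      have vV: "v \<in> vertices m" "x < m" using partial_matchingD[OF D v] by (auto simp: vertices_def)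
      have "fst v = 0"
        using vertex_fst[OF vV(1)] c1 vV(2) lm vV(1) by (auto simp: boundary_pos_def vertices_def)
      then obtain y where y: "v = (0, y)" by (metis prod.collapse)
      have "y \<noteq> k" "y \<noteq> ?l"
      proof -
        show "y \<noteq> k" using partial_matching_unique[OF D k, of "(0, x)"] v' y x by auto
        have k': "{(0, ?l), (0, k)} \<in> D" using k by (simp add: insert_commute)
        show "y \<noteq> ?l" using partial_matching_unique[OF D k', of "(0, x)"] v' y x by auto
      qed
      then have y2: "k < y" "y < ?l" using c1 c2 vV y by auto
      have yx: "y \<noteq> x" using partial_matchingD(1)[OF D v] y by auto
      show False
      proof (cases "x < y")
        case True
        then have "y = x + Suc (y - Suc x)" "y - Suc x < d" using x y2 by auto
        then show ?thesis using min[of "y - Suc x" x] v y by simp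
      next
        case False
        then have "x = y + Suc (x - Suc y)" "x - Suc y < d" using x y2 yx by auto
        then show ?thesis using min[of "x - Suc y" y] v' y by simp
      qed
    qed
    then obtain E where E: "E \<in> mo m" "lequiv m D E" "card E < card D"
      using reduce_empty_arc[OF less.prems k refl] by blast
    from less.hyps[OF E(3,1)] obtain F where F: "F \<in> mo m" "lequiv m E F" "no_top_arc F" by (elim bexE conjE)
    show ?thesis by (intro bexI[of _ F] conjI lequiv_trans[OF E(2)] F)
  qed
qed

lemma tops_less: "D \<in> mo m \<Longrightarrow> tops D \<subseteq> {..<m}"
proof
  fix a assume D: "D \<in> mo m" and "a \<in> tops D"
  then have "(0, a) \<in> \<Union> D" by (simp only: tops_def mem_Collect_eq)
  from used_partner[OF D this] obtain w where "{(0, a), w} \<in> D" .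
  from partial_matchingD(2)[OF mo_pm[OF D] this] show "a \<in> {..<m}" by (simp add: vertices_def)
qed

text \<open>A used place with a vacant right neighbour moves one step right, and the total distance
  of the used places from the right end drops.\<close>

lemma push_tops:
  "D \<in> mo m \<Longrightarrow> no_top_arc D \<Longrightarrow> \<exists>E\<in>mo m. lequiv m D E \<and> no_top_arc E \<and>
     (\<forall>k. k \<in> tops E \<longrightarrow> Suc k < m \<longrightarrow> Suc k \<in> tops E)"
proof (induction "\<Sum>a\<in>tops D. m - a" arbitrary: D rule: less_induct)
  case less
  show ?case
  proof (cases "\<exists>k. k \<in> tops D \<and> Suc k < m \<and> Suc k \<notin> tops D")
    case False then show ?thesis using less.prems lequiv_refl by blast
  next
    case True
    then obtain k where k: "k \<in> tops D" "Suc k < m" "Suc k \<notin> tops D" by blast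
    have iso: "(0, Suc k) \<notin> \<Union> D" using k(3) by (simp add: tops_def)
    let ?E = "(`) (swv k) ` D"
    note E = lequiv_swap[OF less.prems(1) k(2) disjI2[OF refl] iso]
    have fin: "finite (tops D)" using finite_subset[OF tops_less[OF less.prems(1)]] by blast
    have tE: "tops ?E = insert (Suc k) (tops D - {k})"
    proof (rule Set.set_eqI)
      fix x show "x \<in> tops ?E \<longleftrightarrow> x \<in> insert (Suc k) (tops D - {k})"
        using k unfolding tops_def mem_Collect_eq used_swap by (simp add: swv_def)
    qed
    have "(\<Sum>a\<in>tops ?E. m - a) = (m - Suc k) + (\<Sum>a\<in>tops D - {k}. m - a)"
      unfolding tE using k fin by (subst sum.insert) auto
    moreover have "(\<Sum>a\<in>tops D. m - a) = (m - k) + (\<Sum>a\<in>tops D - {k}. m - a)"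
      by (rule sum.remove[OF fin k(1)])
    ultimately have "(\<Sum>a\<in>tops ?E. m - a) < (\<Sum>a\<in>tops D. m - a)" using k(2) by simp
    moreover have "no_top_arc ?E"
      unfolding no_top_arc_def
    proof (intro allI notI)
      fix a b assume "{(0, a), (0, b)} \<in> ?E"
      then have "{swv k (0, a), swv k (0, b)} \<in> D" by (simp add: image_swv_doubleton)
      moreover have "\<exists>a'. swv k (0, a) = (0, a')" "\<exists>b'. swv k (0, b) = (0, b')" by (auto simp: swv_def)
      ultimately show False using less.prems(2) unfolding no_top_arc_def by (elim exE) simp
    qed
    ultimately obtain F where "F \<in> mo m" "lequiv m ?E F" "no_top_arc F"
        "\<forall>k. k \<in> tops F \<longrightarrow> Suc k < m \<longrightarrow> Suc k \<in> tops F"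
      using less.hyps[of ?E] E(1) by blast
    note F = this
    show ?thesis by (intro bexI[of _ F] conjI lequiv_trans[OF E(2)] F)
  qed
qed

lemma no_top_arc_tops:
  assumes "D \<in> mo m" "no_top_arc D"
  shows "tops D = fst ` strands D"
proof (rule subset_antisym[OF _ fst_strands_tops], rule subsetI)
  fix a assume "a \<in> tops D"
  then have "(0, a) \<in> \<Union> D" by (simp only: tops_def mem_Collect_eq)
  from used_partner[OF assms(1) this] obtain w where w: "{(0, a), w} \<in> D" .
  have "w \<in> vertices m" using partial_matchingD[OF mo_pm[OF assms(1)] w] by blast
  moreover have "fst w \<noteq> 0" using assms(2) w unfolding no_top_arc_def by (metis prod.collapse)
  ultimately have "w = (1, snd w)" using vertex_fst by (metis prod.collapse)
  then have "(a, snd w) \<in> strands D" using w by (simp add: strands_def)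
  then show "a \<in> fst ` strands D" by force
qed

lemma up_closed_interval:
  assumes "T \<subseteq> {..<m}" "\<forall>k. k \<in> T \<longrightarrow> Suc k < m \<longrightarrow> Suc k \<in> T"
  shows "T = {m - card T..<m}"
proof (cases "T = {}")
  case False
  have fin: "finite T" using assms(1) finite_subset by blast
  let ?a = "Min T"
  have a: "?a \<in> T" "?a < m" using False fin Min_in assms(1) by blast+
  have "?a + d < m \<Longrightarrow> ?a + d \<in> T" for d
    by (induction d) (use a assms(2) in auto)
  then have "{?a..<m} \<subseteq> T" by (metis atLeastLessThan_iff le_Suc_ex subsetI)
  moreover have "T \<subseteq> {?a..<m}" using fin assms(1) by auto
  ultimately have T: "T = {?a..<m}" by blast
  then have "card T = m - ?a" by (metis card_atLeastLessThan)
  then have "m - card T = ?a" using a by simp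
  then show ?thesis using T by simp
qed simp

lemma normal_form:
  assumes "D \<in> mo m"
  shows "\<exists>E\<in>mo m. lequiv m D E \<and> tops E = fst ` strands E \<and> tops E = {m - through_strands D..<m}
    \<and> through_strands E = through_strands D"
proof -
  obtain E0 where E0: "E0 \<in> mo m" "lequiv m D E0" "no_top_arc E0" using reduce_top_arcs[OF assms] by blast
  obtain E where E: "E \<in> mo m" "lequiv m E0 E" "no_top_arc E"
     "\<forall>k. k \<in> tops E \<longrightarrow> Suc k < m \<longrightarrow> Suc k \<in> tops E" using push_tops[OF E0(1,3)] by blast
  have eq: "lequiv m D E" by (rule lequiv_trans[OF E0(2) E(2)])
  have ts: "through_strands E = through_strands D"
  proof (rule lequivE[OF eq], rule antisym)
    fix u w assume u: "set u \<subseteq> gens m" "E = foldr lact u D" "set w \<subseteq> gens m" "D = foldr lact w E"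
    show "through_strands E \<le> through_strands D" using through_lact_list[OF assms u(1)] u(2) by simp
    show "through_strands D \<le> through_strands E" using through_lact_list[OF E(1) u(3)] u(4) by simp
  qed
  have t: "tops E = fst ` strands E" by (rule no_top_arc_tops[OF E(1,3)])
  have "card (tops E) = through_strands D" using card_strands(2)[OF E(1)] t ts by simp
  then have "tops E = {m - through_strands D..<m}"
    using up_closed_interval[OF tops_less[OF E(1)] E(4)] by simp
  then show ?thesis using E(1) eq t ts by (intro bexI[of _ E] conjI)
qed

lemma through_strands_le: "D \<in> mo m \<Longrightarrow> through_strands D \<le> m"
  using card_mono[of "{..<m}" "fst ` strands D"] strands_subset[of D m] card_strands(2)[of D m] by force

lemma bots_flip: "D \<in> mo m \<Longrightarrow> bots (flip D) = tops D" 
proof (rule Set.set_eqI)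
  fix x assume D: "D \<in> mo m"
  have "x \<in> bots (flip D) \<longleftrightarrow> (\<exists>w. {(1, x), w} \<in> flip D)"
    unfolding bots_def mem_Collect_eq used_iff[OF flip_mo[OF D]] ..
  also have "\<dots> \<longleftrightarrow> (\<exists>w. {(0, x), flipv w} \<in> D)" by (simp add: flip_iff)
  also have "\<dots> \<longleftrightarrow> (\<exists>w. {(0, x), w} \<in> D)" by (metis flipv_flipv)
  finally show "x \<in> bots (flip D) \<longleftrightarrow> x \<in> tops D"
    unfolding tops_def mem_Collect_eq used_iff[OF D] .
qed

text \<open>Normalising the top, turning the diagram over and normalising again ends at the
  idempotent, by \<open>eps_unique\<close>. So a diagram and the idempotent with as many through
  strands are multiples of each other, with words of generators on both sides.\<close>

theorem strand_equiv:
  assumes "D \<in> mo m"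
  shows "\<exists>u v u' v'. set u \<subseteq> gens m \<and> set v \<subseteq> gens m \<and> set u' \<subseteq> gens m \<and> set v' \<subseteq> gens m \<and>
    D = foldr lact u (flip (foldr lact v (eps m (through_strands D)))) \<and>
    eps m (through_strands D) = foldr lact v' (flip (foldr lact u' D))"
proof -
  let ?j = "through_strands D"
  have jm: "?j \<le> m" by (rule through_strands_le[OF assms])
  obtain E where E: "E \<in> mo m" "lequiv m D E" "tops E = {m - ?j..<m}" "through_strands E = ?j"
    using normal_form[OF assms] by blast
  have F: "flip E \<in> mo m" "through_strands (flip E) = ?j" "bots (flip E) = {m - ?j..<m}"
    using flip_mo[OF E(1)] through_strands_flip[OF E(1)] bots_flip[OF E(1)] E by auto
  obtain G where G: "G \<in> mo m" "lequiv m (flip E) G" "tops G = fst ` strands G" "tops G = {m - ?j..<m}"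
      "through_strands G = ?j"
    using normal_form[OF F(1)] F(2) by auto
  have "bots G \<subseteq> bots (flip E)"
  proof (rule lequivE[OF G(2)])
    fix u w assume u: "set u \<subseteq> gens m" "G = foldr lact u (flip E)"
    show ?thesis using bots_lact_list[OF F(1) u(1)] u(2) by simp
  qed
  then have Ge: "G = eps m ?j" using G F(3) jm by (intro eps_unique) auto
  from G(2)[unfolded Ge] obtain v' v where v0: "set v' \<subseteq> gens m" "eps m ?j = foldr lact v' (flip E)"
     "set v \<subseteq> gens m" "flip E = foldr lact v (eps m ?j)" by (rule lequivE)
  have v: "set v \<subseteq> gens m" "flip E = foldr lact v (eps m ?j)"
     "set v' \<subseteq> gens m" "eps m ?j = foldr lact v' (flip E)" using v0 by simp_all
  from E(2) obtain u' u where u: "set u' \<subseteq> gens m" "E = foldr lact u' D" "set u \<subseteq> gens m" "D = foldr lact u E"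
    by (rule lequivE)
  have "flip (flip E) = flip (foldr lact v (eps m ?j))" using v(2) by simp
  then have fE: "E = flip (foldr lact v (eps m ?j))" by (simp only: flip_flip)
  show ?thesis
  proof (intro exI conjI)
    show "D = foldr lact u (flip (foldr lact v (eps m ?j)))" by (simp only: u(4)[symmetric] fE[symmetric])
    show "eps m ?j = foldr lact v' (flip (foldr lact u' D))" by (simp only: u(2)[symmetric] v(4)[symmetric])
  qed (rule u v)+
qed

subsection \<open>Words and diagrams\<close>

text \<open>Bottom labels opposite to \<open>base\<close>: as \<open>cup Up Dn = 1\<close>, a
  vertical strand forces \<open>Up\<close> on top, and \<open>eps m i\<close> becomes the base
  vector.\<close>

definition dual_base :: "nat \<Rightarrow> nat \<Rightarrow> lab list" where
  "dual_base i m = replicate (m - i) Emp @ replicate i Dn"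

lemma op_cong:
  assumes "\<And>w. length w = m \<Longrightarrow> y w = y' w" "length w = m"
  shows "op g y w = op g y' w"
  using assms by (cases g) auto

lemma Psi_eps:
  assumes "i \<le> m" "length w = m"
  shows "Psi m (eps m i) (lab_of w (dual_base i m)) = delta (base i m) w"
proof -
  let ?f = "lab_of w (dual_base i m)"
  have db: "dual_base i m ! k = (if k < m - i then Emp else Dn)" if "k < m" for k
    using that assms(1) by (auto simp: dual_base_def nth_append)
  have bs: "base i m ! k = (if k < m - i then Emp else Up)" if "k < m" for k
    using that assms(1) by (auto simp: base_def nth_append)
  have eq: "w = base i m \<longleftrightarrow> (\<forall>k<m. w ! k = base i m ! k)"
    using assms by (auto simp: list_eq_iff_nth_eq base_def)
  have un: "v \<in> \<Union> (eps m i) \<longleftrightarrow> m - i \<le> snd v" if "v \<in> vertices m" for v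
    using that by (cases v) (auto simp: eps_def vertices_def)
  have iso: "(\<forall>v\<in>vertices m. v \<notin> \<Union> (eps m i) \<longrightarrow> ?f v = Emp) \<longleftrightarrow> (\<forall>k<m - i. w ! k = Emp)"
  proof
    assume a: "\<forall>v\<in>vertices m. v \<notin> \<Union> (eps m i) \<longrightarrow> ?f v = Emp"
    show "\<forall>k<m - i. w ! k = Emp"
    proof (intro allI impI)
      fix k assume "k < m - i"
      then have "(0, k) \<in> vertices m" "\<not> m - i \<le> k" by (auto simp: vertices_def)
      then have "?f (0, k) = Emp" using a un[of "(0, k)"] by (metis snd_conv)
      then show "w ! k = Emp" by (simp add: lab_of_def)
    qed
  next
    assume a: "\<forall>k<m - i. w ! k = Emp"
    show "\<forall>v\<in>vertices m. v \<notin> \<Union> (eps m i) \<longrightarrow> ?f v = Emp"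
    proof (intro ballI impI)
      fix v assume v: "v \<in> vertices m" "v \<notin> \<Union> (eps m i)"
      then have "\<not> m - i \<le> snd v" using un by (simp only: not_False_eq_True)
      then have "snd v < m - i" by simp
      then show "?f v = Emp" using a db[of "snd v"] by (simp add: lab_of_def)
    qed
  qed
  have bw: "bweight m {(0, k), (1, k)} ?f = (if w ! k = Up then 1 else 0)" if "m - i \<le> k" "k < m" for k
  proof -
    have "bweight m {(0, k), (1, k)} ?f = cup (?f (0, k)) (?f (1, k))"
      by (rule bweight_eq) (use that in simp)
    also have "?f (1, k) = Dn" using db[OF that(2)] that by (simp add: lab_of_def)
    also have "?f (0, k) = w ! k" by (simp add: lab_of_def)
    finally show ?thesis by (cases "w ! k") auto
  qed
  have fin: "finite (eps m i)" by (rule finite_partial_matching[OF mo_pm[OF eps_mo]])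
  have prod: "(\<Prod>e\<in>eps m i. bweight m e ?f) = (if \<forall>k. m - i \<le> k \<and> k < m \<longrightarrow> w ! k = Up then 1 else 0)"
  proof (cases "\<forall>k. m - i \<le> k \<and> k < m \<longrightarrow> w ! k = Up")
    case True
    have "bweight m e ?f = 1" if "e \<in> eps m i" for e using that bw True unfolding eps_def by auto
    then show ?thesis using True by simp
  next
    case False
    then obtain k where k: "m - i \<le> k" "k < m" "w ! k \<noteq> Up" by blast
    then have "{(0, k), (1, k)} \<in> eps m i" "bweight m {(0, k), (1, k)} ?f = 0"
      using bw unfolding eps_def by auto
    then show ?thesis using False fin prod_zero[of "eps m i"] by auto
  qed
  have "w = base i m \<longleftrightarrow> (\<forall>k<m - i. w ! k = Emp) \<and> (\<forall>k. m - i \<le> k \<and> k < m \<longrightarrow> w ! k = Up)"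
  proof -
    have "w = base i m \<longleftrightarrow> (\<forall>k<m. w ! k = (if k < m - i then Emp else Up))" unfolding eq using bs by simp
    also have "\<dots> \<longleftrightarrow> (\<forall>k<m - i. w ! k = Emp) \<and> (\<forall>k. m - i \<le> k \<and> k < m \<longrightarrow> w ! k = Up)"
    proof (intro iffI conjI allI impI)
      fix k assume a: "\<forall>k<m. w ! k = (if k < m - i then Emp else Up)"
      { assume "k < m - i" then show "w ! k = Emp" using a[rule_format, of k] by simp }
      { assume "m - i \<le> k \<and> k < m" then show "w ! k = Up" using a[rule_format, of k] by simp }
    next
      fix k assume "(\<forall>k<m - i. w ! k = Emp) \<and> (\<forall>k. m - i \<le> k \<and> k < m \<longrightarrow> w ! k = Up)" "k < m"
      then show "w ! k = (if k < m - i then Emp else Up)" by (cases "k < m - i") simp_all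
    qed
    finally show ?thesis .
  qed
  then show ?thesis unfolding Psi_def iso prod delta_def by simp
qed

text \<open>With fixed bottom labels, the state that a word makes of the base vector depends only on
  the diagram that the word makes of \<open>eps m i\<close>.\<close>

lemma ops_eq_Psi:
  assumes "i \<le> m" "set ws \<subseteq> gens m" "length w = m"
  shows "ops ws (delta (base i m)) w = Psi m (foldr lact ws (eps m i)) (lab_of w (dual_base i m))"
  using assms(2,3)
proof (induction ws arbitrary: w)
  case Nil then show ?case using Psi_eps[OF assms(1)] by simp
next
  case (Cons g ws)
  have D: "foldr lact ws (eps m i) \<in> mo m" using Cons.prems lact_list_mo[OF eps_mo] by simp
  have "ops (g # ws) (delta (base i m)) w
      = op g (\<lambda>w. Psi m (foldr lact ws (eps m i)) (lab_of w (dual_base i m))) w"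
    using Cons by (simp, intro op_cong[of m]) auto
  also have "\<dots> = Psi m (lact g (foldr lact ws (eps m i))) (lab_of w (dual_base i m))"
    by (rule Psi_op[OF D, symmetric]) (use Cons.prems in auto)
  finally show ?case by simp
qed

text \<open>The link between modules and the model: the coefficient is 1 or 0 according to whether
  the idempotent returns the diagram to \<open>eps m i\<close> or loses a through strand.\<close>

theorem matrix_coefficient:
  assumes i: "i \<le> m" and ws: "set ws \<subseteq> gens m"
  defines "D \<equiv> foldr lact ws (eps m i)"
  shows "ops ws (delta (base i m)) (base i m) = 1 \<and> foldr lact (epsw m i) D = eps m i
    \<or> ops ws (delta (base i m)) (base i m) = 0 \<and> through_strands (foldr lact (epsw m i) D) < i"
proof -
  let ?f = "lab_of (base i m) (dual_base i m)" and ?A = "{m - i..<m}"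
  let ?E = "foldr lact (epsw m i) D"
  have Dm: "D \<in> mo m" unfolding D_def by (rule lact_list_mo[OF eps_mo ws])
  note pm = mo_pm[OF Dm]
  have Em: "?E \<in> mo m" by (rule lact_list_mo[OF Dm epsw_gens])
  have lb: "length (base i m) = m" using i by (simp add: base_def)
  have val: "ops ws (delta (base i m)) (base i m) = Psi m D ?f"
    unfolding D_def by (rule ops_eq_Psi[OF i ws lb])
  have lab: "?f (0, k) = (if k < m - i then Emp else Up)" "?f (1, k) = (if k < m - i then Emp else Dn)"
    if "k < m" for k
    using that i by (auto simp: lab_of_def base_def dual_base_def nth_append)
  have "bots (eps m i) \<subseteq> ?A" by (auto simp: bots_def eps_def)
  then have bD: "bots D \<subseteq> ?A" using bots_lact_list[OF eps_mo ws, of i] unfolding D_def by blast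
  have bE: "bots ?E \<subseteq> ?A" using bots_lact_list[OF Dm epsw_gens, of i] bD by blast
  have E: "?E = {e \<in> D. \<forall>k<m - i. (0, k) \<notin> e}" by (rule epsw_del)
  have tE: "tops ?E \<subseteq> ?A"
  proof
    fix a assume a: "a \<in> tops ?E"
    then have "a < m" using tops_less[OF Em] by blast
    moreover have "\<not> a < m - i" using a unfolding tops_def E by blast
    ultimately show "a \<in> ?A" by simp
  qed
  have full: "?E = eps m i" if "through_strands ?E \<ge> i"
    using eps_unique[OF Em i _ bE that tE] fst_strands_tops[of ?E] tE by blast
  \<comment> \<open>Top vertices come first along the boundary; \<open>Up\<close> labels only top
    and \<open>Dn\<close> only bottom vertices. So the entry \<open>cup Dn Up = \<i>\<close> never
    occurs and each weight is 0 or 1.\<close>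
  have bw0: "bweight m e ?f = 1" if e: "e \<in> D" and n: "bweight m e ?f \<noteq> 0" for e
  proof -
    from partial_matching_cases[OF pm e] obtain u0 v0
      where uv0: "e = {u0, v0}" "u0 \<noteq> v0" "u0 \<in> vertices m" "v0 \<in> vertices m" .
    have "\<exists>u v. e = {u, v} \<and> boundary_pos m u < boundary_pos m v \<and> u \<in> vertices m \<and> v \<in> vertices m"
    proof (cases "boundary_pos m u0 < boundary_pos m v0")
      case True then show ?thesis using uv0 by blast
    next
      case False
      then have "boundary_pos m v0 < boundary_pos m u0" using bp_inj[OF uv0(3,4)] uv0(2) by simp
      then show ?thesis using uv0 by (metis insert_commute)
    qed
    then obtain u v where uv: "e = {u, v}" "boundary_pos m u < boundary_pos m v" "u \<in> vertices m" "v \<in> vertices m"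
      by blast
    have b: "bweight m e ?f = cup (?f u) (?f v)" unfolding uv(1) by (rule bweight_eq[OF uv(2)])
    have "\<not> (?f u = Dn \<and> ?f v = Up)"
    proof
      assume d: "?f u = Dn \<and> ?f v = Up"
      obtain l k l' k' where "u = (l, k)" "v = (l', k')" by (cases u; cases v)
      moreover have "l = 0 \<or> l = 1" "l' = 0 \<or> l' = 1" "k < m" "k' < m" using uv(3,4) calculation by (auto simp: vertices_def)
      moreover have "l \<noteq> 0" using d lab(1)[of k] calculation by (auto split: if_splits)
      moreover have "l' \<noteq> 1" using d lab(2)[of k'] calculation by (auto split: if_splits)
      ultimately show False using uv(2) by (auto simp: boundary_pos_def)
    qed
    then show ?thesis using n unfolding b by (cases "?f u"; cases "?f v") auto
  qed
  show ?thesis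
  proof (cases "Psi m D ?f = 0")
    case False
    then have iso: "\<forall>v\<in>vertices m. v \<notin> \<Union> D \<longrightarrow> ?f v = Emp" and pr: "(\<Prod>e\<in>D. bweight m e ?f) \<noteq> 0"
      unfolding Psi_def by (auto split: if_splits)
    have nz: "bweight m e ?f \<noteq> 0" if "e \<in> D" for e
    proof
      assume "bweight m e ?f = 0"
      then have "(\<Prod>e\<in>D. bweight m e ?f) = 0"
        by (intro prod_zero[OF finite_partial_matching[OF pm]] bexI[OF _ that])
      then show False using pr by simp
    qed
    have "(\<Prod>e\<in>D. bweight m e ?f) = 1" by (intro prod.neutral ballI bw0 nz)
    then have v1: "Psi m D ?f = 1" unfolding Psi_def using iso by simp
    \<comment> \<open>A top vertex labelled \<open>Up\<close> is not isolated, and a nonzero weight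
      makes its partner a \<open>Dn\<close>, hence a bottom vertex. This yields \<open>i\<close>
      through strands.\<close>
    have st: "a \<in> fst ` strands ?E" if a: "a \<in> ?A" for a
    proof -
      have aV: "(0, a) \<in> vertices m" using a by (auto simp: vertices_def)
      have fa: "?f (0, a) = Up" using lab(1)[of a] a by auto
      then have "(0, a) \<in> \<Union> D" using iso aV by (metis lab.distinct(1))
      from used_partner[OF Dm this] obtain v where v: "{(0, a), v} \<in> D" .
      have vV: "v \<in> vertices m" "v \<noteq> (0, a)" using partial_matchingD[OF pm v] by auto
      have fv: "?f v = Dn"
      proof (cases "boundary_pos m (0, a) < boundary_pos m v")
        case True
        then show ?thesis using nz[OF v] bweight_eq[OF True, of ?f] fa by (cases "?f v") auto
      next
        case F: False
        then have lt: "boundary_pos m v < boundary_pos m (0, a)" using bp_inj[OF vV(1) aV] vV(2) by simp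
        then show ?thesis using nz[OF v] bweight_eq[OF lt, of ?f] fa by (cases "?f v") (auto simp: insert_commute)
      qed
      obtain l k where lk: "v = (l, k)" by (cases v)
      have k: "k < m" "l = 0 \<or> l = 1" using vV lk by (auto simp: vertices_def)
      have "l = 1" using fv lab(1)[OF k(1)] k(2) lk by (auto split: if_splits)
      then have "{(0, a), (1, k)} \<in> ?E" using v lk a unfolding E by auto
      then have "(a, k) \<in> strands ?E" by (simp add: strands_def)
      then show ?thesis by force
    qed
    have "i \<le> card (fst ` strands ?E)"
      using card_mono[OF finite_imageI[OF finite_strands[OF Em]] subsetI[of ?A, OF st]] i by simp
    then show ?thesis using full card_strands(2)[OF Em] val v1 by simp
  next
    case True
    have "through_strands ?E < i"
    proof (rule ccontr)
      assume "\<not> through_strands ?E < i"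
      then have eq: "?E = eps m i" using full by simp
      then have sub: "eps m i \<subseteq> D" using E by auto
      \<comment> \<open>The strands of \<open>eps m i\<close> already use all vertices with a label
        other than \<open>Emp\<close>, so the remaining blocks have weight 1.\<close>
      have other: "?f x = Emp" if e: "e \<in> D" "e \<notin> eps m i" and x: "x \<in> e" for e x
      proof (rule ccontr)
        assume nE: "?f x \<noteq> Emp"
        have xV: "x \<in> vertices m" using e x pm unfolding partial_matching_def by blast
        obtain l k where lk: "x = (l, k)" by (cases x)
        have k: "k < m" "l = 0 \<or> l = 1" using xV lk by (auto simp: vertices_def)
        then have "m - i \<le> k" using nE lab[OF k(1)] lk by (auto split: if_splits)
        then have d: "{(0, k), (1, k)} \<in> eps m i" using k unfolding eps_def by auto
        have "x \<in> {(0, k), (1, k)}" using lk k by auto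
        from partial_matching_disjoint[OF pm e(1) subsetD[OF sub d] x this] show False using e(2) d by simp
      qed
      have iso: "?f v = Emp" if v: "v \<in> vertices m" "v \<notin> \<Union> D" for v
      proof (rule ccontr)
        assume nE: "?f v \<noteq> Emp"
        obtain l k where lk: "v = (l, k)" by (cases v)
        have k: "k < m" "l = 0 \<or> l = 1" using v lk by (auto simp: vertices_def)
        then have "m - i \<le> k" using nE lab[OF k(1)] lk by (auto split: if_splits)
        then have d: "{(0, k), (1, k)} \<in> eps m i" using k unfolding eps_def by auto
        moreover have "v \<in> {(0, k), (1, k)}" using lk k by auto
        ultimately show False using sub v(2) by blast
      qed
      have "bweight m e ?f \<noteq> 0" if e: "e \<in> D" for e
      proof (cases "e \<in> eps m i")
        case True
        then obtain k where k: "e = {(0, k), (1, k)}" "m - i \<le> k" "k < m" unfolding eps_def by blast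
        have "bweight m e ?f = cup (?f (0, k)) (?f (1, k))" unfolding k(1) by (rule bweight_eq) (use k in simp)
        then show ?thesis using lab[OF k(3)] k(2) by simp
      next
        case F: False
        from partial_matching_cases[OF pm e] obtain u v
          where uv: "e = {u, v}" "u \<noteq> v" "u \<in> vertices m" "v \<in> vertices m" .
        have fe: "?f u = Emp" "?f v = Emp" using other[OF e F] uv(1) by auto
        show ?thesis
        proof (cases "boundary_pos m u < boundary_pos m v")
          case True then show ?thesis using bweight_eq[OF True, of ?f] uv fe by simp
        next
          case False
          then have lt: "boundary_pos m v < boundary_pos m u" using bp_inj[OF uv(3,4)] uv(2) by simp
          have "e = {v, u}" using uv by auto
          then show ?thesis using bweight_eq[OF lt, of ?f] fe by simp
        qed
      qed
      then have "(\<Prod>e\<in>D. bweight m e ?f) \<noteq> 0" using finite_partial_matching[OF pm] by simp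
      then show False using True iso unfolding Psi_def by auto
    qed
    then show ?thesis using val True by simp
  qed
qed

subsection \<open>Modules over the Motzkin monoid\<close>

lemma motzkin_simps: "carrier (motzkin m) = mo m" "x \<otimes>\<^bsub>motzkin m\<^esub> y = diagram_mult x y"
  by (simp_all add: motzkin_def mo_def)

definition actw :: "nat \<Rightarrow> (diagram, 'v) cmodule \<Rightarrow> gen list \<Rightarrow> 'v \<Rightarrow> 'v" where
  "actw m V ws v = foldr (\<lambda>g. act V (gd m g)) ws v"

lemma actw_simps [simp]: "actw m V [] v = v" "actw m V (g # ws) v = act V (gd m g) (actw m V ws v)"
    "actw m V (us @ ws) v = actw m V us (actw m V ws v)"
  by (simp_all add: actw_def)

text \<open>A condition on diagrams without reference to a module: the same word then acts as
  \<open>D\<close> on any two modules that are to be compared.\<close>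

definition represents :: "nat \<Rightarrow> gen list \<Rightarrow> diagram \<Rightarrow> bool" where
  "represents m w D \<longleftrightarrow> (\<exists>u v. set u \<subseteq> gens m \<and> set v \<subseteq> gens m \<and>
     w = u @ epsw m (through_strands D) @ rev (map tr v) \<and>
     D = foldr lact u (flip (foldr lact v (eps m (through_strands D)))))"

lemma represents_exists:
  assumes "D \<in> mo m"
  shows "\<exists>w. represents m w D"
proof -
  obtain u v where "set u \<subseteq> gens m" "set v \<subseteq> gens m"
      "D = foldr lact u (flip (foldr lact v (eps m (through_strands D))))"
    using strand_equiv[OF assms] by (elim exE conjE)
  then show ?thesis unfolding represents_def
    by (intro exI[of _ "u @ epsw m (through_strands D) @ rev (map tr v)"] exI[of _ u] exI[of _ v] conjI refl)
qed

lemma set_map_tr: "set v \<subseteq> gens m \<Longrightarrow> set (rev (map tr v)) \<subseteq> gens m"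
  by (auto intro!: tr_gens)

lemma represents_gens: "represents m w D \<Longrightarrow> set w \<subseteq> gens m"
  unfolding represents_def by (elim exE conjE) (simp only: set_append Un_least epsw_gens set_map_tr)

locale mo_module =
  fixes m :: nat and V :: "(diagram, 'v::ab_group_add) cmodule"
  assumes mod: "monoid_module (motzkin m) V"
begin

sublocale vs: vector_space "smul V"
  using mod by (rule monoid_module.vector_space)

lemma vecs_subspace: "vs.subspace (vecs V)"
  using mod by (rule monoid_module.subspace)

lemma act_mem: "D \<in> mo m \<Longrightarrow> x \<in> vecs V \<Longrightarrow> act V D x \<in> vecs V"
  using monoid_module.act_closed[OF mod] by (simp add: motzkin_simps)

lemma act_linear: "D \<in> mo m \<Longrightarrow> linear_on (smul V) (smul V) (vecs V) (act V D)"
  using monoid_module.act_add[OF mod] monoid_module.act_smul[OF mod]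
  by (intro linear_onI) (simp_all add: motzkin_simps)

lemma act_prod: "D \<in> mo m \<Longrightarrow> E \<in> mo m \<Longrightarrow> x \<in> vecs V \<Longrightarrow> act V (diagram_mult D E) x = act V D (act V E x)"
  using monoid_module.act_mult[OF mod] by (simp add: motzkin_simps)

lemma act_one: "x \<in> vecs V \<Longrightarrow> act V (eps m m) x = x"
  using monoid_module.act_one[OF mod] by (simp add: one_eq_eps)

lemma actw_mem: "set ws \<subseteq> gens m \<Longrightarrow> x \<in> vecs V \<Longrightarrow> actw m V ws x \<in> vecs V"
  by (induction ws) (auto intro: act_mem gd_mo)

lemma actw_add: "set ws \<subseteq> gens m \<Longrightarrow> x \<in> vecs V \<Longrightarrow> y \<in> vecs V \<Longrightarrow>
    actw m V ws (x + y) = actw m V ws x + actw m V ws y"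
proof (induction ws)
  case (Cons g ws)
  then show ?case using act_linear[OF gd_mo, of g] actw_mem[of ws] by (simp add: linear_on_def)
qed simp

lemma actw_smul: "set ws \<subseteq> gens m \<Longrightarrow> x \<in> vecs V \<Longrightarrow> actw m V ws (smul V c x) = smul V c (actw m V ws x)"
proof (induction ws)
  case (Cons g ws)
  then show ?case using act_linear[OF gd_mo, of g] actw_mem[of ws] by (simp add: linear_on_def)
qed simp

lemma actw_linear: "set ws \<subseteq> gens m \<Longrightarrow> linear_on (smul V) (smul V) (vecs V) (actw m V ws)"
  by (intro linear_onI) (simp_all add: actw_add actw_smul)

lemma act_lact: "D \<in> mo m \<Longrightarrow> set ws \<subseteq> gens m \<Longrightarrow> x \<in> vecs V \<Longrightarrow>
    act V (foldr lact ws D) x = actw m V ws (act V D x)"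
proof (induction ws)
  case (Cons g ws)
  have E: "foldr lact ws D \<in> mo m" "g \<in> gens m" using Cons.prems lact_list_mo[of D m ws] by simp_all
  have "act V (lact g (foldr lact ws D)) x = act V (gd m g) (act V (foldr lact ws D) x)"
    using act_prod[OF gd_mo[OF E(2)] E(1) Cons.prems(3)] gd_mult[OF mo_pm[OF E(1)] E(2)] by simp
  then show ?case using Cons by simp
qed simp

lemma act_flip_lact: "D \<in> mo m \<Longrightarrow> set ws \<subseteq> gens m \<Longrightarrow> x \<in> vecs V \<Longrightarrow>
    act V (flip (foldr lact ws D)) x = act V (flip D) (actw m V (rev (map tr ws)) x)"
proof (induction ws arbitrary: x)
  case (Cons g ws)
  let ?E = "foldr lact ws D"
  have E: "?E \<in> mo m" "tr g \<in> gens m" using Cons.prems lact_list_mo[of D m ws] tr_gens by simp_all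
  have "flip (lact g ?E) = diagram_mult (flip ?E) (gd m (tr g))"
    using mult_gd[OF flip_mo[OF E(1)] E(2)] by simp
  then have "act V (flip (lact g ?E)) x = act V (flip ?E) (act V (gd m (tr g)) x)"
    using act_prod[OF flip_mo[OF E(1)] gd_mo[OF E(2)] Cons.prems(3)] by simp
  then show ?case using Cons act_mem[OF gd_mo[OF E(2)]] by simp
qed simp

lemma act_eps: "x \<in> vecs V \<Longrightarrow> act V (eps m j) x = actw m V (epsw m j) x"
  using act_lact[OF eps_mo epsw_gens, of x j m] lact_epsw[of m j] by (simp add: act_one)

lemma represents_act:
  assumes "represents m w D" "x \<in> vecs V"
  shows "act V D x = actw m V w x"
proof -
  let ?j = "through_strands D"
  obtain u v where uv: "set u \<subseteq> gens m" "set v \<subseteq> gens m" "w = u @ epsw m ?j @ rev (map tr v)"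
     "D = foldr lact u (flip (foldr lact v (eps m ?j)))"
    using assms(1) unfolding represents_def by (elim exE conjE)
  have r: "set (rev (map tr v)) \<subseteq> gens m" by (rule set_map_tr[OF uv(2)])
  have "act V D x = actw m V u (act V (flip (foldr lact v (eps m ?j))) x)"
    by (subst uv(4)) (rule act_lact[OF flip_mo[OF lact_list_mo[OF eps_mo uv(2)]] uv(1) assms(2)])
  also have "\<dots> = actw m V u (act V (eps m ?j) (actw m V (rev (map tr v)) x))"
    using act_flip_lact[OF eps_mo uv(2) assms(2), of ?j] by simp
  also have "\<dots> = actw m V w x" using uv(3) act_eps[OF actw_mem[OF r assms(2)]] by simp
  finally show ?thesis .
qed

lemma act_through_eps:
  assumes "D \<in> mo m"
  shows "\<exists>u v. set u \<subseteq> gens m \<and> set v \<subseteq> gens m \<and> (\<forall>x\<in>vecs V. act V D x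
      = actw m V u (actw m V (epsw m (through_strands D)) (actw m V v x)))"
proof -
  obtain w where w: "represents m w D" using represents_exists[OF assms] ..
  then obtain u v where uv: "set u \<subseteq> gens m" "set v \<subseteq> gens m"
      "w = u @ epsw m (through_strands D) @ rev (map tr v)"
    unfolding represents_def by (elim exE conjE)
  have r: "set (rev (map tr v)) \<subseteq> gens m" by (rule set_map_tr[OF uv(2)])
  then show ?thesis using represents_act[OF w] uv
    by (intro exI[of _ u] exI[of _ "rev (map tr v)"] conjI) simp_all
qed

lemma eps_through_act:
  assumes "D \<in> mo m"
  shows "\<exists>u v. set u \<subseteq> gens m \<and> set v \<subseteq> gens m \<and> (\<forall>x\<in>vecs V.
      actw m V (epsw m (through_strands D)) x = actw m V u (act V D (actw m V v x)))"
proof -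
  obtain u v where uv: "set u \<subseteq> gens m" "set v \<subseteq> gens m"
      "eps m (through_strands D) = foldr lact v (flip (foldr lact u D))"
    using strand_equiv[OF assms] by (elim exE conjE)
  have r: "set (rev (map tr v)) \<subseteq> gens m" by (rule set_map_tr[OF uv(2)])
  note E = lact_list_mo[OF assms uv(1)]
  have "actw m V (epsw m (through_strands D)) x = actw m V u (act V D (actw m V (rev (map tr v)) x))"
    if x: "x \<in> vecs V" for x
  proof -
    have "actw m V (epsw m (through_strands D)) x = act V (eps m (through_strands D)) x" using act_eps[OF x] by simp
    also have "eps m (through_strands D) = flip (foldr lact v (flip (foldr lact u D)))"
      using uv(3) flip_eps by metis
    also have "act V \<dots> x = act V (foldr lact u D) (actw m V (rev (map tr v)) x)"
      using act_flip_lact[OF flip_mo[OF E] uv(2) x] by simp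
    also have "\<dots> = actw m V u (act V D (actw m V (rev (map tr v)) x))"
      by (rule act_lact[OF assms uv(1) actw_mem[OF r x]])
    finally show ?thesis .
  qed
  then show ?thesis using uv r by blast
qed

lemma submoduleD:
  assumes "submodule (motzkin m) V U"
  shows "U \<subseteq> vecs V" "vs.subspace U" "set ws \<subseteq> gens m \<Longrightarrow> x \<in> U \<Longrightarrow> actw m V ws x \<in> U"
    and "D \<in> mo m \<Longrightarrow> x \<in> U \<Longrightarrow> act V D x \<in> U"
proof -
  show 1: "U \<subseteq> vecs V" "vs.subspace U" using assms by (auto simp: submodule_def)
  show 2: "act V D x \<in> U" if "D \<in> mo m" "x \<in> U" for D x using assms that by (auto simp: submodule_def motzkin_simps)
  show "actw m V ws x \<in> U" if "set ws \<subseteq> gens m" "x \<in> U"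
    using that by (induction ws) (auto intro: 2 gd_mo)
qed

text \<open>Every diagram acts through some word of generators, so stability under the generators
  suffices.\<close>

lemma submoduleI:
  assumes "U \<subseteq> vecs V" "vs.subspace U" "\<And>g x. g \<in> gens m \<Longrightarrow> x \<in> U \<Longrightarrow> act V (gd m g) x \<in> U"
  shows "submodule (motzkin m) V U"
proof -
  have w: "actw m V ws x \<in> U" if "set ws \<subseteq> gens m" "x \<in> U" for ws x
    using that by (induction ws) (auto intro: assms(3))
  have "act V D x \<in> U" if D: "D \<in> mo m" and x: "x \<in> U" for D x
  proof -
    obtain w where r: "represents m w D" using represents_exists[OF D] ..
    show ?thesis using represents_act[OF r] w[OF represents_gens[OF r] x] x assms(1) by (simp add: subsetD)
  qed
  then show ?thesis using assms by (simp add: submodule_def motzkin_simps)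
qed

lemma eps_idem: "x \<in> vecs V \<Longrightarrow> actw m V (epsw m i) (actw m V (epsw m i) x) = actw m V (epsw m i) x"
proof -
  assume x: "x \<in> vecs V"
  have "foldr lact (epsw m i) (eps m i) = eps m i" unfolding epsw_del eps_def by auto
  then have "actw m V (epsw m i) (act V (eps m i) x) = act V (eps m i) x"
    using act_lact[OF eps_mo epsw_gens x, of i i] by simp
  then show ?thesis using act_eps[OF x] by simp
qed

lemma finite_span_dim_image_le:
  assumes "vs.subspace W" "W \<subseteq> vecs V" "finite T" "W \<subseteq> vs.span T" "linear_on (smul V) (smul V) W f"
  shows "vs.dim (f ` W) \<le> vs.dim W"
proof -
  interpret l: linear_on_subspace "smul V" "smul V" W f
    by unfold_locales (use assms in auto)
  show ?thesis using l.rank_nullity[OF assms(3,4)] by simp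
qed

lemma subspace_actw_image:
  assumes "vs.subspace W" "W \<subseteq> vecs V" "set ws \<subseteq> gens m"
  shows "vs.subspace (actw m V ws ` W)"
proof -
  interpret l: linear_on_subspace "smul V" "smul V" W "actw m V ws"
    by unfold_locales (use assms linear_on_subset[OF actw_linear] in auto)
  show ?thesis using l.subspace_image[OF assms(1)] by simp
qed

text \<open>By \<open>strand_equiv\<close> the two actions factor through each other, so each image
  has at most the dimension of the other. In particular the character does not depend on the chosen
  idempotents.\<close>

lemma dim_act_eq:
  assumes "D \<in> mo m" "finite T" "vecs V \<subseteq> vs.span T"
  shows "vs.dim (act V D ` vecs V) = vs.dim (actw m V (epsw m (through_strands D)) ` vecs V)"
proof (rule antisym)
  let ?E = "actw m V (epsw m (through_strands D)) ` vecs V" and ?A = "act V D ` vecs V"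
  have EV: "?E \<subseteq> vecs V" using actw_mem[OF epsw_gens] by auto
  have AV: "?A \<subseteq> vecs V" using act_mem[OF assms(1)] by auto
  have sE: "vs.subspace ?E" by (rule subspace_actw_image[OF vecs_subspace subset_refl epsw_gens])
  have sA: "vs.subspace ?A"
  proof -
    interpret l: linear_on_subspace "smul V" "smul V" "vecs V" "act V D"
      by unfold_locales (use vecs_subspace act_linear[OF assms(1)] in auto)
    show ?thesis using l.subspace_image[OF vecs_subspace] by simp
  qed
  obtain u v where uv: "set u \<subseteq> gens m" "set v \<subseteq> gens m" "\<forall>x\<in>vecs V. act V D x
      = actw m V u (actw m V (epsw m (through_strands D)) (actw m V v x))"
    using act_through_eps[OF assms(1)] by (elim exE conjE)
  have "?A \<subseteq> actw m V u ` ?E"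
  proof
    fix y assume "y \<in> ?A"
    then obtain x where x: "x \<in> vecs V" "y = act V D x" by blast
    then have "y = actw m V u (actw m V (epsw m (through_strands D)) (actw m V v x))" using uv(3) by simp
    then show "y \<in> actw m V u ` ?E" using actw_mem[OF uv(2) x(1)] by blast
  qed
  then have "vs.dim ?A \<le> vs.dim (actw m V u ` ?E)"
    by (rule vs.dim_mono_span[OF sA subspace_actw_image[OF sE EV uv(1)]])
      (use actw_mem[OF uv(1)] EV assms in blast)+
  also have "\<dots> \<le> vs.dim ?E"
    by (rule finite_span_dim_image_le[OF sE EV assms(2)])
      (use EV assms(3) linear_on_subset[OF actw_linear[OF uv(1)] EV] in auto)
  finally show "vs.dim ?A \<le> vs.dim ?E" .
  obtain u v where uv: "set u \<subseteq> gens m" "set v \<subseteq> gens m" "\<forall>x\<in>vecs V.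
      actw m V (epsw m (through_strands D)) x = actw m V u (act V D (actw m V v x))"
    using eps_through_act[OF assms(1)] by (elim exE conjE)
  have "?E \<subseteq> actw m V u ` ?A"
  proof
    fix y assume "y \<in> ?E"
    then obtain x where x: "x \<in> vecs V" "y = actw m V (epsw m (through_strands D)) x" by blast
    then have "y = actw m V u (act V D (actw m V v x))" using uv(3) by simp
    then show "y \<in> actw m V u ` ?A" using actw_mem[OF uv(2) x(1)] by blast
  qed
  then have "vs.dim ?E \<le> vs.dim (actw m V u ` ?A)"
    by (rule vs.dim_mono_span[OF sE subspace_actw_image[OF sA AV uv(1)]])
      (use actw_mem[OF uv(1)] AV assms in blast)+
  also have "\<dots> \<le> vs.dim ?A"
    by (rule finite_span_dim_image_le[OF sA AV assms(2)])
      (use AV assms(3) linear_on_subset[OF actw_linear[OF uv(1)] AV] in auto)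
  finally show "vs.dim ?E \<le> vs.dim ?A" .
qed

end

subsection \<open>Sections without intermediate submodules\<close>

text \<open>A simple subquotient with apex \<open>i\<close>, expressed inside \<open>V\<close> so
  that no quotient space has to be formed. The conditions on smaller \<open>j\<close> concern the
  idempotents only; \<open>lower\<close> extends them to all diagrams with fewer strands.\<close>

locale mo_section = mo_module +
  fixes U W :: "'a set" and i :: nat
  assumes subU: "submodule (motzkin m) V U" and subW: "submodule (motzkin m) V W"
    and UW: "U \<subset> W"
    and cover: "\<And>X. submodule (motzkin m) V X \<Longrightarrow> U \<subset> X \<Longrightarrow> X \<subset> W \<Longrightarrow> False"
    and im: "i \<le> m" and apex: "\<not> actw m V (epsw m i) ` W \<subseteq> U"
    and below: "\<And>j. j < i \<Longrightarrow> actw m V (epsw m j) ` W \<subseteq> U"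
begin

lemmas U = submoduleD[OF subU] and W = submoduleD[OF subW]

definition v :: "'a" where
  "v = (SOME x. x \<in> actw m V (epsw m i) ` W \<and> x \<notin> U)"

lemma v: "v \<in> W" "v \<notin> U" "actw m V (epsw m i) v = v"
proof -
  have "\<exists>x. x \<in> actw m V (epsw m i) ` W \<and> x \<notin> U" using apex by blast
  then have *: "v \<in> actw m V (epsw m i) ` W \<and> v \<notin> U" unfolding v_def by (rule someI_ex)
  then obtain x where x: "x \<in> W" "v = actw m V (epsw m i) x" by blast
  show "v \<in> W" using W(3)[OF epsw_gens x(1)] x(2) by simp
  show "v \<notin> U" using * by simp
  show "actw m V (epsw m i) v = v" using eps_idem x W(1) by auto
qed

lemma lower: "D \<in> mo m \<Longrightarrow> through_strands D < i \<Longrightarrow> x \<in> W \<Longrightarrow> act V D x \<in> U"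
proof -
  assume D: "D \<in> mo m" "through_strands D < i" and x: "x \<in> W"
  obtain a b where ab: "set a \<subseteq> gens m" "set b \<subseteq> gens m" "\<forall>x\<in>vecs V. act V D x
      = actw m V a (actw m V (epsw m (through_strands D)) (actw m V b x))"
    using act_through_eps[OF D(1)] by (elim exE conjE)
  have "actw m V (epsw m (through_strands D)) (actw m V b x) \<in> U"
    using below[OF D(2)] W(3)[OF ab(2) x] by blast
  then show ?thesis using ab(3) x W(1) U(3)[OF ab(1)] by auto
qed

abbreviation coef :: "gen list \<Rightarrow> complex" where
  "coef ws \<equiv> ops ws (delta (base i m)) (base i m)"

text \<open>\<open>matrix_coefficient\<close> in the module: the resulting diagram either fixes
  \<open>v\<close> or has fewer than \<open>i\<close> through strands and sends \<open>v\<close>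
  into \<open>U\<close>.\<close>

lemma coef: "set ws \<subseteq> gens m \<Longrightarrow> actw m V (epsw m i) (actw m V ws v) - smul V (coef ws) v \<in> U"
proof -
  assume ws: "set ws \<subseteq> gens m"
  let ?D = "foldr lact ws (eps m i)"
  have vV: "v \<in> vecs V" using v(1) W(1) by blast
  have D: "?D \<in> mo m" by (rule lact_list_mo[OF eps_mo ws])
  have ev: "act V (eps m i) v = v" using act_eps[OF vV] v(3) by simp
  have "actw m V ws v = act V ?D v" using act_lact[OF eps_mo ws vV, of i] ev by simp
  then have e: "actw m V (epsw m i) (actw m V ws v) = act V (foldr lact (epsw m i) ?D) v"
    using act_lact[OF D epsw_gens vV] by simp
  from matrix_coefficient[OF im ws] show ?thesis
  proof (elim disjE conjE)
    assume "coef ws = 1" "foldr lact (epsw m i) ?D = eps m i"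
    then show ?thesis using e ev vs.subspace_0[OF U(2)] by simp
  next
    assume "coef ws = 0" "through_strands (foldr lact (epsw m i) ?D) < i"
    then show ?thesis using e lower[OF lact_list_mo[OF D epsw_gens] _ v(1)] by simp
  qed
qed

definition gen_set :: "'a set" where
  "gen_set = {actw m V ws v | ws. set ws \<subseteq> gens m}"

text \<open>The right-hand side is a submodule of \<open>W\<close> that properly contains
  \<open>U\<close>, since it contains \<open>v\<close>; nothing lies strictly between.\<close>

lemma W_eq: "W = {x + y | x y. x \<in> U \<and> y \<in> vs.span gen_set}"
proof -
  let ?X = "{x + y | x y. x \<in> U \<and> y \<in> vs.span gen_set}"
  have gW: "gen_set \<subseteq> W" using W(3) v(1) unfolding gen_set_def by blast
  have sW: "vs.span gen_set \<subseteq> W" using vs.span_minimal[OF gW W(2)] .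
  have XW: "?X \<subseteq> W" using sW UW vs.subspace_add[OF W(2)] by blast
  have sX: "vs.subspace ?X" using vs.subspace_sums[OF U(2) vs.subspace_span] .
  have "act V (gd m g) z \<in> ?X" if g: "g \<in> gens m" and z: "z \<in> ?X" for g z
  proof -
    obtain x y where xy: "z = x + y" "x \<in> U" "y \<in> vs.span gen_set" using z by blast
    interpret l: linear_on_subspace "smul V" "smul V" "vecs V" "act V (gd m g)"
      by unfold_locales (use vecs_subspace act_linear[OF gd_mo[OF g]] in auto)
    have gV: "gen_set \<subseteq> vecs V" using gW W(1) by blast
    have "act V (gd m g) ` gen_set \<subseteq> gen_set"
    proof
      fix t assume "t \<in> act V (gd m g) ` gen_set"
      then obtain ws where ws: "set ws \<subseteq> gens m" "t = act V (gd m g) (actw m V ws v)"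
        unfolding gen_set_def by blast
      then have "t = actw m V (g # ws) v" "set (g # ws) \<subseteq> gens m" using g by simp_all
      then show "t \<in> gen_set" unfolding gen_set_def by blast
    qed
    then have "act V (gd m g) y \<in> vs.span gen_set"
      using l.map_span[OF gV] xy(3) vs.span_mono by blast
    moreover have "act V (gd m g) x \<in> U" by (rule U(4)[OF gd_mo[OF g] xy(2)])
    moreover have "act V (gd m g) z = act V (gd m g) x + act V (gd m g) y"
      unfolding xy(1) using xy(2,3) U(1) sW W(1) by (intro l.map_add) blast+
    ultimately show ?thesis by blast
  qed
  then have "submodule (motzkin m) V ?X" using XW W(1) sX by (intro submoduleI) blast+
  moreover have "U \<subset> ?X"
  proof
    show "U \<subseteq> ?X" using vs.span_zero by force
    have "v \<in> gen_set" unfolding gen_set_def by (auto intro!: exI[of _ "[]"])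
    then have "0 + v \<in> ?X" using vs.subspace_0[OF U(2)] vs.span_base by blast
    then show "U \<noteq> ?X" using v(2) by auto
  qed
  ultimately show ?thesis using cover[of ?X] XW by blast
qed

end

text \<open>The action of generators on families of coefficients: right translation of
  words.\<close>

definition shift :: "nat \<Rightarrow> gen list \<Rightarrow> (gen list \<Rightarrow> complex) \<Rightarrow> gen list \<Rightarrow> complex" where
  "shift m w h = (\<lambda>ws. if set ws \<subseteq> gens m then h (ws @ w) else 0)"

lemma theta_ops: "set w \<subseteq> gens m \<Longrightarrow> theta i m (ops w y) = shift m w (theta i m y)"
  by (rule HOL.ext) (simp add: theta_def shift_def)

context mo_section
begin

text \<open>The idempotent maps \<open>W\<close> onto the line of \<open>v\<close> modulo
  \<open>U\<close>; \<open>c\<close> is the coordinate there. It is unique because \<open>v\<close>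
  is not in \<open>U\<close>.\<close>

definition approx :: "gen list \<Rightarrow> 'a \<Rightarrow> complex \<Rightarrow> bool" where
  "approx ws x c \<longleftrightarrow> actw m V (epsw m i) (actw m V ws x) - smul V c v \<in> U"

lemma approx_unique:
  assumes "approx ws x c" "approx ws x d"
  shows "c = d"
proof (rule ccontr)
  assume cd: "c \<noteq> d"
  have "(actw m V (epsw m i) (actw m V ws x) - smul V d v) - (actw m V (epsw m i) (actw m V ws x) - smul V c v) \<in> U"
    using assms vs.subspace_diff[OF U(2)] unfolding approx_def by blast
  then have "smul V (c - d) v \<in> U" by (simp add: vs.scale_left_diff_distrib)
  then have "smul V (inverse (c - d)) (smul V (c - d) v) \<in> U" by (rule vs.subspace_scale[OF U(2)])
  then show False using v(2) cd by simp
qed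

lemma epsact_linear:
  assumes "set ws \<subseteq> gens m" "x \<in> W" "y \<in> W"
  shows "actw m V (epsw m i) (actw m V ws (x + y)) = actw m V (epsw m i) (actw m V ws x) + actw m V (epsw m i) (actw m V ws y)"
    and "actw m V (epsw m i) (actw m V ws (smul V c x)) = smul V c (actw m V (epsw m i) (actw m V ws x))"
proof -
  have x: "x \<in> vecs V" "y \<in> vecs V" using assms W(1) by auto
  show "actw m V (epsw m i) (actw m V ws (x + y)) = actw m V (epsw m i) (actw m V ws x) + actw m V (epsw m i) (actw m V ws y)"
    unfolding actw_add[OF assms(1) x] by (rule actw_add[OF epsw_gens actw_mem[OF assms(1) x(1)] actw_mem[OF assms(1) x(2)]])
  show "actw m V (epsw m i) (actw m V ws (smul V c x)) = smul V c (actw m V (epsw m i) (actw m V ws x))"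
    unfolding actw_smul[OF assms(1) x(1)] by (rule actw_smul[OF epsw_gens actw_mem[OF assms(1) x(1)]])
qed

lemma approx_add:
  assumes "set ws \<subseteq> gens m" "x \<in> W" "y \<in> W" "approx ws x c" "approx ws y d"
  shows "approx ws (x + y) (c + d)"
proof -
  let ?p = "\<lambda>x. actw m V (epsw m i) (actw m V ws x)"
  have "?p (x + y) - smul V (c + d) v = (?p x - smul V c v) + (?p y - smul V d v)"
    by (simp add: epsact_linear(1)[OF assms(1-3)] vs.scale_left_distrib)
  then show ?thesis using assms(4,5) vs.subspace_add[OF U(2)] unfolding approx_def by simp
qed

lemma approx_scale:
  assumes "set ws \<subseteq> gens m" "x \<in> W" "approx ws x c"
  shows "approx ws (smul V a x) (a * c)"
proof -
  let ?p = "\<lambda>x. actw m V (epsw m i) (actw m V ws x)"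
  have "?p (smul V a x) - smul V (a * c) v = smul V a (?p x - smul V c v)"
    by (simp add: epsact_linear(2)[OF assms(1,2,2)] vs.scale_right_diff_distrib)
  then show ?thesis using assms(3) vs.subspace_scale[OF U(2)] unfolding approx_def by simp
qed

lemma approx_U: "set ws \<subseteq> gens m \<Longrightarrow> x \<in> U \<Longrightarrow> approx ws x 0"
  using U(3)[OF epsw_gens U(3)] by (simp add: approx_def)

lemma approx_gen: "set ws \<subseteq> gens m \<Longrightarrow> set w \<subseteq> gens m \<Longrightarrow> approx ws (actw m V w v) (coef (ws @ w))"
  using coef[of "ws @ w"] by (simp add: approx_def)

lemma gen_set_W: "gen_set \<subseteq> W"
  using W(3) v(1) unfolding gen_set_def by blast

lemma approx_exists:
  assumes ws: "set ws \<subseteq> gens m" and x: "x \<in> W"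
  shows "\<exists>c. approx ws x c"
proof -
  let ?X = "{x \<in> W. \<exists>c. approx ws x c}"
  have "vs.subspace ?X"
  proof (rule vs.subspaceI)
    show "0 \<in> ?X" using approx_U[OF ws vs.subspace_0[OF U(2)]] vs.subspace_0[OF W(2)] by blast
    show "x + y \<in> ?X" if "x \<in> ?X" "y \<in> ?X" for x y
      using that approx_add[OF ws] vs.subspace_add[OF W(2)] by blast
    show "smul V c x \<in> ?X" if "x \<in> ?X" for c x
      using that approx_scale[OF ws] vs.subspace_scale[OF W(2)] by blast
  qed
  note X = this
  have "gen_set \<subseteq> ?X"
  proof
    fix y assume "y \<in> gen_set"
    then obtain w where "y = actw m V w v" "set w \<subseteq> gens m" unfolding gen_set_def by blast
    then show "y \<in> ?X" using approx_gen[OF ws, of w] W(3)[of w v] v(1) by blast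
  qed
  then have sp: "vs.span gen_set \<subseteq> ?X" by (rule vs.span_minimal[OF _ X])
  obtain u y where uy: "x = u + y" "u \<in> U" "y \<in> vs.span gen_set" using x W_eq by blast
  have "u \<in> ?X" using approx_U[OF ws uy(2)] uy(2) UW by blast
  moreover have "y \<in> ?X" using sp uy(3) by blast
  ultimately have "x \<in> ?X" unfolding uy(1) by (rule vs.subspace_add[OF X])
  then show ?thesis by blast
qed

text \<open>The counterpart of \<open>theta\<close> for a section, read off modulo \<open>U\<close>.
  Both maps agree on the translates of \<open>v\<close> and of the base vector, which is how the
  model enters.\<close>

definition Theta :: "'a \<Rightarrow> gen list \<Rightarrow> complex" where
  "Theta x = (\<lambda>ws. if set ws \<subseteq> gens m then THE c. approx ws x c else 0)"

lemma Theta_eqI: "set ws \<subseteq> gens m \<Longrightarrow> approx ws x c \<Longrightarrow> Theta x ws = c"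
  using approx_unique by (auto simp: Theta_def intro: the_equality)

lemma Theta_approx: "set ws \<subseteq> gens m \<Longrightarrow> x \<in> W \<Longrightarrow> approx ws x (Theta x ws)"
  using approx_exists[of ws x] Theta_eqI[of ws x] by metis

lemma Theta_outside: "\<not> set ws \<subseteq> gens m \<Longrightarrow> Theta x ws = 0"
  by (simp add: Theta_def)

lemma Theta_add: "x \<in> W \<Longrightarrow> y \<in> W \<Longrightarrow> Theta (x + y) = (\<lambda>ws. Theta x ws + Theta y ws)"
proof (rule HOL.ext)
  fix ws assume "x \<in> W" "y \<in> W"
  then show "Theta (x + y) ws = Theta x ws + Theta y ws"
    by (cases "set ws \<subseteq> gens m") (auto intro!: Theta_eqI approx_add Theta_approx simp: Theta_outside)
qed

lemma Theta_scale: "x \<in> W \<Longrightarrow> Theta (smul V a x) = (\<lambda>ws. a * Theta x ws)"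
proof (rule HOL.ext)
  fix ws assume "x \<in> W"
  then show "Theta (smul V a x) ws = a * Theta x ws"
    by (cases "set ws \<subseteq> gens m") (auto intro!: Theta_eqI approx_scale Theta_approx simp: Theta_outside)
qed

lemma Theta_linear: "linear_on (smul V) (\<lambda>c t x. c * t x) W Theta"
  by (rule linear_onI) (simp_all add: Theta_add Theta_scale plus_fun_def)

lemma Theta_gen: "set w \<subseteq> gens m \<Longrightarrow> Theta (actw m V w v) = theta i m (ops w (delta (base i m)))"
proof (rule HOL.ext)
  fix ws assume w: "set w \<subseteq> gens m"
  show "Theta (actw m V w v) ws = theta i m (ops w (delta (base i m))) ws"
  proof (cases "set ws \<subseteq> gens m")
    case True
    then show ?thesis using Theta_eqI[OF True approx_gen[OF True w]] by (simp add: theta_def)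
  next
    case False
    then show ?thesis by (simp add: Theta_outside theta_def)
  qed
qed

lemma Theta_U: "x \<in> U \<Longrightarrow> Theta x = 0"
proof (rule HOL.ext)
  fix ws assume "x \<in> U"
  then show "Theta x ws = 0 ws"
    by (cases "set ws \<subseteq> gens m") (auto intro!: Theta_eqI approx_U simp: Theta_outside)
qed

lemma Theta_actw: "set w \<subseteq> gens m \<Longrightarrow> x \<in> W \<Longrightarrow> Theta (actw m V w x) = shift m w (Theta x)"
proof (rule HOL.ext)
  fix ws assume w: "set w \<subseteq> gens m" and x: "x \<in> W"
  show "Theta (actw m V w x) ws = shift m w (Theta x) ws"
  proof (cases "set ws \<subseteq> gens m")
    case True
    have "approx (ws @ w) x (Theta x (ws @ w))" by (rule Theta_approx) (use True w x in auto)
    then have "approx ws (actw m V w x) (Theta x (ws @ w))" by (simp add: approx_def)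
    then show ?thesis using Theta_eqI[OF True] True by (simp add: shift_def)
  next
    case False
    then show ?thesis by (simp add: Theta_outside shift_def)
  qed
qed

sublocale l: linear_on_subspace "smul V" "\<lambda>c t x. c * t x" W Theta
  by (intro linear_on_subspace.intro linear_on_subspace_axioms.intro vs.vector_space_axioms
      fn.vector_space_axioms W(2) Theta_linear)

lemma Theta_image: "Theta ` W = theta i m ` cyc i m"
proof -
  interpret t: linear_on_subspace "\<lambda>c t x. c * t x" "\<lambda>c t x. c * t x" UNIV "theta i m"
    by (rule flinear_onI[OF theta_linear fn.subspace_UNIV])
  have sW: "vs.span gen_set \<subseteq> W" by (rule vs.span_minimal[OF gen_set_W W(2)])
  have "Theta ` W = Theta ` vs.span gen_set"
  proof
    show "Theta ` W \<subseteq> Theta ` vs.span gen_set"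
    proof
      fix h assume "h \<in> Theta ` W"
      then obtain x where x: "x \<in> W" "h = Theta x" by blast
      obtain u y where uy: "x = u + y" "u \<in> U" "y \<in> vs.span gen_set" using x(1) W_eq by blast
      have "u \<in> W" "y \<in> W" using uy sW UW by auto
      then have "Theta x = Theta u + Theta y" unfolding uy(1) by (rule l.map_add)
      then have "Theta x = Theta y" using Theta_U[OF uy(2)] by simp
      then show "h \<in> Theta ` vs.span gen_set" using x uy(3) by blast
    qed
  qed (use sW in blast)
  also have "\<dots> = fn.span (Theta ` gen_set)" by (rule l.map_span[OF gen_set_W])
  also have "Theta ` gen_set = theta i m ` {ops ws (delta (base i m)) | ws. set ws \<subseteq> gens m}"
  proof
    show "Theta ` gen_set \<subseteq> theta i m ` {ops ws (delta (base i m)) | ws. set ws \<subseteq> gens m}"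
    proof
      fix h assume "h \<in> Theta ` gen_set"
      then obtain w where w: "set w \<subseteq> gens m" "h = Theta (actw m V w v)" unfolding gen_set_def by blast
      then have "h = theta i m (ops w (delta (base i m)))" using Theta_gen by simp
      then show "h \<in> theta i m ` {ops ws (delta (base i m)) | ws. set ws \<subseteq> gens m}" using w(1) by blast
    qed
    show "theta i m ` {ops ws (delta (base i m)) | ws. set ws \<subseteq> gens m} \<subseteq> Theta ` gen_set"
    proof
      fix h assume "h \<in> theta i m ` {ops ws (delta (base i m)) | ws. set ws \<subseteq> gens m}"
      then obtain w where w: "set w \<subseteq> gens m" "h = theta i m (ops w (delta (base i m)))" by blast
      then have "h = Theta (actw m V w v)" using Theta_gen by simp
      then show "h \<in> Theta ` gen_set" using w(1) unfolding gen_set_def by blast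
    qed
  qed
  also have "fn.span \<dots> = theta i m ` cyc i m" unfolding cyc_def by (rule t.map_span[symmetric]) simp
  finally show ?thesis .
qed

text \<open>The kernel is a submodule between \<open>U\<close> and \<open>W\<close> that misses
  \<open>v\<close>, hence it is \<open>U\<close>.\<close>

lemma Theta_kernel: "{x \<in> W. Theta x = 0} = U"
proof -
  let ?X = "{x \<in> W. Theta x = 0}"
  have UX: "U \<subseteq> ?X" using UW Theta_U by blast
  have "submodule (motzkin m) V ?X"
  proof (rule submoduleI)
    show "?X \<subseteq> vecs V" using W(1) by blast
    show "vs.subspace ?X" by (rule l.subspace_kernel)
    fix g x assume g: "g \<in> gens m" and x: "x \<in> ?X"
    have "Theta (actw m V [g] x) = shift m [g] (Theta x)" using Theta_actw[of "[g]" x] g x by simp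
    moreover have "shift m [g] 0 = 0" by (rule HOL.ext) (simp add: shift_def)
    moreover have "actw m V [g] x \<in> W" using W(3)[of "[g]" x] g x by simp
    ultimately show "act V (gd m g) x \<in> ?X" using x by simp
  qed
  moreover have "v \<notin> ?X"
  proof
    assume "v \<in> ?X"
    then have "approx [] v 0" using Theta_approx[of "[]" v] by simp
    then show False using v by (simp add: approx_def)
  qed
  ultimately show ?thesis using cover[of ?X] UX v(1) by blast
qed

text \<open>Rank-nullity for \<open>Theta\<close> on the image of the idempotent; translation by
  \<open>epsw m j\<close> turns the image of \<open>Theta\<close> into the space measured by
  \<open>rk\<close>.\<close>

lemma dim_section:
  assumes T: "finite T" "vecs V \<subseteq> vs.span T"
  shows "vs.dim (actw m V (epsw m j) ` W) = vs.dim (actw m V (epsw m j) ` U) + rk i m j"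
proof -
  let ?E = "actw m V (epsw m j)"
  have EW: "?E ` W \<subseteq> W" using W(3)[OF epsw_gens] by blast
  interpret E: linear_on_subspace "smul V" "\<lambda>c t x. c * t x" "?E ` W" Theta
    by (intro linear_on_subspace.intro linear_on_subspace_axioms.intro vs.vector_space_axioms
      fn.vector_space_axioms subspace_actw_image[OF W(2,1) epsw_gens] linear_on_subset[OF Theta_linear EW])
  have "vs.dim (?E ` W) = vs.dim {x \<in> ?E ` W. Theta x = 0} + fn.dim (Theta ` ?E ` W)"
    by (rule E.rank_nullity[OF T(1)]) (use EW W(1) T(2) in blast)
  \<comment> \<open>An element of the image that lies in \<open>U\<close> is fixed by the
    idempotent, so it is the image of itself.\<close>
  also have "{x \<in> ?E ` W. Theta x = 0} = ?E ` U"
  proof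
    show "{x \<in> ?E ` W. Theta x = 0} \<subseteq> ?E ` U"
    proof
      fix x assume x: "x \<in> {x \<in> ?E ` W. Theta x = 0}"
      then obtain z where z: "z \<in> W" "x = ?E z" by blast
      have "x \<in> U" using x EW Theta_kernel by blast
      moreover have "?E x = x" using eps_idem[of z j] z W(1) by auto
      ultimately show "x \<in> ?E ` U" by (metis imageI)
    qed
    show "?E ` U \<subseteq> {x \<in> ?E ` W. Theta x = 0}" using UW U(3)[OF epsw_gens] Theta_U by blast
  qed
  also have "Theta ` ?E ` W = shift m (epsw m j) ` Theta ` W"
    unfolding image_image by (rule image_cong[OF refl]) (rule Theta_actw[OF epsw_gens])
  also have "\<dots> = theta i m ` ops (epsw m j) ` cyc i m"
    unfolding Theta_image unfolding image_image
    by (rule image_cong[OF refl]) (rule theta_ops[OF epsw_gens, symmetric])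
  finally show ?thesis by (simp only: rk_def)
qed

end

text \<open>The two coordinate maps have the same image, determined by the model, and the one on
  \<open>S\<close> is injective. The homomorphism is the first followed by the inverse of the
  second.\<close>

lemma factor_iso_sections:
  fixes V :: "(diagram, 'v::ab_group_add) cmodule" and S :: "(diagram, 's::ab_group_add) cmodule"
  assumes "mo_section m V U W i" "mo_section m S {0} (vecs S) i"
  shows "factor_iso (motzkin m) V W U S"
proof -
  interpret V: mo_section m V U W i by fact
  interpret S: mo_section m S "{0}" "vecs S" i by fact
  define f where "f x = inv_into (vecs S) S.Theta (V.Theta x)" for x
  have im: "V.Theta ` W = S.Theta ` vecs S" using V.Theta_image S.Theta_image by simp
  have f: "f x \<in> vecs S" "S.Theta (f x) = V.Theta x" if "x \<in> W" for x
  proof -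
    have "V.Theta x \<in> S.Theta ` vecs S" using that im by blast
    then show "f x \<in> vecs S" "S.Theta (f x) = V.Theta x"
      unfolding f_def by (rule inv_into_into, rule f_inv_into_f)
  qed
  have inj: "s = t" if s: "s \<in> vecs S" and t: "t \<in> vecs S" and e: "S.Theta s = S.Theta t" for s t
  proof -
    have "S.Theta (s - t) = 0" using S.l.map_diff[OF s t] e by simp
    moreover have "s - t \<in> vecs S" by (rule S.vs.subspace_diff[OF S.vecs_subspace s t])
    ultimately have "s - t \<in> {0}" using S.Theta_kernel by blast
    then show ?thesis by simp
  qed
  show ?thesis
    unfolding factor_iso_def
  proof (intro exI[of _ f] conjI ballI allI)
    show "f (x + y) = f x + f y" if "x \<in> W" "y \<in> W" for x y
    proof (rule inj)
      have xy: "x + y \<in> W" by (rule V.vs.subspace_add[OF V.W(2) that])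
      show "f (x + y) \<in> vecs S" by (rule f(1)[OF xy])
      show "f x + f y \<in> vecs S" by (rule S.vs.subspace_add[OF S.vecs_subspace f(1)[OF that(1)] f(1)[OF that(2)]])
      show "S.Theta (f (x + y)) = S.Theta (f x + f y)"
        using f(2)[OF xy] f[OF that(1)] f[OF that(2)] V.l.map_add[OF that] S.l.map_add by simp
    qed
    show "f (smul V c x) = smul S c (f x)" if "x \<in> W" for c x
    proof (rule inj)
      have xy: "smul V c x \<in> W" by (rule V.vs.subspace_scale[OF V.W(2) that])
      show "f (smul V c x) \<in> vecs S" by (rule f(1)[OF xy])
      show "smul S c (f x) \<in> vecs S" by (rule S.vs.subspace_scale[OF S.vecs_subspace f(1)[OF that]])
      show "S.Theta (f (smul V c x)) = S.Theta (smul S c (f x))"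
        using f(2)[OF xy] f[OF that] V.l.map_scale[OF that] S.l.map_scale by simp
    qed
    show "f (act V D x) = act S D (f x)" if D: "D \<in> carrier (motzkin m)" and x: "x \<in> W" for D x
    proof (rule inj)
      have D: "D \<in> mo m" using D by (simp add: motzkin_simps)
      have xy: "act V D x \<in> W" by (rule V.W(4)[OF D x])
      show "f (act V D x) \<in> vecs S" by (rule f(1)[OF xy])
      show "act S D (f x) \<in> vecs S" by (rule S.act_mem[OF D f(1)[OF x]])
      obtain w where w: "represents m w D" using represents_exists[OF D] ..
      have "V.Theta (act V D x) = shift m w (V.Theta x)"
        using V.represents_act[OF w] V.Theta_actw[OF represents_gens[OF w] x] x V.W(1) by auto
      moreover have "S.Theta (act S D (f x)) = shift m w (S.Theta (f x))"
        using S.represents_act[OF w f(1)[OF x]] S.Theta_actw[OF represents_gens[OF w] f(1)[OF x]] by simp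
      ultimately show "S.Theta (f (act V D x)) = S.Theta (act S D (f x))" using f(2)[OF xy] f(2)[OF x] by simp
    qed
    show "f ` W = vecs S"
    proof
      show "f ` W \<subseteq> vecs S" using f(1) by blast
      show "vecs S \<subseteq> f ` W"
      proof
        fix s assume s: "s \<in> vecs S"
        then obtain x where x: "x \<in> W" "V.Theta x = S.Theta s" using im by (metis imageE imageI)
        then have "f x = s" using inj[OF f(1)[OF x(1)] s] f(2)[OF x(1)] by simp
        then show "s \<in> f ` W" using x(1) by blast
      qed
    qed
    have "f x = 0 \<longleftrightarrow> V.Theta x = 0" if x: "x \<in> W" for x
    proof
      assume "f x = 0" then show "V.Theta x = 0" using f(2)[OF x] S.l.map_zero by simp
    next
      assume "V.Theta x = 0"
      then have "S.Theta (f x) = S.Theta 0" using f(2)[OF x] S.l.map_zero by simp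
      then show "f x = 0" by (rule inj[OF f(1)[OF x] S.vs.subspace_0[OF S.vecs_subspace]])
    qed
    then show "{x \<in> W. f x = 0} = U" using V.Theta_kernel by blast
  qed
qed

context mo_module
begin

text \<open>The apex is the least index whose idempotent does not send \<open>W\<close> into
  \<open>U\<close>. One exists because \<open>epsw m m\<close> is the empty word.\<close>

lemma section_exists:
  assumes "submodule (motzkin m) V U" "submodule (motzkin m) V W" "U \<subset> W"
    "\<not> (\<exists>X. submodule (motzkin m) V X \<and> U \<subset> X \<and> X \<subset> W)"
  shows "\<exists>i\<le>m. mo_section m V U W i"
proof -
  let ?P = "\<lambda>i. \<not> actw m V (epsw m i) ` W \<subseteq> U"
  have "epsw m m = []" by (simp add: epsw_def)
  then have "?P m" using assms(3) by auto
  then have *: "?P (LEAST i. ?P i)" "(LEAST i. ?P i) \<le> m" by (rule LeastI, rule Least_le)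
  have "mo_section m V U W (LEAST i. ?P i)"
  proof (rule mo_section.intro[OF mo_module_axioms], rule mo_section_axioms.intro)
    show False if "submodule (motzkin m) V X" "U \<subset> X" "X \<subset> W" for X
      using assms(4) that by blast
    show "actw m V (epsw m j) ` W \<subseteq> U" if "j < (LEAST i. ?P i)" for j
      using not_less_Least[OF that] by simp
  qed (fact assms *)+
  then show ?thesis using *(2) by blast
qed

end

lemma through_strands_eps: "j \<le> m \<Longrightarrow> through_strands (eps m j) = j"
proof -
  assume "j \<le> m"
  have "strands (eps m j) = (\<lambda>k. (k, k)) ` {m - j..<m}"
    by (auto simp: strands_def eps_iff)
  moreover have "inj_on (\<lambda>k. (k, k)) {m - j..<m}" by (auto intro: inj_onI)
  ultimately have "card (strands (eps m j)) = j" using \<open>j \<le> m\<close> by (simp add: card_image)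
  then show ?thesis using through_strands_card[OF eps_mo, of m j] by simp
qed

text \<open>The apex is stated with the given idempotent \<open>e i\<close>, which acts through
  \<open>epsw m i\<close>; so that word cannot act by zero on \<open>S\<close>.\<close>

lemma simple_section:
  assumes "J_idempotents m e" "simple_with_apex m e S i" "i \<le> m"
  shows "mo_section m S {0} (vecs S) i"
proof -
  have S: "simple_module (motzkin m) S" using assms(2) by (simp add: simple_with_apex_def)
  interpret S: mo_module m S by (rule mo_module.intro) (use S in \<open>simp add: simple_module_def\<close>)
  have e: "e i \<in> mo m" "through_strands (e i) = i"
    using assms(1,3) by (auto simp: J_idempotents_def motzkin_simps)
  have act0: "D \<in> mo m \<Longrightarrow> through_strands D < i \<Longrightarrow> x \<in> vecs S \<Longrightarrow> act S D x = 0" for D x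
    using assms(2) by (simp add: simple_with_apex_def motzkin_simps)
  have z: "0 \<in> vecs S" by (rule S.vs.subspace_0[OF S.vecs_subspace])
  have a0: "act S D 0 = 0" if "D \<in> mo m" for D
    using S.act_linear[OF that] z S.vs.scale_zero_left unfolding linear_on_def by (metis add_cancel_left_right)
  have w0: "actw m S w 0 = 0" if "set w \<subseteq> gens m" for w
    using that by (induction w) (auto simp: a0 gd_mo)
  show ?thesis
  proof
    show "submodule (motzkin m) S {0}"
      by (rule S.submoduleI) (use z a0 gd_mo S.vs.subspace_single_0 in auto)
    show "submodule (motzkin m) S (vecs S)"
      by (rule S.submoduleI) (use S.vecs_subspace S.act_mem gd_mo in auto)
    show "{0} \<subset> vecs S" using z S by (auto simp: simple_module_def)
    show False if "submodule (motzkin m) S X" "{0} \<subset> X" "X \<subset> vecs S" for X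
      using S that by (auto simp: simple_module_def)
    show "i \<le> m" by fact
    show "\<not> actw m S (epsw m i) ` vecs S \<subseteq> {0}"
    proof
      assume k: "actw m S (epsw m i) ` vecs S \<subseteq> {0}"
      obtain a b where ab: "set a \<subseteq> gens m" "set b \<subseteq> gens m" "\<forall>x\<in>vecs S. act S (e i) x
          = actw m S a (actw m S (epsw m (through_strands (e i))) (actw m S b x))"
        using S.act_through_eps[OF e(1)] by (elim exE conjE)
      have "act S (e i) x = 0" if x: "x \<in> vecs S" for x
      proof -
        have "actw m S (epsw m i) (actw m S b x) = 0" using k S.actw_mem[OF ab(2) x] by blast
        then show ?thesis using ab(3) x w0[OF ab(1)] e(2) by simp
      qed
      then have "act S (e i) ` vecs S = {0}" using z by force
      then show False using assms(2) by (simp add: simple_with_apex_def)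
    qed
    show "actw m S (epsw m j) ` vecs S \<subseteq> {0}" if "j < i" for j
    proof
      fix y assume "y \<in> actw m S (epsw m j) ` vecs S"
      then obtain x where x: "x \<in> vecs S" "y = actw m S (epsw m j) x" by blast
      then have "y = act S (eps m j) x" using S.act_eps by simp
      then show "y \<in> {0}" using act0[OF eps_mo _ x(1), of j] through_strands_eps[of j m] that assms(3) by simp
    qed
  qed
qed

text \<open>Which idempotents act by zero on the section is an isomorphism invariant, and the apex
  is the least index at which this fails.\<close>

lemma factor_iso_apex:
  fixes V :: "(diagram, 'v::ab_group_add) cmodule" and S :: "(diagram, 's::ab_group_add) cmodule"
  assumes V: "mo_section m V U W i" and S: "mo_section m S {0} (vecs S) i'"
    and iso: "factor_iso (motzkin m) V W U S"
  shows "i = i'"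
proof -
  interpret V: mo_section m V U W i by fact
  interpret S: mo_section m S "{0}" "vecs S" i' by fact
  obtain f where f: "\<forall>a\<in>carrier (motzkin m). \<forall>x\<in>W. f (act V a x) = act S a (f x)"
      "f ` W = vecs S" "{x \<in> W. f x = 0} = U"
    using iso unfolding factor_iso_def by (elim exE conjE)
  have *: "actw m V (epsw m j) ` W \<subseteq> U \<longleftrightarrow> actw m S (epsw m j) ` vecs S \<subseteq> {0}" for j
  proof -
    have e: "f (actw m V (epsw m j) x) = actw m S (epsw m j) (f x)" if x: "x \<in> W" for x
    proof -
      have "x \<in> vecs V" "f x \<in> vecs S" using x V.W(1) f(2) by auto
      moreover have "f (act V (eps m j) x) = act S (eps m j) (f x)"
        using f(1) eps_mo[of m j] x by (simp add: motzkin_simps)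
      ultimately show ?thesis by (simp only: V.act_eps S.act_eps)
    qed
    have W: "actw m V (epsw m j) x \<in> W" if "x \<in> W" for x by (rule V.W(3)[OF epsw_gens that])
    have "actw m V (epsw m j) ` W \<subseteq> U \<longleftrightarrow> (\<forall>x\<in>W. f (actw m V (epsw m j) x) = 0)"
      using f(3) W by blast
    also have "\<dots> \<longleftrightarrow> (\<forall>x\<in>W. actw m S (epsw m j) (f x) = 0)" using e by simp
    also have "\<dots> \<longleftrightarrow> actw m S (epsw m j) ` f ` W \<subseteq> {0}" by blast
    finally show ?thesis unfolding f(2) .
  qed
  show ?thesis
    using V.apex S.apex V.below[of i'] S.below[of i] * by (metis linorder_neqE_nat)
qed

subsection \<open>Composition series\<close>

text \<open>A proper submodule of maximal dimension admits nothing between itself and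
  \<open>W\<close>; induction on the dimension supplies the series below it.\<close>

lemma composition_series_exists:
  assumes mod: "monoid_module M V" and fin: "fin_dim V"
  shows "\<exists>Us. composition_series M V Us"
proof -
  interpret vs: vector_space "smul V" using mod by (rule monoid_module.vector_space)
  obtain B where B: "finite B" "vs.span B = vecs V" using fin unfolding fin_dim_def by blast
  note sub = monoid_module.subspace[OF mod]
  have zV: "0 \<in> vecs V" by (rule vs.subspace_0[OF sub])
  have z: "submodule M V {0}"
  proof -
    have "act V a 0 = 0" if "a \<in> carrier M" for a
      using monoid_module.act_smul[OF mod that zV, of 0] by (simp add: vs.scale_zero_left)
    then show ?thesis using zV by (simp add: submodule_def vs.subspace_single_0)
  qed
  have le: "vs.dim U \<le> vs.dim W" if "submodule M V U" "submodule M V W" "U \<subseteq> W" for U W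
    by (rule vs.dim_mono_span[OF _ _ that(3) _ B(1)]) (use that(1,2) B(2) in \<open>simp_all add: submodule_def\<close>)
  have eq: "U = W" if "submodule M V U" "submodule M V W" "U \<subseteq> W" "vs.dim W \<le> vs.dim U" for U W
    by (rule vs.subspace_dim_equal_span[OF _ _ that(3) _ B(1) that(4)]) (use that(1,2) B(2) in \<open>simp_all add: submodule_def\<close>)
  define good where "good W Us \<longleftrightarrow> Us \<noteq> [] \<and> hd Us = {0} \<and> last Us = W \<and> (\<forall>U\<in>set Us. submodule M V U) \<and>
     (\<forall>k. Suc k < length Us \<longrightarrow> Us ! k \<subset> Us ! Suc k \<and>
        \<not> (\<exists>U. submodule M V U \<and> Us ! k \<subset> U \<and> U \<subset> Us ! Suc k))" for W Us
  have "submodule M V W \<Longrightarrow> \<exists>Us. good W Us" for W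
  proof (induction "vs.dim W" arbitrary: W rule: less_induct)
    case less
    show ?case
    proof (cases "W = {0}")
      case True
      then have "good W [{0}]" using z by (simp add: good_def)
      then show ?thesis ..
    next
      case False
      let ?S = "{U. submodule M V U \<and> U \<subset> W}"
      have "0 \<in> W" using less.prems vs.subspace_0 unfolding submodule_def by blast
      then have "{0} \<in> ?S" using False z by auto
      moreover have fS: "finite (vs.dim ` ?S)"
        by (rule finite_subset[of _ "{..vs.dim W}"]) (use le[OF _ less.prems] in auto)
      ultimately have "Max (vs.dim ` ?S) \<in> vs.dim ` ?S" by (intro Max_in) auto
      then obtain U where "Max (vs.dim ` ?S) = vs.dim U" "U \<in> ?S" by (rule imageE)
      then have U: "submodule M V U" "U \<subset> W" "vs.dim U = Max (vs.dim ` ?S)"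
        by (simp_all only: mem_Collect_eq)
      have lt: "vs.dim U < vs.dim W" using eq[OF U(1) less.prems] U(2) by force
      obtain Us where Us: "good U Us" using less.hyps[OF lt U(1)] ..
      have ne: "Us \<noteq> []" and lU: "last Us = U" using Us by (auto simp: good_def)
      have no: "\<not> (\<exists>X. submodule M V X \<and> U \<subset> X \<and> X \<subset> W)"
      proof
        assume "\<exists>X. submodule M V X \<and> U \<subset> X \<and> X \<subset> W"
        then obtain X where X: "submodule M V X" "U \<subset> X" "X \<subset> W" by blast
        have "vs.dim X \<le> vs.dim U" unfolding U(3) by (rule Max_ge[OF fS]) (use X in blast)
        then show False using eq[OF U(1) X(1)] X(2) by blast
      qed
      have "good W (Us @ [W])"
        unfolding good_def
      proof (intro conjI allI impI)
        show "\<forall>U\<in>set (Us @ [W]). submodule M V U" using Us less.prems by (auto simp: good_def)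
        fix k assume k: "Suc k < length (Us @ [W])"
        have *: "(Us @ [W]) ! k \<subset> (Us @ [W]) ! Suc k \<and>
          \<not> (\<exists>X. submodule M V X \<and> (Us @ [W]) ! k \<subset> X \<and> X \<subset> (Us @ [W]) ! Suc k)"
        proof (cases "Suc k < length Us")
          case True
          then have n: "(Us @ [W]) ! k = Us ! k" "(Us @ [W]) ! Suc k = Us ! Suc k" by (simp_all add: nth_append)
          have "\<forall>k. Suc k < length Us \<longrightarrow> Us ! k \<subset> Us ! Suc k \<and>
            \<not> (\<exists>U. submodule M V U \<and> Us ! k \<subset> U \<and> U \<subset> Us ! Suc k)"
            using Us unfolding good_def by (elim conjE)
          then show ?thesis unfolding n using True by (elim allE[of _ k] impE)
        next
          case False
          then have "k = length Us - 1" "Suc k = length Us" using k ne by auto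
          then have "(Us @ [W]) ! k = U" "(Us @ [W]) ! Suc k = W" using lU ne by (simp_all add: nth_append last_conv_nth)
          then show ?thesis using U(2) no by (simp only: simp_thms)
        qed
        then show "(Us @ [W]) ! k \<subset> (Us @ [W]) ! Suc k"
          "\<not> (\<exists>X. submodule M V X \<and> (Us @ [W]) ! k \<subset> X \<and> X \<subset> (Us @ [W]) ! Suc k)" by (rule conjunct1, rule conjunct2)
      qed (use Us ne in \<open>auto simp: good_def\<close>)
      then show ?thesis ..
    qed
  qed
  moreover have "submodule M V (vecs V)" using sub monoid_module.act_closed[OF mod] by (simp add: submodule_def)
  ultimately obtain Us where "good (vecs V) Us" by blast
  then have "composition_series M V Us" unfolding good_def composition_series_def .
  then show ?thesis ..
qed

text \<open>The change of unknowns that undoes the coupling of the even ranks \<open>i\<close> and \<open>i + 2\<close>.\<close>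

fun uncouple :: "(nat \<Rightarrow> rat) \<Rightarrow> nat \<Rightarrow> rat" where
  "uncouple a i = (if i < 2 \<or> odd i then a i else a i - uncouple a (i - 2))"

declare uncouple.simps [simp del]

lemma couple: "a i = (if odd i \<or> i = 0 then uncouple a i else uncouple a i + uncouple a (i - 2))"
proof -
  have "(i < 2 \<or> odd i) = (odd i \<or> i = 0)" by presburger
  then show ?thesis using uncouple.simps[of a i] by auto
qed

text \<open>\<open>mot j i\<close> is the sum of the ranks at \<open>i\<close> and
  \<open>i + 2\<close> for even \<open>i\<close>, so the shift by 2 is moved from the ranks to the
  coefficients, where it undoes \<open>uncouple\<close>.\<close>

lemma sum_uncouple:
  assumes "j \<le> m"
  shows "(\<Sum>i\<le>m. a i * of_nat (rk i m j)) = (\<Sum>i\<le>m. uncouple a i * of_nat (mot j i))"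
proof -
  let ?b = "uncouple a" and ?r = "\<lambda>i. of_nat (rk i m j) :: rat"
  have shift: "(\<Sum>i\<le>m. if even i \<and> i + 2 \<le> m then ?b i * ?r (i + 2) else 0)
      = (\<Sum>i\<le>m. if even i \<and> 2 \<le> i then ?b (i - 2) * ?r i else 0)"
  proof -
    have "(\<Sum>i\<in>{i \<in> {..m}. even i \<and> i + 2 \<le> m}. ?b i * ?r (i + 2))
        = (\<Sum>i\<in>{i \<in> {..m}. even i \<and> 2 \<le> i}. ?b (i - 2) * ?r i)"
      by (rule sum.reindex_bij_witness[where i = "\<lambda>i. i - 2" and j = "\<lambda>i. i + 2"]) auto
    then show ?thesis by (simp only: sum.inter_filter[OF finite_atMost])
  qed
  have "(\<Sum>i\<le>m. ?b i * of_nat (mot j i)) = (\<Sum>i\<le>m. ?b i * ?r i + (if even i \<and> i + 2 \<le> m then ?b i * ?r (i + 2) else 0))"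
  proof (rule sum.cong[OF refl])
    fix i assume "i \<in> {..m}"
    then have i: "i \<le> m" by simp
    have "mot j i = rk i m j + (if even i \<and> i + 2 \<le> m then rk (i + 2) m j else 0)"
      using rk_odd[OF _ i assms] rk_even[OF _ i assms] by (cases "even i") auto
    then show "?b i * of_nat (mot j i) = ?b i * ?r i + (if even i \<and> i + 2 \<le> m then ?b i * ?r (i + 2) else 0)"
      by (simp add: distrib_left)
  qed
  also have "\<dots> = (\<Sum>i\<le>m. ?b i * ?r i + (if even i \<and> 2 \<le> i then ?b (i - 2) * ?r i else 0))"
    by (simp only: sum.distrib shift)
  also have "\<dots> = (\<Sum>i\<le>m. a i * ?r i)"
  proof (rule sum.cong[OF refl])
    fix i
    show "?b i * ?r i + (if even i \<and> 2 \<le> i then ?b (i - 2) * ?r i else 0) = a i * ?r i"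
    proof (cases "odd i \<or> i = 0")
      case True
      then show ?thesis using couple[of a i] by auto
    next
      case False
      then have "even i" "2 \<le> i" by presburger+
      then show ?thesis using couple[of a i] False by (simp add: distrib_right)
    qed
  qed
  finally show ?thesis by simp
qed

definition mult_formula :: "nat \<Rightarrow> (nat \<Rightarrow> rat) \<Rightarrow> nat \<Rightarrow> rat" where
  "mult_formula m X i = (if odd i \<or> i = 0 then (\<Sum>j\<le>m. X j * S_inv j i)
     else (\<Sum>j\<le>m. X j * S_inv j i) + (\<Sum>j\<le>m. X j * S_inv j (i - 2)))"

text \<open>After uncoupling, the unknowns are multiplied by the matrix \<open>mot\<close>, which
  \<open>S_inv\<close> inverts; recoupling gives the two cases.\<close>

lemma mult_formula_unique:
  assumes X: "\<And>j. j \<le> m \<Longrightarrow> X j = (\<Sum>i\<le>m. a i * of_nat (rk i m j))" and i: "i \<le> m"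
  shows "a i = mult_formula m X i"
proof -
  have *: "(\<Sum>j\<le>m. X j * S_inv j i) = uncouple a i" if i: "i \<le> m" for i
  proof -
    have "(\<Sum>j\<le>m. X j * S_inv j i) = (\<Sum>j\<le>m. \<Sum>k\<le>m. uncouple a k * (S_inv j i * of_nat (mot j k)))"
      by (rule sum.cong) (simp_all add: X sum_uncouple sum_distrib_left sum_distrib_right mult_ac)
    also have "\<dots> = (\<Sum>k\<le>m. uncouple a k * (\<Sum>j\<le>m. S_inv j i * of_nat (mot j k)))"
      by (subst sum.swap) (simp only: sum_distrib_left)
    also have "\<dots> = (\<Sum>k\<le>m. if k = i then uncouple a k else 0)"
      by (rule sum.cong) (simp_all add: S_inv_mot[OF i])
    also have "\<dots> = uncouple a i" using i by simp
    finally show ?thesis .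
  qed
  have "i - 2 \<le> m" using i by simp
  from *[OF i] *[OF this] couple[of a i] show ?thesis by (simp only: mult_formula_def)
qed

section \<open>Multiplicities and length\<close>

context mo_module
begin

lemma composition_sections:
  assumes "composition_series (motzkin m) V Us"
  obtains ap where "\<And>k. Suc k < length Us \<Longrightarrow> ap k \<le> m"
    "\<And>k. Suc k < length Us \<Longrightarrow> mo_section m V (Us ! k) (Us ! Suc k) (ap k)"
proof -
  have "\<forall>k. \<exists>i. Suc k < length Us \<longrightarrow> i \<le> m \<and> mo_section m V (Us ! k) (Us ! Suc k) i"
  proof
    fix k
    show "\<exists>i. Suc k < length Us \<longrightarrow> i \<le> m \<and> mo_section m V (Us ! k) (Us ! Suc k) i"
    proof (cases "Suc k < length Us")
      case True
      have 1: "submodule (motzkin m) V (Us ! k)" "submodule (motzkin m) V (Us ! Suc k)"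
        using assms True unfolding composition_series_def by simp_all
      have 2: "Us ! k \<subset> Us ! Suc k"
        "\<not> (\<exists>X. submodule (motzkin m) V X \<and> Us ! k \<subset> X \<and> X \<subset> Us ! Suc k)"
        using assms True unfolding composition_series_def by blast+
      obtain i where "i \<le> m" "mo_section m V (Us ! k) (Us ! Suc k) i"
        using section_exists[OF 1 2] by (elim exE conjE)
      then show ?thesis by (intro exI[of _ i] impI conjI)
    qed simp
  qed
  then obtain ap where "\<forall>k. Suc k < length Us \<longrightarrow> ap k \<le> m \<and> mo_section m V (Us ! k) (Us ! Suc k) (ap k)"
    by (rule choice[THEN exE])
  then show thesis by (intro that[of ap]) simp_all
qed

text \<open>The dimensions of the images of the idempotents are linear in the numbers of sections
  with a given apex, with the ranks as coefficients; this system has a unique solution.\<close>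

lemma series_multiplicity:
  assumes fin: "fin_dim V" and Us: "composition_series (motzkin m) V Us"
    and ap: "\<And>k. Suc k < length Us \<Longrightarrow> ap k \<le> m"
      "\<And>k. Suc k < length Us \<Longrightarrow> mo_section m V (Us ! k) (Us ! Suc k) (ap k)"
    and i: "i \<le> m"
  shows "of_nat (card {k. Suc k < length Us \<and> ap k = i})
    = mult_formula m (\<lambda>j. of_nat (vs.dim (act V (eps m j) ` vecs V))) i"
proof (rule mult_formula_unique[OF _ i])
  fix j
  let ?E = "actw m V (epsw m j)" and ?l = "length Us - 1"
  obtain B where B: "finite B" "vecs V \<subseteq> vs.span B" using fin unfolding fin_dim_def by blast
  have len: "Us \<noteq> []" "Us ! 0 = {0}" "Us ! ?l = vecs V"
    using Us unfolding composition_series_def by (auto simp: hd_conv_nth last_conv_nth)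
  \<comment> \<open>\<open>dim_section\<close> telescopes along the series.\<close>
  have dims: "k < length Us \<Longrightarrow> vs.dim (?E ` (Us ! k)) = (\<Sum>k'<k. rk (ap k') m j)" for k
  proof (induction k)
    case 0
    have "0 \<in> vecs V" by (rule vs.subspace_0[OF vecs_subspace])
    from actw_smul[OF epsw_gens this, of j 0] have "?E 0 = 0" by (simp add: vs.scale_zero_left)
    moreover have "vs.dim {0} = 0"
      using vs.dim_eq_0_iff_subspace[OF vs.subspace_single_0, of B] vs.span_zero B(1) by simp
    ultimately show ?case by (simp add: len(2))
  next
    case (Suc k)
    then show ?case using mo_section.dim_section[OF ap(2)[OF Suc.prems] B, of j] by simp
  qed
  have lt: "Suc k < length Us \<longleftrightarrow> k < ?l" for k by auto
  have "act V (eps m j) ` vecs V = ?E ` vecs V" by (rule image_cong[OF refl act_eps])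
  also have "vs.dim \<dots> = (\<Sum>k<?l. rk (ap k) m j)" using dims[of ?l] len by simp
  also have "\<dots> = (\<Sum>i\<le>m. \<Sum>k\<in>{k \<in> {..<?l}. ap k = i}. rk (ap k) m j)"
    by (rule sum.group[symmetric]) (use ap(1) lt in auto)
  also have "\<dots> = (\<Sum>i\<le>m. card {k. Suc k < length Us \<and> ap k = i} * rk i m j)"
  proof (rule sum.cong[OF refl])
    fix i
    have "{k \<in> {..<?l}. ap k = i} = {k. Suc k < length Us \<and> ap k = i}" using lt by auto
    moreover have "(\<Sum>k\<in>{k \<in> {..<?l}. ap k = i}. rk (ap k) m j) = (\<Sum>k\<in>{k \<in> {..<?l}. ap k = i}. rk i m j)"
      by (rule sum.cong) auto
    ultimately show "(\<Sum>k\<in>{k \<in> {..<?l}. ap k = i}. rk (ap k) m j) = card {k. Suc k < length Us \<and> ap k = i} * rk i m j"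
      by simp
  qed
  finally show "of_nat (vs.dim (act V (eps m j) ` vecs V))
      = (\<Sum>i\<le>m. of_nat (card {k. Suc k < length Us \<and> ap k = i}) * of_nat (rk i m j))"
    by simp
qed

text \<open>The formula does not mention the series, so all series give the same count, and the
  definite description is justified without a Jordan-Hoelder argument.\<close>

theorem comp_mult_formula:
  assumes fin: "fin_dim V" and e: "J_idempotents m e" and S: "simple_with_apex m e S i" and i: "i \<le> m"
  shows "of_nat (comp_mult (motzkin m) V S)
    = mult_formula m (\<lambda>j. of_nat (vs.dim (act V (eps m j) ` vecs V))) i" (is "_ = ?F")
proof -
  note sec = simple_section[OF e S i]
  have F: "of_nat (card {k. Suc k < length Us \<and> factor_iso (motzkin m) V (Us ! Suc k) (Us ! k) S}) = ?F"
    if Us: "composition_series (motzkin m) V Us" for Us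
  proof -
    obtain ap where ap: "\<And>k. Suc k < length Us \<Longrightarrow> ap k \<le> m"
      "\<And>k. Suc k < length Us \<Longrightarrow> mo_section m V (Us ! k) (Us ! Suc k) (ap k)"
      using composition_sections[OF Us] by metis
    have "factor_iso (motzkin m) V (Us ! Suc k) (Us ! k) S \<longleftrightarrow> ap k = i" if k: "Suc k < length Us" for k
      using factor_iso_apex[OF ap(2)[OF k] sec] factor_iso_sections[OF _ sec] ap(2)[OF k] by metis
    then have "{k. Suc k < length Us \<and> factor_iso (motzkin m) V (Us ! Suc k) (Us ! k) S}
      = {k. Suc k < length Us \<and> ap k = i}" by blast
    then show ?thesis using series_multiplicity[OF fin Us ap i] by simp
  qed
  obtain Us where Us: "composition_series (motzkin m) V Us"
    using composition_series_exists[OF mod fin] ..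
  let ?c = "card {k. Suc k < length Us \<and> factor_iso (motzkin m) V (Us ! Suc k) (Us ! k) S}"
  have "comp_mult (motzkin m) V S = ?c"
    unfolding comp_mult_def
  proof (rule the_equality)
    fix c assume "\<exists>Us. composition_series (motzkin m) V Us \<and>
        c = card {k. Suc k < length Us \<and> factor_iso (motzkin m) V (Us ! Suc k) (Us ! k) S}"
    then obtain Us' where Us': "composition_series (motzkin m) V Us'"
        "c = card {k. Suc k < length Us' \<and> factor_iso (motzkin m) V (Us' ! Suc k) (Us' ! k) S}"
      by (elim exE conjE)
    have "(of_nat c :: rat) = of_nat ?c" unfolding Us'(2) by (rule trans[OF F[OF Us'(1)] F[OF Us, symmetric]])
    then show "c = ?c" by (rule of_nat_eq_iff[THEN iffD1])
  qed (use Us in blast)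
  then show ?thesis using F[OF Us] by simp
qed

text \<open>Each section is counted once, under its apex, so the length is obtained without
  exhibiting a simple module for every index.\<close>

theorem comp_length_formula:
  assumes fin: "fin_dim V"
  shows "of_nat (comp_length (motzkin m) V)
    = (\<Sum>i\<le>m. mult_formula m (\<lambda>j. of_nat (vs.dim (act V (eps m j) ` vecs V))) i)" (is "_ = ?F")
proof -
  have F: "of_nat l = ?F" if Us: "composition_series (motzkin m) V Us" and l: "length Us = Suc l" for Us l
  proof -
    obtain ap where ap: "\<And>k. Suc k < length Us \<Longrightarrow> ap k \<le> m"
      "\<And>k. Suc k < length Us \<Longrightarrow> mo_section m V (Us ! k) (Us ! Suc k) (ap k)"
      using composition_sections[OF Us] by metis
    have "?F = (\<Sum>i\<le>m. of_nat (card {k. Suc k < length Us \<and> ap k = i}))"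
      by (rule sum.cong[OF refl]) (simp add: series_multiplicity[OF fin Us ap])
    also have "\<dots> = of_nat (\<Sum>i\<le>m. card {k. Suc k < length Us \<and> ap k = i})" by simp
    also have "(\<Sum>i\<le>m. card {k. Suc k < length Us \<and> ap k = i}) = (\<Sum>i\<le>m. \<Sum>k\<in>{k \<in> {..<l}. ap k = i}. 1)"
      by (simp add: l)
    also have "\<dots> = (\<Sum>k<l. 1)" by (rule sum.group) (use ap(1) l in auto)
    finally show ?thesis by simp
  qed
  obtain Us where Us: "composition_series (motzkin m) V Us"
    using composition_series_exists[OF mod fin] ..
  then have "Us \<noteq> []" by (simp add: composition_series_def)
  then obtain l where l: "length Us = Suc l" by (cases Us) auto
  have "comp_length (motzkin m) V = l"
    unfolding comp_length_def
  proof (rule the_equality)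
    fix l' assume "\<exists>Us. composition_series (motzkin m) V Us \<and> length Us = Suc l'"
    then obtain Us' where Us': "composition_series (motzkin m) V Us'" "length Us' = Suc l'" by (elim exE conjE)
    have "(of_nat l' :: rat) = of_nat l" by (rule trans[OF F[OF Us'] F[OF Us l, symmetric]])
    then show "l' = l" by (rule of_nat_eq_iff[THEN iffD1])
  qed (use Us l in blast)
  then show ?thesis using F[OF Us l] by simp
qed

end

theorem proposition2p2p18:
  fixes m n :: nat
    and e :: "nat \<Rightarrow> diagram"
    and V :: "(diagram, 'v::ab_group_add) cmodule"
    and \<chi> :: "nat \<Rightarrow> nat"
  assumes "m \<ge> 1" and "n \<ge> 1"
    and "J_idempotents m e"
    and "monoid_module (motzkin m) V" and "fin_dim V"
    and "\<And>j. j \<le> m \<Longrightarrow> \<chi> j = mo_character e V j"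
  shows
    "(\<forall>i j. i \<le> j \<longrightarrow>
        S_inv i j = (- 1) ^ (j - i) *
          (\<Sum>r = 0..(j - i) div 2.
             (- 1) ^ r * of_nat ((i + r) choose r) * of_nat ((j - r) choose (j - i - 2 * r)))) \<and>
     (\<forall>i\<le>m. \<forall>S :: (diagram, 's::ab_group_add) cmodule. simple_with_apex m e S i \<longrightarrow>
        of_nat (comp_mult (motzkin m) (tensor_power n V) S) =
          (if odd i \<or> i = 0 then (\<Sum>j\<le>m. of_nat (\<chi> j) ^ n * S_inv j i)
           else (\<Sum>j\<le>m. of_nat (\<chi> j) ^ n * S_inv j i)
              + (\<Sum>j\<le>m. of_nat (\<chi> j) ^ n * S_inv j (i - 2)))) \<and>
     of_nat (comp_length (motzkin m) (tensor_power n V)) =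
       (\<Sum>i\<le>m.
          if odd i \<or> i = 0 then (\<Sum>j\<le>m. of_nat (\<chi> j) ^ n * S_inv j i)
          else (\<Sum>j\<le>m. of_nat (\<chi> j) ^ n * S_inv j i)
             + (\<Sum>j\<le>m. of_nat (\<chi> j) ^ n * S_inv j (i - 2)))"
proof -
  interpret V: mo_module m V by (rule mo_module.intro) (rule assms(4))
  interpret t: tensor_module "motzkin m" V n by (rule tensor_module.intro) (rule assms(4,5))+
  interpret T: mo_module m "tensor_power n V" by (rule mo_module.intro) (rule t.tensor_monoid_module)
  have dim: "T.vs.dim (act t.T (eps m j) ` vecs t.T) = \<chi> j ^ n" if j: "j \<le> m" for j
  proof -
    obtain B where B: "finite B" "vecs V \<subseteq> V.vs.span B" using assms(5) unfolding fin_dim_def by blast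
    have ej: "e j \<in> mo m" "through_strands (e j) = j"
      using assms(3) j by (auto simp: J_idempotents_def motzkin_simps)
    \<comment> \<open>The character is taken at \<open>e j\<close> and the count at
      \<open>eps m j\<close>; both have \<open>j\<close> through strands, on which alone the
      dimension depends.\<close>
    have "\<chi> j = V.vs.dim (act V (e j) ` vecs V)" using assms(6)[OF j] by (simp add: mo_character_def)
    also have "\<dots> = V.vs.dim (act V (eps m j) ` vecs V)"
      using V.dim_act_eq[OF ej(1) B] V.dim_act_eq[OF eps_mo B, of j] ej(2) through_strands_eps[OF j] by simp
    finally have "\<chi> j ^ n = fn.dim (act t.T (eps m j) ` vecs t.T)"
      using t.dim_act_tensor[of "eps m j"] eps_mo[of m j] by (simp add: motzkin_simps)
    then show ?thesis by (simp only: t.smul_T)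
  qed
  have F: "mult_formula m (\<lambda>j. of_nat (T.vs.dim (act t.T (eps m j) ` vecs t.T))) i
      = (if odd i \<or> i = 0 then (\<Sum>j\<le>m. of_nat (\<chi> j) ^ n * S_inv j i)
           else (\<Sum>j\<le>m. of_nat (\<chi> j) ^ n * S_inv j i)
              + (\<Sum>j\<le>m. of_nat (\<chi> j) ^ n * S_inv j (i - 2)))" for i
  proof -
    have "(\<Sum>j\<le>m. of_nat (T.vs.dim (act t.T (eps m j) ` vecs t.T)) * S_inv j k)
      = (\<Sum>j\<le>m. of_nat (\<chi> j) ^ n * S_inv j k)" for k
      by (rule sum.cong) (simp_all add: dim)
    then show ?thesis by (simp only: mult_formula_def)
  qed
  show ?thesis
  proof (intro conjI allI impI)
    show "S_inv i j = (- 1) ^ (j - i) *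
          (\<Sum>r = 0..(j - i) div 2.
             (- 1) ^ r * of_nat ((i + r) choose r) * of_nat ((j - r) choose (j - i - 2 * r)))"
      if "i \<le> j" for i j using that by (rule S_inv_closed_form)
    show "of_nat (comp_mult (motzkin m) (tensor_power n V) S) =
          (if odd i \<or> i = 0 then (\<Sum>j\<le>m. of_nat (\<chi> j) ^ n * S_inv j i)
           else (\<Sum>j\<le>m. of_nat (\<chi> j) ^ n * S_inv j i)
              + (\<Sum>j\<le>m. of_nat (\<chi> j) ^ n * S_inv j (i - 2)))"
      if "i \<le> m" "simple_with_apex m e S i" for i and S :: "(diagram, 's) cmodule"
      using T.comp_mult_formula[OF t.tensor_fin_dim assms(3) that(2,1)] by (simp only: F)
    show "of_nat (comp_length (motzkin m) (tensor_power n V)) =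
       (\<Sum>i\<le>m.
          if odd i \<or> i = 0 then (\<Sum>j\<le>m. of_nat (\<chi> j) ^ n * S_inv j i)
          else (\<Sum>j\<le>m. of_nat (\<chi> j) ^ n * S_inv j i)
             + (\<Sum>j\<le>m. of_nat (\<chi> j) ^ n * S_inv j (i - 2)))"
      using T.comp_length_formula[OF t.tensor_fin_dim] by (simp only: F)
  qed
qed

end
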